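(* Let $-\frac12<s<0$. There exists $\delta>0$ such that the following holds for all $\kappa,\varkappa\ge1$ (with $\kappa\ne\varkappa$ for the two difference flows) and all initial data in $B_\delta\cap\mathcal S(\mathbb{R})$. Along the solution $q(t)$ of each of the NLS, mKdV, NLS difference, and mKdV difference flows, the density $$\rho(\varkappa)=\frac{q\,g_{21}(\varkappa)-r\,g_{12}(\varkappa)}{2+\gamma(\varkappa)}$$ satisfies the microscopic conservation law $$\partial_t\rho(\varkappa)+\partial_x j_\star=0,$$ where the current $j_\star$ for the respective flow is $$j_{\mathrm{NLS}}(\varkappa)=-i\Bigl(\frac{q'g_{21}(\varkappa)+r'g_{12}(\varkappa)}{2+\gamma(\varkappa)}-qr+2\varkappa\rho(\varkappa)\Bigr),$$ $$j_{\mathrm{mKdV}}(\varkappa)=\frac{(q''-2q^2r)g_{21}(\varkappa)-(r''-2r^2q)g_{12}(\varkappa)}{2+\gamma(\varkappa)}-q'r+qr'+2i\varkappa\, j_{\mathrm{NLS}}(\varkappa),$$ $$j_{\mathrm{NLS}}^{\mathrm{diff}}(\varkappa,\kappa)=j_{\mathrm{NLS}}(\varkappa)+4\kappa^3\bigl(j(\varkappa,\kappa)-j(\varkappa,-\kappa)\bigr),$$ $$j_{\mathrm{mKdV}}^{\mathrm{diff}}(\varkappa,\kappa)=j_{\mathrm{mKdV}}(\varkappa)+8i\kappa^4\bigl(j(\varkappa,\kappa)+j(\varkappa,-\kappa)\bigr)+4\kappa^2\rho(\varkappa),$$ with $$j(\varkappa,\kappa):=-i\,\frac{g_{12}(\kappa)g_{21}(\varkappa)+g_{21}(\kappa)g_{12}(\varkappa)}{2(\kappa-\varkappa)(2+\gamma(\varkappa))}+i\,\frac{\gamma(\kappa)}{4(\kappa-\varkappa)}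 .$$
   Context: Conventions: $q$ is complex-valued, primes denote $x$-derivatives, and $r:=\pm\bar q$ (upper sign: defocusing; lower sign: focusing; either choice is fixed throughout). $B_\delta:=\{q\in H^s(\mathbb{R}):\|q\|_{H^s}\le\delta\}$ with $\|q\|_{H^s}^2=\int(4+\xi^2)^s|\hat q(\xi)|^2d\xi$. Diagonal Green's functions. For real $|\kappa|\ge1$ let $$L(\kappa)=\begin{bmatrix}\kappa-\partial&q\\-r&\kappa+\partial\end{bmatrix},\qquad L_0(\kappa)=\begin{bmatrix}\kappa-\partial&0\\0&\kappa+\partial\end{bmatrix}.$$ For $\|q\|_{H^s}$ sufficiently small (uniformly in $|\kappa|\ge1$), $L(\kappa)$ is invertible on $L^2(\mathbb{R})$ and $L(\kappa)^{-1}$ has a ($2\times2$ matrix-valued) integral kernel $G(x,y;\kappa)$ such that $G-G_0$ is continuous in $(x,y)$, where $G_0$ is the kernel of $L_0(\kappa)^{-1}$, i.e. $G_0(x,y;\kappa)=e^{-\kappa|x-y|}\operatorname{diag}(1_{\{x<y\}},1_{\{y<x\}})$ for $\kappa>0$ and $G_0(x,y;\kappa)=-G_0(y,x;-\kappa)$ for $\kappa<0$. Define $$g_{12}(x;\kappa)=\operatorname{sgn}(\kappa)G_{12}(x,x;\kappa),\quad g_{21}(x;\kappa)=\operatorname{sgn}(\kappa)G_{21}(x,x;\kappa),$$ $$\gamma(x;\kappa)=\operatorname{sgn}(\kappa)\bigl[(G-G_0)_{11}+(G-G_0)_{22}\bigr](x,x;\kappa).$$ Dependence on $q$ (hence on $t$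 when $q=q(t)$) is suppressed. Flows: NLS: $i\frac{d}{dt}q=-q''+2q^2r$. mKdV: $\frac{d}{dt}q=-q'''+6qrq'$. NLS difference flow with parameter $\kappa$: $i\frac{d}{dt}q=-q''+2q^2r-4\kappa^3\bigl(g_{12}(\kappa)-g_{12}(-\kappa)\bigr)-4\kappa^2q$. mKdV difference flow with parameter $\kappa$: $\frac{d}{dt}q=-q'''+6qrq'-8\kappa^4\bigl(g_{12}(\kappa)+g_{12}(-\kappa)\bigr)-4\kappa^2q'$. For small $\delta$, each of these has a global Schwartz-class solution for every initial datum in $B_\delta\cap\mathcal S$, which remains small in $H^s$ so that the quantities above are defined. *)

theory Defs
  imports "HOL-Analysis.Analysis"
begin

section \<open>Schwartz functions and the Sobolev norm\<close>

definition Dx :: "(real \<Rightarrow> complex) \<Rightarrow> real \<Rightarrow> complex" where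
  "Dx f = (\<lambda>x. vector_derivative f (at x))"

definition schwartz :: "(real \<Rightarrow> complex) \<Rightarrow> bool" where
  "schwartz f \<longleftrightarrow>
     (\<forall>n. (\<forall>x. (Dx ^^ n) f differentiable (at x)) \<and>
          (\<forall>m. bounded (range (\<lambda>x. x ^ m *\<^sub>R (Dx ^^ n) f x))))"

text \<open>Curves in \<open>C(\<real>; \<S>)\<close>: uniform convergence of \<open>x\<^sup>m \<partial>\<^sub>x\<^sup>n q(\<tau>, x)\<close> as \<open>\<tau> \<rightarrow> t\<close>,
  for all \<open>m\<close> and \<open>n\<close>, is convergence in the Schwartz topology.\<close>

definition schwartz_curve :: "(real \<Rightarrow> real \<Rightarrow> complex) \<Rightarrow> bool" where
  "schwartz_curve q \<longleftrightarrow>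
     (\<forall>t. schwartz (q t)) \<and>
     (\<forall>t m n. uniform_limit UNIV (\<lambda>\<tau> x. x ^ m *\<^sub>R (Dx ^^ n) (q \<tau>) x)
                (\<lambda>x. x ^ m *\<^sub>R (Dx ^^ n) (q t) x) (at t))"

definition fourier :: "(real \<Rightarrow> complex) \<Rightarrow> real \<Rightarrow> complex" where
  "fourier f \<xi> = (LINT x|lborel. exp (- (\<i> * of_real (\<xi> * x))) * f x) / of_real (sqrt (2 * pi))"

text \<open>Only used for Schwartz functions, where the integrals converge absolutely.\<close>

definition Hs_norm :: "real \<Rightarrow> (real \<Rightarrow> complex) \<Rightarrow> real" where
  "Hs_norm s f = sqrt (LINT \<xi>|lborel. (4 + \<xi>\<^sup>2) powr s * (cmod (fourier f \<xi>))\<^sup>2)"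


section \<open>The Lax operator and its Green's function\<close>

definition L2 :: "(real \<Rightarrow> 'a::euclidean_space) set" where
  "L2 = {f \<in> borel_measurable lborel. integrable lborel (\<lambda>x. (norm (f x))\<^sup>2)}"

definition L2_norm :: "(real \<Rightarrow> 'a::euclidean_space) \<Rightarrow> real" where
  "L2_norm f = sqrt (LINT x|lborel. (norm (f x))\<^sup>2)"

text \<open>\<open>u \<in> H\<^sup>1(\<real>)\<close> with distributional derivative \<open>v\<close>.\<close>

definition H1_deriv :: "(real \<Rightarrow> complex) \<Rightarrow> (real \<Rightarrow> complex) \<Rightarrow> bool" where
  "H1_deriv u v \<longleftrightarrow> u \<in> L2 \<and> v \<in> L2 \<and>
     (\<forall>\<phi>. schwartz \<phi> \<longrightarrow>
        (LINT x|lborel. u x * Dx \<phi> x) = - (LINT x|lborel. v x * \<phi> x))"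

text \<open>The graph of the unbounded operator
  \<open>L(\<kappa>) = [[\<kappa> - \<partial>, q], [-r, \<kappa> + \<partial>]]\<close> on \<open>L\<^sup>2(\<real>; \<complex>\<^sup>2)\<close> with domain \<open>H\<^sup>1(\<real>; \<complex>\<^sup>2)\<close>.
  Elements of \<open>L\<^sup>2\<close> are represented by functions, hence the equations hold almost everywhere.\<close>

definition Lax :: "(real \<Rightarrow> complex) \<Rightarrow> (real \<Rightarrow> complex) \<Rightarrow> real \<Rightarrow>
    (real \<Rightarrow> complex ^ 2) \<Rightarrow> (real \<Rightarrow> complex ^ 2) \<Rightarrow> bool" where
  "Lax q r \<kappa> u f \<longleftrightarrow> f \<in> L2 \<and>
     (\<exists>v\<^sub>1 v\<^sub>2. H1_deriv (\<lambda>x. u x $ 1) v\<^sub>1 \<and> H1_deriv (\<lambda>x. u x $ 2) v\<^sub>2 \<and>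
        (AE x in lborel.
           f x $ 1 = of_real \<kappa> * u x $ 1 - v\<^sub>1 x + q x * u x $ 2 \<and>
           f x $ 2 = - r x * u x $ 1 + (of_real \<kappa> * u x $ 2 + v\<^sub>2 x)))"

text \<open>Invertibility: surjective onto \<open>L\<^sup>2\<close>, with an \<open>L\<^sup>2\<close> bound on solutions, which gives both
  injectivity and boundedness of the inverse.\<close>

definition Lax_invertible :: "(real \<Rightarrow> complex) \<Rightarrow> (real \<Rightarrow> complex) \<Rightarrow> real \<Rightarrow> bool" where
  "Lax_invertible q r \<kappa> \<longleftrightarrow>
     (\<forall>f\<in>L2. \<exists>u. Lax q r \<kappa> u f) \<and>
     (\<exists>C. \<forall>u f. Lax q r \<kappa> u f \<longrightarrow> L2_norm u \<le> C * L2_norm f)"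

definition G0_pos :: "real \<Rightarrow> real \<Rightarrow> real \<Rightarrow> complex ^ 2 ^ 2" where
  "G0_pos \<kappa> x y = vector [vector [if x < y then of_real (exp (- \<kappa> * \<bar>x - y\<bar>)) else 0, 0],
                          vector [0, if y < x then of_real (exp (- \<kappa> * \<bar>x - y\<bar>)) else 0]]"

definition G0 :: "real \<Rightarrow> real \<Rightarrow> real \<Rightarrow> complex ^ 2 ^ 2" where
  "G0 \<kappa> x y = (if \<kappa> > 0 then G0_pos \<kappa> x y else - G0_pos (- \<kappa>) y x)"

text \<open>\<open>D = G - G\<^sub>0\<close>, where \<open>G\<close> is the integral kernel of \<open>L(\<kappa>)\<^sup>-\<^sup>1\<close>. A kernel is determined only
  up to null sets; continuity of \<open>D\<close> is what gives meaning to its values on the diagonal.\<close>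

definition green_correction :: "(real \<Rightarrow> complex) \<Rightarrow> (real \<Rightarrow> complex) \<Rightarrow> real \<Rightarrow>
    (real \<Rightarrow> real \<Rightarrow> complex ^ 2 ^ 2) \<Rightarrow> bool" where
  "green_correction q r \<kappa> D \<longleftrightarrow>
     Lax_invertible q r \<kappa> \<and>
     continuous_on UNIV (\<lambda>(x, y). D x y) \<and>
     (\<forall>u f. Lax q r \<kappa> u f \<longrightarrow>
        (AE x in lborel.
           integrable lborel (\<lambda>y. (G0 \<kappa> x y + D x y) *v f y) \<and>
           u x = (LINT y|lborel. (G0 \<kappa> x y + D x y) *v f y)))"

definition has_green :: "(real \<Rightarrow> complex) \<Rightarrow> (real \<Rightarrow> complex) \<Rightarrow> real \<Rightarrow> bool" where
  "has_green q r \<kappa> \<longleftrightarrow> (\<exists>D. green_correction q r \<kappa> D)"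

definition G_minus_G0 :: "(real \<Rightarrow> complex) \<Rightarrow> (real \<Rightarrow> complex) \<Rightarrow> real \<Rightarrow>
    real \<Rightarrow> real \<Rightarrow> complex ^ 2 ^ 2" where
  "G_minus_G0 q r \<kappa> = (THE D. green_correction q r \<kappa> D)"

definition G :: "(real \<Rightarrow> complex) \<Rightarrow> (real \<Rightarrow> complex) \<Rightarrow> real \<Rightarrow>
    real \<Rightarrow> real \<Rightarrow> complex ^ 2 ^ 2" where
  "G q r \<kappa> x y = G0 \<kappa> x y + G_minus_G0 q r \<kappa> x y"

definition g12 :: "(real \<Rightarrow> complex) \<Rightarrow> (real \<Rightarrow> complex) \<Rightarrow> real \<Rightarrow> real \<Rightarrow> complex" where
  "g12 q r \<kappa> x = of_real (sgn \<kappa>) * (G q r \<kappa> x x $ 1 $ 2)"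

definition g21 :: "(real \<Rightarrow> complex) \<Rightarrow> (real \<Rightarrow> complex) \<Rightarrow> real \<Rightarrow> real \<Rightarrow> complex" where
  "g21 q r \<kappa> x = of_real (sgn \<kappa>) * (G q r \<kappa> x x $ 2 $ 1)"

definition gam :: "(real \<Rightarrow> complex) \<Rightarrow> (real \<Rightarrow> complex) \<Rightarrow> real \<Rightarrow> real \<Rightarrow> complex" where
  "gam q r \<kappa> x =
     of_real (sgn \<kappa>) * (G_minus_G0 q r \<kappa> x x $ 1 $ 1 + G_minus_G0 q r \<kappa> x x $ 2 $ 2)"


section \<open>Density and currents\<close>

text \<open>\<open>\<mu>\<close> is the spectral parameter (varkappa) at which the density is evaluated; \<open>\<kappa>\<close> is the
  parameter of the difference flows.\<close>

definition rho :: "(real \<Rightarrow> complex) \<Rightarrow> (real \<Rightarrow> complex) \<Rightarrow> real \<Rightarrow> real \<Rightarrow> complex" where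
  "rho q r \<mu> x = (q x * g21 q r \<mu> x - r x * g12 q r \<mu> x) / (2 + gam q r \<mu> x)"

definition j_NLS :: "(real \<Rightarrow> complex) \<Rightarrow> (real \<Rightarrow> complex) \<Rightarrow> real \<Rightarrow> real \<Rightarrow> complex" where
  "j_NLS q r \<mu> x =
     - \<i> * ((Dx q x * g21 q r \<mu> x + Dx r x * g12 q r \<mu> x) / (2 + gam q r \<mu> x)
            - q x * r x + 2 * of_real \<mu> * rho q r \<mu> x)"

definition j_mKdV :: "(real \<Rightarrow> complex) \<Rightarrow> (real \<Rightarrow> complex) \<Rightarrow> real \<Rightarrow> real \<Rightarrow> complex" where
  "j_mKdV q r \<mu> x =
     ((Dx (Dx q) x - 2 * (q x)\<^sup>2 * r x) * g21 q r \<mu> x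
        - (Dx (Dx r) x - 2 * (r x)\<^sup>2 * q x) * g12 q r \<mu> x) / (2 + gam q r \<mu> x)
     - Dx q x * r x + q x * Dx r x + 2 * \<i> * of_real \<mu> * j_NLS q r \<mu> x"

definition j_pair :: "(real \<Rightarrow> complex) \<Rightarrow> (real \<Rightarrow> complex) \<Rightarrow> real \<Rightarrow> real \<Rightarrow> real \<Rightarrow> complex" where
  "j_pair q r \<mu> \<kappa> x =
     - \<i> * ((g12 q r \<kappa> x * g21 q r \<mu> x + g21 q r \<kappa> x * g12 q r \<mu> x)
            / (2 * of_real (\<kappa> - \<mu>) * (2 + gam q r \<mu> x)))
     + \<i> * (gam q r \<kappa> x / (4 * of_real (\<kappa> - \<mu>)))"

definition j_NLS_diff :: "(real \<Rightarrow> complex) \<Rightarrow> (real \<Rightarrow> complex) \<Rightarrow> real \<Rightarrow> real \<Rightarrow> real \<Rightarrow> complex" where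
  "j_NLS_diff q r \<mu> \<kappa> x =
     j_NLS q r \<mu> x + 4 * of_real \<kappa> ^ 3 * (j_pair q r \<mu> \<kappa> x - j_pair q r \<mu> (- \<kappa>) x)"

definition j_mKdV_diff :: "(real \<Rightarrow> complex) \<Rightarrow> (real \<Rightarrow> complex) \<Rightarrow> real \<Rightarrow> real \<Rightarrow> real \<Rightarrow> complex" where
  "j_mKdV_diff q r \<mu> \<kappa> x =
     j_mKdV q r \<mu> x + 8 * \<i> * of_real \<kappa> ^ 4 * (j_pair q r \<mu> \<kappa> x + j_pair q r \<mu> (- \<kappa>) x)
     + 4 * of_real \<kappa> ^ 2 * rho q r \<mu> x"


section \<open>The flows\<close>

definition evolves :: "(real \<Rightarrow> real \<Rightarrow> complex) \<Rightarrow> complex \<Rightarrow>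
    ((real \<Rightarrow> complex) \<Rightarrow> (real \<Rightarrow> complex) \<Rightarrow> real \<Rightarrow> complex) \<Rightarrow>
    (real \<Rightarrow> real \<Rightarrow> complex) \<Rightarrow> bool" where
  "evolves r c F q \<longleftrightarrow>
     (\<forall>t x. (\<lambda>\<tau>. q \<tau> x) differentiable (at t) \<and>
            c * vector_derivative (\<lambda>\<tau>. q \<tau> x) (at t) = F (q t) (r t) x)"

definition NLS_flow :: "(real \<Rightarrow> real \<Rightarrow> complex) \<Rightarrow> (real \<Rightarrow> real \<Rightarrow> complex) \<Rightarrow> bool" where
  "NLS_flow q r \<longleftrightarrow> evolves r \<i> (\<lambda>q r x. - Dx (Dx q) x + 2 * (q x)\<^sup>2 * r x) q"

definition mKdV_flow :: "(real \<Rightarrow> real \<Rightarrow> complex) \<Rightarrow> (real \<Rightarrow> real \<Rightarrow> complex) \<Rightarrow> bool" where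
  "mKdV_flow q r \<longleftrightarrow> evolves r 1 (\<lambda>q r x. - Dx (Dx (Dx q)) x + 6 * q x * r x * Dx q x) q"

definition NLS_diff_flow ::
    "real \<Rightarrow> (real \<Rightarrow> real \<Rightarrow> complex) \<Rightarrow> (real \<Rightarrow> real \<Rightarrow> complex) \<Rightarrow> bool" where
  "NLS_diff_flow \<kappa> q r \<longleftrightarrow> evolves r \<i>
     (\<lambda>q r x. - Dx (Dx q) x + 2 * (q x)\<^sup>2 * r x
        - 4 * of_real \<kappa> ^ 3 * (g12 q r \<kappa> x - g12 q r (- \<kappa>) x) - 4 * of_real \<kappa> ^ 2 * q x) q"

definition mKdV_diff_flow ::
    "real \<Rightarrow> (real \<Rightarrow> real \<Rightarrow> complex) \<Rightarrow> (real \<Rightarrow> real \<Rightarrow> complex) \<Rightarrow> bool" where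
  "mKdV_diff_flow \<kappa> q r \<longleftrightarrow> evolves r 1
     (\<lambda>q r x. - Dx (Dx (Dx q)) x + 6 * q x * r x * Dx q x
        - 8 * of_real \<kappa> ^ 4 * (g12 q r \<kappa> x + g12 q r (- \<kappa>) x) - 4 * of_real \<kappa> ^ 2 * Dx q x) q"

definition conservation_law ::
    "(real \<Rightarrow> real \<Rightarrow> complex) \<Rightarrow> (real \<Rightarrow> real \<Rightarrow> complex) \<Rightarrow> bool" where
  "conservation_law \<rho> j \<longleftrightarrow>
     (\<forall>t x. (\<lambda>\<tau>. \<rho> \<tau> x) differentiable (at t) \<and> (\<lambda>y. j t y) differentiable (at x) \<and>
            vector_derivative (\<lambda>\<tau>. \<rho> \<tau> x) (at t) + vector_derivative (\<lambda>y. j t y) (at x) = 0)"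

text \<open>Without this, the definite description in \<open>G_minus_G0\<close> and the totalised division in \<open>rho\<close>
  and the currents could carry no information.\<close>

definition quantities_defined ::
    "real \<Rightarrow> (real \<Rightarrow> real \<Rightarrow> complex) \<Rightarrow> (real \<Rightarrow> real \<Rightarrow> complex) \<Rightarrow> bool" where
  "quantities_defined \<mu> q r \<longleftrightarrow>
     (\<forall>t. (\<forall>k. 1 \<le> \<bar>k\<bar> \<longrightarrow> has_green (q t) (r t) k) \<and>
          (\<forall>x. 2 + gam (q t) (r t) \<mu> x \<noteq> 0))"

end

theory Submission
  imports Defs "HOL-Probability.Probability" "HOL-Real_Asymp.Real_Asymp"
begin

text \<open>The Jost solutions of \<open>L(\<kappa>)\<close> are encoded by the bounded solutions of the Riccati equations
  \<open>a' = r - 2\<kappa>a - qa\<^sup>2\<close> and \<open>b' = 2\<kappa>b + q - rb\<^sup>2\<close>; they yield \<open>g\<^sub>1\<^sub>2 = b / (1 - ab)\<close>,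
  \<open>g\<^sub>2\<^sub>1 = a / (1 - ab)\<close>, \<open>2 + \<gamma> = 2 / (1 - ab)\<close> and hence \<open>\<rho> = (qa - rb) / 2\<close>, while \<open>-\<kappa>\<close> amounts to
  exchanging \<open>q\<close> and \<open>r\<close>. Each flow has a zero curvature representation
  \<open>q\<^sub>t = V\<^sub>1\<^sub>2' - 2\<mu>V\<^sub>1\<^sub>2 + 2qv\<close>, \<open>r\<^sub>t = V\<^sub>2\<^sub>1' + 2\<mu>V\<^sub>2\<^sub>1 - 2rv\<close>, \<open>v' = qV\<^sub>2\<^sub>1 - rV\<^sub>1\<^sub>2\<close>, which gives
  \<open>(qa)\<^sub>t = (v + V\<^sub>1\<^sub>2 a)'\<close> and \<open>(rb)\<^sub>t = (-v + V\<^sub>2\<^sub>1 b)'\<close>; the currents are read off from this.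
  What must be controlled is \<open>\<bar>a\<bar>, \<bar>b\<bar> \<le> 1/4\<close> for all times. The energy \<open>\<kappa> \<integral> \<bar>a\<bar>\<^sup>2\<close> is comparable to the
  conserved \<open>\<integral> qa\<close>, it is initially \<open>O(\<delta>\<^sup>2 \<kappa>\<^sup>-\<^sup>1\<^sup>-\<^sup>2\<^sup>s)\<close>, and it controls the differences of the solutions at
  \<open>\<kappa>, 2\<kappa>, 4\<kappa>, \<dots>\<close>; summing the geometric series bounds \<open>a\<close> by \<open>1/8\<close>, which closes a continuity argument.\<close>

text \<open>Only the H^s norm at time 0 is small; the decay constant \<open>M\<close> of the
  potential is arbitrary and uniform only on compact time intervals. Hence bounds containing
  \<open>M\<close> serve for limits, openness and a priori finiteness, while every bound that must
  be small depends on \<open>s\<close> and \<delta> alone. The condition s > -1/2 enters twice,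
  through p = 2 + 2s > 1: it makes a dyadic (sewing) recursion for the energy summable, and it makes
  the energy decay in \<kappa>, so that the increments along the chain of parameters are geometric.
  Two features of the difference flows shape the rest. Their vector field contains the Green's
  function, so uniform differentiability in time is available only while the Riccati solutions exist
  and has to be proved inside the continuity argument. Energies are always compared with time 0, so
  losses do not accumulate.\<close>

abbreviation (input) hvd :: "(real \<Rightarrow> 'a::real_normed_vector) \<Rightarrow> 'a \<Rightarrow> real filter \<Rightarrow> bool" (infix "hvd" 50) where
  "f hvd D \<equiv> (f has_vector_derivative D)"

abbreviation (input) nd :: "real \<Rightarrow> real" where "nd \<equiv> std_normal_density"

lemmas hvd_add = has_vector_derivative_add and hvd_at_within = has_vector_derivative_at_within
 and hvd_cnj = has_vector_derivative_cnj and hvd_const = has_vector_derivative_const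
 and hvd_continuous = has_vector_derivative_continuous and hvd_def = has_vector_derivative_def
 and hvd_diff = has_vector_derivative_diff and hvd_divide = has_vector_derivative_divide
 and hvd_eq_rhs = has_vector_derivative_eq_rhs and hvd_minus = has_vector_derivative_minus
 and hvd_mult = has_vector_derivative_mult and hvd_mult_left = has_vector_derivative_mult_left
 and hvd_mult_right = has_vector_derivative_mult_right and hvd_of_real = has_vector_derivative_of_real
 and hvd_zero_constant = has_vector_derivative_zero_constant


section \<open>Damped linear equations with a decaying potential\<close>

text \<open>Integrable, with primitive \<open>arctan\<close>, and slowly varying: |wt'| <= wt.
  Against the growth of exp (2 \<kappa> x) it is almost constant, so damped equations pass this
  decay on from forcing to solution.\<close>

definition wt :: "real => real" where
 "wt x = 1 / (1 + x^2)"

lemma wt_denom_pos: "0 < 1 + x^2" for x :: real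
 by (metis add_strict_increasing zero_le_power2 zero_less_one)

lemma wt_pos: "0 < wt x"
 by (simp add: wt_def wt_denom_pos)

lemma wt_le_1: "wt x <= 1"
 by (simp add: wt_def wt_denom_pos divide_le_eq)

lemma wt_minus [simp]: "wt (- x) = wt x"
 by (simp add: wt_def)

lemma continuous_on_wt: "continuous_on S wt"
 unfolding wt_def using wt_denom_pos by (intro continuous_intros) (auto simp: less_le)

lemma wt_deriv: "(wt has_real_derivative - 2 * x * (wt x)^2) (at x)"
 unfolding wt_def using wt_denom_pos[of x]
 by (auto intro!: derivative_eq_intros simp: power2_eq_square)

lemma wt_deriv_bound: "\<bar>- 2 * x * (wt x)^2\<bar> <= wt x"
proof -
 have "2 * \<bar>x\<bar> <= 1 + x^2"
  using zero_le_power2[of "\<bar>x\<bar> - 1"] by (simp add: power2_eq_square algebra_simps)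
 then have "2 * \<bar>x\<bar> * wt x <= 1"
  using wt_denom_pos[of x] by (simp add: wt_def divide_le_eq)
 then have "2 * \<bar>x\<bar> * wt x * wt x <= 1 * wt x"
  using wt_pos[of x] by (intro mult_right_mono) auto
 then show ?thesis using wt_pos[of x] by (simp add: abs_mult power2_eq_square mult.assoc)
qed

lemma arctan_deriv_wt: "(arctan has_real_derivative wt x) (at x)"
 unfolding wt_def using DERIV_arctan[of x] by (simp add: inverse_eq_divide)

text \<open>What is kept of Schwartz decay in x. The bound \<open>M\<close> may be large, so it must
  stay out of every smallness condition.\<close>

definition pot :: "real => (real => complex) => bool" where
 "pot M f \<longleftrightarrow> continuous_on UNIV f \<and> (\<forall>x. cmod (f x) <= M * wt x)"

lemma pot_cont: "pot M f ==> continuous_on S f"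
 unfolding pot_def using continuous_on_subset by blast

lemma pot_bound: "pot M f ==> cmod (f x) <= M * wt x"
 by (simp add: pot_def)

lemma pot_nonneg: assumes "pot M f" shows "0 <= M"
proof -
 have "0 <= M * wt 0" using pot_bound[OF assms, of 0] norm_ge_zero order_trans by blast
 then show ?thesis using wt_pos[of 0] by (simp add: wt_def)
qed

lemma pot_bound1: "pot M f ==> cmod (f x) <= M"
 using pot_bound[of M f x] wt_le_1[of x] pot_nonneg[of M f] 
 by (meson mult_left_le order_trans)

lemma pot_mono: "pot M f ==> M <= N ==> pot N f"
 unfolding pot_def by (meson mult_right_mono order_trans wt_pos less_imp_le)

lemma pot_mult_bounded:
 assumes "pot M f" "continuous_on UNIV g" "\<And>x. cmod (g x) <= c"
 shows "pot (M * c) (\<lambda>x. f x * g x)"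
proof -
 have "cmod (f x * g x) <= M * c * wt x" for x
 proof -
  have "cmod (f x) * cmod (g x) <= (M * wt x) * c"
   using assms(1,3) pot_nonneg[OF assms(1)] wt_pos[of x]
   by (intro mult_mono) (auto simp: pot_def)
  then show ?thesis by (simp add: norm_mult mult_ac)
 qed
 then show ?thesis using assms unfolding pot_def by (auto intro: continuous_intros)
qed

lemma pot_reflect:
 assumes "pot M f" shows "pot M (\<lambda>x. f (- x))"
proof -
 have "continuous_on UNIV (\<lambda>x. f (- x))"
  by (rule continuous_on_compose2[OF pot_cont[OF assms, of UNIV] continuous_on_minus[OF continuous_on_id]]) simp
 moreover have "cmod (f (- x)) <= M * wt x" for x
  using pot_bound[OF assms, of "- x"] by simp
 ultimately show ?thesis by (simp add: pot_def)
qed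

lemma pot_cnj: "pot M f ==> \<bar>s\<bar> = 1 ==> pot M (\<lambda>x. of_real s * cnj (f x))"
 unfolding pot_def by (auto simp: norm_mult intro!: continuous_intros)

lemma antideriv_exists:
 fixes f :: "real => complex"
 assumes "continuous_on UNIV f"
 shows "\<exists>F. \<forall>x. (F hvd f x) (at x)"
proof -
 have "\<And>x. -\<infinity> < ereal x ==> ereal x < \<infinity> ==> isCont f x"
  using assms by (simp add: continuous_on_eq_continuous_at)
 from einterval_antiderivative[of "-\<infinity>" "\<infinity>" f, OF _ this]
 show ?thesis by auto
qed

lemma deriv_bound_general:
 fixes F :: "real => complex"
 assumes "y <= x" "\<And>u. (F hvd F' u) (at u)"
  "\<And>u. (p has_real_derivative p' u) (at u)" "\<And>u. cmod (F' u) <= p' u"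
 shows "cmod (F x - F y) <= p x - p y"
proof (cases "y = x")
 case False
 have 1: "continuous_on {y..x} F"
  using assms(2) by (meson continuous_at_imp_continuous_on hvd_continuous)
 have 2: "continuous_on {y..x} p"
  using assms(3) by (meson DERIV_isCont continuous_at_imp_continuous_on)
 show ?thesis
  by (rule differentiable_bound_general[of y x F p F' p'])
   (use False assms 1 2 has_real_derivative_iff_has_vector_derivative in auto)
qed simp

lemma deriv_cont: 
 fixes F :: "real => complex"
 shows "(\<And>u. (F hvd F' u) (at u)) ==> continuous_on S F"
 by (meson continuous_at_imp_continuous_on hvd_continuous)

text \<open>Comparison with \<open>M * arctan\<close>; the factor 2 bounds pi / 2.\<close>

lemma pot_antideriv:
 assumes "pot M f"
 obtains F where "\<And>x. (F hvd f x) (at x)" "\<And>x. cmod (F x) <= 2 * M"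
proof -
 obtain F0 where F0: "\<And>x. (F0 hvd f x) (at x)"
  using antideriv_exists[OF pot_cont[OF assms]] by auto
 define F where "F = (\<lambda>x. F0 x - F0 0)"
 have D: "(F hvd f x) (at x)" for x
  unfolding F_def using F0[of x] by (auto intro!: derivative_eq_intros)
 have at: "((\<lambda>x. M * arctan x) has_real_derivative M * wt u) (at u)" for u
  using arctan_deriv_wt[of u] by (rule DERIV_cmult)
 have pi: "\<bar>arctan x\<bar> <= 2" for x
  using arctan_bounded[of x] pi_less_4 by auto
 have b: "cmod (F x) <= 2 * M" for x
 proof (cases "0 <= x")
  case True
  have "cmod (F x - F 0) <= M * arctan x - M * arctan 0"
   by (rule deriv_bound_general[OF True D at]) (use assms in \<open>auto simp: pot_def\<close>)
  also have "\<dots> <= M * 2" using pi[of x] pot_nonneg[OF assms] 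
   by (simp add: mult_left_mono abs_le_iff)
  finally show ?thesis by (simp add: F_def)
 next
  case False
  then have "x <= 0" by simp
  then have "cmod (F 0 - F x) <= M * arctan 0 - M * arctan x"
   by (rule deriv_bound_general[OF _ D at]) (use assms in \<open>auto simp: pot_def\<close>)
  also have "\<dots> <= M * 2" using pi[of x] pot_nonneg[OF assms] 
   using mult_left_mono[of "- arctan x" 2 M] by (simp add: abs_le_iff)
  finally show ?thesis by (simp add: F_def norm_minus_commute)
 qed
 show ?thesis using that D b by blast
qed

text \<open>Since \<open>\<bar>G'\<bar> \<le> G\<close>, the function \<open>exp (2\<kappa>x) G / \<kappa>\<close> grows at least as fast as
 \<open>exp (2\<kappa>x) g\<close>; this makes \<open>m G / \<kappa>\<close> a barrier.\<close>

lemma damped_bound: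
 fixes z g :: "real => complex" and G G' :: "real => real"
 assumes k: "1 <= \<kappa>"
  and z: "\<And>x. (z hvd (- (2 * of_real \<kappa>) * z x + g x)) (at x)"
  and zb: "\<And>x. cmod (z x) <= c"
  and g: "\<And>x. cmod (g x) <= m * G x" and m: "0 <= m"
  and G: "\<And>x. (G has_real_derivative G' x) (at x)" and G': "\<And>x. \<bar>G' x\<bar> <= G x"
 shows "cmod (z x) <= m / \<kappa> * G x"
proof -
 define F where "F = (\<lambda>y. of_real (exp (2 * \<kappa> * y)) * z y)"
 define p where "p = (\<lambda>y. m / \<kappa> * (exp (2 * \<kappa> * y) * G y))"
 have G0: "0 <= G y" for y using G'[of y] by linarith
 have F': "(F hvd of_real (exp (2 * \<kappa> * y)) * g y) (at y)" for y
 proof -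
  have "((\<lambda>y. exp (2 * \<kappa> * y)) has_real_derivative exp (2 * \<kappa> * y) * (2 * \<kappa>)) (at y)"
   by (auto intro!: derivative_eq_intros)
  from hvd_mult[OF hvd_of_real[OF this] z[of y]]
  show ?thesis
   unfolding F_def by (rule hvd_eq_rhs) (simp add: algebra_simps)
 qed
 have p': "(p has_real_derivative m / \<kappa> * (exp (2 * \<kappa> * y) * (2 * \<kappa> * G y + G' y))) (at y)" for y
  unfolding p_def
  by (rule derivative_eq_intros G refl | simp add: algebra_simps)+
 have le: "cmod (of_real (exp (2 * \<kappa> * y)) * g y) <= m / \<kappa> * (exp (2 * \<kappa> * y) * (2 * \<kappa> * G y + G' y))" for y
 proof -
  have "G y <= \<kappa> * G y" using k G0[of y] by (simp add: mult_le_cancel_right1)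
  then have "\<kappa> * G y <= 2 * \<kappa> * G y + G' y" using G'[of y] by auto
  then have "m / \<kappa> * (\<kappa> * G y) <= m / \<kappa> * (2 * \<kappa> * G y + G' y)"
   using m k by (intro mult_left_mono) auto
  then have "m * G y <= m / \<kappa> * (2 * \<kappa> * G y + G' y)"
   using k by simp
  then have "cmod (g y) <= m / \<kappa> * (2 * \<kappa> * G y + G' y)" using g[of y] by linarith
  then have "exp (2 * \<kappa> * y) * cmod (g y) <= exp (2 * \<kappa> * y) * (m / \<kappa> * (2 * \<kappa> * G y + G' y))"
   by (rule mult_left_mono) simp
  then show ?thesis
   by (simp only: norm_mult norm_of_real abs_exp_cancel mult.left_commute[of "exp _" "m / \<kappa>"])
 qed
 \<comment> \<open>The last term is the value at the left end. It dies as y tends to -infinity: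
   boundedness of z takes the place of an initial condition.\<close>
 have bd: "cmod (F x) <= p x + exp (2 * \<kappa> * y) * c" if "y <= x" for y
 proof -
  have "cmod (F x - F y) <= p x - p y"
   by (rule deriv_bound_general[OF that F' p' le])
  moreover have "0 <= p y" unfolding p_def using m k G0[of y] by simp
  moreover have "cmod (F y) <= exp (2 * \<kappa> * y) * c"
   unfolding F_def using zb[of y] by (simp add: norm_mult)
  moreover have "cmod (F x) <= cmod (F x - F y) + cmod (F y)"
   by (metis diff_add_cancel norm_triangle_ineq)
  ultimately show ?thesis by linarith
 qed
 have "((\<lambda>y. p x + exp (2 * \<kappa> * y) * c) \<longlongrightarrow> p x + 0 * c) at_bot"
 proof (intro tendsto_intros)
  have "filterlim (\<lambda>y. 2 * \<kappa> * y) at_bot at_bot"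
   using k by (intro filterlim_tendsto_pos_mult_at_bot[OF tendsto_const]) (auto intro: filterlim_ident)
  then show "((\<lambda>y. exp (2 * \<kappa> * y)) \<longlongrightarrow> 0) at_bot"
   by (rule filterlim_compose[OF exp_at_bot])
 qed
 then have "cmod (F x) <= p x + 0 * c"
  by (rule tendsto_lowerbound)
   (auto simp: eventually_at_bot_linorder intro!: exI[of _ x] bd)
 then have "exp (2 * \<kappa> * x) * cmod (z x) <= exp (2 * \<kappa> * x) * (m / \<kappa> * G x)"
  by (simp add: F_def p_def norm_mult mult_ac)
 then show ?thesis by (simp only: mult_le_cancel_left_pos exp_gt_zero)
qed

text \<open>An integrating factor exp Z with Z' = \<zeta> removes the potential. As |Z| <= 2L it
  costs exp (2L) on entering and again on leaving, independently of \<kappa>.\<close>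

lemma damped_bound_pot:
 fixes z g \<zeta> :: "real => complex" and G G' :: "real => real"
 assumes k: "1 <= \<kappa>" and \<zeta>: "pot L \<zeta>"
  and z: "\<And>x. (z hvd (- (2 * of_real \<kappa> + \<zeta> x) * z x + g x)) (at x)"
  and zb: "\<And>x. cmod (z x) <= c"
  and g: "\<And>x. cmod (g x) <= m * G x" and m: "0 <= m"
  and G: "\<And>x. (G has_real_derivative G' x) (at x)" and G': "\<And>x. \<bar>G' x\<bar> <= G x"
 shows "cmod (z x) <= exp (4 * L) * m / \<kappa> * G x"
proof -
 obtain Z where Z: "\<And>x. (Z hvd \<zeta> x) (at x)" and Zb: "\<And>x. cmod (Z x) <= 2 * L"
  using pot_antideriv[OF \<zeta>] by blast
 have e1: "cmod (exp (Z x)) <= exp (2 * L)" "cmod (exp (- Z x)) <= exp (2 * L)" for x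
  using Zb[of x] abs_Re_le_cmod[of "Z x"] by (auto simp: norm_exp_eq_Re)
 have c: "0 <= c" using zb[of 0] norm_ge_zero order_trans by blast
 define y where "y = (\<lambda>x. exp (Z x) * z x)"
 have y: "(y hvd (- (2 * of_real \<kappa>) * y x + exp (Z x) * g x)) (at x)" for x
 proof -
  have "((\<lambda>x. exp (Z x)) hvd \<zeta> x * exp (Z x)) (at x)"
   using field_vector_diff_chain_at[OF Z[of x] DERIV_exp] by (simp add: o_def)
  from hvd_mult[OF this z[of x]]
  show ?thesis unfolding y_def
   by (rule hvd_eq_rhs) (simp add: algebra_simps)
 qed
 have yb: "cmod (y x) <= exp (2 * L) * c" for x
  unfolding y_def norm_mult using e1 zb c by (intro mult_mono) auto
 have gb: "cmod (exp (Z x) * g x) <= (exp (2 * L) * m) * G x" for x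
  unfolding norm_mult mult.assoc using e1 g by (intro mult_mono) auto
 have "cmod (y x) <= (exp (2 * L) * m) / \<kappa> * G x" for x
  by (rule damped_bound[OF k y yb gb _ G G']) (use m in auto)
 moreover have "z x = exp (- Z x) * y x" by (simp add: y_def exp_minus)
 ultimately have "cmod (z x) <= exp (2 * L) * ((exp (2 * L) * m) / \<kappa> * G x)"
  using e1(2)[of x] unfolding \<open>z x = _\<close> norm_mult by (intro mult_mono) auto
 also have "\<dots> = exp (4 * L) * m / \<kappa> * G x"
  using exp_add[of "2 * L" "2 * L"] by simp
 finally show ?thesis .
qed

lemma damped_bound_const:
 fixes z g \<zeta> :: "real => complex"
 assumes "1 <= \<kappa>" "pot L \<zeta>"
  "\<And>x. (z hvd (- (2 * of_real \<kappa> + \<zeta> x) * z x + g x)) (at x)"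
  "\<And>x. cmod (z x) <= c" "\<And>x. cmod (g x) <= m"
 shows "cmod (z x) <= exp (4 * L) * m / \<kappa>"
proof -
 have "0 <= m" using assms(5)[of 0] norm_ge_zero order_trans by blast
 then show ?thesis
  using damped_bound_pot[OF assms(1-4), of m "\<lambda>_. 1" "\<lambda>_. 0"] assms(5) by simp
qed

text \<open>Variation of constants started at -infinity. Homogeneous solutions blow up there, so no
  other starting point gives a bounded solution.\<close>

lemma damped_exists:
 fixes g \<zeta> :: "real => complex"
 assumes k: "1 <= \<kappa>" and \<zeta>: "pot L \<zeta>" and gc: "continuous_on UNIV g"
  and g: "\<And>x. cmod (g x) <= m"
 obtains z where "\<And>x. (z hvd (- (2 * of_real \<kappa> + \<zeta> x) * z x + g x)) (at x)"
  "\<And>x. cmod (z x) <= exp (4 * L) * m / \<kappa>"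
proof -
 obtain Z where Z: "\<And>x. (Z hvd \<zeta> x) (at x)" and Zb: "\<And>x. cmod (Z x) <= 2 * L"
  using pot_antideriv[OF \<zeta>] by blast
 have e1: "cmod (exp (Z x)) <= exp (2 * L)" "cmod (exp (- Z x)) <= exp (2 * L)" for x
  using Zb[of x] abs_Re_le_cmod[of "Z x"] by (auto simp: norm_exp_eq_Re)
 have m0: "0 <= m" using g[of 0] norm_ge_zero order_trans by blast
 have Zc: "continuous_on UNIV Z" using Z by (rule deriv_cont)
 define h where "h = (\<lambda>y. of_real (exp (2 * \<kappa> * y)) * exp (Z y) * g y)"
 have "continuous_on UNIV h" unfolding h_def by (intro continuous_intros Zc gc)
 then obtain F0 where F0: "\<And>x. (F0 hvd h x) (at x)"
  using antideriv_exists by blast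
 define C where "C = exp (2 * L) * m / (2 * \<kappa>)"
 have hb: "cmod (h u) <= C * (exp (2 * \<kappa> * u) * (2 * \<kappa>))" for u
 proof -
  have "cmod (exp (Z u)) * cmod (g u) <= exp (2 * L) * m"
   using e1 g by (intro mult_mono) auto
  then show ?thesis using k by (simp add: h_def C_def norm_mult)
 qed
 have D: "cmod (F0 x - F0 y) <= C * exp (2 * \<kappa> * x) - C * exp (2 * \<kappa> * y)" if "y <= x" for x y
  by (rule deriv_bound_general[OF that F0 _ hb]) (auto intro!: derivative_eq_intros)
 have C0: "0 <= C" using m0 k by (simp add: C_def)
 have lim0: "((\<lambda>n. exp (2 * \<kappa> * - real n)) \<longlongrightarrow> 0) sequentially"
  using k by real_asymp
 have "Cauchy (\<lambda>n. F0 (- real n))"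
 proof (rule CauchyI)
  fix e :: real assume "0 < e"
  have "((\<lambda>n. C * exp (2 * \<kappa> * - real n)) \<longlongrightarrow> C * 0) sequentially"
   by (intro tendsto_intros lim0)
  then have "eventually (\<lambda>n. C * exp (2 * \<kappa> * - real n) < e) sequentially"
   using \<open>0 < e\<close> by (auto intro: order_tendstoD)
  then obtain N where N: "C * exp (2 * \<kappa> * - real N) < e"
   by (auto simp: eventually_sequentially)
  have *: "cmod (F0 (- real i) - F0 (- real j)) < e" if "N <= i" "i <= j" for i j
  proof -
   have "cmod (F0 (- real i) - F0 (- real j)) <= C * exp (2 * \<kappa> * - real i) - C * exp (2 * \<kappa> * - real j)"
    by (rule D) (use that in auto)
   also have "\<dots> <= C * exp (2 * \<kappa> * - real i)" using C0 by simp
   also have "\<dots> <= C * exp (2 * \<kappa> * - real N)" using that k C0 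
    by (intro mult_left_mono) auto
   finally show ?thesis using N by linarith
  qed
  show "\<exists>M. \<forall>i\<ge>M. \<forall>j\<ge>M. norm (F0 (- real i) - F0 (- real j)) < e"
   by (metis * linear norm_minus_commute)
 qed
 \<comment> \<open>The integral from -infinity is realised as an antiderivative minus its limit
   \<open>l\<close> along the negative integers.\<close>
 then obtain l where l: "(\<lambda>n. F0 (- real n)) \<longlonglongrightarrow> l" 
  by (meson Cauchy_convergent convergent_def)
 have Fb: "cmod (F0 x - l) <= C * exp (2 * \<kappa> * x)" for x
 proof -
  have "(\<lambda>n. cmod (F0 x - F0 (- real n))) \<longlonglongrightarrow> cmod (F0 x - l)"
   by (intro tendsto_intros l)
  then show ?thesis
  proof (rule tendsto_upperbound)
   show "\<forall>\<^sub>F n in sequentially. cmod (F0 x - F0 (- real n)) <= C * exp (2 * \<kappa> * x)"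
    unfolding eventually_sequentially
   proof (intro exI allI impI)
    fix n assume "nat \<lceil>- x\<rceil> <= n"
    then have "- real n <= x" by linarith
    from D[OF this] C0 show "cmod (F0 x - F0 (- real n)) <= C * exp (2 * \<kappa> * x)"
     by (smt (verit) exp_ge_zero mult_nonneg_nonneg)
   qed
  qed simp
 qed
 define z where "z = (\<lambda>x. of_real (exp (- (2 * \<kappa> * x))) * exp (- Z x) * (F0 x - l))"
 have z: "(z hvd (- (2 * of_real \<kappa> + \<zeta> x) * z x + g x)) (at x)" for x
 proof -
  have 1: "((\<lambda>x. exp (- Z x)) hvd (- \<zeta> x) * exp (- Z x)) (at x)"
   using field_vector_diff_chain_at[OF hvd_minus[OF Z[of x]] DERIV_exp]
   by (simp add: o_def)
  have 2: "((\<lambda>x. exp (- (2 * \<kappa> * x))) has_real_derivative exp (- (2 * \<kappa> * x)) * (- (2 * \<kappa>))) (at x)"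
   by (auto intro!: derivative_eq_intros)
  have 3: "((\<lambda>x. F0 x - l) hvd h x) (at x)"
   using F0[of x] by (auto intro!: derivative_eq_intros)
  have 4: "of_real (exp (- (2 * \<kappa> * x))) * exp (- Z x) * h x = g x"
  proof -
   have a: "exp (- Z x) * exp (Z x) = 1" by (simp add: exp_minus)
   have b: "complex_of_real (exp (- (2 * \<kappa> * x))) * of_real (exp (2 * \<kappa> * x)) = 1"
    by (simp flip: of_real_mult exp_add)
   have "of_real (exp (- (2 * \<kappa> * x))) * exp (- Z x) * h x
     = (complex_of_real (exp (- (2 * \<kappa> * x))) * of_real (exp (2 * \<kappa> * x))) * (exp (- Z x) * exp (Z x)) * g x"
    unfolding h_def by (simp only: mult_ac)
   then show ?thesis using a b by simp
  qed
  show ?thesis unfolding z_def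
   by (rule hvd_eq_rhs[OF hvd_mult[OF hvd_mult[OF hvd_of_real[OF 2] 1] 3]])
    (use 4 in \<open>simp add: algebra_simps\<close>)
 qed
 have zb0: "cmod (z x) <= exp (2 * L) * C" for x
 proof -
  have "cmod (z x) = exp (- (2 * \<kappa> * x)) * (cmod (exp (- Z x)) * cmod (F0 x - l))"
   by (simp add: z_def norm_mult)
  also have "\<dots> <= exp (- (2 * \<kappa> * x)) * (exp (2 * L) * (C * exp (2 * \<kappa> * x)))"
   using e1 Fb by (intro mult_mono mult_nonneg_nonneg order_refl) auto
  also have "\<dots> = exp (2 * L) * C * (exp (- (2 * \<kappa> * x)) * exp (2 * \<kappa> * x))" by (simp only: mult_ac)
  also have "\<dots> = exp (2 * L) * C" by (simp flip: exp_add)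
  finally show ?thesis .
 qed
 have "cmod (z x) <= exp (4 * L) * m / \<kappa>" for x
  by (rule damped_bound_const[OF k \<zeta> z zb0 g])
 then show ?thesis using that z by blast
qed

section \<open>Riccati equations: uniqueness, stability, dependence on a parameter\<close>

text \<open>Boundedness on the whole line replaces a condition at -infinity and singles out the
  solution belonging to the left Jost solution; \<open>ricb\<close> is its mirror image at
  +infinity.\<close>

definition ric :: "real => (real => complex) => (real => complex) => real => (real => complex) => bool" where
 "ric \<kappa> q r c a \<longleftrightarrow>
   (\<forall>x. (a hvd (r x - 2 * of_real \<kappa> * a x - q x * (a x)^2)) (at x)) \<and>
   (\<forall>x. cmod (a x) <= c)"

definition ricb :: "real => (real => complex) => (real => complex) => real => (real => complex) => bool" where
 "ricb \<kappa> q r c b \<longleftrightarrow>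
   (\<forall>x. (b hvd (q x + 2 * of_real \<kappa> * b x - r x * (b x)^2)) (at x)) \<and>
   (\<forall>x. cmod (b x) <= c)"

lemma ricD: "ric \<kappa> q r c a ==> (a hvd (r x - 2 * of_real \<kappa> * a x - q x * (a x)^2)) (at x)"
 by (simp add: ric_def)
lemma ric_le: "ric \<kappa> q r c a ==> cmod (a x) <= c"
 by (simp add: ric_def)
lemma ricbD: "ricb \<kappa> q r c b ==> (b hvd (q x + 2 * of_real \<kappa> * b x - r x * (b x)^2)) (at x)"
 by (simp add: ricb_def)
lemma ricb_le: "ricb \<kappa> q r c b ==> cmod (b x) <= c"
 by (simp add: ricb_def)

lemma ric_cont: "ric \<kappa> q r c a ==> continuous_on S a"
 by (rule deriv_cont) (rule ricD)

lemma ric_mono: "ric \<kappa> q r c a ==> c <= c' ==> ric \<kappa> q r c' a"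
 unfolding ric_def by (meson order_trans)

lemma hvd_reflect:
 assumes "(f hvd D) (at (- x))"
 shows "((\<lambda>x. f (- x)) hvd - D) (at x)"
proof -
 have "(uminus hvd - 1) (at x)" for x :: real
  by (auto intro!: derivative_eq_intros)
 from vector_diff_chain_at[OF this assms] show ?thesis by (simp add: o_def)
qed

text \<open>The reflection x -> -x together with b -> -b exchanges q and r, so every result on left
  solutions transfers to right ones.\<close>

lemma ricb_iff_ric:
 "ricb \<kappa> q r c b \<longleftrightarrow> ric \<kappa> (\<lambda>x. r (- x)) (\<lambda>x. q (- x)) c (\<lambda>x. - b (- x))"
proof
 assume b: "ricb \<kappa> q r c b"
 have "((\<lambda>x. - b (- x)) hvd (q (- x) - 2 * of_real \<kappa> * (- b (- x)) - r (- x) * (- b (- x))^2)) (at x)" for x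
  using hvd_minus[OF hvd_reflect[OF ricbD[OF b]]] by simp
 then show "ric \<kappa> (\<lambda>x. r (- x)) (\<lambda>x. q (- x)) c (\<lambda>x. - b (- x))"
  using b by (simp add: ric_def ricb_def)
next
 assume a: "ric \<kappa> (\<lambda>x. r (- x)) (\<lambda>x. q (- x)) c (\<lambda>x. - b (- x))"
 have "(b hvd (q x + 2 * of_real \<kappa> * b x - r x * (b x)^2)) (at x)" for x
  using hvd_minus[OF hvd_reflect[OF ricD[OF a], of x]] by simp
 moreover have "cmod (b x) <= c" for x using ric_le[OF a, of "- x"] by simp
 ultimately show "ricb \<kappa> q r c b" by (simp add: ricb_def)
qed

lemma ric_reflect_ricb:
 "ric \<kappa> (\<lambda>x. r (- x)) (\<lambda>x. q (- x)) c A ==> ricb \<kappa> q r c (\<lambda>x. - A (- x))"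
 by (simp add: ricb_iff_ric)

text \<open>For r = \<sigma> cnj q, conjugation exchanges the two potentials. This yields the
  solutions for the pair (r, q), which describe the parameter - \<kappa>.\<close>

lemma ric_cnj:
 assumes "ric \<kappa> q (\<lambda>x. of_real s * cnj (q x)) c a" "\<bar>s\<bar> = 1"
 shows "ric \<kappa> (\<lambda>x. of_real s * cnj (q x)) q c (\<lambda>x. of_real s * cnj (a x))"
proof -
 have ss: "complex_of_real s * of_real s = 1"
  using assms(2) by (metis abs_mult_self_eq mult_1 of_real_1 of_real_mult)
 have "((\<lambda>x. of_real s * cnj (a x)) hvd
   (q x - 2 * of_real \<kappa> * (of_real s * cnj (a x)) - of_real s * cnj (q x) * (of_real s * cnj (a x))^2)) (at x)" for x
 proof -
  have "((\<lambda>x. of_real s * cnj (a x)) hvd of_real s *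
    cnj (of_real s * cnj (q x) - 2 * of_real \<kappa> * a x - q x * (a x)^2)) (at x)"
   by (intro hvd_mult_right hvd_cnj ricD[OF assms(1)])
  moreover have "of_real s * cnj (of_real s * cnj (q x) - 2 * of_real \<kappa> * a x - q x * (a x)^2)
    = (of_real s * of_real s) * q x - 2 * of_real \<kappa> * (of_real s * cnj (a x)) - of_real s * cnj (q x) * (cnj (a x))^2"
   by (simp add: algebra_simps)
  moreover have "(of_real s * cnj (a x))^2 = (of_real s * of_real s) * (cnj (a x))^2"
   by (simp add: power2_eq_square)
  ultimately show ?thesis using ss by simp
 qed
 then show ?thesis using assms by (simp add: ric_def norm_mult)
qed

lemma ricb_cnj:
 assumes "ricb \<kappa> q (\<lambda>x. of_real s * cnj (q x)) c b" "\<bar>s\<bar> = 1"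
 shows "ricb \<kappa> (\<lambda>x. of_real s * cnj (q x)) q c (\<lambda>x. of_real s * cnj (b x))"
proof -
 have ss: "complex_of_real s * of_real s = 1"
  using assms(2) by (metis abs_mult_self_eq mult_1 of_real_1 of_real_mult)
 have ss': "of_real s * (of_real s * z) = z" for z :: complex
  using ss by (simp flip: mult.assoc)
 define Q where "Q = (\<lambda>x. of_real s * cnj (q (- x)))"
 have "(\<lambda>x. of_real s * cnj (Q x)) = (\<lambda>x. q (- x))"
  by (simp add: Q_def fun_eq_iff ss')
 then have "ric \<kappa> Q (\<lambda>x. of_real s * cnj (Q x)) c (\<lambda>x. - b (- x))"
  using assms(1) by (simp add: ricb_iff_ric Q_def)
 from ric_cnj[OF this assms(2)] show ?thesis
  unfolding ricb_iff_ric \<open>_ = (\<lambda>x. q (- x))\<close> by (simp add: Q_def)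
qed

text \<open>The difference of squares factors, so the difference of two solutions obeys a linear
  damped equation with potential q (a + a').\<close>

lemma ric_diff_deriv:
 assumes a: "ric \<kappa> q r c a" and a': "ric \<kappa> q' r' c' a'"
 shows "((\<lambda>x. a' x - a x) hvd
   (- (2 * of_real \<kappa> + q x * (a x + a' x)) * (a' x - a x) + ((r' x - r x) - (q' x - q x) * (a' x)^2))) (at x)"
 by (rule hvd_eq_rhs[OF hvd_diff[OF ricD[OF a'] ricD[OF a]]])
  (simp add: algebra_simps power2_eq_square)

lemma cmod_add_le: "cmod x <= c ==> cmod y <= c' ==> cmod (x + y) <= c + c'"
 by (meson add_mono norm_triangle_ineq order_trans)

lemma cmod_mult_le: "cmod x <= c ==> cmod y <= c' ==> cmod (x * y) <= c * c'"
 unfolding norm_mult by (rule mult_mono) (auto intro: order_trans[OF norm_ge_zero])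

lemma cmod_sq_le: "cmod x <= c ==> cmod (x^2) <= c^2"
 unfolding power2_eq_square by (rule cmod_mult_le)

lemma cmod_diff_le: "cmod x <= c ==> cmod y <= c' ==> cmod (x - y) <= c + c'"
 using cmod_add_le[of x c "- y" c'] by simp

text \<open>The damped equation for the difference has potential \<open>pot (M / 2)\<close>, whence
  exp (4 * M / 2), and forcing at most e + e / 16.\<close>

lemma ric_lipschitz:
 assumes k: "1 <= \<kappa>" and q: "pot M q" and a: "ric \<kappa> q r (1/4) a" and a': "ric \<kappa> q' r' (1/4) a'"
  and dq: "\<And>x. cmod (q' x - q x) <= e" and dr: "\<And>x. cmod (r' x - r x) <= e"
 shows "cmod (a' x - a x) <= exp (2 * M) * (2 * e)"
proof -
 have z: "pot (M * (1/4 + 1/4)) (\<lambda>x. q x * (a x + a' x))"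
  by (rule pot_mult_bounded[OF q])
   (intro continuous_intros ric_cont[OF a] ric_cont[OF a'] cmod_add_le ric_le[OF a] ric_le[OF a'])+
 have e: "0 <= e" using dq[of 0] norm_ge_zero order_trans by blast
 have g: "cmod ((r' x - r x) - (q' x - q x) * (a' x)^2) <= e + e * (1/4)^2" for x
  by (intro cmod_diff_le cmod_mult_le cmod_sq_le dq dr ric_le[OF a'])
 have "cmod (a' x - a x) <= exp (4 * (M * (1/4 + 1/4))) * (e + e * (1/4)^2) / \<kappa>"
  by (rule damped_bound_const[OF k z ric_diff_deriv[OF a a'] _ g, of "1/4 + 1/4"])
   (intro cmod_diff_le ric_le[OF a] ric_le[OF a'])
 also have "\<dots> <= exp (4 * (M * (1/4 + 1/4))) * (e + e * (1/4)^2) / 1"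
  using k e by (intro divide_left_mono mult_nonneg_nonneg) auto
 also have "\<dots> <= exp (2 * M) * (2 * e)"
  using e by (simp add: power2_eq_square)
 finally show ?thesis .
qed

lemma ric_unique:
 assumes "1 <= \<kappa>" "pot M q" "ric \<kappa> q r (1/4) a" "ric \<kappa> q r (1/4) a'"
 shows "a = a'"
proof
 fix x
 have "cmod (a' x - a x) <= exp (2 * M) * (2 * 0)"
  by (rule ric_lipschitz[OF assms]) auto
 then show "a x = a' x" by simp
qed

text \<open>The quadratic term counts as forcing, at most M / 16 in the weight, and
  \<open>wt\<close> serves as its own barrier.\<close>

lemma ric_decay:
 assumes k: "1 <= \<kappa>" and q: "pot M q" and r: "pot M r" and a: "ric \<kappa> q r (1/4) a"
 shows "cmod (a x) <= 2 * M / \<kappa> * wt x"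
proof -
 have "cmod (a x) <= (2 * M) / \<kappa> * wt x"
 proof (rule damped_bound[OF k, where g = "\<lambda>x. r x - q x * (a x)^2" and G = wt and c = "1/4"])
  show "(a hvd - (2 * complex_of_real \<kappa>) * a x + (r x - q x * (a x)^2)) (at x)" for x
   by (rule hvd_eq_rhs[OF ricD[OF a]]) simp
  show "cmod (r x - q x * (a x)^2) <= 2 * M * wt x" for x
  proof -
   have "cmod (r x - q x * (a x)^2) <= M * wt x + (M * wt x) * (1/4)^2"
    by (intro cmod_diff_le cmod_mult_le cmod_sq_le pot_bound[OF q] pot_bound[OF r] ric_le[OF a])
   also have "\<dots> <= 2 * M * wt x"
    using pot_nonneg[OF q] wt_pos[of x] by (simp add: power2_eq_square)
   finally show ?thesis .
  qed
  show "0 <= 2 * M" using pot_nonneg[OF q] by simp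
 qed (rule ric_le[OF a] wt_deriv wt_deriv_bound)+
 then show ?thesis .
qed

lemma ricb_decay:
 assumes "1 <= \<kappa>" "pot M q" "pot M r" "ricb \<kappa> q r (1/4) b"
 shows "cmod (b x) <= 2 * M / \<kappa> * wt x"
 using ric_decay[OF assms(1) pot_reflect[OF assms(3)] pot_reflect[OF assms(2)] assms(4)[unfolded ricb_iff_ric], of "- x"]
 by simp

lemma ricb_lipschitz:
 assumes k: "1 <= \<kappa>" and q: "pot M r" and a: "ricb \<kappa> q r (1/4) b" and a': "ricb \<kappa> q' r' (1/4) b'"
  and dq: "\<And>x. cmod (q' x - q x) <= e" and dr: "\<And>x. cmod (r' x - r x) <= e"
 shows "cmod (b' x - b x) <= exp (2 * M) * (2 * e)"
 using ric_lipschitz[OF k pot_reflect[OF q] a[unfolded ricb_iff_ric] a'[unfolded ricb_iff_ric] dr dq, of "- x"]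
 by (simp add: norm_minus_commute)

text \<open>The correction \<open>d\<close> to a solution \<open>a\<close> for the unperturbed potentials solves
 \<open>d' = - (2\<kappa> + 2qa) d + h(d)\<close> with \<open>h\<close> small and contractive near \<open>0\<close>.\<close>

lemma ric_stable:
 assumes M: "0 <= M"
 obtains e where "0 < e"
  "\<And>\<kappa> q r q' r' a. [|1 <= \<kappa>; pot M q; continuous_on UNIV r; continuous_on UNIV q'; continuous_on UNIV r';
    \<And>x. cmod (q' x - q x) <= e; \<And>x. cmod (r' x - r x) <= e; ric \<kappa> q r (1/8) a|]
   ==> \<exists>a'. ric \<kappa> q' r' (1/4) a'"
proof -
 \<comment> \<open>\<open>\<rho>\<close> is the radius of the ball of corrections d: at most 1/8, so
   that |a + d| <= 1/4, and so small that exp M times the quadratic term \<open>q d\<^sup>2\<close>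
   uses up at most an eighth of it. \<open>e\<close> depends on \<open>M\<close> only, so one
   neighbourhood serves every \<kappa>.\<close>
 define \<rho> where "\<rho> = exp (- M) / (8 * (M + 1))"
 define e where "e = \<rho> * exp (- M) / 4"
 have \<rho>: "0 < \<rho>" "\<rho> <= 1/8"
 proof -
  have "exp (- M) <= M + 1" using M by (meson add_increasing exp_le_one_iff le_numeral_extra(4) neg_le_0_iff_le order_trans)
  then show "\<rho> <= 1/8" using M by (simp add: \<rho>_def field_simps)
 qed (use M in \<open>simp add: \<rho>_def\<close>)
 have e: "0 < e" using \<rho> by (simp add: e_def)
 have eM: "exp M * e = \<rho> / 4" by (simp add: e_def exp_minus field_simps)
 have rM: "exp M * (M * \<rho>) <= 1/8"
 proof -
  have "exp M * (M * \<rho>) = M / (8 * (M + 1)) * (exp M * exp (- M))" by (simp add: \<rho>_def)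
  then have "exp M * (M * \<rho>) = M / (8 * (M + 1))" by (simp flip: exp_add)
  also have "\<dots> <= 1/8" using M by (simp add: field_simps)
  finally show ?thesis .
 qed
 have "\<exists>a'. ric \<kappa> q' r' (1/4) a'"
  if k: "1 <= \<kappa>" and q: "pot M q" and rc: "continuous_on UNIV r" and q'c: "continuous_on UNIV q'"
   and r'c: "continuous_on UNIV r'" and dq: "\<And>x. cmod (q' x - q x) <= e"
   and dr: "\<And>x. cmod (r' x - r x) <= e" and a: "ric \<kappa> q r (1/8) a" for \<kappa> q r q' r' a
 proof -
  define h where "h = (\<lambda>(d :: real => complex) x. (r' x - r x) - (q' x - q x) * (a x + d x)^2 - q x * (d x)^2)"
  have "cmod (2 * a x) <= 1/4" for x using ric_le[OF a, of x] by (simp add: norm_mult)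
  then have z: "pot (M * (1/4)) (\<lambda>x. q x * (2 * a x))"
   by (intro pot_mult_bounded[OF q] continuous_intros ric_cont[OF a])
  have hc: "continuous_on UNIV (h d)" if "continuous_on UNIV d" for d
   unfolding h_def by (intro continuous_intros that rc r'c q'c pot_cont[OF q] ric_cont[OF a])
  have hb: "cmod (h d x) <= 2 * e + M * \<rho>^2" if "\<And>x. cmod (d x) <= \<rho>" for d x
  proof -
   have "cmod (h d x) <= e + e * (1/8 + \<rho>)^2 + M * \<rho>^2"
    unfolding h_def
    by (intro cmod_diff_le cmod_mult_le cmod_sq_le cmod_add_le dq dr ric_le[OF a] that pot_bound1[OF q])
   moreover have "(1/8 + \<rho>)^2 <= 1" using \<rho> by (intro power_le_one) auto
   ultimately show ?thesis using e mult_left_mono[of "(1/8 + \<rho>)^2" 1 e] by linarith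
  qed
  have hl: "cmod (h d x - h d' x) <= (e + 2 * M * \<rho>) * C"
   if d: "\<And>x. cmod (d x) <= \<rho>" and d': "\<And>x. cmod (d' x) <= \<rho>" and C: "\<And>x. cmod (d x - d' x) <= C" for d d' x C
  proof -
   have eq: "h d x - h d' x = - ((q' x - q x) * ((a x + d x) + (a x + d' x)) + q x * (d x + d' x)) * (d x - d' x)"
    unfolding h_def by (simp add: algebra_simps power2_eq_square)
   have "cmod ((q' x - q x) * ((a x + d x) + (a x + d' x)) + q x * (d x + d' x))
    <= e * ((1/8 + \<rho>) + (1/8 + \<rho>)) + M * (\<rho> + \<rho>)"
    by (intro cmod_mult_le cmod_add_le dq ric_le[OF a] d d' pot_bound1[OF q])
   also have "\<dots> <= e * 1 + M * (\<rho> + \<rho>)" using \<rho> e M by (intro add_mono mult_left_mono) auto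
   also have "\<dots> = e + 2 * M * \<rho>" by simp
   finally have "cmod (- ((q' x - q x) * ((a x + d x) + (a x + d' x)) + q x * (d x + d' x))) <= e + 2 * M * \<rho>"
    unfolding norm_minus_cancel .
   then show ?thesis unfolding eq by (intro cmod_mult_le C)
  qed
  define sol where "sol = (\<lambda>g m z. (\<forall>x. (z hvd (- (2 * of_real \<kappa> + q x * (2 * a x)) * z x + g x)) (at x)) \<and>
   (\<forall>x::real. cmod (z x) <= exp M * m))"
  define m0 where "m0 = 2 * e + M * \<rho>^2"
  have m0: "0 <= m0" using e M by (simp add: m0_def)
  have m0': "exp M * m0 <= \<rho>"
  proof -
   have "exp M * m0 = 2 * (exp M * e) + exp M * (M * \<rho>) * \<rho>"
    by (simp add: m0_def algebra_simps power2_eq_square)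
   also have "\<dots> <= 2 * (\<rho> / 4) + (1/8) * \<rho>"
    unfolding eM using rM \<rho> by (intro add_mono mult_right_mono) auto
   also have "\<dots> <= \<rho>" using \<rho> by simp
   finally show ?thesis .
  qed
  have kdiv: "exp (4 * (M * (1/4))) * m / \<kappa> <= exp M * m" if "0 <= m" for m
  proof -
   have "exp M * m / \<kappa> <= exp M * m / 1"
    using k that by (intro divide_left_mono) auto
   then show ?thesis by simp
  qed
  have ex: "\<exists>z. sol (h d) m0 z" if dc: "continuous_on UNIV d" and db: "\<And>x. cmod (d x) <= \<rho>" for d
  proof -
   obtain z where "\<And>x. (z hvd (- (2 * of_real \<kappa> + q x * (2 * a x)) * z x + h d x)) (at x)"
    "\<And>x. cmod (z x) <= exp (4 * (M * (1/4))) * m0 / \<kappa>"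
    using damped_exists[OF k z hc[OF dc] hb[OF db]] unfolding m0_def by blast
   then show ?thesis using kdiv[OF m0] unfolding sol_def by (meson order_trans)
  qed
  \<comment> \<open>Banach's theorem on a closed ball of bounded continuous functions: T d solves
    the linear equation with forcing h d, maps the ball to itself by m0', and contracts by
    1/2.\<close>
  define S where "S = cball (0 :: real \<Rightarrow>\<^sub>C complex) \<rho>"
  have S: "d \<in> S \<longleftrightarrow> (\<forall>x. cmod (apply_bcontfun d x) <= \<rho>)" for d
  proof
   assume "d \<in> S"
   then have "norm d <= \<rho>" by (simp add: S_def)
   then show "\<forall>x. cmod (apply_bcontfun d x) <= \<rho>" using norm_bounded[of d] order_trans by blast
  next
   assume "\<forall>x. cmod (apply_bcontfun d x) <= \<rho>"
   then have "norm d <= \<rho>" by (intro norm_bound) auto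
   then show "d \<in> S" by (simp add: S_def)
  qed
  define T where "T = (\<lambda>d. Bcontfun (SOME z. sol (h (apply_bcontfun d)) m0 z))"
  have T: "sol (h (apply_bcontfun d)) m0 (apply_bcontfun (T d))" if "d \<in> S" for d
  proof -
   define z where "z = (SOME z. sol (h (apply_bcontfun d)) m0 z)"
   have "\<exists>z. sol (h (apply_bcontfun d)) m0 z"
    by (rule ex) (use that S in auto)
   then have z: "sol (h (apply_bcontfun d)) m0 z"
    unfolding z_def by (rule someI_ex)
   have "continuous_on UNIV z" by (rule deriv_cont) (use z in \<open>auto simp: sol_def\<close>)
   then have "z \<in> bcontfun" by (rule bcontfun_normI) (use z in \<open>auto simp: sol_def\<close>)
   then have "apply_bcontfun (T d) = z" unfolding T_def z_def[symmetric] by (simp add: Bcontfun_inverse)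
   then show ?thesis using z by simp
  qed
  have TS: "T d \<in> S" if "d \<in> S" for d
   using T[OF that] m0' unfolding S sol_def by (meson order_trans)
  have contr: "dist (T d) (T d') <= 1/2 * dist d d'" if "d \<in> S" "d' \<in> S" for d d'
  proof (rule dist_bound)
   fix x
   define g where "g = (\<lambda>x. h (apply_bcontfun d) x - h (apply_bcontfun d') x)"
   define zz where "zz = (\<lambda>x. apply_bcontfun (T d) x - apply_bcontfun (T d') x)"
   have C: "cmod (apply_bcontfun d x - apply_bcontfun d' x) <= dist d d'" for x
    by (metis dist_bounded dist_norm)
   have gb: "cmod (g x) <= (e + 2 * M * \<rho>) * dist d d'" for x
    unfolding g_def by (rule hl) (use that S C in auto)
   have zd: "(zz hvd (- (2 * of_real \<kappa> + q x * (2 * a x)) * zz x + g x)) (at x)" for x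
   proof -
    have "(zz hvd
      ((- (2 * of_real \<kappa> + q x * (2 * a x)) * apply_bcontfun (T d) x + h (apply_bcontfun d) x) -
      (- (2 * of_real \<kappa> + q x * (2 * a x)) * apply_bcontfun (T d') x + h (apply_bcontfun d') x))) (at x)"
     unfolding zz_def using T[OF that(1)] T[OF that(2)] unfolding sol_def
     by (intro hvd_diff) auto
    then show ?thesis
     by (rule hvd_eq_rhs) (simp add: zz_def g_def algebra_simps)
   qed
   have zzb: "cmod (zz x) <= \<rho> + \<rho>" for x
    unfolding zz_def using TS that S by (intro cmod_diff_le) auto
   have "cmod (zz x) <= exp (4 * (M * (1/4))) * ((e + 2 * M * \<rho>) * dist d d') / \<kappa>"
    by (rule damped_bound_const[OF k z zd zzb gb])
   also have "\<dots> <= exp M * ((e + 2 * M * \<rho>) * dist d d')"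
    using e M \<rho> by (intro kdiv mult_nonneg_nonneg) auto
   also have "\<dots> = (exp M * e + 2 * (exp M * (M * \<rho>))) * dist d d'" by (simp add: algebra_simps)
   also have "\<dots> <= (1/2) * dist d d'"
    unfolding eM using rM \<rho> by (intro mult_right_mono) auto
   finally show "dist (apply_bcontfun (T d) x) (apply_bcontfun (T d') x) <= 1/2 * dist d d'"
    by (simp add: zz_def dist_norm)
  qed
  have "Topological_Spaces.complete S" unfolding S_def by (simp add: complete_eq_closed)
  moreover have "S \<noteq> {}" using \<rho> by (auto simp: S_def)
  ultimately have "\<exists>!d. d \<in> S \<and> T d = d"
   by (rule Banach_fix[where c = "1/2"]) (use TS contr in auto)
  then obtain d where d: "d \<in> S" "T d = d" by blast
  have "ric \<kappa> q' r' (1/4) (\<lambda>x. a x + apply_bcontfun d x)"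
   unfolding ric_def
  proof safe
   fix x
   have 1: "(apply_bcontfun d hvd (- (2 * of_real \<kappa> + q x * (2 * a x)) * apply_bcontfun d x + h (apply_bcontfun d) x)) (at x)"
    using T[OF d(1)] d(2) by (simp add: sol_def)
   show "((\<lambda>x. a x + apply_bcontfun d x) hvd
     r' x - 2 * of_real \<kappa> * (a x + apply_bcontfun d x) - q' x * (a x + apply_bcontfun d x)^2) (at x)"
    by (rule hvd_eq_rhs[OF hvd_add[OF ricD[OF a] 1]])
     (simp add: h_def algebra_simps power2_eq_square)
   have "cmod (a x + apply_bcontfun d x) <= 1/8 + 1/8"
    using d(1) \<rho>(2) unfolding S by (intro cmod_add_le ric_le[OF a]) (meson order_trans)
   then show "cmod (a x + apply_bcontfun d x) <= 1/4" by simp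
  qed
  then show ?thesis by blast
 qed
 then show ?thesis using that e by blast
qed

section \<open>Differentiability in time, uniformly in space\<close>

text \<open>The error is uniform in x because that is what sup norm estimates for damped equations
  propagate, and what permits differentiating integrals over x.\<close>

definition udiff :: "(real => real => complex) => (real => complex) => real => bool" where
 "udiff f f' t \<longleftrightarrow> (\<forall>e>0. \<exists>d>0. \<forall>\<tau>. \<bar>\<tau> - t\<bar> < d -->
   (\<forall>x. cmod (f \<tau> x - f t x - of_real (\<tau> - t) * f' x) <= e * \<bar>\<tau> - t\<bar>))"

lemma udiff_pointwise:
 assumes "udiff f f' t" shows "((\<lambda>\<tau>. f \<tau> x) hvd f' x) (at t)"
 unfolding hvd_def has_derivative_at_alt
proof (intro conjI allI impI)
 show "bounded_linear (\<lambda>h. h *\<^sub>R f' x)" by (rule bounded_linear_scaleR_left)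
 fix e :: real assume "0 < e"
 then obtain d where "d > 0" "\<And>\<tau> x. \<bar>\<tau> - t\<bar> < d ==> cmod (f \<tau> x - f t x - of_real (\<tau> - t) * f' x) <= e * \<bar>\<tau> - t\<bar>"
  using assms unfolding udiff_def by meson
 then show "\<exists>d>0. \<forall>y. norm (y - t) < d --> cmod (f y x - f t x - (y - t) *\<^sub>R f' x) <= e * norm (y - t)"
  by (intro exI[of _ d]) (simp add: scaleR_conv_of_real del: of_real_diff)
qed

lemma udiff_lipschitz:
 assumes "udiff f f' t" "\<And>x. cmod (f' x) <= K"
 shows "\<exists>d>0. \<forall>\<tau>. \<bar>\<tau> - t\<bar> < d --> (\<forall>x. cmod (f \<tau> x - f t x) <= (K + 1) * \<bar>\<tau> - t\<bar>)"
proof -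
 obtain d where d: "d > 0" "\<And>\<tau> x. \<bar>\<tau> - t\<bar> < d ==> cmod (f \<tau> x - f t x - of_real (\<tau> - t) * f' x) <= 1 * \<bar>\<tau> - t\<bar>"
  using assms(1) unfolding udiff_def by (meson zero_less_one)
 have "cmod (f \<tau> x - f t x) <= (K + 1) * \<bar>\<tau> - t\<bar>" if "\<bar>\<tau> - t\<bar> < d" for \<tau> x
 proof -
  have "cmod ((f \<tau> x - f t x - of_real (\<tau> - t) * f' x) + of_real (\<tau> - t) * f' x) <= 1 * \<bar>\<tau> - t\<bar> + \<bar>\<tau> - t\<bar> * K"
   by (intro cmod_add_le cmod_mult_le d that assms(2)) (simp only: norm_of_real)
  then show ?thesis by (simp add: algebra_simps)
 qed
 then show ?thesis using d by blast
qed

text \<open>The remainder a(\<tau>) - a(t) - (\<tau> - t) P solves a damped equation with forcing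
  o(\<tau> - t), hence is o(\<tau> - t) itself. The candidate \<open>P\<close> is handed in: the
  zero curvature relations supply it explicitly.\<close>

lemma udiff_ric:
 assumes k: "1 <= \<kappa>" and q: "pot M (q t)"
  and dq: "udiff q qt t" and dr: "udiff r rt t"
  and qt: "\<And>x. cmod (qt x) <= K" and rt: "\<And>x. cmod (rt x) <= K"
  and d0: "0 < d0" and a: "\<And>\<tau>. \<bar>\<tau> - t\<bar> < d0 ==> ric \<kappa> (q \<tau>) (r \<tau>) (1/4) (a \<tau>)"
  and P: "\<And>x. (P hvd (- (2 * of_real \<kappa> + 2 * q t x * a t x) * P x + (rt x - qt x * (a t x)^2))) (at x)"
  and Pb: "\<And>x. cmod (P x) <= K"
 shows "udiff a P t"
 unfolding udiff_def
proof (intro allI impI)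
 fix e :: real assume e: "0 < e"
 have K: "0 <= K" using Pb[of 0] norm_ge_zero order_trans by blast
 have M: "0 <= M" using pot_nonneg[OF q] .
 obtain d1 where d1: "d1 > 0" "\<And>\<tau> x. \<bar>\<tau> - t\<bar> < d1 ==> cmod (q \<tau> x - q t x) <= (K + 1) * \<bar>\<tau> - t\<bar>"
  using udiff_lipschitz[OF dq qt] by blast
 obtain d2 where d2: "d2 > 0" "\<And>\<tau> x. \<bar>\<tau> - t\<bar> < d2 ==> cmod (r \<tau> x - r t x) <= (K + 1) * \<bar>\<tau> - t\<bar>"
  using udiff_lipschitz[OF dr rt] by blast
 \<comment> \<open>The forcing will be at most 4 * e' * D and the damped equation multiplies it by
   exp (2 * M); the product is e * D.\<close>
 define e' where "e' = e / (4 * exp (2 * M))"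
 have e': "0 < e'" using e by (simp add: e'_def)
 obtain d3 where d3: "d3 > 0" "\<And>\<tau> x. \<bar>\<tau> - t\<bar> < d3 ==> cmod (q \<tau> x - q t x - of_real (\<tau> - t) * qt x) <= e' * \<bar>\<tau> - t\<bar>"
  using dq e' unfolding udiff_def by meson
 obtain d4 where d4: "d4 > 0" "\<And>\<tau> x. \<bar>\<tau> - t\<bar> < d4 ==> cmod (r \<tau> x - r t x - of_real (\<tau> - t) * rt x) <= e' * \<bar>\<tau> - t\<bar>"
  using dr e' unfolding udiff_def by meson
 define C where "C = exp (2 * M) * (2 * (K + 1))"
 have C: "0 < C" using K by (simp add: C_def)
 define d5 where "d5 = e' / (C * K + M * C * K + 1)"
 have den: "0 < C * K + M * C * K + 1" using C K M by (intro add_nonneg_pos add_nonneg_nonneg mult_nonneg_nonneg) auto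
 have d5: "0 < d5" using e' den by (simp add: d5_def)
 define d where "d = Min {d0, d1, d2, d3, d4, d5}"
 have "cmod (a \<tau> x - a t x - of_real (\<tau> - t) * P x) <= e * \<bar>\<tau> - t\<bar>" if tau: "\<bar>\<tau> - t\<bar> < d" for \<tau> x
 proof -
  have lt: "\<bar>\<tau> - t\<bar> < d0" "\<bar>\<tau> - t\<bar> < d1" "\<bar>\<tau> - t\<bar> < d2" "\<bar>\<tau> - t\<bar> < d3" "\<bar>\<tau> - t\<bar> < d4" "\<bar>\<tau> - t\<bar> < d5"
   using tau by (auto simp: d_def)
  define D where "D = \<bar>\<tau> - t\<bar>"
  have aT: "ric \<kappa> (q \<tau>) (r \<tau>) (1/4) (a \<tau>)" and a0: "ric \<kappa> (q t) (r t) (1/4) (a t)"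
   using a lt d0 by auto
  have lip: "cmod (a \<tau> x - a t x) <= C * D" for x
  proof -
   have "cmod (a \<tau> x - a t x) <= exp (2 * M) * (2 * ((K + 1) * \<bar>\<tau> - t\<bar>))"
    by (rule ric_lipschitz[OF k q a0 aT d1(2) d2(2)]) (use lt in auto)
   then show ?thesis by (simp only: C_def D_def mult.assoc)
  qed
  define h where "h = complex_of_real (\<tau> - t)"
  have hD: "cmod h = D" unfolding h_def D_def by (simp only: norm_of_real)
  define z where "z = (\<lambda>x. a \<tau> x - a t x - h * P x)"
  define g where "g = (\<lambda>x. (r \<tau> x - r t x - h * rt x) - ((q \<tau> x - q t x - h * qt x) * (a \<tau> x)^2
    + h * (qt x * ((a \<tau> x + a t x) * (a \<tau> x - a t x)))) - q t x * ((a \<tau> x - a t x) * (h * P x)))"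
  have zd: "(z hvd (- (2 * of_real \<kappa> + q t x * (a t x + a \<tau> x)) * z x + g x)) (at x)" for x
   unfolding z_def
   by (rule hvd_eq_rhs[OF hvd_diff[OF ric_diff_deriv[OF a0 aT] hvd_mult_right[OF P]]])
    (simp add: g_def algebra_simps power2_eq_square)
  have zp: "pot (M * (1/4 + 1/4)) (\<lambda>x. q t x * (a t x + a \<tau> x))"
   by (rule pot_mult_bounded[OF q])
    (intro continuous_intros ric_cont[OF a0] ric_cont[OF aT] cmod_add_le ric_le[OF a0] ric_le[OF aT])+
  have zb: "cmod (z x) <= 1/4 + 1/4 + D * K" for x
   unfolding z_def by (intro cmod_diff_le cmod_mult_le ric_le[OF a0] ric_le[OF aT] Pb) (simp add: hD)
  have gb: "cmod (g x) <= 4 * e' * D" for x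
  proof -
   have "cmod (g x) <= e' * D + (e' * D * (1/4)^2 + D * (K * ((1/4 + 1/4) * (C * D)))) + M * ((C * D) * (D * K))"
    unfolding g_def
    by (intro cmod_diff_le cmod_add_le cmod_mult_le cmod_sq_le ric_le[OF a0] ric_le[OF aT] Pb qt lip pot_bound1[OF q])
     (rule d3(2)[OF lt(4), folded h_def D_def] d4(2)[OF lt(5), folded h_def D_def] | simp add: hD)+
   also have "\<dots> <= e' * D + e' * D + (C * K + M * C * K + 1) * D * D"
   proof -
    have n: "0 <= D * D" "0 <= D * (K * (C * D))" "0 <= e' * D" using C K e' by (auto simp: D_def)
    have "D * (K * ((1/4 + 1/4) * (C * D))) = (1/2) * (D * (K * (C * D)))" by simp
    moreover have "(C * K + M * C * K + 1) * D * D = D * (K * (C * D)) + M * ((C * D) * (D * K)) + D * D"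
     by (simp add: algebra_simps)
    moreover have "e' * D * (1/4)^2 = e' * D / 16" by (simp add: power2_eq_square)
    ultimately show ?thesis using n by linarith
   qed
   also have "\<dots> <= e' * D + e' * D + e' * D"
   proof -
    have "(C * K + M * C * K + 1) * D <= e'"
     using lt(6) den by (simp add: d5_def D_def pos_less_divide_eq mult.commute)
    then have "(C * K + M * C * K + 1) * D * D <= e' * D" by (intro mult_right_mono) (auto simp: D_def)
    then show ?thesis by (rule add_left_mono)
   qed
   also have "\<dots> <= 4 * e' * D" using e' by (simp add: D_def)
   finally show ?thesis .
  qed
  have "cmod (z x) <= exp (4 * (M * (1/4 + 1/4))) * (4 * e' * D) / \<kappa>"
   by (rule damped_bound_const[OF k zp zd zb gb])
  also have "\<dots> <= exp (4 * (M * (1/4 + 1/4))) * (4 * e' * D) / 1"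
   using k e' by (intro divide_left_mono mult_nonneg_nonneg) (auto simp: D_def)
  also have "\<dots> = e * D" by (simp add: e'_def)
  finally show ?thesis by (simp add: z_def h_def D_def)
 qed
 moreover have "0 < d" using d0 d1 d2 d3 d4 d5 by (simp add: d_def)
 ultimately show "\<exists>d>0. \<forall>\<tau>. \<bar>\<tau> - t\<bar> < d --> (\<forall>x. cmod (a \<tau> x - a t x - of_real (\<tau> - t) * P x) <= e * \<bar>\<tau> - t\<bar>)"
  by blast
qed

lemma udiff_reflect: "udiff f f' t ==> udiff (\<lambda>\<tau> x. f \<tau> (- x)) (\<lambda>x. f' (- x)) t"
 unfolding udiff_def by meson

lemma udiff_minus: "udiff f f' t ==> udiff (\<lambda>\<tau> x. - f \<tau> x) (\<lambda>x. - f' x) t"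
proof -
 have "cmod (- f \<tau> x - - f t x - of_real (\<tau> - t) * - f' x) = cmod (f \<tau> x - f t x - of_real (\<tau> - t) * f' x)" for \<tau> x
  by (subst norm_minus_cancel[symmetric]) (simp add: algebra_simps)
 then show "udiff f f' t ==> udiff (\<lambda>\<tau> x. - f \<tau> x) (\<lambda>x. - f' x) t" by (simp only: udiff_def)
qed

lemma udiff_ricb:
 assumes k: "1 <= \<kappa>" and r: "pot M (r t)"
  and dq: "udiff q qt t" and dr: "udiff r rt t"
  and qt: "\<And>x. cmod (qt x) <= K" and rt: "\<And>x. cmod (rt x) <= K"
  and d0: "0 < d0" and b: "\<And>\<tau>. \<bar>\<tau> - t\<bar> < d0 ==> ricb \<kappa> (q \<tau>) (r \<tau>) (1/4) (b \<tau>)"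
  and P: "\<And>x. (P hvd ((2 * of_real \<kappa> - 2 * r t x * b t x) * P x + (qt x - rt x * (b t x)^2))) (at x)"
  and Pb: "\<And>x. cmod (P x) <= K"
 shows "udiff b P t"
proof -
 have "udiff (\<lambda>\<tau> x. - b \<tau> (- x)) (\<lambda>x. - P (- x)) t"
 proof (rule udiff_ric[OF k pot_reflect[OF r] udiff_reflect[OF dr] udiff_reflect[OF dq] _ _ d0])
  show "ric \<kappa> (\<lambda>x. r \<tau> (- x)) (\<lambda>x. q \<tau> (- x)) (1/4) (\<lambda>x. - b \<tau> (- x))" if "\<bar>\<tau> - t\<bar> < d0" for \<tau>
   using b[OF that] by (simp add: ricb_iff_ric)
  show "((\<lambda>x. - P (- x)) hvd
     - (2 * complex_of_real \<kappa> + 2 * r t (- x) * - b t (- x)) * - P (- x) + (qt (- x) - rt (- x) * (- b t (- x))^2)) (at x)" for x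
   by (rule hvd_eq_rhs[OF hvd_minus[OF hvd_reflect[OF P]]])
    (simp add: algebra_simps)
 qed (use qt rt Pb in auto)
 from udiff_minus[OF udiff_reflect[OF this]] show ?thesis by simp
qed

section \<open>Energy identities\<close>

lemma cmod_sq_deriv:
 assumes "(f hvd f') (at x)"
 shows "((\<lambda>x. (cmod (f x))^2) has_real_derivative 2 * Re (cnj (f x) * f')) (at x)"
proof -
 have 1: "((\<lambda>x. Re (f x)) has_real_derivative Re f') (at x)"
  using bounded_linear.has_vector_derivative[OF bounded_linear_Re assms]
  by (simp add: has_real_derivative_iff_has_vector_derivative)
 have 2: "((\<lambda>x. Im (f x)) has_real_derivative Im f') (at x)"
  using bounded_linear.has_vector_derivative[OF bounded_linear_Im assms]
  by (simp add: has_real_derivative_iff_has_vector_derivative)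
 have "((\<lambda>x. (Re (f x))^2 + (Im (f x))^2) has_real_derivative 2 * Re (cnj (f x) * f')) (at x)"
  by (rule derivative_eq_intros 1 2 refl | simp)+
 then show ?thesis by (simp add: cmod_power2)
qed

lemma sq_le_16: "cmod z <= 1/4 ==> (cmod z)^2 <= 1/16"
 using power_mono[of "cmod z" "1/4" 2] by (simp add: power2_eq_square)

locale riccati =
 fixes \<sigma> \<kappa> M :: real and q a :: "real => complex"
 assumes \<sigma>: "\<sigma> = 1 \<or> \<sigma> = - 1" and \<kappa>: "1 <= \<kappa>" and q: "pot M q"
  and a: "ric \<kappa> q (\<lambda>x. of_real \<sigma> * cnj (q x)) (1/4) a"
begin

definition "n x = (cmod (a x))^2"
text \<open>The conformal denominator of the metric in which solutions are compared: hyperbolic for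
  \<sigma> = 1, spherical for \<sigma> = -1.\<close>

definition "m x = 1 - \<sigma> * n x"

lemma n_bounds: "0 <= n x" "n x <= 1/16"
 using sq_le_16[OF ric_le[OF a]] by (auto simp: n_def)

lemma m_bounds: "15/16 <= m x" "m x <= 17/16" "0 < m x"
 using n_bounds[of x] \<sigma> by (auto simp: m_def)

lemma n_cont: "continuous_on S n"
 unfolding n_def by (intro continuous_intros ric_cont[OF a])

lemma m_cont: "continuous_on S m"
 unfolding m_def by (intro continuous_intros n_cont)

lemma n_deriv: "(n has_real_derivative (2 * Re (q x * a x) * (\<sigma> - n x) - 4 * \<kappa> * n x)) (at x)"
proof -
 have nn: "n = (\<lambda>x. (cmod (a x))^2)" by (simp add: n_def fun_eq_iff)
 have eq: "2 * Re (cnj (a x) * (of_real \<sigma> * cnj (q x) - 2 * of_real \<kappa> * a x - q x * (a x)^2))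
  = 2 * Re (q x * a x) * (\<sigma> - n x) - 4 * \<kappa> * n x"
  unfolding n_def cmod_power2 by (simp add: algebra_simps power2_eq_square)
 have "(n has_real_derivative 2 * Re (cnj (a x) * (of_real \<sigma> * cnj (q x) - 2 * of_real \<kappa> * a x - q x * (a x)^2))) (at x)"
  unfolding nn by (rule cmod_sq_deriv[OF ricD[OF a]])
 then show ?thesis unfolding eq .
qed

text \<open>As \<open>\<sigma>\<^sup>2 = 1\<close>, the factor \<sigma> - n in n' equals \<sigma> m.
  Dividing by m therefore leaves q only in Re (q a), the density of the conserved quantity, plus a
  term of one sign.\<close>

lemma ln_m_deriv: "((\<lambda>x. ln (m x)) has_real_derivative (- 2 * Re (q x * a x) + 4 * \<kappa> * \<sigma> * (n x / m x))) (at x)"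
proof -
 have mm: "(m has_real_derivative (0 - \<sigma> * (2 * Re (q x * a x) * (\<sigma> - n x) - 4 * \<kappa> * n x))) (at x)"
  unfolding m_def by (rule DERIV_diff[OF DERIV_const DERIV_cmult[OF n_deriv]])
 have "\<sigma> * (\<sigma> - n x) = m x" using \<sigma> by (auto simp: m_def)
 then have eq: "0 - \<sigma> * (2 * Re (q x * a x) * (\<sigma> - n x) - 4 * \<kappa> * n x) = - 2 * Re (q x * a x) * m x + 4 * \<kappa> * \<sigma> * n x"
 proof -
  have "0 - s * (2 * Q * (s - n) - 4 * k * n) = - 2 * Q * (s * (s - n)) + 4 * k * s * n" for s Q n k :: real
   by (simp add: algebra_simps)
  note this[of \<sigma> "Re (q x * a x)" "n x" \<kappa>]
  then show ?thesis unfolding \<open>\<sigma> * (\<sigma> - n x) = m x\<close> .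
 qed
 have "((\<lambda>x. ln (m x)) has_real_derivative (1 / m x * (- 2 * Re (q x * a x) * m x + 4 * \<kappa> * \<sigma> * n x))) (at x)"
  using DERIV_ln_divide[OF m_bounds(3)] mm[unfolded eq] by (rule DERIV_chain2)
 moreover have "1 / m x * (- 2 * Re (q x * a x) * m x + 4 * \<kappa> * \<sigma> * n x) = - 2 * Re (q x * a x) + 4 * \<kappa> * \<sigma> * (n x / m x)"
  using m_bounds(3)[of x] by (simp add: field_simps)
 ultimately show ?thesis by simp
qed

lemma pot_r: "pot M (\<lambda>x. of_real \<sigma> * cnj (q x))"
 by (rule pot_cnj[OF q]) (use \<sigma> in auto)

lemma decay: "cmod (a x) <= 2 * M / \<kappa> * wt x"
 by (rule ric_decay[OF \<kappa> q pot_r a])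

lemma a_tendsto: "(a \<longlongrightarrow> 0) at_infinity"
proof (rule tendsto_norm_zero_cancel, rule tendsto_sandwich[OF _ _ tendsto_const])
 show "\<forall>\<^sub>F x in at_infinity. 0 <= norm (a x)" by simp
 show "\<forall>\<^sub>F x in at_infinity. norm (a x) <= 2 * M / \<kappa> * wt x" using decay by simp
 have "((\<lambda>x. 2 * M / \<kappa> * wt x) \<longlongrightarrow> 2 * M / \<kappa> * 0) at_infinity"
 proof (intro tendsto_intros)
  show "(wt \<longlongrightarrow> 0) at_infinity"
   unfolding wt_def at_infinity_eq_at_top_bot by (intro filterlim_sup) real_asymp+
 qed
 then show "((\<lambda>x. 2 * M / \<kappa> * wt x) \<longlongrightarrow> 0) at_infinity" by simp
qed

lemma ln_m_tendsto: "((\<lambda>x. ln (m x)) \<longlongrightarrow> 0) at_infinity"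
proof -
 have "((\<lambda>x. 1 - \<sigma> * (cmod (a x))^2) \<longlongrightarrow> 1 - \<sigma> * (cmod 0)^2) at_infinity"
  by (intro tendsto_intros a_tendsto)
 then have "((\<lambda>x. ln (m x)) \<longlongrightarrow> ln 1) at_infinity"
  unfolding m_def n_def by (intro tendsto_ln) auto
 then show ?thesis by simp
qed

lemma boundary_tendsto: "((\<lambda>X. ln (m X) - ln (m (- X))) \<longlongrightarrow> 0) at_top"
proof -
 have 1: "filterlim (\<lambda>X::real. X) at_infinity at_top" 
  by (rule filterlim_mono[OF filterlim_ident at_top_le_at_infinity order_refl])
 have 2: "filterlim (\<lambda>X::real. - X) at_infinity at_top"
  using filterlim_uminus_at_bot_at_top at_bot_le_at_infinity filterlim_mono by blast
 have "((\<lambda>X. ln (m X) - ln (m (- X))) \<longlongrightarrow> 0 - 0) at_top"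
  by (intro tendsto_diff filterlim_compose[OF ln_m_tendsto 1] filterlim_compose[OF ln_m_tendsto 2])
 then show ?thesis by simp
qed

lemma qa_integrable: "(\<lambda>x. q x * a x) integrable_on {u..v}"
 by (intro integrable_continuous_real continuous_intros pot_cont[OF q] ric_cont[OF a])

lemma nm_integrable: "(\<lambda>x. n x / m x) integrable_on {u..v}"
 using m_bounds(3) by (intro integrable_continuous_real continuous_intros n_cont m_cont) (auto simp: less_le)

lemma n_integrable: "n integrable_on {u..v}"
 by (intro integrable_continuous_real n_cont)

text \<open>The left side is comparable to the energy because m lies between 15/16 and 17/16, and
  the boundary term vanishes as X grows. So the integral of q a controls the energy whatever the
  size of q.\<close>

lemma energy_identity:
 assumes "0 <= X"
 shows "4 * \<kappa> * integral {-X..X} (\<lambda>x. n x / m x)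
  = \<sigma> * (2 * Re (integral {-X..X} (\<lambda>x. q x * a x)) + (ln (m X) - ln (m (- X))))"
proof -
 have "((\<lambda>x. - 2 * Re (q x * a x) + 4 * \<kappa> * \<sigma> * (n x / m x)) has_integral (ln (m X) - ln (m (- X)))) {-X..X}"
  using assms ln_m_deriv
  by (intro fundamental_theorem_of_calculus)
   (auto simp: has_real_derivative_iff_has_vector_derivative hvd_at_within)
 moreover have "((\<lambda>x. - 2 * Re (q x * a x) + 4 * \<kappa> * \<sigma> * (n x / m x)) has_integral
   - 2 * Re (integral {-X..X} (\<lambda>x. q x * a x)) + 4 * \<kappa> * \<sigma> * integral {-X..X} (\<lambda>x. n x / m x)) {-X..X}"
  by (intro has_integral_add has_integral_mult_right has_integral_Re integrable_integral qa_integrable nm_integrable)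
 ultimately have "ln (m X) - ln (m (- X)) =
   - 2 * Re (integral {-X..X} (\<lambda>x. q x * a x)) + 4 * \<kappa> * \<sigma> * integral {-X..X} (\<lambda>x. n x / m x)"
  by (rule has_integral_unique)
 then show ?thesis using \<sigma> by auto
qed

end

text \<open>Stated on symmetric windows instead of the whole line, so that the fundamental theorem
  of calculus applies directly and no integrability has to be carried along.\<close>

definition en :: "real => (real => complex) => real => bool" where
 "en \<kappa> a B \<longleftrightarrow> (\<forall>X\<ge>0. \<kappa> * integral {-X..X} (\<lambda>x. (cmod (a x))^2) <= B)"

lemma en_nonneg: "en \<kappa> a B ==> 0 <= B"
 unfolding en_def by (drule spec[of _ 0]) simp

text \<open>By the energy identity, asymptotically equal integrals of q a mean comparable energies.
  It is applied between two times and between a and the reflected b. The true constant is 17/15, the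
  ratio of the bounds of m.\<close>

lemma energy_transfer:
 assumes "riccati \<sigma> \<kappa> M q a" "riccati \<sigma> \<kappa> N q' a'"
  and lim: "((\<lambda>X. Re (integral {-X..X} (\<lambda>x. q' x * a' x)) - Re (integral {-X..X} (\<lambda>x. q x * a x))) \<longlongrightarrow> 0) at_top"
  and en: "en \<kappa> a B"
 shows "en \<kappa> a' (2 * B)"
 unfolding en_def
proof (intro allI impI)
 interpret A: riccati \<sigma> \<kappa> M q a by fact
 interpret A': riccati \<sigma> \<kappa> N q' a' by fact
 fix X :: real assume X: "0 <= X"
 define D where "D = (\<lambda>X. (Re (integral {-X..X} (\<lambda>x. q' x * a' x)) - Re (integral {-X..X} (\<lambda>x. q x * a x))) * 2
   + (ln (A'.m X) - ln (A'.m (- X))) - (ln (A.m X) - ln (A.m (- X))))"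
 have "(D \<longlongrightarrow> 0 * 2 + 0 - 0) at_top"
  unfolding D_def by (intro tendsto_intros lim A.boundary_tendsto A'.boundary_tendsto)
 then have D: "((\<lambda>X. \<sigma> * D X / 4) \<longlongrightarrow> \<sigma> * 0 / 4) at_top" by (intro tendsto_intros) auto
 have bound: "\<kappa> * integral {-X..X} A'.n <= 17/15 * B + 17/16 * (\<sigma> * D Y / 4)" if Y: "X <= Y" for Y
 proof -
  have Y0: "0 <= Y" using X Y by simp
  have "\<kappa> * integral {-X..X} A'.n <= \<kappa> * integral {-Y..Y} A'.n"
   using A.\<kappa> Y A'.n_bounds by (intro mult_left_mono integral_subset_le A'.n_integrable) auto
  also have "\<dots> <= \<kappa> * integral {-Y..Y} (\<lambda>x. 17/16 * (A'.n x / A'.m x))"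
  proof -
   have "A'.n x <= 17/16 * (A'.n x / A'.m x)" for x
    using A'.n_bounds[of x] A'.m_bounds[of x] 
     mult_left_mono[of "A'.m x" "17/16" "A'.n x"] by (simp add: field_simps)
   then show ?thesis
    using A.\<kappa> by (intro mult_left_mono integral_le A'.n_integrable integrable_on_mult_right A'.nm_integrable) auto
  qed
  also have "\<dots> = 17/16 * (\<kappa> * integral {-Y..Y} (\<lambda>x. A'.n x / A'.m x))"
   unfolding integral_mult_right by simp
  also have "\<kappa> * integral {-Y..Y} (\<lambda>x. A'.n x / A'.m x) = \<kappa> * integral {-Y..Y} (\<lambda>x. A.n x / A.m x) + \<sigma> * D Y / 4"
  proof -
   have "4 * \<kappa> * integral {-Y..Y} (\<lambda>x. A'.n x / A'.m x) - 4 * \<kappa> * integral {-Y..Y} (\<lambda>x. A.n x / A.m x) = \<sigma> * D Y"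
    unfolding A.energy_identity[OF Y0] A'.energy_identity[OF Y0] D_def by (simp add: algebra_simps)
   then show ?thesis by linarith
  qed
  also have "\<kappa> * integral {-Y..Y} (\<lambda>x. A.n x / A.m x) <= 16/15 * B"
  proof -
   have le: "A.n x / A.m x <= 16/15 * A.n x" for x
    using A.n_bounds[of x] A.m_bounds[of x]
     mult_left_mono[of "15/16" "A.m x" "A.n x"] by (simp add: field_simps)
   have "\<kappa> * integral {-Y..Y} (\<lambda>x. A.n x / A.m x) <= \<kappa> * integral {-Y..Y} (\<lambda>x. 16/15 * A.n x)"
    using A.\<kappa> le by (intro mult_left_mono integral_le integrable_on_mult_right A.n_integrable A.nm_integrable) auto
   also have "\<dots> = 16/15 * (\<kappa> * integral {-Y..Y} A.n)" by simp
   also have "\<dots> <= 16/15 * B"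
    using en Y0 unfolding en_def A.n_def by (intro mult_left_mono) auto
   finally show ?thesis .
  qed
  finally show ?thesis by (simp add: algebra_simps)
 qed
 have "((\<lambda>Y. 17/15 * B + 17/16 * (\<sigma> * D Y / 4)) \<longlongrightarrow> 17/15 * B + 17/16 * (\<sigma> * 0 / 4)) at_top"
  by (intro tendsto_add tendsto_mult_left tendsto_const D)
 then have "\<kappa> * integral {-X..X} A'.n <= 17/15 * B + 17/16 * (\<sigma> * 0 / 4)"
  by (rule tendsto_lowerbound) (use bound in \<open>auto simp: eventually_at_top_linorder\<close>)
 also have "\<dots> <= 2 * B" using en_nonneg[OF en] by simp
 finally show "\<kappa> * integral {-X..X} (\<lambda>x. (cmod (a' x))^2) <= 2 * B"
  unfolding A'.n_def .
qed

lemma riccati_reflect: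
 assumes \<sigma>: "\<sigma> = 1 \<or> \<sigma> = - 1" and "1 <= \<kappa>" "pot M q" "ricb \<kappa> q (\<lambda>x. of_real \<sigma> * cnj (q x)) (1/4) b"
 shows "riccati \<sigma> \<kappa> M (\<lambda>x. of_real \<sigma> * cnj (q (- x))) (\<lambda>x. - b (- x))"
proof
 have ss: "of_real \<sigma> * (of_real \<sigma> * z) = z" for z :: complex using \<sigma> by auto
 show "ric \<kappa> (\<lambda>x. complex_of_real \<sigma> * cnj (q (- x)))
   (\<lambda>x. complex_of_real \<sigma> * cnj (complex_of_real \<sigma> * cnj (q (- x)))) (1 / 4) (\<lambda>x. - b (- x))"
  using assms(4) by (simp add: ricb_iff_ric ss)
 show "pot M (\<lambda>x. complex_of_real \<sigma> * cnj (q (- x)))"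
  by (rule pot_cnj[OF pot_reflect[OF assms(3)]]) (use \<sigma> in auto)
qed (use assms in auto)

text \<open>\<open>1 - ab\<close> is, up to the product of two nonvanishing exponentials, the constant Wronskian of the
 Jost solutions; its decay at both ends equates the energies of \<open>a\<close> and \<open>b\<close>.\<close>

lemma energy_right:
 assumes A: "riccati \<sigma> \<kappa> M q a" and b: "ricb \<kappa> q (\<lambda>x. of_real \<sigma> * cnj (q x)) (1/4) b"
  and en: "en \<kappa> a B"
 shows "en \<kappa> (\<lambda>x. - b (- x)) (2 * B)"
proof -
 interpret A: riccati \<sigma> \<kappa> M q a by fact
 have Rb: "riccati \<sigma> \<kappa> M (\<lambda>x. of_real \<sigma> * cnj (q (- x))) (\<lambda>x. - b (- x))"
  by (rule riccati_reflect[OF A.\<sigma> A.\<kappa> A.q b])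
 interpret B: riccati \<sigma> \<kappa> M "\<lambda>x. of_real \<sigma> * cnj (q (- x))" "\<lambda>x. - b (- x)" by fact
 define r where "r = (\<lambda>x. of_real \<sigma> * cnj (q x))"
 have bc: "continuous_on S b" for S by (rule deriv_cont) (rule ricbD[OF b])
 have rc: "continuous_on S r" for S unfolding r_def by (intro continuous_intros pot_cont[OF A.q])
 define f where "f = (\<lambda>x. 1 - a x * b x)"
 have fb: "1/2 <= cmod (f x)" for x
 proof -
  have "cmod (a x * b x) <= 1/4 * (1/4)" by (intro cmod_mult_le ric_le[OF A.a] ricb_le[OF b])
  then show ?thesis unfolding f_def using norm_triangle_ineq2[of 1 "a x * b x"] by simp
 qed
 have f': "(f hvd - (q x * a x + r x * b x) * f x) (at x)" for x
  unfolding f_def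
  by (rule hvd_eq_rhs[OF hvd_diff[OF hvd_const
     hvd_mult[OF ricD[OF A.a] ricbD[OF b]]]])
   (simp add: r_def algebra_simps power2_eq_square)
 \<comment> \<open>f = 1 - a b solves a linear homogeneous equation with coefficient - (q a + r b),
   so the logarithm of its modulus integrates the real part of that sum exactly.\<close>
 define h where "h = (\<lambda>x. ln ((cmod (f x))^2))"
 have h': "(h has_real_derivative - 2 * Re (q x * a x + r x * b x)) (at x)" for x
 proof -
  have pos: "0 < (cmod (f x))^2" using fb[of x] by auto
  have "(h has_real_derivative 1 / (cmod (f x))^2 * (2 * Re (cnj (f x) * (- (q x * a x + r x * b x) * f x)))) (at x)"
   unfolding h_def using DERIV_ln_divide[OF pos] cmod_sq_deriv[OF f'] by (rule DERIV_chain2)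
  moreover have "cnj (f x) * (- (q x * a x + r x * b x) * f x) = of_real ((cmod (f x))^2) * (- (q x * a x + r x * b x))"
   using complex_norm_square[of "f x"] by (simp add: mult_ac)
  moreover have "1 / s * (2 * Re (of_real s * - w)) = - 2 * Re w" if "0 < s" for s w
   using that by simp
  note this[OF pos, of "q x * a x + r x * b x"]
  ultimately show ?thesis by (simp only:)
 qed
 have "((\<lambda>x. - b (- x)) \<longlongrightarrow> 0) at_infinity" by (rule B.a_tendsto)
 have 1: "filterlim (\<lambda>X::real. X) at_infinity at_top" 
  by (rule filterlim_mono[OF filterlim_ident at_top_le_at_infinity order_refl])
 have 2: "filterlim (\<lambda>X::real. - X) at_infinity at_top"
  using filterlim_uminus_at_bot_at_top at_bot_le_at_infinity filterlim_mono by blast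
 have lims: "(a \<longlongrightarrow> 0) at_top" "((\<lambda>X. a (- X)) \<longlongrightarrow> 0) at_top" "(b \<longlongrightarrow> 0) at_top" "((\<lambda>X. b (- X)) \<longlongrightarrow> 0) at_top"
  using filterlim_compose[OF A.a_tendsto 1] filterlim_compose[OF A.a_tendsto 2]
   tendsto_minus[OF filterlim_compose[OF B.a_tendsto 1]] tendsto_minus[OF filterlim_compose[OF B.a_tendsto 2]]
  by auto
 have "((\<lambda>X. h X) \<longlongrightarrow> ln ((cmod (1 - 0 * 0))^2)) at_top"
  unfolding h_def f_def by (intro tendsto_intros lims) auto
 moreover have "((\<lambda>X. h (- X)) \<longlongrightarrow> ln ((cmod (1 - 0 * 0))^2)) at_top"
  unfolding h_def f_def by (intro tendsto_intros lims) auto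
 ultimately have "((\<lambda>X. (h X - h (- X)) / 2) \<longlongrightarrow> (ln ((cmod (1 - 0 * 0))^2) - ln ((cmod (1 - 0 * 0))^2)) / 2) at_top"
  by (intro tendsto_divide tendsto_diff tendsto_const) auto
 then have lim: "((\<lambda>X. (h X - h (- X)) / 2) \<longlongrightarrow> 0) at_top" by simp
 have eqX: "(h X - h (- X)) / 2 = Re (integral {-X..X} (\<lambda>x. of_real \<sigma> * cnj (q (- x)) * - b (- x))) - Re (integral {-X..X} (\<lambda>x. q x * a x))"
  if "0 <= X" for X
 proof -
  have "((\<lambda>x. - 2 * Re (q x * a x + r x * b x)) has_integral h X - h (- X)) {-X..X}"
   using that h' by (intro fundamental_theorem_of_calculus)
    (auto simp: has_real_derivative_iff_has_vector_derivative hvd_at_within)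
  moreover have "((\<lambda>x. - 2 * Re (q x * a x + r x * b x)) has_integral - 2 * Re (integral {-X..X} (\<lambda>x. q x * a x) + integral {-X..X} (\<lambda>x. r x * b x))) {-X..X}"
   by (intro has_integral_mult_right has_integral_Re has_integral_add integrable_integral A.qa_integrable
     integrable_continuous_real continuous_intros rc bc)
  ultimately have "h X - h (- X) = - 2 * Re (integral {-X..X} (\<lambda>x. q x * a x) + integral {-X..X} (\<lambda>x. r x * b x))"
   by (rule has_integral_unique)
  moreover have "integral {-X..X} (\<lambda>x. of_real \<sigma> * cnj (q (- x)) * - b (- x)) = - integral {-X..X} (\<lambda>x. r x * b x)"
   using Henstock_Kurzweil_Integration.integral_reflect_real[of X "-X" "\<lambda>x. - (r x * b x)"] by (simp add: r_def)
  ultimately show ?thesis by simp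
 qed
 from energy_transfer[OF A Rb tendsto_cong[OF eventually_mono[OF eventually_ge_at_top eqX], THEN iffD1, OF _ lim] en]
 show ?thesis .
qed

text \<open>The difference of two solutions is measured in the chordal (\<open>\<sigma> = - 1\<close>) or pseudohyperbolic
 (\<open>\<sigma> = 1\<close>) metric; there the coefficient \<open>q\<close>, which is not small, cancels.\<close>

lemma chordal_bound:
 assumes "riccati \<sigma> \<kappa> M q a" "riccati \<sigma> \<nu> M q a'"
  and \<nu>: "2 * \<kappa> <= \<nu>" "\<nu> <= 3 * \<kappa>" and en: "en \<nu> a' B"
 shows "(cmod (a' x - a x))^2 <= 6 * B"
proof -
 interpret A: riccati \<sigma> \<kappa> M q a by fact
 interpret A': riccati \<sigma> \<nu> M q a' by fact
 have k: "1 <= \<kappa>" by (rule A.\<kappa>)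
 define d where "d = (\<lambda>x. a' x - a x)"
 define N where "N = (\<lambda>x. (cmod (d x))^2)"
 \<comment> \<open>The reciprocal of the two denominators, written through logarithms so that its
   derivative can be read off from \<open>ln_m_deriv\<close>.\<close>
 define E where "E = (\<lambda>x. exp (- (ln (A'.m x) + ln (A.m x))))"
 define H where "H = (\<lambda>x. N x * E x)"
 have E: "E x = 1 / (A'.m x * A.m x)" for x
  using A.m_bounds(3)[of x] A'.m_bounds(3)[of x] by (simp add: E_def exp_minus exp_add exp_diff inverse_eq_divide)
 have Eb: "0 < E x" "E x <= 256/225" for x
 proof -
  have "15/16 * (15/16) <= A'.m x * A.m x" 
   using A.m_bounds[of x] A'.m_bounds[of x] by (intro mult_mono) auto
  then show "E x <= 256/225" unfolding E by (simp add: divide_le_eq)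
 qed (simp add: E_def)
 have N': "(N has_real_derivative (- 4 * \<kappa> * N x - 4 * (\<nu> - \<kappa>) * Re (cnj (d x) * a' x) - 2 * Re (q x * a' x) * N x - 2 * Re (q x * a x) * N x)) (at x)" for x
 proof -
  have "2 * Re (cnj (d x) * ((of_real \<sigma> * cnj (q x) - 2 * of_real \<nu> * a' x - q x * (a' x)^2) - (of_real \<sigma> * cnj (q x) - 2 * of_real \<kappa> * a x - q x * (a x)^2)))
   = - 4 * \<kappa> * N x - 4 * (\<nu> - \<kappa>) * Re (cnj (d x) * a' x) - 2 * Re (q x * a' x) * N x - 2 * Re (q x * a x) * N x"
   unfolding N_def d_def cmod_power2 by (simp add: algebra_simps power2_eq_square)
  then show ?thesis
   using cmod_sq_deriv[OF hvd_diff[OF ricD[OF A'.a] ricD[OF A.a]], of x]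
   by (simp add: N_def d_def)
 qed
 define l where "l = (\<lambda>x. 4 * \<nu> * \<sigma> * (A'.n x / A'.m x) + 4 * \<kappa> * \<sigma> * (A.n x / A.m x))"
 have E': "(E has_real_derivative E x * (2 * Re (q x * a' x) + 2 * Re (q x * a x) - l x)) (at x)" for x
 proof -
  have "(E has_real_derivative E x * (- ((- 2 * Re (q x * a' x) + 4 * \<nu> * \<sigma> * (A'.n x / A'.m x)) + (- 2 * Re (q x * a x) + 4 * \<kappa> * \<sigma> * (A.n x / A.m x))))) (at x)"
   unfolding E_def by (rule DERIV_chain2[OF DERIV_exp DERIV_minus[OF DERIV_add[OF A'.ln_m_deriv A.ln_m_deriv]]])
  then show ?thesis by (simp add: l_def algebra_simps)
 qed
 define H' where "H' = (\<lambda>x. E x * (- 4 * \<kappa> * N x - 4 * (\<nu> - \<kappa>) * Re (cnj (d x) * a' x) - N x * l x))"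
 have HD: "(H has_real_derivative H' x) (at x)" for x
  unfolding H_def by (rule DERIV_cong[OF DERIV_mult[OF N' E']]) (simp add: H'_def algebra_simps)
 \<comment> \<open>The damping - 4 \<kappa> N absorbs the bad terms: the cross term costs 2 \<kappa>
   N + 8 \<kappa> \<open>A'.n x\<close> because \<nu> - \<kappa> <= 2 \<kappa>, and the logarithmic
   terms cost 16/15 \<kappa> N. What survives is turned into the energy at \<nu> by 2 \<kappa> <=
   \<nu>.\<close>
 have H'b: "H' x <= 5 * \<nu> * A'.n x" for x
 proof -
  have nm: "A.n x / A.m x <= 1/15" "A'.n x / A'.m x <= 1/15" "0 <= A.n x / A.m x" "0 <= A'.n x / A'.m x"
   using A.n_bounds[of x] A.m_bounds[of x] A'.n_bounds[of x] A'.m_bounds[of x] by (auto simp: field_simps)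
  have "\<nu> * (A'.n x / A'.m x) <= (3 * \<kappa>) * (1/15)" using \<nu> k nm by (intro mult_mono) auto
  moreover have "\<kappa> * (A.n x / A.m x) <= \<kappa> * (1/15)" using k nm by (intro mult_left_mono) auto
  moreover have "0 <= \<nu> * (A'.n x / A'.m x)" "0 <= \<kappa> * (A.n x / A.m x)"
   using \<nu> k nm by (auto intro!: mult_nonneg_nonneg simp del: times_divide_eq_right)
  ultimately have l: "- l x <= 16/15 * \<kappa>" 
   using A.\<sigma> unfolding l_def by auto
  have N0: "0 <= N x" by (simp add: N_def)
  have "- Re (cnj (d x) * a' x) <= cmod (d x) * cmod (a' x)"
   using abs_Re_le_cmod[of "cnj (d x) * a' x"] by (simp add: norm_mult)
  then have "4 * (\<nu> - \<kappa>) * (- Re (cnj (d x) * a' x)) <= 4 * (\<nu> - \<kappa>) * (cmod (d x) * cmod (a' x))"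
   using \<nu> k by (intro mult_left_mono) auto
  also have "\<dots> <= 4 * (2 * \<kappa>) * (cmod (d x) * cmod (a' x))"
   using \<nu> k by (intro mult_right_mono mult_nonneg_nonneg) auto
  also have "\<dots> <= \<kappa> * (2 * N x + 8 * A'.n x)"
  proof -
   have "8 * (cmod (d x) * cmod (a' x)) <= 2 * N x + 8 * A'.n x"
    using zero_le_power2[of "cmod (d x) - 2 * cmod (a' x)"] unfolding N_def A'.n_def
    by (simp add: power2_eq_square algebra_simps)
   then show ?thesis using mult_left_mono[of _ _ \<kappa>] k by fastforce
  qed
  finally have 1: "- 4 * (\<nu> - \<kappa>) * Re (cnj (d x) * a' x) <= \<kappa> * (2 * N x + 8 * A'.n x)"
   by (simp only: mult_minus_left mult_minus_right)
  have 2: "- (N x * l x) <= 16/15 * \<kappa> * N x" using mult_left_mono[OF l N0] by (simp add: mult_ac)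
  have "0 <= \<kappa> * N x" using k N0 by simp
  then have "- 4 * \<kappa> * N x - 4 * (\<nu> - \<kappa>) * Re (cnj (d x) * a' x) - N x * l x <= 8 * \<kappa> * A'.n x"
   using 1 2 by (simp add: algebra_simps)
  also have "\<dots> <= 4 * \<nu> * A'.n x" using \<nu> A'.n_bounds(1)[of x] by (intro mult_right_mono) auto
  finally have "H' x <= E x * (4 * \<nu> * A'.n x)" unfolding H'_def using Eb(1)[of x] by (intro mult_left_mono) auto
  also have "\<dots> <= 256/225 * (4 * \<nu> * A'.n x)" using Eb A'.n_bounds(1)[of x] \<nu> k by (intro mult_right_mono) auto
  also have "\<dots> <= 5 * \<nu> * A'.n x" using A'.n_bounds(1)[of x] \<nu> k by (simp add: mult_right_mono)
  finally show ?thesis .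
 qed
 have step: "H x <= 5 * B + H (- X)" if X: "\<bar>x\<bar> <= X" for X
 proof -
  have "(H' has_integral H x - H (- X)) {-X..x}"
   using X HD by (intro fundamental_theorem_of_calculus)
    (auto simp: has_real_derivative_iff_has_vector_derivative hvd_at_within)
  moreover have "((\<lambda>x. 5 * \<nu> * A'.n x) has_integral 5 * \<nu> * integral {-X..x} A'.n) {-X..x}"
   by (intro has_integral_mult_right integrable_integral A'.n_integrable)
  ultimately have "H x - H (- X) <= 5 * \<nu> * integral {-X..x} A'.n"
   by (rule has_integral_le) (rule H'b)
  also have "\<dots> <= 5 * \<nu> * integral {-X..X} A'.n"
   using X \<nu> k A'.n_bounds by (intro mult_left_mono integral_subset_le A'.n_integrable) auto
  also have "\<dots> <= 5 * B" using en X unfolding en_def A'.n_def by auto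
  finally show ?thesis by simp
 qed
 have "((\<lambda>X. 5 * B + H (- X)) \<longlongrightarrow> 5 * B + 0) at_top"
 proof (intro tendsto_intros)
  have 2: "filterlim (\<lambda>X::real. - X) at_infinity at_top"
   using filterlim_uminus_at_bot_at_top at_bot_le_at_infinity filterlim_mono by blast
  have "((\<lambda>X. (cmod (a' (- X) - a (- X)))^2 * (256/225)) \<longlongrightarrow> (cmod (0 - 0))^2 * (256/225)) at_top"
   by (intro tendsto_intros filterlim_compose[OF A.a_tendsto 2] filterlim_compose[OF A'.a_tendsto 2])
  then have lim: "((\<lambda>X. (cmod (a' (- X) - a (- X)))^2 * (256/225)) \<longlongrightarrow> 0) at_top" by simp
  show "((\<lambda>X. H (- X)) \<longlongrightarrow> 0) at_top"
  proof (rule tendsto_sandwich[OF _ _ tendsto_const lim])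
   show "\<forall>\<^sub>F X in at_top. 0 <= H (- X)" using Eb(1) by (auto simp: H_def N_def less_imp_le)
   show "\<forall>\<^sub>F X in at_top. H (- X) <= (cmod (a' (- X) - a (- X)))^2 * (256/225)"
    unfolding H_def N_def d_def using Eb by (intro always_eventually allI mult_left_mono) auto
  qed
 qed
 then have "H x <= 5 * B + 0"
  by (rule tendsto_lowerbound) (use step in \<open>auto simp: eventually_at_top_linorder intro!: exI[of _ "\<bar>x\<bar>"]\<close>)
 then have Hx: "H x <= 5 * B" by simp
 have "N x = H x * (A'.m x * A.m x)" using A.m_bounds(3)[of x] A'.m_bounds(3)[of x] by (simp add: H_def E)
 also have "\<dots> <= (5 * B) * (17/16 * (17/16))"
  using Hx A.m_bounds[of x] A'.m_bounds[of x] en_nonneg[OF en] by (intro mult_mono) auto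
 also have "\<dots> <= 6 * B" using en_nonneg[OF en] by simp
 finally show ?thesis by (simp add: N_def d_def)
qed

section \<open>The energy in terms of local averages of the potential\<close>

lemma wt_integrable: "integrable lborel wt"
proof -
 have "wt = (\<lambda>x. inverse (1 + x^2))" by (simp add: wt_def fun_eq_iff inverse_eq_divide)
 then show ?thesis using integrable_inverse_1_plus_square by (simp add: set_integrable_def einterval_def)
qed

lemma wt_integral: "(LINT x|lborel. wt x) <= 4"
proof -
 have "(LINT x|lborel. wt x) = pi"
  using LBINT_inverse_1_plus_square
  by (simp add: interval_lebesgue_integral_def set_lebesgue_integral_def wt_def inverse_eq_divide einterval_def)
 then show ?thesis using pi_less_4 by simp
qed

lemma integrable_wt_bound:
 fixes f :: "real => 'b::{banach, second_countable_topology}"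
 assumes "continuous_on UNIV f" "\<And>x. norm (f x) <= C * wt x"
 shows "integrable lborel f"
proof (rule Bochner_Integration.integrable_bound)
 show "integrable lborel (\<lambda>x. C * wt x)" by (intro integrable_mult_right wt_integrable)
 show "f \<in> borel_measurable lborel" using borel_measurable_continuous_onI[OF assms(1)] by simp
 show "AE x in lborel. norm (f x) <= norm (C * wt x)"
  using assms(2) by (intro AE_I2) (metis abs_ge_self order_trans real_norm_def)
qed

lemma integral_wt_bound:
 fixes f :: "real => real"
 assumes "continuous_on UNIV f" "\<And>x. \<bar>f x\<bar> <= C * wt x"
 shows "(LINT x|lborel. f x) <= 4 * C"
proof -
 have C: "0 <= C" using assms(2)[of 0] abs_ge_zero[of "f 0"] wt_pos[of 0] by (smt (verit) mult_neg_pos)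
 have "(LINT x|lborel. f x) <= (LINT x|lborel. C * wt x)"
  using assms(2) by (intro integral_mono integrable_wt_bound[OF assms(1), of C] integrable_mult_right wt_integrable)
   (auto simp: abs_le_iff)
 also have "\<dots> = C * (LINT x|lborel. wt x)" by simp
 also have "\<dots> <= C * 4" using C wt_integral by (intro mult_left_mono) auto
 finally show ?thesis by simp
qed

lemma integral_shift: "(LINT x|lborel. f (x + h)) = (LINT x|lborel. f x)" for f :: "real => real"
 using lborel_integral_real_affine[of 1 f h] by (simp add: add.commute)

lemma integrable_shift: "integrable lborel f ==> integrable lborel (\<lambda>x. f (x + h))" for f :: "real => real"
 using lborel_integrable_real_affine[of f 1 h] by (simp add: add.commute)

lemma wt_near:
 assumes "\<bar>y - x\<bar> <= 1" shows "wt y <= 3 * wt x"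
proof -
 have "x^2 <= (\<bar>y\<bar> + 1)^2" using assms by (intro power2_le_iff_abs_le[THEN iffD2]) auto
 also have "\<dots> <= 2 * y^2 + 2" 
  using zero_le_power2[of "\<bar>y\<bar> - 1"] by (simp add: power2_eq_square algebra_simps)
 also have "\<dots> <= 3 * y^2 + 2" by simp
 finally have "1 + x^2 <= 3 * (1 + y^2)" by simp
 then show ?thesis unfolding wt_def using wt_denom_pos[of x] wt_denom_pos[of y] by (simp add: field_simps)
qed

lemma deriv_bound_local:
 fixes F :: "real => complex"
 assumes "x <= y" "\<And>u. (F hvd F' u) (at u)" "\<And>u. x <= u ==> u <= y ==> cmod (F' u) <= B"
 shows "cmod (F y - F x) <= B * (y - x)"
proof (cases "x = y")
 case False
 have "cmod (F y - F x) <= B * y - B * x"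
 proof (rule differentiable_bound_general[of x y F "\<lambda>u. B * u" F' "\<lambda>_. B"])
  show "continuous_on {x..y} F" by (rule deriv_cont[OF assms(2)])
  show "((\<lambda>x. B * x) hvd B) (at u)" for u
   by (auto intro!: derivative_eq_intros simp: has_real_derivative_iff_has_vector_derivative[symmetric])
 qed (use False assms in \<open>auto intro!: continuous_intros\<close>)
 then show ?thesis by (simp add: algebra_simps)
qed simp

section \<open>Window averages and the sewing recursion\<close>

text \<open>The value at x + l of the solution of V' = -2 \<kappa> V + q started from 0 at x: the
  average of q that a window of length l contributes to the damped equation.\<close>

definition Vint :: "real => (real => complex) => real => real => complex" where
 "Vint \<kappa> q l x = integral {x..x + l} (\<lambda>y. of_real (exp (- (2 * \<kappa> * (x + l - y)))) * q y)"

lemma Vint_eq: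
 assumes U: "\<And>y. (U hvd of_real (exp (2 * \<kappa> * y)) * q y) (at y)" and "0 <= l"
 shows "Vint \<kappa> q l x = of_real (exp (- (2 * \<kappa> * (x + l)))) * (U (x + l) - U x)"
proof -
 have "((\<lambda>y. of_real (exp (2 * \<kappa> * y)) * q y) has_integral (U (x + l) - U x)) {x..x + l}"
  using assms by (intro fundamental_theorem_of_calculus) (auto intro: hvd_at_within)
 then have "((\<lambda>y. of_real (exp (- (2 * \<kappa> * (x + l)))) * (of_real (exp (2 * \<kappa> * y)) * q y)) has_integral
   of_real (exp (- (2 * \<kappa> * (x + l)))) * (U (x + l) - U x)) {x..x + l}"
  by (rule has_integral_mult_right)
 moreover have "of_real (exp (- (2 * \<kappa> * (x + l)))) * (of_real (exp (2 * \<kappa> * y)) * q y)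
   = of_real (exp (- (2 * \<kappa> * (x + l - y)))) * q y" for y
  by (simp add: mult.assoc[symmetric] right_diff_distrib flip: of_real_mult exp_add)
 ultimately show ?thesis unfolding Vint_def by (simp add: integral_unique)
qed

text \<open>The sum of the geometric series with ratio \<open>2 powr (1 - p)\<close>, which is below
  1 exactly when p > 1.\<close>

definition sewK :: "real => real" where "sewK p = 1 / (1 - 2 powr (1 - p))"

text \<open>The constant that \<open>energy_bound\<close> yields for \<Lambda> = 26
  \<open>sewK p\<close>. It is a function of p alone; \<open>M\<close> has dropped out.\<close>

definition enK :: "real => real" where
 "enK p = 3 * (16 + (sewK p / 2) * (26 * sewK p + 2 * (416 + 338 * (sewK p)^2) / (26 * sewK p)))"

text \<open>\<open>Vb\<close> is the quantitative information on q: square means of window averages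
  at scale l. An H^s bound provides it with p = 2 + 2s.\<close>

locale sewing = riccati +
 fixes p v :: real
 assumes p: "1 < p" "p <= 2" and v: "0 <= v"
  and Vb: "\<And>l. 0 < l ==> l <= 1 ==> (LINT x|lborel. (cmod (Vint \<kappa> q l x))^2) <= v * l powr p"
begin

definition "U = (SOME U. \<forall>y. (U hvd of_real (exp (2 * \<kappa> * y)) * q y) (at y))"
definition "A = (SOME U. \<forall>y. (U hvd of_real (exp (2 * \<kappa> * y)) * (q y * (a y)^2)) (at y))"

lemma U: "(U hvd of_real (exp (2 * \<kappa> * y)) * q y) (at y)"
proof -
 have "continuous_on UNIV (\<lambda>y. of_real (exp (2 * \<kappa> * y)) * q y)" by (intro continuous_intros pot_cont[OF q])
 from someI_ex[OF antideriv_exists[OF this]] show ?thesis unfolding U_def by simp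
qed

lemma A: "(A hvd of_real (exp (2 * \<kappa> * y)) * (q y * (a y)^2)) (at y)"
proof -
 have "continuous_on UNIV (\<lambda>y. of_real (exp (2 * \<kappa> * y)) * (q y * (a y)^2))"
  by (intro continuous_intros pot_cont[OF q] ric_cont[OF a])
 from someI_ex[OF antideriv_exists[OF this]] show ?thesis unfolding A_def by simp
qed

lemma U_cont: "continuous_on S U" by (rule deriv_cont) (rule U)
lemma A_cont: "continuous_on S A" by (rule deriv_cont) (rule A)

definition "E y = complex_of_real (exp (- (2 * \<kappa> * y)))"
text \<open>\<open>V\<close> is the window average of q, \<open>N\<close> that of
  \<open>q a\<^sup>2\<close>, \<open>R\<close> the error made in N by freezing a at the left end,
  and \<open>\<Theta>\<close> the increment of a with the free decay taken out.\<close>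

definition "V l x = E (x + l) * (U (x + l) - U x)"
definition "N l x = E (x + l) * (A (x + l) - A x)"
definition "R l x = N l x - V l x * (a x)^2"
definition "\<Delta> l x = a (x + l) - a x"
definition "\<Theta> l x = a (x + l) - E l * a x"

lemma E_add: "E (x + y) = E x * E y"
 by (simp add: E_def ring_distribs flip: of_real_mult exp_add)

lemma E_norm_le: "0 <= l ==> cmod (E l) <= 1"
 using \<kappa> by (simp add: E_def)

lemma V_Vint: "0 <= l ==> Vint \<kappa> q l x = V l x"
 unfolding V_def E_def by (rule Vint_eq[OF U])

text \<open>N is additive under joining two windows. Hence the error over the double window is the
  sum of the two errors, one of them damped, plus a product of two small quantities, which arises
  from moving the freezing point.\<close>

lemma R_split: "R (2 * l) x = E l * R l x + R l (x + l) + V l (x + l) * ((a (x + l))^2 - (a x)^2)"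
proof -
 have "x + 2 * l = (x + l) + l" by simp
 then show ?thesis unfolding R_def N_def V_def using E_add[of "x + l" l]
  by (simp add: algebra_simps power2_eq_square)
qed

text \<open>Duhamel's formula over one window: exp (2 \<kappa> y) a(y) and the primitives of its
  derivative differ by a constant.\<close>

lemma step_identity: "\<Theta> l x = of_real \<sigma> * cnj (V l x) - N l x"
proof -
 define F where "F = (\<lambda>y. of_real (exp (2 * \<kappa> * y)) * a y - (of_real \<sigma> * cnj (U y) - A y))"
 have "(F hvd 0) (at y)" for y
 proof -
  have "((\<lambda>y. exp (2 * \<kappa> * y)) has_real_derivative exp (2 * \<kappa> * y) * (2 * \<kappa>)) (at y)"
   by (auto intro!: derivative_eq_intros)
  note 1 = hvd_mult[OF hvd_of_real[OF this] ricD[OF a, of y]]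
  show ?thesis unfolding F_def
   by (rule hvd_eq_rhs[OF hvd_diff[OF 1 hvd_diff[OF
     hvd_mult_right[OF hvd_cnj[OF U]] A]]])
    (simp add: algebra_simps)
 qed
 then obtain c where "\<And>y. F y = c"
  using hvd_zero_constant[of UNIV F] by (auto simp: hvd_at_within)
 then have "F (x + l) = F x" by simp
 then have eq: "of_real (exp (2 * \<kappa> * (x + l))) * a (x + l) - of_real (exp (2 * \<kappa> * x)) * a x
   = of_real \<sigma> * cnj (U (x + l) - U x) - (A (x + l) - A x)"
  unfolding F_def complex_cnj_diff right_diff_distrib
  by (simp only: diff_eq_eq eq_diff_eq add_diff_eq diff_diff_eq2 diff_add_eq) (simp only: add_ac)
 have e1: "E (x + l) * of_real (exp (2 * \<kappa> * (x + l))) = 1"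
  unfolding E_def by (simp flip: of_real_mult exp_add)
 have e2: "E (x + l) * of_real (exp (2 * \<kappa> * x)) = E l"
  unfolding E_def by (simp add: ring_distribs flip: of_real_mult exp_add)
 have "\<Theta> l x = E (x + l) * (of_real (exp (2 * \<kappa> * (x + l))) * a (x + l) - of_real (exp (2 * \<kappa> * x)) * a x)"
  unfolding \<Theta>_def right_diff_distrib mult.assoc[symmetric] e1 e2 by simp
 also have "\<dots> = of_real \<sigma> * cnj (V l x) - N l x"
  unfolding eq V_def N_def E_def by (simp add: algebra_simps)
 finally show ?thesis .
qed

lemma a_shift_cont: "continuous_on S (\<lambda>x. a (x + l))"
 by (rule continuous_on_compose2[OF ric_cont[OF a, of UNIV]]) (auto intro!: continuous_intros)

lemma V_cont: "continuous_on S (V l)" and N_cont: "continuous_on S (N l)"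
proof -
 have "continuous_on S (\<lambda>x. U (x + l))" "continuous_on S (\<lambda>x. A (x + l))"
  by (rule continuous_on_compose2[OF U_cont[of UNIV]] continuous_on_compose2[OF A_cont[of UNIV]]; auto intro!: continuous_intros)+
 then show "continuous_on S (V l)" "continuous_on S (N l)"
  unfolding V_def N_def E_def by (intro continuous_intros U_cont A_cont; simp)+
qed

lemma R_cont: "continuous_on S (R l)" and \<Delta>_cont: "continuous_on S (\<Delta> l)" and \<Theta>_cont: "continuous_on S (\<Theta> l)"
 unfolding R_def \<Delta>_def \<Theta>_def by (intro continuous_intros V_cont N_cont ric_cont[OF a] a_shift_cont)+

lemma E_exp_bound: "u <= x + l ==> cmod (E (x + l) * (of_real (exp (2 * \<kappa> * u)) * z)) <= cmod z"
proof -
 assume u: "u <= x + l"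
 have "E (x + l) * of_real (exp (2 * \<kappa> * u)) = of_real (exp (2 * \<kappa> * (u - (x + l))))"
  unfolding E_def by (simp add: algebra_simps flip: of_real_mult exp_add)
 moreover have "\<kappa> * (u - (x + l)) <= 0" using u \<kappa> by (simp add: mult_le_0_iff)
 ultimately have "cmod (E (x + l) * of_real (exp (2 * \<kappa> * u))) <= 1" by simp
 then show ?thesis unfolding mult.assoc[symmetric] norm_mult[of _ z] using mult_right_mono by fastforce
qed

lemma M0: "0 <= M" by (rule pot_nonneg[OF q])

lemma V_bound: assumes "0 <= l" "l <= 1" shows "cmod (V l x) <= 3 * M * wt x"
proof -
 have "cmod (E (x + l) * U (x + l) - E (x + l) * U x) <= (3 * M * wt x) * ((x + l) - x)"
 proof (rule deriv_bound_local[OF _ hvd_mult_right[OF U]])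
  fix u assume u: "x <= u" "u <= x + l"
  have "cmod (E (x + l) * (of_real (exp (2 * \<kappa> * u)) * q u)) <= cmod (q u)" by (rule E_exp_bound) (rule u)
  also have "\<dots> <= M * wt u" by (rule pot_bound[OF q])
  also have "\<dots> <= M * (3 * wt x)" using u assms by (intro mult_left_mono wt_near M0) auto
  finally show "cmod (E (x + l) * (of_real (exp (2 * \<kappa> * u)) * q u)) <= 3 * M * wt x" by simp
 qed (use assms in auto)
 also have "\<dots> <= 3 * M * wt x" using assms M0 wt_pos[of x] by (simp add: mult_left_le)
 finally show ?thesis by (simp add: V_def right_diff_distrib)
qed

lemma a_step: assumes "x <= y" "y <= x + 1" shows "cmod (a y - a x) <= 18 * M * wt x * (y - x)"
proof (rule deriv_bound_local[OF assms(1) ricD[OF a]])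
 fix u assume u: "x <= u" "u <= y"
 have w0: "0 <= M * wt u" using M0 wt_pos[of u] by simp
 have "cmod (of_real \<sigma> * cnj (q u) - 2 * of_real \<kappa> * a u - q u * (a u)^2)
   <= M * wt u + 2 * \<kappa> * (2 * M / \<kappa> * wt u) + M * wt u * (1/4)^2"
  by (intro cmod_diff_le cmod_mult_le cmod_sq_le pot_bound[OF q] pot_bound[OF pot_r] ric_le[OF a] decay)
   (use \<kappa> in auto)
 also have "\<dots> = (5 + 1/16) * (M * wt u)" using \<kappa> by (simp add: power2_eq_square field_simps)
 also have "\<dots> <= 6 * (M * wt u)" using w0 by (intro mult_right_mono) auto
 also have "\<dots> <= 6 * (M * (3 * wt x))" using u assms by (intro mult_left_mono wt_near M0) auto
 finally show "cmod (of_real \<sigma> * cnj (q u) - 2 * of_real \<kappa> * a u - q u * (a u)^2) <= 18 * M * wt x" by simp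
qed

lemma \<Delta>_bound: assumes "0 <= l" "l <= 1" shows "cmod (\<Delta> l x) <= 18 * M * wt x * l"
 using a_step[of x "x + l"] assms by (simp add: \<Delta>_def)

text \<open>A crude bound, quadratic in l with a constant depending on \<open>M\<close>. It gives
  integrability and makes the tail of the dyadic recursion vanish, but leaves no trace in the final
  constant.\<close>

lemma R_bound: assumes "0 <= l" "l <= 1" shows "cmod (R l x) <= 27 * M^2 * l^2 * wt x"
proof -
 have "cmod (E (x + l) * (A (x + l) - (a x)^2 * U (x + l)) - E (x + l) * (A x - (a x)^2 * U x)) <= (3 * M * wt x * (9 * M * l)) * ((x + l) - x)"
 proof (rule deriv_bound_local[OF _ hvd_mult_right[OF hvd_diff[OF A hvd_mult_right[OF U]]]])
  fix u assume u: "x <= u" "u <= x + l"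
  have d: "cmod (a u - a x) <= 18 * M * l"
  proof -
   have "cmod (a u - a x) <= 18 * M * wt x * (u - x)" by (rule a_step) (use u assms in auto)
   also have "\<dots> <= 18 * M * 1 * l" using u M0 wt_le_1[of x] wt_pos[of x] by (intro mult_mono) auto
   finally show ?thesis by simp
  qed
  have "E (x + l) * (of_real (exp (2 * \<kappa> * u)) * (q u * (a u)^2) - (a x)^2 * (of_real (exp (2 * \<kappa> * u)) * q u))
    = E (x + l) * (of_real (exp (2 * \<kappa> * u)) * (q u * ((a u + a x) * (a u - a x))))"
   by (simp add: algebra_simps power2_eq_square)
  also have "cmod \<dots> <= cmod (q u * ((a u + a x) * (a u - a x)))" by (rule E_exp_bound) (rule u)
  also have "\<dots> <= (M * wt u) * ((1/4 + 1/4) * (18 * M * l))"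
   by (intro cmod_mult_le cmod_add_le ric_le[OF a] d pot_bound[OF q])
  also have "\<dots> <= (M * (3 * wt x)) * ((1/4 + 1/4) * (18 * M * l))"
   using u assms M0 by (intro mult_right_mono mult_left_mono wt_near) auto
  also have "\<dots> = 3 * M * wt x * (9 * M * l)" by simp
  finally show "cmod (E (x + l) * (of_real (exp (2 * \<kappa> * u)) * (q u * (a u)^2) - (a x)^2 * (of_real (exp (2 * \<kappa> * u)) * q u)))
    <= 3 * M * wt x * (9 * M * l)" .
 qed (use assms in auto)
 moreover have "E (x + l) * (A (x + l) - (a x)^2 * U (x + l)) - E (x + l) * (A x - (a x)^2 * U x) = R l x"
  by (simp add: R_def N_def V_def algebra_simps)
 moreover have "(3 * M * wt x * (9 * M * l)) * ((x + l) - x) = 27 * M^2 * l^2 * wt x"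
  by (simp add: power2_eq_square)
 ultimately show ?thesis by (simp only:)
qed

lemma sq_wt_bound: assumes "cmod z <= C * wt x" shows "(cmod z)^2 <= C^2 * wt x"
proof -
 have "(cmod z)^2 <= (C * wt x)^2" using assms by (intro power_mono) auto
 also have "\<dots> = C^2 * (wt x * wt x)" by (simp add: power2_eq_square)
 also have "\<dots> <= C^2 * (1 * wt x)" using wt_pos[of x] wt_le_1[of x] by (intro mult_left_mono mult_right_mono) auto
 finally show ?thesis by simp
qed

lemma sq_integrable:
 fixes f :: "real => complex"
 assumes "continuous_on UNIV f" "\<And>x. cmod (f x) <= C * wt x"
 shows "integrable lborel (\<lambda>x. (cmod (f x))^2)"
 by (rule integrable_wt_bound[where C = "C^2"]) (use sq_wt_bound[OF assms(2)] in \<open>auto intro!: continuous_intros assms(1)\<close>)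

lemma a_sq_integrable: "integrable lborel (\<lambda>x. (cmod (a x))^2)"
 by (rule sq_integrable[OF ric_cont[OF a] decay])

text \<open>Dyadic scales from 1 / \<kappa> downwards; the free decay over the first one is exp
  (-2).\<close>

definition l :: "nat => real" where "l j = 1 / (\<kappa> * 2 ^ j)"

lemma l_bounds: "0 < l j" "l j <= 1" "0 <= l j" "\<kappa> * l j <= 1"
proof -
 have "1 * 1 <= \<kappa> * 2 ^ j" using \<kappa> by (intro mult_mono) auto
 then show "l j <= 1" "0 < l j" "0 <= l j" by (auto simp: l_def)
 show "\<kappa> * l j <= 1" using \<kappa> by (simp add: l_def)
qed

lemma l_Suc: "l j = 2 * l (Suc j)" by (simp add: l_def)

lemma l_powr_Suc: "l (Suc j) powr p = l j powr p * 2 powr (- p)"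
 using l_bounds(1)[of "Suc j"] by (simp add: l_Suc[of j] powr_mult mult_ac flip: powr_add)

lemma l_sq_le: "(l j)^2 <= l j powr p"
 using l_bounds[of j] p powr_mono'[of p 2 "l j"] by (simp add: powr_numeral)

lemma l_sq_le': "(\<kappa> * l j)^2 <= \<kappa> powr p * l j powr p"
proof -
 have "0 < \<kappa> * l j" using \<kappa> l_bounds(1) by simp
 then have "(\<kappa> * l j)^2 <= (\<kappa> * l j) powr p"
  using l_bounds[of j] p powr_mono'[of p 2 "\<kappa> * l j"] by (simp add: powr_numeral)
 also have "\<dots> = \<kappa> powr p * l j powr p" using \<kappa> l_bounds by (simp add: powr_mult)
 finally show ?thesis .
qed

definition "vj j = (LINT x|lborel. (cmod (V (l j) x))^2)"
definition "\<rho> j = (LINT x|lborel. cmod (R (l j) x))"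
definition "\<delta> j = (LINT x|lborel. (cmod (\<Delta> (l j) x))^2)"
definition "\<tau> j = (LINT x|lborel. (cmod (\<Theta> (l j) x))^2)"
definition "X = (LINT x|lborel. (cmod (a x))^2)"

lemma V_sq_integrable: "integrable lborel (\<lambda>x. (cmod (V (l j) x))^2)"
 by (rule sq_integrable[OF V_cont V_bound]) (use l_bounds in auto)

lemma R_integrable: "integrable lborel (\<lambda>x. cmod (R (l j) x))"
 by (rule integrable_wt_bound[where C = "27 * M^2 * (l j)^2"])
  (use R_bound[OF l_bounds(3,2)] in \<open>auto intro!: continuous_intros R_cont\<close>)

lemma \<Delta>_sq_integrable: "integrable lborel (\<lambda>x. (cmod (\<Delta> (l j) x))^2)"
 by (rule sq_integrable[where C = "18 * M * l j"])
  (use \<Delta>_bound[OF l_bounds(3,2)] in \<open>auto intro!: \<Delta>_cont simp: mult_ac\<close>)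

lemma vj_le: "vj j <= v * l j powr p"
 using Vb[OF l_bounds(1,2), of j] l_bounds(3)[of j] by (simp add: vj_def V_Vint)

text \<open>\<open>R\<close> is controlled in L^1 only, while \<open>\<Theta>\<close> is wanted in
  L^2. Since |a| <= 1/4 forces |\<Theta>| <= 1/2, one has |R| <= 1/2 + 2 |V|, and one factor of |R|
  in its square can be given away.\<close>

lemma \<Theta>_pointwise: "(cmod (\<Theta> (l j) x))^2 <= 16 * (cmod (V (l j) x))^2 + 2 * cmod (R (l j) x)"
proof -
 define r w where "r = cmod (R (l j) x)" and "w = cmod (V (l j) x)"
 have w0: "0 <= w" and r0: "0 <= r" by (auto simp: r_def w_def)
 have Neq: "N (l j) x = R (l j) x + V (l j) x * (a x)^2" by (simp add: R_def)
 have a2: "cmod (V (l j) x * (a x)^2) <= w * (1/4)^2"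
  unfolding w_def by (intro cmod_mult_le cmod_sq_le ric_le[OF a] order_refl)
 have sV: "cmod (of_real \<sigma> * cnj (V (l j) x)) <= w" using \<sigma> by (auto simp: w_def norm_mult)
 have th: "cmod (\<Theta> (l j) x) <= 2 * w + r"
 proof -
  have "cmod (\<Theta> (l j) x) <= w + (r + w * (1/4)^2)"
   unfolding step_identity Neq by (intro cmod_diff_le cmod_add_le sV a2) (simp add: r_def)
  then show ?thesis using w0 by (simp add: power2_eq_square)
 qed
 have th2: "cmod (\<Theta> (l j) x) <= 1/2"
 proof -
  have "cmod (\<Theta> (l j) x) <= 1/4 + 1 * (1/4)"
   unfolding \<Theta>_def by (intro cmod_diff_le cmod_mult_le ric_le[OF a] E_norm_le l_bounds)
  then show ?thesis by simp
 qed
 have "r <= 1/2 + 2 * w"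
 proof -
  have "R (l j) x = of_real \<sigma> * cnj (V (l j) x) - \<Theta> (l j) x - V (l j) x * (a x)^2"
   using step_identity[of "l j" x] Neq by (simp add: algebra_simps)
  then have "r <= w + 1/2 + w * (1/4)^2" unfolding r_def by (metis cmod_diff_le sV th2 a2)
  then show ?thesis using w0 by (simp add: power2_eq_square)
 qed
 then have "r * r <= r * (1/2 + 2 * w)" using r0 by (intro mult_left_mono) auto
 moreover have "r * (2 * w) <= r^2 / 2 + 2 * w^2"
  using zero_le_power2[of "r - 2 * w"] by (simp add: power2_eq_square algebra_simps)
 ultimately have r2: "r^2 <= r + 4 * w^2" by (simp add: power2_eq_square algebra_simps)
 have "(cmod (\<Theta> (l j) x))^2 <= (2 * w + r)^2" using th by (intro power_mono) auto
 also have "\<dots> <= 8 * w^2 + 2 * r^2"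
  using zero_le_power2[of "2 * w - r"] by (simp add: power2_eq_square algebra_simps)
 finally show ?thesis using r2 unfolding w_def r_def by linarith
qed

lemma \<tau>_integrable: "integrable lborel (\<lambda>x. (cmod (\<Theta> (l j) x))^2)"
 by (rule Bochner_Integration.integrable_bound[where f = "\<lambda>x. 16 * (cmod (V (l j) x))^2 + 2 * cmod (R (l j) x)"])
  (use \<Theta>_pointwise in \<open>auto intro!: V_sq_integrable R_integrable borel_measurable_continuous_onI continuous_intros \<Theta>_cont\<close>)

lemma \<tau>_le: "\<tau> j <= 16 * vj j + 2 * \<rho> j"
proof -
 have "\<tau> j <= (LINT x|lborel. 16 * (cmod (V (l j) x))^2 + 2 * cmod (R (l j) x))"
  unfolding \<tau>_def using \<Theta>_pointwise by (intro integral_mono \<tau>_integrable) (auto intro!: V_sq_integrable R_integrable)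
 then show ?thesis using V_sq_integrable[of j] R_integrable[of j] by (simp add: vj_def \<rho>_def)
qed

text \<open>The L^1 norm of \<open>R_split\<close>. The product of V and \<Delta> is separated by
  Young's inequality with a free weight \<Lambda>; a large weight makes the contribution of \<Delta>
  absorbable.\<close>

lemma \<rho>_step:
 assumes L: "0 < \<Lambda>"
 shows "\<rho> j <= 2 * \<rho> (Suc j) + (\<Lambda> * vj (Suc j) + \<delta> (Suc j) / \<Lambda>) / 4"
proof -
 define h where "h = l (Suc j)"
 have pw: "cmod (R (l j) x) <= cmod (R h x) + cmod (R h (x + h)) + (\<Lambda> * (cmod (V h (x + h)))^2 + (cmod (\<Delta> h x))^2 / \<Lambda>) / 4" for x
 proof -
  define w d where "w = cmod (V h (x + h))" and "d = cmod (\<Delta> h x)"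
  have "R (l j) x = E h * R h x + R h (x + h) + V h (x + h) * ((a (x + h) + a x) * \<Delta> h x)"
   unfolding l_Suc[of j] h_def[symmetric] R_split by (simp add: \<Delta>_def algebra_simps power2_eq_square)
  also have "cmod \<dots> <= 1 * cmod (R h x) + cmod (R h (x + h)) + w * ((1/4 + 1/4) * d)"
   unfolding w_def d_def by (intro cmod_add_le cmod_mult_le ric_le[OF a] order_refl E_norm_le) (simp add: h_def l_bounds)
  also have "w * ((1/4 + 1/4) * d) = (w * d) / 2" by simp
  also have "w * d <= (\<Lambda> * w^2 + d^2 / \<Lambda>) / 2"
  proof -
   have "0 <= (\<Lambda> * w - d)^2 / \<Lambda>" using L by simp
   also have "\<dots> = \<Lambda> * w^2 + d^2 / \<Lambda> - 2 * (w * d)"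
    using L by (simp add: power2_eq_square field_simps)
   finally show ?thesis by simp
  qed
  finally show ?thesis by (simp add: w_def d_def)
 qed
 have i1: "integrable lborel (\<lambda>x. cmod (R h (x + h)))" "integrable lborel (\<lambda>x. (cmod (V h (x + h)))^2)"
  unfolding h_def by (intro integrable_shift[of "\<lambda>x. cmod (R _ x)"] integrable_shift[of "\<lambda>x. (cmod (V _ x))^2"] R_integrable V_sq_integrable)+
 have i2: "integrable lborel (\<lambda>x. cmod (R h x))" "integrable lborel (\<lambda>x. (cmod (\<Delta> h x))^2)"
  unfolding h_def by (intro R_integrable \<Delta>_sq_integrable)+
 have "\<rho> j <= (LINT x|lborel. cmod (R h x) + cmod (R h (x + h)) + (\<Lambda> * (cmod (V h (x + h)))^2 + (cmod (\<Delta> h x))^2 / \<Lambda>) / 4)"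
  unfolding \<rho>_def using pw i1 i2 by (intro integral_mono R_integrable) auto
 also have "\<dots> = (LINT x|lborel. cmod (R h x)) + (LINT x|lborel. cmod (R h (x + h)))
   + (\<Lambda> * (LINT x|lborel. (cmod (V h (x + h)))^2) + (LINT x|lborel. (cmod (\<Delta> h x))^2) / \<Lambda>) / 4"
  using i1 i2 by simp
 also have "\<dots> = 2 * \<rho> (Suc j) + (\<Lambda> * vj (Suc j) + \<delta> (Suc j) / \<Lambda>) / 4"
  using integral_shift[of "\<lambda>x. cmod (R h x)" h] integral_shift[of "\<lambda>x. (cmod (V h x))^2" h]
  by (simp add: \<rho>_def vj_def \<delta>_def h_def)
 finally show ?thesis .
qed

abbreviation "K \<equiv> sewK p"

text \<open>The third inequality makes K c \<open>l powr p\<close> a supersolution of the recursion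
  \<rho> j <= 2 \<rho> (j + 1) + c \<open>l powr p\<close>.\<close>

lemma K: "0 < K" "1 <= K" "(2 * K + 1) * 2 powr (- p) <= K"
proof -
 define g where "g = (2::real) powr (1 - p)"
 have g: "0 < g" "g < 1" using p by (auto simp: g_def powr_less_one)
 have Kg: "K = 1 / (1 - g)" by (simp add: sewK_def g_def)
 show "0 < K" "1 <= K" using g by (auto simp: Kg)
 have "2 powr (- p) = g / 2" unfolding g_def by (simp add: powr_diff powr_minus_divide)
 moreover have "K * (1 - g) = 1" using g by (simp add: Kg)
 ultimately show "(2 * K + 1) * 2 powr (- p) <= K" using g by (simp add: algebra_simps)
qed

text \<open>Subtracting the supersolution leaves e j <= 2 e (j + 1). Iterating n times costs 2^n,
  but the crude bound shrinks by 4 at each halving, so the excess is at most 0.\<close>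

lemma \<rho>_le:
 assumes L: "0 < \<Lambda>" and D: "\<And>j. \<delta> j <= D * l j powr p"
 shows "\<rho> j <= K * ((\<Lambda> * v + D / \<Lambda>) / 4) * l j powr p"
proof -
 define c where "c = (\<Lambda> * v + D / \<Lambda>) / 4"
 have D0: "0 <= D"
 proof -
  have "0 <= \<delta> 0" unfolding \<delta>_def by (rule integral_nonneg_AE) simp
  also have "\<dots> <= D * l 0 powr p" by (rule D)
  finally show ?thesis using l_bounds(1)[of 0] by (simp add: zero_le_mult_iff)
 qed
 have c0: "0 <= c" using L v D0 by (simp add: c_def)
 define e where "e = (\<lambda>j. \<rho> j - K * c * l j powr p)"
 have estep: "e j <= 2 * e (Suc j)" for j
 proof -
  have "\<Lambda> * vj (Suc j) <= \<Lambda> * (v * l (Suc j) powr p)" using L vj_le by (intro mult_left_mono) auto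
  moreover have "\<delta> (Suc j) / \<Lambda> <= D * l (Suc j) powr p / \<Lambda>" using L D by (intro divide_right_mono) auto
  moreover have "(\<Lambda> * (v * l (Suc j) powr p) + D * l (Suc j) powr p / \<Lambda>) / 4 = c * l (Suc j) powr p"
   by (simp add: c_def algebra_simps add_divide_distrib)
  ultimately have "\<rho> j <= 2 * \<rho> (Suc j) + c * l (Suc j) powr p" using \<rho>_step[OF L, of j] by argo
  moreover have "c * l (Suc j) powr p + 2 * (K * c * l (Suc j) powr p) <= K * c * l j powr p"
  proof -
   have "((2 * K + 1) * 2 powr (- p)) * (c * l j powr p) <= K * (c * l j powr p)"
    using K(3) c0 by (intro mult_right_mono) auto
   then show ?thesis unfolding l_powr_Suc by (simp add: algebra_simps)
  qed
  moreover have "x - z <= 2 * (y - w)" if "x <= 2 * y + u" "u + 2 * w <= z" for x y z u w :: real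
   using that by simp
  ultimately show ?thesis unfolding e_def by blast
 qed
 have iter: "e j <= 2 ^ n * e (j + n)" for n
 proof (induction n)
  case (Suc n)
  have "2 ^ n * e (j + n) <= 2 ^ n * (2 * e (Suc (j + n)))" using estep by (intro mult_left_mono) auto
  from Suc this have "e j <= 2 ^ n * (2 * e (Suc (j + n)))" by (rule order_trans)
  then show ?case by (simp add: mult_ac)
 qed simp
 define C where "C = 4 * (27 * M^2) * (l j)^2"
 have "e j <= C * (1/2) ^ n" for n
 proof -
  have "\<rho> (j + n) <= 4 * (27 * M^2 * (l (j + n))^2)"
   unfolding \<rho>_def by (rule integral_wt_bound) (use R_bound[OF l_bounds(3,2)] in \<open>auto intro!: continuous_intros R_cont\<close>)
  moreover have "l (j + n) = l j * (1/2) ^ n" by (simp add: l_def power_add power_one_over field_simps)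
  ultimately have "2 ^ n * \<rho> (j + n) <= 2 ^ n * (C * ((1/2) ^ n * (1/2) ^ n))"
   by (simp add: C_def power2_eq_square mult_ac)
  also have "\<dots> = C * (1/2) ^ n * (2 * (1/2)) ^ n" unfolding power_mult_distrib by simp
  finally have "2 ^ n * \<rho> (j + n) <= C * (1/2) ^ n" by simp
  moreover have "e (j + n) <= \<rho> (j + n)" using K(1) c0 by (simp add: e_def)
  then have "2 ^ n * e (j + n) <= 2 ^ n * \<rho> (j + n)" by (intro mult_left_mono) auto
  ultimately show ?thesis using iter[of n] by linarith
 qed
 moreover have "(\<lambda>n. C * (1/2) ^ n) \<longlonglongrightarrow> C * 0"
  by (intro tendsto_intros LIMSEQ_realpow_zero) auto
 ultimately have "e j <= C * 0" by (intro LIMSEQ_le_const) auto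
 then show ?thesis by (simp add: e_def c_def)
qed

text \<open>Over the scale 1 / \<kappa> the free decay factor exp (-2) is below 1/4. Translation
  invariance of the integral then lets the old value of a be absorbed into the left side.\<close>

lemma X_le: "X <= 3 * \<tau> 0"
proof -
 have l0: "l 0 = 1 / \<kappa>" by (simp add: l_def)
 have E0: "cmod (E (l 0)) <= 1/4"
 proof -
  have "E (l 0) = of_real (exp (- 2))" using \<kappa> by (simp add: E_def l0)
  moreover have "exp (- 2 :: real) <= 1/4"
  proof -
   have "2 <= exp (1::real)" using exp_ge_add_one_self[of 1] by simp
   then have "2 * 2 <= exp (1::real) * exp 1" by (intro mult_mono) auto
   then have "4 <= exp (2::real)" by (simp flip: exp_add)
   then show ?thesis by (simp add: exp_minus field_simps)
  qed
  ultimately show ?thesis by simp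
 qed
 have pw: "(cmod (a (x + l 0)))^2 <= 2 * (cmod (\<Theta> (l 0) x))^2 + (cmod (a x))^2 / 8" for x
 proof -
  have "a (x + l 0) = \<Theta> (l 0) x + E (l 0) * a x" by (simp add: \<Theta>_def)
  then have "cmod (a (x + l 0)) <= cmod (\<Theta> (l 0) x) + 1/4 * cmod (a x)"
   by (metis cmod_add_le cmod_mult_le E0 order_refl)
  then have "(cmod (a (x + l 0)))^2 <= (cmod (\<Theta> (l 0) x) + 1/4 * cmod (a x))^2" by (intro power_mono) auto
  also have "\<dots> <= 2 * (cmod (\<Theta> (l 0) x))^2 + (cmod (a x))^2 / 8"
   using zero_le_power2[of "cmod (\<Theta> (l 0) x) - 1/4 * cmod (a x)"] by (simp add: power2_eq_square algebra_simps)
  finally show ?thesis .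
 qed
 have "X = (LINT x|lborel. (cmod (a (x + l 0)))^2)" unfolding X_def using integral_shift[of "\<lambda>x. (cmod (a x))^2"] by simp
 also have "\<dots> <= (LINT x|lborel. 2 * (cmod (\<Theta> (l 0) x))^2 + (cmod (a x))^2 / 8)"
  using pw a_sq_integrable \<tau>_integrable
  by (intro integral_mono integrable_shift[of "\<lambda>x. (cmod (a x))^2"]) auto
 also have "\<dots> = 2 * \<tau> 0 + X / 8" using a_sq_integrable \<tau>_integrable by (simp add: \<tau>_def X_def)
 finally have "X <= 16/7 * \<tau> 0" by simp
 moreover have "0 <= \<tau> 0" unfolding \<tau>_def by (rule integral_nonneg_AE) simp
 ultimately show ?thesis by linarith
qed

lemma \<delta>_le: "\<delta> j <= 2 * \<tau> j + 8 * (\<kappa> * l j)^2 * X"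
proof -
 have E1: "cmod (1 - E (l j)) <= 2 * (\<kappa> * l j)"
 proof -
  have "1 - E (l j) = of_real (1 - exp (- (2 * \<kappa> * l j)))" by (simp add: E_def)
  moreover have "1 - 2 * \<kappa> * l j <= exp (- (2 * \<kappa> * l j))" using exp_ge_add_one_self[of "- (2 * \<kappa> * l j)"] by simp
  moreover have "exp (- (2 * \<kappa> * l j)) <= 1" using \<kappa> l_bounds(3)[of j] by simp
  ultimately show ?thesis by (simp only: norm_of_real)
 qed
 have pw: "(cmod (\<Delta> (l j) x))^2 <= 2 * (cmod (\<Theta> (l j) x))^2 + 8 * (\<kappa> * l j)^2 * (cmod (a x))^2" for x
 proof -
  have "\<Delta> (l j) x = \<Theta> (l j) x - (1 - E (l j)) * a x" by (simp add: \<Theta>_def \<Delta>_def algebra_simps)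
  then have "cmod (\<Delta> (l j) x) <= cmod (\<Theta> (l j) x) + 2 * (\<kappa> * l j) * cmod (a x)"
   by (metis cmod_diff_le cmod_mult_le E1 order_refl)
  then have "(cmod (\<Delta> (l j) x))^2 <= (cmod (\<Theta> (l j) x) + 2 * (\<kappa> * l j) * cmod (a x))^2" by (intro power_mono) auto
  also have "\<dots> <= 2 * (cmod (\<Theta> (l j) x))^2 + 2 * (2 * (\<kappa> * l j) * cmod (a x))^2"
   using zero_le_power2[of "cmod (\<Theta> (l j) x) - 2 * (\<kappa> * l j) * cmod (a x)"]
   by (simp add: power2_sum power2_diff)
  finally show ?thesis by (simp add: power_mult_distrib)
 qed
 have "\<delta> j <= (LINT x|lborel. 2 * (cmod (\<Theta> (l j) x))^2 + 8 * (\<kappa> * l j)^2 * (cmod (a x))^2)"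
  unfolding \<delta>_def using pw a_sq_integrable \<tau>_integrable by (intro integral_mono \<Delta>_sq_integrable) auto
 also have "\<dots> = 2 * \<tau> j + 8 * (\<kappa> * l j)^2 * X" using a_sq_integrable \<tau>_integrable by (simp add: \<tau>_def X_def)
 finally show ?thesis .
qed

text \<open>The chain of estimates closes into a linear inequality for D, the best constant in
  \<delta> j <= D \<open>l j powr p\<close>. D is finite by the crude bound, so half of it can be
  absorbed, and what remains is proportional to v.\<close>

lemma energy_bound: "X <= enK p * v * \<kappa> powr (- p)"
proof -
 \<comment> \<open>The loop multiplies D by 26 * 2 * K / (4 * \<Lambda>), where 26 = 2 + 24 collects
   \<open>\<delta>_le\<close> and \<open>X_le\<close>. This choice makes the factor 1/2.\<close>
 define \<Lambda> where "\<Lambda> = 26 * K"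
 have L: "0 < \<Lambda>" using K by (simp add: \<Lambda>_def)
 define D where "D = (SUP j. \<delta> j / l j powr p)"
 have lp: "0 < l j powr p" for j using l_bounds(1)[of j] by simp
 have bdd: "bdd_above (range (\<lambda>j. \<delta> j / l j powr p))"
 proof (rule bdd_aboveI2)
  fix j
  have "\<delta> j <= 4 * (18 * M * l j)^2"
   unfolding \<delta>_def
  proof (rule integral_wt_bound)
   show "\<bar>(cmod (\<Delta> (l j) x))^2\<bar> <= (18 * M * l j)^2 * wt x" for x
    using sq_wt_bound[of "\<Delta> (l j) x" "18 * M * l j" x] \<Delta>_bound[OF l_bounds(3,2), of j x] by (simp add: mult_ac)
  qed (intro continuous_intros \<Delta>_cont)
  also have "\<dots> = 4 * (18 * M)^2 * (l j)^2" by (simp add: power_mult_distrib)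
  also have "\<dots> <= 4 * (18 * M)^2 * l j powr p" by (intro mult_left_mono l_sq_le) auto
  finally show "\<delta> j / l j powr p <= 4 * (18 * M)^2" using lp[of j] by (simp add: divide_le_eq)
 qed
 have D: "\<delta> j <= D * l j powr p" for j
  using cSUP_upper[OF UNIV_I bdd, of j] lp[of j] unfolding D_def by (simp add: divide_le_eq)
 define c where "c = K * ((\<Lambda> * v + D / \<Lambda>) / 4)"
 have \<rho>: "\<rho> j <= c * l j powr p" for j unfolding c_def by (rule \<rho>_le[OF L D])
 have \<tau>: "\<tau> j <= (16 * v + 2 * c) * l j powr p" for j
  using \<tau>_le[of j] vj_le[of j] \<rho>[of j] by (simp add: algebra_simps)
 have l0: "l 0 powr p = \<kappa> powr (- p)" using \<kappa> by (simp add: l_def powr_minus_divide powr_divide)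
 have X: "X <= 3 * ((16 * v + 2 * c) * \<kappa> powr (- p))" using X_le \<tau>[of 0] by (simp add: l0)
 have kk: "\<kappa> powr p * \<kappa> powr (- p) = 1" using \<kappa> by (simp flip: powr_add)
 have "\<delta> j / l j powr p <= 26 * (16 * v + 2 * c)" for j
 proof -
  have "8 * (\<kappa> * l j)^2 * X <= 8 * (\<kappa> powr p * l j powr p) * X"
  proof -
   have "0 <= X" unfolding X_def by (rule integral_nonneg_AE) simp
   then show ?thesis using l_sq_le'[of j] by (intro mult_right_mono mult_left_mono) auto
  qed
  also have "\<dots> <= 8 * (\<kappa> powr p * l j powr p) * (3 * ((16 * v + 2 * c) * \<kappa> powr (- p)))"
   using X by (intro mult_left_mono) auto
  also have "\<dots> = 24 * ((16 * v + 2 * c) * l j powr p) * (\<kappa> powr p * \<kappa> powr (- p))" by (simp add: mult_ac)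
  finally have "\<delta> j <= 2 * ((16 * v + 2 * c) * l j powr p) + 24 * ((16 * v + 2 * c) * l j powr p)"
   using \<delta>_le[of j] \<tau>[of j] unfolding kk by linarith
  also have "\<dots> = 26 * (16 * v + 2 * c) * l j powr p" by simp
  finally show ?thesis using lp[of j] by (simp add: divide_le_eq)
 qed
 then have "D <= 26 * (16 * v + 2 * c)" unfolding D_def by (intro cSUP_least) auto
 also have "\<dots> = 416 * v + 338 * K^2 * v + D / 2"
  using K(1) by (simp add: c_def \<Lambda>_def power2_eq_square field_simps)
 finally have D2: "D <= 2 * (416 + 338 * K^2) * v" by (simp add: algebra_simps)
 have "D / \<Lambda> <= 2 * (416 + 338 * K^2) * v / \<Lambda>" using D2 L by (intro divide_right_mono) auto
 then have "c <= K * ((\<Lambda> * v + 2 * (416 + 338 * K^2) * v / \<Lambda>) / 4)"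
  unfolding c_def using K(1) by (intro mult_left_mono[OF divide_right_mono] add_left_mono) auto
 then have "3 * (16 * v + 2 * c) <= 3 * (16 * v + 2 * (K * ((\<Lambda> * v + 2 * (416 + 338 * K^2) * v / \<Lambda>) / 4)))" by simp
 also have "\<dots> = enK p * v" by (simp add: enK_def \<Lambda>_def algebra_simps)
 finally have "3 * (16 * v + 2 * c) * \<kappa> powr (- p) <= enK p * v * \<kappa> powr (- p)" by (intro mult_right_mono) auto
 then show ?thesis by (intro order_trans[OF X]) (simp only: mult.assoc)
qed

lemma energy_en: "en \<kappa> a (enK p * v * \<kappa> powr (1 - p))"
 unfolding en_def
proof (intro allI impI)
 fix Y :: real
 have i: "set_integrable lborel {-Y..Y} (\<lambda>x. (cmod (a x))^2)"
  by (rule set_integrable_subset[of _ UNIV]) (use a_sq_integrable in \<open>auto simp: set_integrable_def\<close>)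
 have "integral {-Y..Y} (\<lambda>x. (cmod (a x))^2) = (LINT x:{-Y..Y}|lborel. (cmod (a x))^2)"
  using set_borel_integral_eq_integral(2)[OF i] by simp
 also have "\<dots> <= X"
  unfolding set_lebesgue_integral_def X_def
  using i a_sq_integrable by (intro integral_mono) (auto simp: set_integrable_def indicator_def)
 finally have "\<kappa> * integral {-Y..Y} (\<lambda>x. (cmod (a x))^2) <= \<kappa> * (enK p * v * \<kappa> powr (- p))"
  using energy_bound \<kappa> by (intro mult_left_mono) auto
 also have "\<dots> = enK p * v * (\<kappa> powr 1 * \<kappa> powr (- p))" using \<kappa> by simp
 also have "\<kappa> powr 1 * \<kappa> powr (- p) = \<kappa> powr (1 - p)" by (subst powr_add[symmetric]) simp
 finally show "\<kappa> * integral {-Y..Y} (\<lambda>x. (cmod (a x))^2) <= enK p * v * \<kappa> powr (1 - p)" .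
qed

end

section \<open>Plancherel and the Sobolev norm\<close>

text \<open>An integrable factor times a kernel with uniformly bounded L^1 sections: the common
  shape of the exchanges of integration below.\<close>

lemma fubini_general:
 fixes f :: "real => 'b::{real_normed_field, banach, second_countable_topology}" and h :: "real => real => 'b"
 assumes f: "integrable lborel f"
  and h[measurable]: "(\<lambda>(x, y). h x y) \<in> borel_measurable (lborel \<Otimes>\<^sub>M lborel)"
  and hi: "\<And>x. integrable lborel (h x)" and hb: "\<And>x. (LINT y|lborel. norm (h x y)) <= C"
 shows "integrable (lborel \<Otimes>\<^sub>M lborel) (\<lambda>(x, y). f x * h x y)"
  and "(LINT y|lborel. LINT x|lborel. f x * h x y) = (LINT x|lborel. f x * (LINT y|lborel. h x y))"
proof -
 have [measurable]: "f \<in> borel_measurable lborel" using f by auto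
 show *: "integrable (lborel \<Otimes>\<^sub>M lborel) (\<lambda>(x, y). f x * h x y)"
 proof (rule lborel_pair.Fubini_integrable)
  show "AE x in lborel. integrable lborel (\<lambda>y. case (x, y) of (x, y) => f x * h x y)"
   using hi by (intro AE_I2) auto
  have eq: "(LINT y|lborel. norm (case (x, y) of (x, y) => f x * h x y)) = norm (f x) * (LINT y|lborel. norm (h x y))" for x
   by (simp add: norm_mult)
  have nn: "0 <= (LINT y|lborel. norm (h x y))" for x by (rule integral_nonneg_AE) simp
  show "integrable lborel (\<lambda>x. LINT y|lborel. norm (case (x, y) of (x, y) => f x * h x y))"
   unfolding eq
  proof (rule Bochner_Integration.integrable_bound)
   show "integrable lborel (\<lambda>x. norm (f x) * C)" using f by auto
   show "AE x in lborel. norm (norm (f x) * (LINT y|lborel. norm (h x y))) <= norm (norm (f x) * C)"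
    using order_trans[OF hb abs_ge_self] nn by (intro AE_I2) (auto simp: abs_mult intro!: mult_left_mono)
  qed measurable
 qed measurable
 show "(LINT y|lborel. LINT x|lborel. f x * h x y) = (LINT x|lborel. f x * (LINT y|lborel. h x y))"
  using lborel_pair.Fubini_integral[OF *] by simp
qed

lemma fubini_kernel:
 fixes f g :: "real => complex" and K :: "real => real => complex"
 assumes f: "integrable lborel f" and g: "integrable lborel g"
  and K[measurable]: "(\<lambda>(x, y). K x y) \<in> borel_measurable (lborel \<Otimes>\<^sub>M lborel)"
  and Kb: "\<And>x y. cmod (K x y) <= 1"
 shows "(LINT y|lborel. LINT x|lborel. f x * (g y * K x y)) = (LINT x|lborel. f x * (LINT y|lborel. g y * K x y))"
proof (rule fubini_general(2)[OF f])
 have [measurable]: "g \<in> borel_measurable lborel" using g by auto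
 show "(\<lambda>(x, y). g y * K x y) \<in> borel_measurable (lborel \<Otimes>\<^sub>M lborel)" by measurable
 have le: "cmod (g y * K x y) <= cmod (g y)" for x y
  using Kb[of x y] by (simp add: norm_mult mult_left_le)
 have Km: "K x \<in> borel_measurable lborel" for x
  using measurable_compose[OF measurable_Pair1' K, of x] by simp
 show i: "integrable lborel (\<lambda>y. g y * K x y)" for x
  by (rule Bochner_Integration.integrable_bound[OF g]) (use le Km in auto)
 show "(LINT y|lborel. cmod (g y * K x y)) <= (LINT y|lborel. cmod (g y))" for x
  using le i g by (intro integral_mono) auto
qed

section \<open>Plancherel by Gaussian regularisation\<close>

definition gs :: "real => real => real" where "gs \<epsilon> \<xi> = exp (- (\<epsilon> * \<xi>)\<^sup>2 / 2)"

lemma gs_std: "gs \<epsilon> \<xi> = sqrt (2 * pi) * nd (\<epsilon> * \<xi>)"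
 by (simp add: gs_def std_normal_density_def)

lemma std_int: "integrable lborel nd" "(LINT z|lborel. nd z) = 1"
 by auto

lemma gs_integrable: assumes "0 < \<epsilon>" shows "integrable lborel (gs \<epsilon>)"
proof -
 have "gs \<epsilon> = (\<lambda>\<xi>. sqrt (2 * pi) * nd (0 + \<epsilon> * \<xi>))" by (simp add: gs_std fun_eq_iff)
 then show ?thesis
  using lborel_integrable_real_affine[OF std_int(1), of \<epsilon> 0] assms by (simp add: integrable_mult_right)
qed

lemma gs_bounds: "0 < gs \<epsilon> \<xi>" "gs \<epsilon> \<xi> <= 1"
 by (auto simp: gs_def)

text \<open>Rescaled from the characteristic function of the standard normal distribution.\<close>

lemma gauss_fourier:
 assumes "0 < \<epsilon>"
 shows "(LINT \<xi>|lborel. of_real (gs \<epsilon> \<xi>) * exp (\<i> * of_real (\<xi> * u))) = of_real (2 * pi / \<epsilon> * nd (u / \<epsilon>))"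
proof -
 define t where "t = u / \<epsilon>"
 have "char std_normal_distribution t = (LINT x|lborel. nd x *\<^sub>R iexp (t * x))"
  unfolding char_def by (subst integral_density) (auto simp: normal_density_nonneg)
 then have "of_real (exp (- (t^2) / 2)) = (LINT x|lborel. nd x *\<^sub>R iexp (t * x))"
  by (simp add: char_std_normal_distribution)
 also have "\<dots> = \<epsilon> *\<^sub>R (LINT \<xi>|lborel. nd (\<epsilon> * \<xi>) *\<^sub>R iexp (t * (\<epsilon> * \<xi>)))"
  using lborel_integral_real_affine[of \<epsilon> "\<lambda>x. nd x *\<^sub>R iexp (t * x)" 0] assms by simp
 also have "(LINT \<xi>|lborel. nd (\<epsilon> * \<xi>) *\<^sub>R iexp (t * (\<epsilon> * \<xi>)))
   = (LINT \<xi>|lborel. of_real (1 / sqrt (2 * pi)) * (of_real (gs \<epsilon> \<xi>) * exp (\<i> * of_real (\<xi> * u))))"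
  using assms by (intro Bochner_Integration.integral_cong refl)
   (simp add: gs_std t_def scaleR_conv_of_real mult_ac)
 also have "\<dots> = of_real (1 / sqrt (2 * pi)) * (LINT \<xi>|lborel. of_real (gs \<epsilon> \<xi>) * exp (\<i> * of_real (\<xi> * u)))"
  by (rule integral_mult_right_zero)
 finally have e: "of_real (exp (- (t^2) / 2)) = \<epsilon> *\<^sub>R (of_real (1 / sqrt (2 * pi)) * (LINT \<xi>|lborel. of_real (gs \<epsilon> \<xi>) * exp (\<i> * of_real (\<xi> * u))))" .
 define I where "I = (LINT \<xi>|lborel. of_real (gs \<epsilon> \<xi>) * exp (\<i> * of_real (\<xi> * u)))"
 have "I = of_real (sqrt (2 * pi) / \<epsilon>) * of_real (exp (- (t^2) / 2))"
  unfolding e I_def[symmetric] using assms by (simp add: scaleR_conv_of_real)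
 also have "\<dots> = of_real (2 * pi / \<epsilon> * nd (u / \<epsilon>))"
 proof -
  have "sqrt (2 * pi) / \<epsilon> * exp (- (t^2) / 2) = 2 * pi / \<epsilon> * nd t"
  proof -
   have "2 * pi / sqrt (2 * pi) = sqrt (2 * pi)" by (rule real_div_sqrt) simp
   moreover have "2 * pi / \<epsilon> * nd t = (2 * pi / sqrt (2 * pi)) / \<epsilon> * exp (- (t^2) / 2)"
    by (simp add: std_normal_density_def)
   ultimately show ?thesis by (simp only:)
  qed
  then show ?thesis unfolding of_real_mult[symmetric] t_def[symmetric] by (rule arg_cong)
 qed
 finally show ?thesis by (simp add: I_def)
qed

locale l1cont =
 fixes f :: "real => complex" and C :: real
 assumes fc: "continuous_on UNIV f" and fb: "\<And>x. cmod (f x) <= C * wt x"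
begin

lemma f_int: "integrable lborel f" by (rule integrable_wt_bound[OF fc fb])

lemma f_meas [measurable]: "f \<in> borel_measurable borel" using borel_measurable_continuous_onI[OF fc] .

lemma cnj_meas [measurable]: "cnj \<in> borel_measurable borel"
 by (intro borel_measurable_continuous_onI continuous_intros)

lemma C0: "0 <= C"
proof -
 have "0 <= C * wt 0" using fb[of 0] norm_ge_zero order_trans by blast
 then show ?thesis using wt_pos[of 0] by (simp add: wt_def)
qed

lemma f_le: "cmod (f x) <= C"
 using fb[of x] wt_le_1[of x] C0 by (meson mult_left_le order_trans)

lemma fourier_meas [measurable]: "fourier f \<in> borel_measurable borel"
 unfolding fourier_def[abs_def] by measurable

lemma fourier_bound: "cmod (fourier f \<xi>) <= (LINT x|lborel. cmod (f x))"
proof -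
 have "cmod (LINT x|lborel. exp (- (\<i> * of_real (\<xi> * x))) * f x) <= (LINT x|lborel. cmod (exp (- (\<i> * of_real (\<xi> * x))) * f x))"
  by (rule integral_norm_bound)
 also have "\<dots> = (LINT x|lborel. cmod (f x))" by (simp add: norm_mult norm_exp_eq_Re)
 finally have 1: "cmod (LINT x|lborel. exp (- (\<i> * of_real (\<xi> * x))) * f x) <= (LINT x|lborel. cmod (f x))" .
 have s: "1 <= sqrt (2 * pi)" using pi_gt3 by simp
 have "cmod (fourier f \<xi>) = cmod (LINT x|lborel. exp (- (\<i> * of_real (\<xi> * x))) * f x) / sqrt (2 * pi)"
  by (simp add: fourier_def norm_divide)
 also have "\<dots> <= cmod (LINT x|lborel. exp (- (\<i> * of_real (\<xi> * x))) * f x) / 1"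
  using s by (intro divide_left_mono) auto
 finally show ?thesis using 1 by simp
qed

text \<open>With the Gaussian cut-off everything converges absolutely, and two applications of
  Fubini carry the frequency integral inside, where it becomes an average of f at width
  \<epsilon>.\<close>

lemma plancherel_eps:
 assumes e: "0 < \<epsilon>"
 shows "(LINT \<xi>|lborel. of_real (gs \<epsilon> \<xi>) * (fourier f \<xi> * cnj (fourier f \<xi>)))
  = (LINT x|lborel. f x * (LINT z|lborel. of_real (nd z) * cnj (f (x + \<epsilon> * z))))"
proof -
 define c where "c = complex_of_real (1 / sqrt (2 * pi))"
 define E where "E = (\<lambda>u :: real. exp (\<i> * complex_of_real u))"
 have E1: "cmod (E u) = 1" for u by (simp add: E_def norm_exp_eq_Re)
 have Eadd: "E (u + v) = E u * E v" for u v by (simp add: E_def ring_distribs exp_add)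
 have [measurable]: "E \<in> borel_measurable borel" unfolding E_def by measurable
 have cc: "c * c * of_real (2 * pi) = 1"
  unfolding c_def by (simp flip: of_real_mult)
 define g where "g = (\<lambda>\<xi>. of_real (gs \<epsilon> \<xi>) * cnj (fourier f \<xi>))"
 have gi: "integrable lborel g"
 proof (rule Bochner_Integration.integrable_bound)
  show "integrable lborel (\<lambda>\<xi>. gs \<epsilon> \<xi> * (LINT x|lborel. cmod (f x)))" using gs_integrable[OF e] by simp
  show "AE \<xi> in lborel. norm (g \<xi>) <= norm (gs \<epsilon> \<xi> * (LINT x|lborel. cmod (f x)))"
   using fourier_bound gs_bounds(1)[of \<epsilon>]
   by (intro AE_I2) (auto simp: g_def norm_mult abs_mult less_imp_le intro!: mult_left_mono intro: order_trans)
  show "g \<in> borel_measurable lborel" unfolding g_def gs_def by measurable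
 qed
 have Gi: "integrable lborel (\<lambda>\<xi>. complex_of_real (gs \<epsilon> \<xi>))" using gs_integrable[OF e] by simp
 have F: "fourier f \<xi> = c * (LINT x|lborel. f x * E (- (\<xi> * x)))" for \<xi>
  unfolding fourier_def c_def E_def by (simp add: mult.commute divide_inverse)
 have cF: "cnj (fourier f \<xi>) = c * (LINT y|lborel. cnj (f y) * E (\<xi> * y))" for \<xi>
 proof -
  have "cnj (LINT x|lborel. f x * E (- (\<xi> * x))) = (LINT y|lborel. cnj (f y) * E (\<xi> * y))"
  proof -
   have "cnj (LINT x|lborel. f x * E (- (\<xi> * x))) = (LINT x|lborel. cnj (f x * E (- (\<xi> * x))))"
    by (rule Bochner_Integration.integral_cnj[symmetric])
   also have "\<dots> = (LINT y|lborel. cnj (f y) * E (\<xi> * y))"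
    by (intro Bochner_Integration.integral_cong refl) (simp add: E_def exp_cnj)
   finally show ?thesis .
  qed
  then show ?thesis unfolding F by (simp add: c_def)
 qed
 have inner: "(LINT \<xi>|lborel. g \<xi> * E (- (\<xi> * x))) = of_real (2 * pi) * (c * (LINT z|lborel. of_real (nd z) * cnj (f (x + \<epsilon> * z))))" for x
 proof -
  have "(LINT \<xi>|lborel. g \<xi> * E (- (\<xi> * x))) = (LINT \<xi>|lborel. c * (LINT y|lborel. cnj (f y) * (of_real (gs \<epsilon> \<xi>) * E (\<xi> * (y - x)))))"
  proof (intro Bochner_Integration.integral_cong refl)
   fix \<xi>
   have "(LINT y|lborel. cnj (f y) * (of_real (gs \<epsilon> \<xi>) * E (\<xi> * (y - x)))) = (LINT y|lborel. (of_real (gs \<epsilon> \<xi>) * E (- (\<xi> * x))) * (cnj (f y) * E (\<xi> * y)))"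
    using Eadd[of "- (\<xi> * x)"] by (intro Bochner_Integration.integral_cong refl) (simp add: right_diff_distrib)
   also have "\<dots> = (of_real (gs \<epsilon> \<xi>) * E (- (\<xi> * x))) * (LINT y|lborel. cnj (f y) * E (\<xi> * y))"
    by (rule integral_mult_right_zero)
   finally show "g \<xi> * E (- (\<xi> * x)) = c * (LINT y|lborel. cnj (f y) * (of_real (gs \<epsilon> \<xi>) * E (\<xi> * (y - x))))"
    unfolding g_def cF by (simp add: mult_ac)
  qed
  also have "\<dots> = c * (LINT \<xi>|lborel. LINT y|lborel. cnj (f y) * (of_real (gs \<epsilon> \<xi>) * E (\<xi> * (y - x))))"
   by (rule integral_mult_right_zero)
  also have "(LINT \<xi>|lborel. LINT y|lborel. cnj (f y) * (of_real (gs \<epsilon> \<xi>) * E (\<xi> * (y - x))))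
    = (LINT y|lborel. cnj (f y) * (LINT \<xi>|lborel. of_real (gs \<epsilon> \<xi>) * E (\<xi> * (y - x))))"
   by (rule fubini_kernel) (use f_int Gi E1 in auto)
  also have "\<dots> = (LINT y|lborel. cnj (f y) * of_real (2 * pi / \<epsilon> * nd ((y - x) / \<epsilon>)))"
   unfolding E_def gauss_fourier[OF e] ..
  also have "\<dots> = \<epsilon> *\<^sub>R (LINT z|lborel. cnj (f (x + \<epsilon> * z)) * of_real (2 * pi / \<epsilon> * nd z))"
   using lborel_integral_real_affine[of \<epsilon> "\<lambda>y. cnj (f y) * of_real (2 * pi / \<epsilon> * nd ((y - x) / \<epsilon>))" x] e
   by simp
  also have "\<dots> = (LINT z|lborel. of_real (2 * pi) * (of_real (nd z) * cnj (f (x + \<epsilon> * z))))"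
   unfolding integral_scaleR_right[symmetric] using e
   by (intro Bochner_Integration.integral_cong refl) (simp add: scaleR_conv_of_real mult_ac)
  also have "\<dots> = of_real (2 * pi) * (LINT z|lborel. of_real (nd z) * cnj (f (x + \<epsilon> * z)))"
   by (rule integral_mult_right_zero)
  finally show ?thesis by (simp add: mult_ac)
 qed
 have "(LINT \<xi>|lborel. of_real (gs \<epsilon> \<xi>) * (fourier f \<xi> * cnj (fourier f \<xi>)))
   = (LINT \<xi>|lborel. c * (LINT x|lborel. f x * (g \<xi> * E (- (\<xi> * x)))))"
 proof (intro Bochner_Integration.integral_cong refl)
  fix \<xi>
  have "(LINT x|lborel. f x * (g \<xi> * E (- (\<xi> * x)))) = (LINT x|lborel. g \<xi> * (f x * E (- (\<xi> * x))))"
   by (simp only: mult_ac)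
  also have "\<dots> = g \<xi> * (LINT x|lborel. f x * E (- (\<xi> * x)))" by (rule integral_mult_right_zero)
  finally show "of_real (gs \<epsilon> \<xi>) * (fourier f \<xi> * cnj (fourier f \<xi>)) = c * (LINT x|lborel. f x * (g \<xi> * E (- (\<xi> * x))))"
   unfolding g_def by (subst F) (simp add: mult_ac)
 qed
 also have "\<dots> = c * (LINT \<xi>|lborel. LINT x|lborel. f x * (g \<xi> * E (- (\<xi> * x))))"
  by (rule integral_mult_right_zero)
 also have "(LINT \<xi>|lborel. LINT x|lborel. f x * (g \<xi> * E (- (\<xi> * x)))) = (LINT x|lborel. f x * (LINT \<xi>|lborel. g \<xi> * E (- (\<xi> * x))))"
  by (rule fubini_kernel) (use f_int gi E1 in auto)
 also have "\<dots> = (LINT x|lborel. (of_real (2 * pi) * c) * (f x * (LINT z|lborel. of_real (nd z) * cnj (f (x + \<epsilon> * z)))))"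
  unfolding inner by (intro Bochner_Integration.integral_cong refl) (simp only: mult_ac)
 also have "\<dots> = (of_real (2 * pi) * c) * (LINT x|lborel. f x * (LINT z|lborel. of_real (nd z) * cnj (f (x + \<epsilon> * z))))"
  by (rule integral_mult_right_zero)
 also have "c * (of_real (2 * pi) * c * z) = (c * c * of_real (2 * pi)) * z" for z by (simp only: mult_ac)
 finally show ?thesis unfolding cc mult_1_left .
qed

text \<open>As the cut-off is removed, the frequency side increases monotonically, while on the
  other side the averages converge to f(x) by continuity and are dominated by a constant.\<close>

lemma plancherel:
 "integrable lborel (\<lambda>\<xi>. (cmod (fourier f \<xi>))^2)"
 "(LINT \<xi>|lborel. (cmod (fourier f \<xi>))^2) = (LINT x|lborel. (cmod (f x))^2)"
proof -
 define e where "e = (\<lambda>n. 1 / real (Suc n))"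
 have e0: "0 < e n" for n by (simp add: e_def)
 have elim: "e \<longlonglongrightarrow> 0" unfolding e_def by (rule LIMSEQ_Suc[OF lim_1_over_n])
 define I where "I = (\<lambda>n x. LINT z|lborel. of_real (nd z) * cnj (f (x + e n * z)))"
 have Ib: "cmod (of_real (nd z) * cnj (f (x + e n * z))) <= nd z * C" for n x z
  using f_le by (simp add: norm_mult normal_density_nonneg mult_left_mono)
 have Ilim: "(\<lambda>n. I n x) \<longlonglongrightarrow> cnj (f x)" for x
 proof -
  have "(\<lambda>n. I n x) \<longlonglongrightarrow> (LINT z|lborel. of_real (nd z) * cnj (f x))"
   unfolding I_def
  proof (rule integral_dominated_convergence[where w = "\<lambda>z. nd z * C"])
   show "integrable lborel (\<lambda>z. nd z * C)" using std_int by simp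
   show "AE z in lborel. norm (of_real (nd z) * cnj (f (x + e n * z))) <= nd z * C" for n
    using Ib by simp
   have "(\<lambda>n. f (x + e n * z)) \<longlonglongrightarrow> f x" for z
   proof -
    have "(\<lambda>n. x + e n * z) \<longlonglongrightarrow> x + 0 * z" by (intro tendsto_intros elim)
    then have "(\<lambda>n. x + e n * z) \<longlonglongrightarrow> x" by simp
    moreover have "isCont f x" using fc by (simp add: continuous_on_eq_continuous_at)
    ultimately show ?thesis using isCont_tendsto_compose by blast
   qed
   then show "AE z in lborel. (\<lambda>n. of_real (nd z) * cnj (f (x + e n * z))) \<longlonglongrightarrow> of_real (nd z) * cnj (f x)"
    by (intro AE_I2 tendsto_intros)
  qed measurable
  also have "(LINT z|lborel. of_real (nd z) * cnj (f x)) = cnj (f x)"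
   using std_int by (simp add: integral_complex_of_real)
  finally show ?thesis .
 qed
 have Ile: "cmod (I n x) <= C" for n x
 proof -
  have "cmod (I n x) <= (LINT z|lborel. cmod (of_real (nd z) * cnj (f (x + e n * z))))"
   unfolding I_def by (rule integral_norm_bound)
  also have "\<dots> <= (LINT z|lborel. nd z * C)"
  proof (rule integral_mono)
   show 1: "integrable lborel (\<lambda>z. nd z * C)" using std_int by simp
   show "integrable lborel (\<lambda>z. cmod (of_real (nd z) * cnj (f (x + e n * z))))"
    by (intro integrable_norm Bochner_Integration.integrable_bound[OF 1]) 
     (use Ib C0 in \<open>auto simp: abs_mult normal_density_nonneg intro: order_trans\<close>)
  qed (use Ib in auto)
  also have "\<dots> = C" using std_int by simp
  finally show ?thesis .
 qed
 have lim1: "(\<lambda>n. LINT x|lborel. f x * I n x) \<longlonglongrightarrow> (LINT x|lborel. f x * cnj (f x))"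
 proof (rule integral_dominated_convergence[where w = "\<lambda>x. cmod (f x) * C"])
  show "integrable lborel (\<lambda>x. cmod (f x) * C)" using f_int by auto
  show "AE x in lborel. (\<lambda>n. f x * I n x) \<longlonglongrightarrow> f x * cnj (f x)" by (intro AE_I2 tendsto_intros Ilim)
  show "AE x in lborel. norm (f x * I n x) <= cmod (f x) * C" for n
   using Ile by (intro AE_I2) (simp add: norm_mult mult_left_mono)
  show "(\<lambda>x. f x * I n x) \<in> borel_measurable lborel" for n unfolding I_def by measurable
 qed measurable
 define J where "J = (\<lambda>n \<xi>. gs (e n) \<xi> * (cmod (fourier f \<xi>))^2)"
 have Ji: "integrable lborel (J n)" for n
 proof (rule Bochner_Integration.integrable_bound)
  show "integrable lborel (\<lambda>\<xi>. gs (e n) \<xi> * (LINT x|lborel. cmod (f x))^2)" using gs_integrable[OF e0] by simp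
  show "AE \<xi> in lborel. norm (J n \<xi>) <= norm (gs (e n) \<xi> * (LINT x|lborel. cmod (f x))^2)"
   using fourier_bound gs_bounds(1)[of "e n"]
   by (intro AE_I2) (auto simp: J_def abs_mult less_imp_le intro!: mult_left_mono power_mono)
  show "J n \<in> borel_measurable lborel" unfolding J_def gs_def by measurable
 qed
 have cplx: "complex_of_real (cmod w ^ 2) = w * cnj w" for w by (rule complex_norm_square)
 have Jc: "complex_of_real (LINT \<xi>|lborel. J n \<xi>) = (LINT x|lborel. f x * I n x)" for n
  unfolding integral_complex_of_real[symmetric] J_def of_real_mult cplx I_def
  by (rule plancherel_eps[OF e0])
 have "complex_of_real (LINT x|lborel. (cmod (f x))^2) = (LINT x|lborel. f x * cnj (f x))"
  unfolding integral_complex_of_real[symmetric] cplx ..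
 then have "(\<lambda>n. complex_of_real (LINT \<xi>|lborel. J n \<xi>)) \<longlonglongrightarrow> complex_of_real (LINT x|lborel. (cmod (f x))^2)"
  using lim1 by (simp add: Jc)
 then have lim: "(\<lambda>n. LINT \<xi>|lborel. J n \<xi>) \<longlonglongrightarrow> (LINT x|lborel. (cmod (f x))^2)"
  by (simp only: tendsto_of_real_iff)
 have mono: "AE \<xi> in lborel. mono (\<lambda>n. J n \<xi>)"
 proof (intro AE_I2 monoI)
  fix \<xi> :: real and m n :: nat assume "m <= n"
  then have "e n <= e m" by (simp add: e_def frac_le)
  then have "(e n * \<xi>)^2 <= (e m * \<xi>)^2"
   unfolding power_mult_distrib using e0[of n] by (intro mult_right_mono power_mono) (auto simp: less_imp_le)
  then show "J m \<xi> <= J n \<xi>" unfolding J_def gs_def by (intro mult_right_mono) auto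
 qed
 have pt: "AE \<xi> in lborel. (\<lambda>n. J n \<xi>) \<longlonglongrightarrow> (cmod (fourier f \<xi>))^2"
 proof (rule AE_I2)
  fix \<xi>
  have "(\<lambda>n. J n \<xi>) \<longlonglongrightarrow> exp (- (0 * \<xi>)\<^sup>2 / 2) * (cmod (fourier f \<xi>))^2"
   unfolding J_def gs_def by (intro tendsto_intros elim) auto
  then show "(\<lambda>n. J n \<xi>) \<longlonglongrightarrow> (cmod (fourier f \<xi>))^2" by simp
 qed
 have meas: "(\<lambda>\<xi>. (cmod (fourier f \<xi>))^2) \<in> borel_measurable lborel" by measurable
 show "integrable lborel (\<lambda>\<xi>. (cmod (fourier f \<xi>))^2)"
  by (rule integrable_monotone_convergence[OF Ji mono pt lim meas])
 show "(LINT \<xi>|lborel. (cmod (fourier f \<xi>))^2) = (LINT x|lborel. (cmod (f x))^2)"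
  by (rule integral_monotone_convergence[OF Ji mono pt lim meas])
qed

end

section \<open>The Fourier multiplier of the window averages\<close>

text \<open>\<open>Vint\<close> is the correlation of q with this kernel, hence \<open>khat\<close>,
  with the sign + in the exponent, is its multiplier.\<close>

definition kk :: "real => real => real => complex" where
 "kk \<kappa> l y = indicator {0..l} y *\<^sub>R of_real (exp (- (2 * \<kappa> * (l - y))))"

definition khat :: "real => real => real => complex" where
 "khat \<kappa> l \<xi> = (LINT y|lborel. kk \<kappa> l y * exp (\<i> * of_real (\<xi> * y)))"

lemma kk_integrable: "integrable lborel (kk \<kappa> l)"
proof -
 have "set_integrable lborel {0..l} (\<lambda>y. complex_of_real (exp (- (2 * \<kappa> * (l - y)))))"
  by (rule borel_integrable_atLeastAtMost') (intro continuous_intros)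
 then show ?thesis by (simp add: set_integrable_def kk_def[abs_def])
qed

lemma kk_norm: assumes "0 <= \<kappa>" shows "cmod (kk \<kappa> l y) <= indicator {0..l} y"
 using assms by (auto simp: kk_def indicator_def)

lemma khat_le_length:
 assumes "0 <= \<kappa>" "0 <= l" shows "cmod (khat \<kappa> l \<xi>) <= l"
proof -
 have "cmod (khat \<kappa> l \<xi>) <= (LINT y|lborel. cmod (kk \<kappa> l y * exp (\<i> * of_real (\<xi> * y))))"
  unfolding khat_def by (rule integral_norm_bound)
 also have "\<dots> = (LINT y|lborel. cmod (kk \<kappa> l y))" by (simp add: norm_mult norm_exp_eq_Re)
 also have "\<dots> <= (LINT y|lborel. indicator {0..l} y)"
  using kk_norm[OF assms(1)] kk_integrable assms by (intro integral_mono) (auto intro!: integrable_norm)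
 also have "\<dots> = l" using assms by simp
 finally show ?thesis .
qed

text \<open>The integral is explicit with denominator 2 \<kappa> + i \<xi>, and \<kappa> >= 1 bounds
  its modulus below by the square root of 4 + \<open>\<xi>\<^sup>2\<close>, matching the Sobolev
  weight.\<close>

lemma khat_le_inverse:
 assumes "1 <= \<kappa>" "0 <= l" shows "(cmod (khat \<kappa> l \<xi>))^2 <= 4 / (4 + \<xi>^2)"
proof -
 define w where "w = Complex (2 * \<kappa>) \<xi>"
 have w0: "w \<noteq> 0" using assms by (auto simp: w_def complex_eq_iff)
 define F where "F = (\<lambda>y::real. exp (w * of_real y - of_real (2 * \<kappa> * l)) / w)"
 have F: "(F hvd exp (w * of_real y - of_real (2 * \<kappa> * l))) (at y)" for y
 proof -
  have "((\<lambda>z. exp (w * z - of_real (2 * \<kappa> * l)) / w) has_field_derivative exp (w * of_real y - of_real (2 * \<kappa> * l))) (at (complex_of_real y))"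
   using w0 by (auto intro!: derivative_eq_intros)
  from field_vector_diff_chain_at[OF hvd_of_real[OF DERIV_ident] this]
  show ?thesis by (simp add: F_def o_def)
 qed
 have eq: "kk \<kappa> l y * exp (\<i> * of_real (\<xi> * y)) = indicator {0..l} y *\<^sub>R exp (w * of_real y - of_real (2 * \<kappa> * l))" for y
 proof -
  have "w = of_real (2 * \<kappa>) + \<i> * of_real \<xi>" by (simp add: w_def complex_eq_iff)
  then have "exp (w * of_real y - of_real (2 * \<kappa> * l)) = of_real (exp (- (2 * \<kappa> * (l - y)))) * exp (\<i> * of_real (\<xi> * y))"
   by (simp add: exp_of_real[symmetric] algebra_simps flip: exp_add)
  then show ?thesis by (simp add: kk_def)
 qed
 have hi: "((\<lambda>y. exp (w * of_real y - of_real (2 * \<kappa> * l))) has_integral (F l - F 0)) {0..l}"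
  using assms F by (intro fundamental_theorem_of_calculus) (auto intro: hvd_at_within)
 have si: "set_integrable lborel {0..l} (\<lambda>y. exp (w * of_real y - of_real (2 * \<kappa> * l)))"
  by (rule borel_integrable_atLeastAtMost') (intro continuous_intros)
 have "khat \<kappa> l \<xi> = F l - F 0"
  unfolding khat_def eq using set_borel_integral_eq_integral(2)[OF si] integral_unique[OF hi]
  by (simp add: set_lebesgue_integral_def)
 also have "\<dots> = (exp (w * of_real l - of_real (2 * \<kappa> * l)) - exp (- of_real (2 * \<kappa> * l))) / w"
  by (simp add: F_def diff_divide_distrib)
 finally have k: "khat \<kappa> l \<xi> = (exp (w * of_real l - of_real (2 * \<kappa> * l)) - exp (- of_real (2 * \<kappa> * l))) / w" .
 have "cmod (exp (w * of_real l - of_real (2 * \<kappa> * l)) - exp (- of_real (2 * \<kappa> * l))) <= 1 + 1"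
  using assms by (intro cmod_diff_le) (auto simp: norm_exp_eq_Re w_def)
 then have "cmod (khat \<kappa> l \<xi>) <= 2 / cmod w" unfolding k norm_divide by (intro divide_right_mono) auto
 then have "(cmod (khat \<kappa> l \<xi>))^2 <= (2 / cmod w)^2" by (intro power_mono) auto
 also have "\<dots> = 4 / (4 * \<kappa>^2 + \<xi>^2)" by (simp add: w_def power_divide cmod_power2 power_mult_distrib)
 also have "\<dots> <= 4 / (4 + \<xi>^2)"
 proof (rule divide_left_mono)
  have "1 <= \<kappa>^2" using assms by (simp add: one_le_power)
  then show "4 + \<xi>^2 <= 4 * \<kappa>^2 + \<xi>^2" by simp
  then show "0 < (4 * \<kappa>^2 + \<xi>^2) * (4 + \<xi>^2)"
   by (intro mult_pos_pos) (smt (verit) zero_le_power2)+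
 qed simp
 finally show ?thesis .
qed

text \<open>Interpolation between the bounds \<open>l\<^sup>2\<close> and 4 / (4 +
  \<open>\<xi>\<^sup>2\<close>) for the squared modulus A, written as \<open>A powr (1 + s)\<close>
  times \<open>A powr (- s)\<close>. The 2 is a bound for \<open>4 powr (- s)\<close>.\<close>

lemma khat_bound:
 assumes "1 <= \<kappa>" "0 < l" and s: "- 1 / 2 < s" "s < 0"
 shows "(cmod (khat \<kappa> l \<xi>))^2 <= 2 * l powr (2 + 2 * s) * (4 + \<xi>^2) powr s"
proof (cases "khat \<kappa> l \<xi> = 0")
 case False
 define A where "A = (cmod (khat \<kappa> l \<xi>))^2"
 have A: "0 < A" using False by (simp add: A_def)
 have p: "0 < 4 + \<xi>^2" by (smt (verit) zero_le_power2)
 have A1: "A <= l^2" unfolding A_def using khat_le_length[of \<kappa> l \<xi>] assms by (intro power_mono) auto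
 have A2: "A <= 4 / (4 + \<xi>^2)" unfolding A_def using khat_le_inverse[of \<kappa> l \<xi>] assms by auto
 have "A = A powr (1 + s) * A powr (- s)" using A by (simp flip: powr_add)
 also have "\<dots> <= (l^2) powr (1 + s) * (4 / (4 + \<xi>^2)) powr (- s)"
  using A A1 A2 s by (intro mult_mono powr_mono2) auto
 also have "(l^2) powr (1 + s) = l powr (2 + 2 * s)"
 proof -
  have "(l^2) powr (1 + s) = (l powr 2) powr (1 + s)" using assms by (simp add: powr_numeral)
  also have "\<dots> = l powr (2 * (1 + s))" by (rule powr_powr)
  finally show ?thesis by (simp add: distrib_left)
 qed
 also have "(4 / (4 + \<xi>^2)) powr (- s) = 4 powr (- s) * (4 + \<xi>^2) powr s"
  using p by (simp add: powr_divide powr_minus field_simps)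
 also have "l powr (2 + 2 * s) * (4 powr (- s) * (4 + \<xi>^2) powr s) <= l powr (2 + 2 * s) * (2 * (4 + \<xi>^2) powr s)"
 proof (intro mult_left_mono mult_right_mono)
  have "4 powr (- s) <= 4 powr (1/2)" using s by (intro powr_mono) auto
  then show "4 powr (- s) <= (2::real)" by (simp add: powr_half_sqrt)
 qed auto
 finally show ?thesis unfolding A_def by (simp only: mult_ac)
qed simp

lemma Vint_conv:
 assumes q: "pot M q" and l: "0 <= l"
 shows "Vint \<kappa> q l x = (LINT y|lborel. kk \<kappa> l y * q (x + y))"
proof -
 define h where "h = (\<lambda>y. of_real (exp (- (2 * \<kappa> * (x + l - y)))) * q y)"
 have si: "set_integrable lborel {x..x + l} h"
  unfolding h_def by (rule borel_integrable_atLeastAtMost') (intro continuous_intros pot_cont[OF q])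
 have "Vint \<kappa> q l x = (LINT y|lborel. indicator {x..x + l} y *\<^sub>R h y)"
  unfolding Vint_def h_def[symmetric] using set_borel_integral_eq_integral(2)[OF si]
  by (simp add: set_lebesgue_integral_def)
 also have "\<dots> = (LINT y|lborel. indicator {x..x + l} (x + y) *\<^sub>R h (x + y))"
  using lborel_integral_real_affine[of 1 "\<lambda>y. indicator {x..x + l} y *\<^sub>R h y" x] by simp
 also have "\<dots> = (LINT y|lborel. kk \<kappa> l y * q (x + y))"
  by (intro Bochner_Integration.integral_cong refl) (auto simp: h_def kk_def indicator_def)
 finally show ?thesis .
qed

lemma Vint_l1cont:
 assumes q: "pot M q" and k: "0 <= \<kappa>" and l: "0 <= l" "l <= 1"
 shows "l1cont (Vint \<kappa> q l) (3 * M)"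
proof
 have "continuous_on UNIV (\<lambda>y. of_real (exp (2 * \<kappa> * y)) * q y)"
  by (intro continuous_intros pot_cont[OF q])
 from antideriv_exists[OF this]
 obtain U where U: "\<And>y. (U hvd of_real (exp (2 * \<kappa> * y)) * q y) (at y)" by auto
 have Uc: "continuous_on S U" for S by (rule deriv_cont[OF U])
 have "Vint \<kappa> q l = (\<lambda>x. of_real (exp (- (2 * \<kappa> * (x + l)))) * (U (x + l) - U x))"
  using Vint_eq[OF U l(1)] by auto
 then show "continuous_on UNIV (Vint \<kappa> q l)"
  by (auto intro!: continuous_intros Uc continuous_on_compose2[OF Uc[of UNIV]])
 fix x
 have b: "cmod (of_real (exp (- (2 * \<kappa> * (x + l - y)))) * q y) <= 3 * M * wt x" if "y \<in> {x..x + l}" for y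
 proof -
  have "cmod (of_real (exp (- (2 * \<kappa> * (x + l - y)))) * q y) <= 1 * (M * wt y)"
   by (intro cmod_mult_le pot_bound[OF q]) (use that k in auto)
  also have "\<dots> <= M * (3 * wt x)" using that l pot_nonneg[OF q] by (simp add: mult_left_mono wt_near)
  finally show ?thesis by simp
 qed
 have "cmod (Vint \<kappa> q l x) <= 3 * M * wt x * ((x + l) - x)"
  unfolding Vint_def
  by (rule integral_bound) (use l b in \<open>auto intro!: continuous_intros pot_cont[OF q]\<close>)
 also have "\<dots> <= 3 * M * wt x" using l pot_nonneg[OF q] wt_pos[of x] by (simp add: mult_left_le)
 finally show "cmod (Vint \<kappa> q l x) <= 3 * M * wt x" .
qed

lemma fourier_Vint:
 assumes q: "pot M q" and k: "0 <= \<kappa>" and l: "0 <= l"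
 shows "fourier (Vint \<kappa> q l) \<xi> = khat \<kappa> l \<xi> * fourier q \<xi>"
proof -
 interpret l1cont q M by unfold_locales (use q in \<open>auto simp: pot_def\<close>)
 define E where "E = (\<lambda>u :: real. exp (\<i> * complex_of_real u))"
 have E1: "cmod (E u) = 1" for u by (simp add: E_def norm_exp_eq_Re)
 have Eadd: "E (u + v) = E u * E v" for u v by (simp add: E_def ring_distribs exp_add)
 have [measurable]: "E \<in> borel_measurable borel" unfolding E_def by measurable
 have sh: "(LINT x|lborel. f (x + y)) = (LINT x|lborel. f x)" for f :: "real => complex" and y
  using lborel_integral_real_affine[of 1 f y] by (simp add: add.commute)
 have shi: "integrable lborel (\<lambda>x. q (x + y))" for y
  using lborel_integrable_real_affine[OF f_int, of 1 y] by (simp add: add.commute)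
 have "(LINT x|lborel. exp (- (\<i> * of_real (\<xi> * x))) * Vint \<kappa> q l x)
   = (LINT x|lborel. LINT y|lborel. kk \<kappa> l y * (q (x + y) * E (- (\<xi> * x))))"
 proof (intro Bochner_Integration.integral_cong refl)
  fix x
  have "(LINT y|lborel. kk \<kappa> l y * (q (x + y) * E (- (\<xi> * x)))) = (LINT y|lborel. E (- (\<xi> * x)) * (kk \<kappa> l y * q (x + y)))"
   by (simp only: mult_ac)
  also have "\<dots> = E (- (\<xi> * x)) * (LINT y|lborel. kk \<kappa> l y * q (x + y))" by (rule integral_mult_right_zero)
  finally show "exp (- (\<i> * of_real (\<xi> * x))) * Vint \<kappa> q l x = (LINT y|lborel. kk \<kappa> l y * (q (x + y) * E (- (\<xi> * x))))"
   by (simp add: Vint_conv[OF q l] E_def)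
 qed
 also have "\<dots> = (LINT y|lborel. kk \<kappa> l y * (LINT x|lborel. q (x + y) * E (- (\<xi> * x))))"
 proof (rule fubini_general(2)[OF kk_integrable])
  show "(\<lambda>(y, x). q (x + y) * E (- (\<xi> * x))) \<in> borel_measurable (lborel \<Otimes>\<^sub>M lborel)" by measurable
  show "integrable lborel (\<lambda>x. q (x + y) * E (- (\<xi> * x)))" for y
   by (rule Bochner_Integration.integrable_bound[OF shi[of y]]) (auto simp: norm_mult E1)
  show "(LINT x|lborel. cmod (q (x + y) * E (- (\<xi> * x)))) <= (LINT x|lborel. cmod (q x))" for y
   using integral_shift[of "\<lambda>x. cmod (q x)" y] by (simp add: norm_mult E1)
 qed
 also have "\<dots> = (LINT y|lborel. kk \<kappa> l y * E (\<xi> * y) * (LINT x|lborel. q x * E (- (\<xi> * x))))"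
 proof (intro Bochner_Integration.integral_cong refl)
  fix y
  have "(LINT x|lborel. q (x + y) * E (- (\<xi> * x))) = (LINT x|lborel. E (\<xi> * y) * (q (x + y) * E (- (\<xi> * (x + y)))))"
   using Eadd[of "\<xi> * y"] by (intro Bochner_Integration.integral_cong refl) (simp add: ring_distribs mult_ac flip: Eadd)
  also have "\<dots> = E (\<xi> * y) * (LINT x|lborel. q x * E (- (\<xi> * x)))"
   using sh[of "\<lambda>x. q x * E (- (\<xi> * x))" y] by simp
  finally show "kk \<kappa> l y * (LINT x|lborel. q (x + y) * E (- (\<xi> * x))) = kk \<kappa> l y * E (\<xi> * y) * (LINT x|lborel. q x * E (- (\<xi> * x)))"
   by simp
 qed
 also have "\<dots> = khat \<kappa> l \<xi> * (LINT x|lborel. q x * E (- (\<xi> * x)))"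
  unfolding khat_def E_def by (rule integral_mult_left_zero)
 finally show ?thesis unfolding fourier_def E_def by (simp add: mult.commute[of "q _"])
qed

text \<open>The bridge from the H^s norm to the hypothesis of \<open>sewing\<close>: Plancherel
  combined with the multiplier bound, giving p = 2 + 2s.\<close>

lemma Vint_Hs:
 assumes q: "pot M q" and k: "1 <= \<kappa>" and l: "0 < l" "l <= 1" and s: "- 1 / 2 < s" "s < 0"
 shows "(LINT x|lborel. (cmod (Vint \<kappa> q l x))^2) <= 2 * (Hs_norm s q)^2 * l powr (2 + 2 * s)"
proof -
 interpret Q: l1cont q M by unfold_locales (use q in \<open>auto simp: pot_def\<close>)
 interpret V: l1cont "Vint \<kappa> q l" "3 * M" by (rule Vint_l1cont[OF q]) (use k l in auto)
 have le1: "(4 + \<xi>^2) powr s <= 1" for \<xi> :: real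
  using s zero_le_power2[of \<xi>] powr_mono2'[of s 1 "4 + \<xi>^2"] by (smt (verit) powr_one_eq_one)
 have i: "integrable lborel (\<lambda>\<xi>. (4 + \<xi>^2) powr s * (cmod (fourier q \<xi>))^2)"
  by (rule Bochner_Integration.integrable_bound[OF Q.plancherel(1)])
   (use le1 in \<open>auto simp: abs_mult intro!: mult_left_le_one_le\<close>)
 have "(LINT x|lborel. (cmod (Vint \<kappa> q l x))^2) = (LINT \<xi>|lborel. (cmod (fourier (Vint \<kappa> q l) \<xi>))^2)"
  using V.plancherel(2) by simp
 also have "\<dots> <= (LINT \<xi>|lborel. (2 * l powr (2 + 2 * s)) * ((4 + \<xi>^2) powr s * (cmod (fourier q \<xi>))^2))"
 proof (rule integral_mono[OF V.plancherel(1)])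
  show "integrable lborel (\<lambda>\<xi>. (2 * l powr (2 + 2 * s)) * ((4 + \<xi>^2) powr s * (cmod (fourier q \<xi>))^2))"
   using i by (rule integrable_mult_right)
  fix \<xi>
  have "(cmod (fourier (Vint \<kappa> q l) \<xi>))^2 = (cmod (khat \<kappa> l \<xi>))^2 * (cmod (fourier q \<xi>))^2"
   using fourier_Vint[OF q, of \<kappa> l \<xi>] k l by (simp add: norm_mult power_mult_distrib)
  also have "\<dots> <= (2 * l powr (2 + 2 * s) * (4 + \<xi>^2) powr s) * (cmod (fourier q \<xi>))^2"
   by (intro mult_right_mono khat_bound k l s) auto
  finally show "(cmod (fourier (Vint \<kappa> q l) \<xi>))^2 <= (2 * l powr (2 + 2 * s)) * ((4 + \<xi>^2) powr s * (cmod (fourier q \<xi>))^2)"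
   by (simp only: mult.assoc)
 qed
 also have "\<dots> = 2 * l powr (2 + 2 * s) * (LINT \<xi>|lborel. (4 + \<xi>^2) powr s * (cmod (fourier q \<xi>))^2)" by simp
 also have "(LINT \<xi>|lborel. (4 + \<xi>^2) powr s * (cmod (fourier q \<xi>))^2) = (Hs_norm s q)^2"
  unfolding Hs_norm_def by (subst real_sqrt_pow2) (auto intro!: integral_nonneg_AE)
 finally show ?thesis by (simp add: mult_ac)
qed

section \<open>Gaussian test functions and representatives of Sobolev functions\<close>

lemma FTC_left_set:
 fixes F :: "real => complex"
 assumes F: "\<And>x. (F hvd F' x) (at x)" and c: "continuous_on UNIV F'"
  and si: "set_integrable lborel {..y} F'" and lim: "(F \<longlongrightarrow> 0) at_bot"
 shows "(LINT x|lborel. indicat_real {..y} x *\<^sub>R F' x) = F y"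
proof -
 have "((\<lambda>a. set_lebesgue_integral lborel {a..y} F') \<longlongrightarrow> set_lebesgue_integral lborel {..y} F') at_bot"
  by (rule tendsto_set_lebesgue_integral_at_bot[OF _ si]) auto
 moreover have "\<forall>\<^sub>F a in at_bot. set_lebesgue_integral lborel {a..y} F' = F y - F a"
 proof (rule eventually_mono[OF eventually_le_at_bot[of y]])
  fix a assume "a <= y"
  have "(F' has_integral (F y - F a)) {a..y}"
   using \<open>a <= y\<close> F by (intro fundamental_theorem_of_calculus) (auto intro: hvd_at_within)
  moreover have "set_integrable lborel {a..y} F'"
   by (rule borel_integrable_atLeastAtMost') (rule continuous_on_subset[OF c], simp)
  ultimately show "set_lebesgue_integral lborel {a..y} F' = F y - F a"
   by (metis integral_unique set_borel_integral_eq_integral(2))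
 qed
 ultimately have "((\<lambda>a. F y - F a) \<longlongrightarrow> set_lebesgue_integral lborel {..y} F') at_bot"
  using tendsto_cong by force
 moreover have "((\<lambda>a. F y - F a) \<longlongrightarrow> F y - 0) at_bot" by (intro tendsto_intros lim)
 ultimately show ?thesis
  using tendsto_unique[OF trivial_limit_at_bot_linorder] by (fastforce simp: set_lebesgue_integral_def)
qed

lemma FTC_left:
 fixes F :: "real => complex"
 assumes "\<And>x. (F hvd F' x) (at x)" "continuous_on UNIV F'"
  and i: "integrable lborel F'" and "(F \<longlongrightarrow> 0) at_bot"
 shows "(LINT x|lborel. indicat_real {..y} x *\<^sub>R F' x) = F y"
 by (rule FTC_left_set[OF assms(1,2) _ assms(4)])
  (use i in \<open>unfold set_integrable_def, intro integrable_mult_indicator, auto\<close>)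

lemma FTC_right:
 fixes F :: "real => complex"
 assumes F: "\<And>x. (F hvd F' x) (at x)" and c: "continuous_on UNIV F'"
  and i: "integrable lborel F'" and lim: "(F \<longlongrightarrow> 0) at_top"
 shows "(LINT x|lborel. indicat_real {y..} x *\<^sub>R F' x) = - F y"
proof -
 have "(LINT x|lborel. indicat_real {..-y} x *\<^sub>R F' (- x)) = - F (- (- y))"
 proof (rule FTC_left[where F = "\<lambda>x. - F (- x)"])
  show "((\<lambda>x. - F (- x)) hvd F' (- x)) (at x)" for x
   using hvd_minus[OF hvd_reflect[OF F]] by simp
  show "continuous_on UNIV (\<lambda>x. F' (- x))"
   by (intro continuous_intros continuous_on_compose2[OF c]) auto
  show "integrable lborel (\<lambda>x. F' (- x))"
   using lborel_integrable_real_affine[OF i, of "- 1" 0] by simp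
  show "((\<lambda>x. - F (- x)) \<longlongrightarrow> 0) at_bot"
   using tendsto_minus[OF lim] by (simp add: filterlim_at_bot_mirror)
 qed
 moreover have "(LINT x|lborel. indicat_real {y..} x *\<^sub>R F' x) = (LINT x|lborel. indicat_real {y..} (- x) *\<^sub>R F' (- x))"
  using lborel_integral_real_affine[of "- 1" "\<lambda>x. indicat_real {y..} x *\<^sub>R F' x" 0] by simp
 moreover have "indicat_real {y..} (- x) = indicat_real {..-y} x" for x by (auto simp: indicator_def)
 ultimately show ?thesis by simp
qed

lemma L2_meas: "f \<in> L2 ==> f \<in> borel_measurable borel" by (simp add: L2_def)
lemma L2_int: "f \<in> L2 ==> integrable lborel (\<lambda>x. (norm (f x))^2)" by (simp add: L2_def)

lemma am_gm: "x * y <= (x^2 + y^2) / 2" for x y :: real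
 using zero_le_power2[of "x - y"] by (simp add: power2_eq_square algebra_simps)

lemma L2_mult_integrable:
 fixes f g :: "real => complex"
 assumes "f \<in> L2" "g \<in> L2" shows "integrable lborel (\<lambda>x. f x * g x)"
proof (rule Bochner_Integration.integrable_bound)
 show "integrable lborel (\<lambda>x. ((cmod (f x))^2 + (cmod (g x))^2) / 2)"
  using L2_int[OF assms(1)] L2_int[OF assms(2)] by simp
 show "(\<lambda>x. f x * g x) \<in> borel_measurable lborel"
  using L2_meas[OF assms(1)] L2_meas[OF assms(2)] by simp
 show "AE x in lborel. norm (f x * g x) <= norm (((cmod (f x))^2 + (cmod (g x))^2) / 2)"
  using am_gm by (intro AE_I2) (simp add: norm_mult)
qed

lemma L2_wt:
 assumes "continuous_on UNIV f" "\<And>x. cmod (f x) <= C * wt x" shows "f \<in> L2"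
proof -
 have "integrable lborel (\<lambda>x. (cmod (f x))^2)"
 proof (rule integrable_wt_bound[where C = "C^2"])
  fix x
  have "(cmod (f x))^2 <= (C * wt x)^2" using assms(2) by (intro power_mono) auto
  also have "\<dots> = C^2 * (wt x * wt x)" by (simp add: power2_eq_square)
  also have "\<dots> <= C^2 * (1 * wt x)" using wt_pos[of x] wt_le_1[of x] by (intro mult_left_mono mult_right_mono) auto
  finally show "norm ((cmod (f x))^2) <= C^2 * wt x" by simp
 qed (intro continuous_intros assms(1))
 then show ?thesis using borel_measurable_continuous_onI[OF assms(1)] by (simp add: L2_def)
qed

text \<open>From (1 + t/k)^k <= exp t with t = y^2 / 2.\<close>

lemma std_power_bound: "\<exists>B. \<forall>y. \<bar>y\<bar> ^ k * nd y <= B"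
proof (cases "k = 0")
 case True
 have "nd y <= 1" for y
 proof -
  have "nd y = exp (- y\<^sup>2 / 2) / sqrt (2 * pi)" by (simp add: std_normal_density_def)
  also have "\<dots> <= 1 / 1" using pi_gt3 by (intro frac_le) auto
  finally show ?thesis by simp
 qed
 then show ?thesis using True by auto
next
 case False
 then have k: "1 <= real k" by simp
 have "\<bar>y\<bar> ^ k * nd y <= (2 * real k) ^ k" for y
 proof -
  have "\<bar>y\<bar> <= 1 + y^2"
   using zero_le_power2[of "\<bar>y\<bar> - 1"] zero_le_power2[of y] by (simp add: power2_eq_square algebra_simps)
  also have "\<dots> <= (2 * real k) * (1 + (y^2 / 2) / real k)"
  proof -
   have "(2 * real k) * (1 + (y^2 / 2) / real k) = 2 * real k + y^2" using k by (simp add: distrib_left)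
   then show ?thesis using k by simp
  qed
  finally have "\<bar>y\<bar> ^ k <= ((2 * real k) * (1 + (y^2 / 2) / real k)) ^ k" by (intro power_mono) auto
  also have "\<dots> = (2 * real k) ^ k * (1 + (y^2 / 2) / real k) ^ k" by (rule power_mult_distrib)
  also have "\<dots> <= (2 * real k) ^ k * exp (y^2 / 2)"
  proof -
   have "- real k <= y^2 / 2" by (rule order_trans[of _ 0]) auto
   then have "(1 + (y^2 / 2) / real k) ^ k <= exp (y^2 / 2)"
    using False by (intro exp_ge_one_plus_x_over_n_power_n) auto
   then show ?thesis by (intro mult_left_mono) auto
  qed
  finally have 1: "\<bar>y\<bar> ^ k <= (2 * real k) ^ k * exp (y^2 / 2)" .
  have "nd y = exp (- (y^2 / 2)) / sqrt (2 * pi)" by (simp add: std_normal_density_def)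
  also have "\<dots> <= exp (- (y^2 / 2)) / 1" using pi_gt3 by (intro divide_left_mono) auto
  finally have 2: "nd y <= exp (- (y^2 / 2))" by simp
  have "\<bar>y\<bar> ^ k * nd y <= ((2 * real k) ^ k * exp (y^2 / 2)) * exp (- (y^2 / 2))"
   using 1 2 by (intro mult_mono) (auto simp: normal_density_nonneg)
  then show ?thesis by (simp add: mult.assoc flip: exp_add)
 qed
 then show ?thesis by blast
qed

lemma std_poly_bound: "\<exists>B. \<forall>y. \<bar>poly p y\<bar> * nd y <= B"
proof -
 have "\<forall>k. \<exists>B. \<forall>y. \<bar>y\<bar> ^ k * \<bar>poly p y\<bar> * nd y <= B"
 proof (induction p)
  case (pCons a p)
  show ?case
  proof
   fix k
   obtain B1 where B1: "\<And>y. \<bar>y\<bar> ^ k * nd y <= B1" using std_power_bound by blast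
   obtain B2 where B2: "\<And>y. \<bar>y\<bar> ^ Suc k * \<bar>poly p y\<bar> * nd y <= B2" using pCons.IH by blast
   have "\<bar>y\<bar> ^ k * \<bar>poly (pCons a p) y\<bar> * nd y <= \<bar>a\<bar> * B1 + B2" for y
   proof -
    have "\<bar>poly (pCons a p) y\<bar> <= \<bar>a\<bar> + \<bar>y\<bar> * \<bar>poly p y\<bar>"
     by (simp flip: abs_mult)
    then have "\<bar>y\<bar> ^ k * \<bar>poly (pCons a p) y\<bar> * nd y <= \<bar>y\<bar> ^ k * (\<bar>a\<bar> + \<bar>y\<bar> * \<bar>poly p y\<bar>) * nd y"
     by (intro mult_right_mono mult_left_mono) (auto simp: normal_density_nonneg)
    also have "\<dots> = \<bar>a\<bar> * (\<bar>y\<bar> ^ k * nd y) + \<bar>y\<bar> ^ Suc k * \<bar>poly p y\<bar> * nd y"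
     by (simp add: algebra_simps)
    also have "\<dots> <= \<bar>a\<bar> * B1 + B2" using B1[of y] B2[of y] by (intro add_mono mult_left_mono) auto
    finally show ?thesis .
   qed
   then show "\<exists>B. \<forall>y. \<bar>y\<bar> ^ k * \<bar>poly (pCons a p) y\<bar> * nd y <= B" by blast
  qed
 qed auto
 from spec[OF this, of 0] show ?thesis by simp
qed

section \<open>Gaussian test functions\<close>

text \<open>Polynomials times a Gaussian of width e centred at z. The family is closed under
  differentiation, which makes the Schwartz property provable by one bound for all orders.\<close>

definition gp :: "real poly => real => real => real => complex" where
 "gp p e z x = of_real (poly p x * nd ((x - z) / e))"

lemma std_deriv: "(nd has_real_derivative - y * nd y) (at y)"
proof -
 have "((\<lambda>y. c * exp (- y\<^sup>2 / 2)) has_real_derivative - y * (c * exp (- y\<^sup>2 / 2))) (at y)" for c :: real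
  by (auto intro!: derivative_eq_intros)
 then show ?thesis unfolding std_normal_density_def[abs_def] .
qed

lemma gp_deriv:
 assumes "e \<noteq> 0"
 shows "(gp p e z hvd gp (pderiv p - smult (1 / e^2) ([:- z, 1:] * p)) e z x) (at x)"
proof -
 have 1: "((\<lambda>x. nd ((x - z) / e)) has_real_derivative (- ((x - z) / e) * nd ((x - z) / e)) * (1 / e)) (at x)"
  by (rule DERIV_chain2[OF std_deriv]) (use assms in \<open>auto intro!: derivative_eq_intros\<close>)
 have "((\<lambda>x. poly p x * nd ((x - z) / e)) has_real_derivative
   poly (pderiv p - smult (1 / e^2) ([:- z, 1:] * p)) x * nd ((x - z) / e)) (at x)"
  by (rule DERIV_cong[OF DERIV_mult[OF poly_DERIV 1]]) (use assms in \<open>simp add: field_simps power2_eq_square\<close>)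
 then show ?thesis unfolding gp_def[abs_def] by (rule hvd_of_real)
qed

lemma gp_bound: assumes "e \<noteq> 0" shows "\<exists>B. \<forall>x. cmod (gp p e z x) <= B"
proof -
 obtain B where B: "\<And>y. \<bar>poly (pcompose p [:z, e:]) y\<bar> * nd y <= B" using std_poly_bound by blast
 have "cmod (gp p e z x) <= B" for x
  using B[of "(x - z) / e"] assms by (simp add: gp_def poly_pcompose norm_mult abs_mult normal_density_nonneg)
 then show ?thesis by blast
qed

lemma Dx_gp: "e \<noteq> 0 ==> Dx (gp p e z) = gp (pderiv p - smult (1 / e^2) ([:- z, 1:] * p)) e z"
 unfolding Dx_def using gp_deriv by (auto intro!: ext vector_derivative_at)

lemma schwartz_gp: assumes "e \<noteq> 0" shows "schwartz (gp p e z)"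
proof -
 have it: "\<exists>p'. (Dx ^^ n) (gp p e z) = gp p' e z" for n
  by (induction n) (auto simp: Dx_gp[OF assms])
 show ?thesis unfolding schwartz_def
 proof (intro allI conjI)
  fix n
  obtain p' where p': "(Dx ^^ n) (gp p e z) = gp p' e z" using it by blast
  show "(Dx ^^ n) (gp p e z) differentiable at x" for x
   unfolding p' using gp_deriv[OF assms] by (rule differentiableI_vector)
  fix m
  obtain B where B: "\<And>x. cmod (gp (monom 1 m * p') e z x) <= B" using gp_bound[OF assms] by blast
  have "x ^ m *\<^sub>R gp p' e z x = gp (monom 1 m * p') e z x" for x
   by (simp add: gp_def poly_monom scaleR_conv_of_real mult_ac)
  then show "bounded (range (\<lambda>x. x ^ m *\<^sub>R (Dx ^^ n) (gp p e z) x))"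
   unfolding p' bounded_iff using B by auto
 qed
qed

lemma gp_cont: "e \<noteq> 0 ==> continuous_on S (gp p e z)"
 by (rule deriv_cont[OF gp_deriv])

lemma wt_shift: "wt (x - z) <= 2 * (1 + z^2) * wt x"
proof -
 have "2 * (1 + z^2) * (1 + (x - z)^2) = 1 + x^2 + (1 + (x - 2 * z)^2 + 2 * (z * (x - z))^2)"
  by (simp add: power2_eq_square algebra_simps)
 then have "1 + x^2 <= 2 * (1 + z^2) * (1 + (x - z)^2)" by simp
 then show ?thesis unfolding wt_def using wt_denom_pos[of x] wt_denom_pos[of "x - z"] by (simp add: field_simps)
qed

text \<open>The dependence on the centre z is explicit so that the bound is uniform for z in a
  bounded interval, over which Gaussians are going to be averaged.\<close>

lemma std_poly_wt:
 assumes "e \<noteq> 0"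
 shows "\<exists>B\<ge>0. \<forall>z x. \<bar>poly p (x - z)\<bar> * nd ((x - z) / e) <= B * (1 + z^2)^2 * (wt x)^2"
proof -
 obtain B where B: "\<And>u. cmod (gp ([:1, 0, 1:]^2 * p) e 0 u) <= B" using gp_bound[OF assms] by blast
 have B0: "0 <= B" using B[of 0] norm_ge_zero order_trans by blast
 have "\<bar>poly p (x - z)\<bar> * nd ((x - z) / e) <= (4 * B) * (1 + z^2)^2 * (wt x)^2" for x z
 proof -
  define u where "u = x - z"
  have "(1 + u^2)^2 * (\<bar>poly p u\<bar> * nd (u / e)) <= B"
  proof -
   have P: "poly ([:1, 0, 1:]^2 * p) u = (1 + u^2)^2 * poly p u"
    by (simp add: poly_power power2_eq_square algebra_simps)
   have "cmod (gp ([:1, 0, 1:]^2 * p) e 0 u) = (1 + u^2)^2 * (\<bar>poly p u\<bar> * nd (u / e))"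
    by (simp only: gp_def P norm_of_real abs_mult) (simp add: normal_density_nonneg)
   then show ?thesis using B[of u] by simp
  qed
  then have "\<bar>poly p u\<bar> * nd (u / e) <= B * (wt u)^2"
   using wt_denom_pos[of u] by (simp add: wt_def power_divide field_simps)
  also have "\<dots> <= B * (2 * (1 + z^2) * wt x)^2"
   using wt_shift[of x z] wt_pos[of u] B0 by (intro mult_left_mono power_mono) (auto simp: u_def less_imp_le)
  also have "\<dots> = (4 * B) * (1 + z^2)^2 * (wt x)^2" unfolding power_mult_distrib by simp
  finally show ?thesis by (simp add: u_def)
 qed
 then show ?thesis using B0 by (intro exI[of _ "4 * B"]) auto
qed

lemma gp_wt: assumes "e \<noteq> 0" shows "\<exists>B\<ge>0. \<forall>x. cmod (gp p e z x) <= B * (wt x)^2"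
proof -
 obtain B where B: "B \<ge> 0" "\<And>z' x. \<bar>poly (pcompose p [:z, 1:]) (x - z')\<bar> * nd ((x - z') / e) <= B * (1 + z'^2)^2 * (wt x)^2"
  using std_poly_wt[OF assms, of "pcompose p [:z, 1:]"] by blast
 show ?thesis
  using B(2)[of _ z] B(1)
  by (intro exI[of _ "B * (1 + z^2)^2"]) (auto simp: gp_def poly_pcompose norm_mult abs_mult normal_density_nonneg)
qed

lemma gp_wt1: assumes "e \<noteq> 0" shows "\<exists>B\<ge>0. \<forall>x. cmod (gp p e z x) <= B * wt x"
proof -
 obtain B where B: "B \<ge> 0" "\<And>x. cmod (gp p e z x) <= B * (wt x)^2" using gp_wt[OF assms] by blast
 have "B * (wt x)^2 <= B * wt x" for x
  using B(1) wt_pos[of x] wt_le_1[of x] by (intro mult_left_mono) (auto simp: power2_eq_square)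
 then show ?thesis using B by (meson order_trans)
qed

section \<open>Primitives of square integrable functions\<close>

text \<open>The signed indicator of the interval between 0 and x, so that a single Lebesgue integral
  gives the primitive vanishing at 0 for both signs of x.\<close>

definition seg :: "real => real => real" where
 "seg x y = (if 0 < y \<and> y <= x then 1 else if x < y \<and> y <= 0 then - 1 else 0)"

lemma seg_abs: "\<bar>seg x y\<bar> <= indicator {-\<bar>x\<bar>..\<bar>x\<bar>} y"
 by (auto simp: seg_def indicator_def)

lemma seg_meas [measurable]: "(\<lambda>(x, y). seg x y) \<in> borel_measurable (borel \<Otimes>\<^sub>M borel)"
 unfolding seg_def by measurable

lemma seg_meas' [measurable]: "seg x \<in> borel_measurable borel"
 unfolding seg_def by measurable

lemma seg_L2_bound:
 fixes v :: "real => complex"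
 assumes v: "v \<in> L2"
 shows "integrable lborel (\<lambda>y. seg x y *\<^sub>R v y)"
  and "(LINT y|lborel. cmod (seg x y *\<^sub>R v y)) <= \<bar>x\<bar> + (LINT y|lborel. (cmod (v y))^2)"
proof -
 have [measurable]: "v \<in> borel_measurable borel" by (rule L2_meas[OF v])
 have i: "integrable lborel (\<lambda>y. (indicator {-\<bar>x\<bar>..\<bar>x\<bar>} y + (cmod (v y))^2) / 2)"
  using L2_int[OF v] by auto
 have le: "cmod (seg x y *\<^sub>R v y) <= (indicator {-\<bar>x\<bar>..\<bar>x\<bar>} y + (cmod (v y))^2) / 2" for y
 proof -
  have "\<bar>seg x y\<bar> * cmod (v y) <= indicator {-\<bar>x\<bar>..\<bar>x\<bar>} y * cmod (v y)" by (intro mult_right_mono seg_abs) auto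
  also have "\<dots> <= ((indicator {-\<bar>x\<bar>..\<bar>x\<bar>} y)^2 + (cmod (v y))^2) / 2" by (rule am_gm)
  finally show ?thesis by (auto simp: indicator_def)
 qed
 show ii: "integrable lborel (\<lambda>y. seg x y *\<^sub>R v y)"
  by (rule Bochner_Integration.integrable_bound[OF i]) (use le in \<open>auto intro: order_trans\<close>)
 have "(LINT y|lborel. cmod (seg x y *\<^sub>R v y)) <= (LINT y|lborel. (indicator {-\<bar>x\<bar>..\<bar>x\<bar>} y + (cmod (v y))^2) / 2)"
  by (intro integral_mono integrable_norm[OF ii] i le)
 also have "\<dots> = (2 * \<bar>x\<bar> + (LINT y|lborel. (cmod (v y))^2)) / 2" using L2_int[OF v] by simp
 also have "\<dots> <= \<bar>x\<bar> + (LINT y|lborel. (cmod (v y))^2)"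
  using integral_nonneg_AE[of "\<lambda>y. (cmod (v y))^2" lborel] by simp
 finally show "(LINT y|lborel. cmod (seg x y *\<^sub>R v y)) <= \<bar>x\<bar> + (LINT y|lborel. (cmod (v y))^2)" .
qed

definition prim :: "(real => complex) => real => complex" where
 "prim v x = (LINT y|lborel. seg x y *\<^sub>R v y)"

lemma prim_bound: "v \<in> L2 ==> cmod (prim v x) <= \<bar>x\<bar> + (LINT y|lborel. (cmod (v y))^2)"
 unfolding prim_def by (rule order_trans[OF integral_norm_bound seg_L2_bound(2)])

lemma abs_wt: "\<bar>x\<bar> * wt x <= 1"
proof -
 have "\<bar>x\<bar> <= 1 + x^2"
  using zero_le_power2[of "\<bar>x\<bar> - 1"] zero_le_power2[of x] by (simp add: power2_eq_square algebra_simps)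
 then show ?thesis using wt_denom_pos[of x] by (simp add: wt_def divide_le_eq)
qed

lemma prim_meas [measurable]: assumes "v \<in> L2" shows "prim v \<in> borel_measurable borel"
proof -
 have [measurable]: "v \<in> borel_measurable borel" by (rule L2_meas[OF assms])
 show ?thesis unfolding prim_def[abs_def] by measurable
qed

lemma prim_wt_bound:
 assumes "v \<in> L2" shows "cmod (prim v x) * (wt x)^2 <= (1 + (LINT y|lborel. (cmod (v y))^2)) * wt x"
proof -
 define D where "D = (LINT y|lborel. (cmod (v y))^2)"
 have D: "0 <= D" unfolding D_def by (rule integral_nonneg_AE) simp
 have "cmod (prim v x) * (wt x)^2 <= (\<bar>x\<bar> + D) * (wt x)^2"
  using prim_bound[OF assms] by (intro mult_right_mono) (auto simp: D_def)
 also have "\<dots> = (\<bar>x\<bar> * wt x + D * wt x) * wt x" by (simp add: power2_eq_square algebra_simps)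
 also have "\<dots> <= (1 + D * 1) * wt x"
  using abs_wt[of x] wt_le_1[of x] wt_pos[of x] D by (intro mult_right_mono add_mono mult_left_mono) auto
 finally show ?thesis by (simp add: D_def)
qed

lemma gp_at_infinity:
 assumes "e \<noteq> 0" shows "(gp p e z \<longlongrightarrow> 0) at_infinity"
proof -
 obtain B where B: "\<And>x. cmod (gp p e z x) <= B * wt x" using gp_wt1[OF assms] by blast
 show ?thesis
 proof (rule tendsto_norm_zero_cancel, rule tendsto_sandwich[OF _ _ tendsto_const])
  show "\<forall>\<^sub>F x in at_infinity. norm (gp p e z x) <= B * wt x" using B by simp
  have "((\<lambda>x. B * wt x) \<longlongrightarrow> B * 0) at_infinity"
  proof (intro tendsto_intros)
   show "(wt \<longlongrightarrow> 0) at_infinity"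
    unfolding wt_def at_infinity_eq_at_top_bot by (intro filterlim_sup) real_asymp+
  qed
  then show "((\<lambda>x. B * wt x) \<longlongrightarrow> 0) at_infinity" by simp
 qed simp
qed

text \<open>A primitive may grow linearly. Shifting one factor \<open>wt\<close> from the Gaussian
  to the primitive makes the former integrable and the latter bounded, as Fubini demands.\<close>

lemma prim_weak:
 assumes v: "v \<in> L2" and e: "e \<noteq> 0"
 shows "integrable lborel (\<lambda>x. prim v x * Dx (gp p e z) x)"
  and "(LINT x|lborel. prim v x * Dx (gp p e z) x) = - (LINT x|lborel. v x * gp p e z x)"
proof -
 have [measurable]: "v \<in> borel_measurable borel" by (rule L2_meas[OF v])
 define p' where "p' = pderiv p - smult (1 / e^2) ([:- z, 1:] * p)"
 have D: "Dx (gp p e z) = gp p' e z" unfolding p'_def by (rule Dx_gp[OF e])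
 obtain B where B: "B \<ge> 0" "\<And>x. cmod (gp p' e z x) <= B * (wt x)^2" using gp_wt[OF e] by blast
 obtain B' where B': "B' \<ge> 0" "\<And>x. cmod (gp p' e z x) <= B' * wt x" using gp_wt1[OF e] by blast
 have c: "continuous_on UNIV (gp p' e z)" by (rule gp_cont[OF e])
 have [measurable]: "gp p' e z \<in> borel_measurable borel" by (rule borel_measurable_continuous_onI[OF c])
 define f where "f = (\<lambda>x. gp p' e z x / of_real (wt x))"
 have fi: "integrable lborel f"
 proof (rule integrable_wt_bound[where C = B])
  show "continuous_on UNIV f"
   unfolding f_def using wt_pos by (intro continuous_intros c continuous_on_wt) (auto simp: less_le)
  show "norm (f x) <= B * wt x" for x
   using B(2)[of x] wt_pos[of x] by (simp add: f_def norm_divide divide_le_eq power2_eq_square mult_ac)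
 qed
 define h where "h = (\<lambda>x y. of_real (wt x) * (of_real (seg x y) * v y))"
 have h1: "integrable lborel (h x)" for x
  using seg_L2_bound(1)[OF v, of x] by (simp add: h_def scaleR_conv_of_real)
 have [measurable]: "wt \<in> borel_measurable borel" by (rule borel_measurable_continuous_onI[OF continuous_on_wt])
 have hm: "(\<lambda>(x, y). h x y) \<in> borel_measurable (lborel \<Otimes>\<^sub>M lborel)" unfolding h_def by measurable
 have hb: "(LINT y|lborel. cmod (h x y)) <= 1 + (LINT y|lborel. (cmod (v y))^2)" for x
 proof -
  have "(LINT y|lborel. cmod (h x y)) = wt x * (LINT y|lborel. cmod (seg x y *\<^sub>R v y))"
   using wt_pos[of x] by (simp add: h_def norm_mult abs_mult less_imp_le flip: integral_mult_right_zero)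
  also have "\<dots> <= wt x * (\<bar>x\<bar> + (LINT y|lborel. (cmod (v y))^2))"
   using wt_pos[of x] by (intro mult_left_mono seg_L2_bound v) auto
  also have "\<dots> = \<bar>x\<bar> * wt x + wt x * (LINT y|lborel. (cmod (v y))^2)" by (simp add: algebra_simps)
  also have "\<dots> <= 1 + 1 * (LINT y|lborel. (cmod (v y))^2)"
   using abs_wt[of x] wt_le_1[of x] by (intro add_mono mult_right_mono integral_nonneg_AE) auto
  finally show ?thesis by simp
 qed
 note F = fubini_general[OF fi hm h1 hb]
 have fh: "f x * h x y = gp p' e z x * (of_real (seg x y) * v y)" for x y
  using wt_pos[of x] by (simp add: f_def h_def)
 have inner: "f x * (LINT y|lborel. h x y) = prim v x * gp p' e z x" for x
  unfolding prim_def scaleR_conv_of_real h_def integral_mult_right_zero f_def using wt_pos[of x] by (simp add: less_le)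
 show "integrable lborel (\<lambda>x. prim v x * Dx (gp p e z) x)"
  unfolding D using lborel_pair.integrable_fst[OF F(1)] by (simp add: inner)
 have gl: "(LINT x|lborel. of_real (seg x y) * gp p' e z x) = - gp p e z y" for y
 proof -
  have i: "integrable lborel (gp p' e z)" by (rule integrable_wt_bound[OF c B'(2)])
  have d: "(gp p e z hvd gp p' e z x) (at x)" for x unfolding p'_def by (rule gp_deriv[OF e])
  show ?thesis
  proof (cases "0 < y")
   case True
   have "(LINT x|lborel. of_real (seg x y) * gp p' e z x) = (LINT x|lborel. indicat_real {y..} x *\<^sub>R gp p' e z x)"
    using True by (intro Bochner_Integration.integral_cong refl) (auto simp: seg_def indicator_def)
   also have "\<dots> = - gp p e z y"
    by (rule FTC_right[OF d c i]) (rule tendsto_mono[OF at_top_le_at_infinity gp_at_infinity[OF e]])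
   finally show ?thesis .
  next
   case False
   \<comment> \<open>\<open>seg\<close> leaves out the point x = y that the closed half line
     contains, so equality holds only almost everywhere.\<close>
   have "(LINT x|lborel. of_real (seg x y) * gp p' e z x) = (LINT x|lborel. - (indicat_real {..y} x *\<^sub>R gp p' e z x))"
    by (rule integral_cong_AE)
     (use False AE_lborel_singleton[of y] in \<open>auto simp: seg_def indicator_def elim!: eventually_mono\<close>)
   also have "\<dots> = - gp p e z y"
    using FTC_left[OF d c i tendsto_mono[OF at_bot_le_at_infinity gp_at_infinity[OF e]]] by simp
   finally show ?thesis .
  qed
 qed
 have "(LINT x|lborel. prim v x * Dx (gp p e z) x) = (LINT y|lborel. LINT x|lborel. f x * h x y)"
  unfolding D using F(2) by (simp add: inner)
 also have "\<dots> = (LINT y|lborel. v y * (LINT x|lborel. of_real (seg x y) * gp p' e z x))"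
  unfolding fh integral_mult_right_zero[symmetric]
  by (intro Bochner_Integration.integral_cong refl) (simp only: mult_ac)
 also have "\<dots> = - (LINT x|lborel. v x * gp p e z x)" unfolding gl by simp
 finally show "(LINT x|lborel. prim v x * Dx (gp p e z) x) = - (LINT x|lborel. v x * gp p e z x)" .
qed

section \<open>Functions with vanishing weak derivative\<close>

text \<open>The setting of the du Bois-Reymond lemma, tested with Gaussians only. The weight
  \<open>wt\<^sup>2\<close> in the integrability makes room for primitives of linear growth.\<close>

locale weak_const =
 fixes g :: "real => complex"
 assumes gm [measurable]: "g \<in> borel_measurable borel"
  and gi: "integrable lborel (\<lambda>x. g x * of_real ((wt x)^2))"
  and g0: "\<And>e z. 0 < e ==> (LINT x|lborel. g x * Dx (gp 1 e z) x) = 0"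
begin

lemma wt_meas [measurable]: "wt \<in> borel_measurable borel"
 by (rule borel_measurable_continuous_onI[OF continuous_on_wt])

lemma avg_fubini:
 fixes a b :: real and h :: "real => real => complex"
 assumes "0 < e"
  and h[measurable]: "(\<lambda>(x, z). h x z) \<in> borel_measurable (borel \<Otimes>\<^sub>M borel)"
  and hb: "\<And>x z. a <= z ==> z <= b ==> cmod (h x z) <= B * (wt x)^2" and B: "0 <= B" and ab: "a <= b"
 shows "(LINT z|lborel. LINT x|lborel. g x * (indicat_real {a..b} z *\<^sub>R h x z)) = (LINT x|lborel. g x * (LINT z|lborel. indicat_real {a..b} z *\<^sub>R h x z))"
proof -
 define k where "k = (\<lambda>x z. (indicat_real {a..b} z *\<^sub>R h x z) / of_real ((wt x)^2))"
 have sets_eq: "sets (lborel \<Otimes>\<^sub>M lborel) = sets (borel \<Otimes>\<^sub>M (borel :: real measure) :: (real \<times> real) measure)"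
  by (rule sets_pair_measure_cong) auto
 have [measurable]: "indicat_real {a..b} \<in> borel_measurable borel" by (rule borel_measurable_indicator) simp
 have km: "(\<lambda>(x, z). k x z) \<in> borel_measurable (lborel \<Otimes>\<^sub>M lborel)"
  unfolding measurable_cong_sets[OF sets_eq refl] k_def by measurable
 have kb: "cmod (k x z) <= B * indicator {a..b} z" for x z
  using hb[of z x] wt_pos[of x] B by (auto simp: k_def indicator_def norm_divide divide_le_eq norm_power)
 have kxm: "k x \<in> borel_measurable lborel" for x
  using measurable_compose[OF measurable_Pair1' km, of x] by simp
 have Bi: "integrable lborel (\<lambda>z. B * indicat_real {a..b} z)"
  by (intro integrable_mult_right integrable_real_indicator) (auto simp: emeasure_lborel_Icc_eq)
 have ki: "integrable lborel (k x)" for x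
 proof (rule Bochner_Integration.integrable_bound[OF _ kxm])
  show "integrable lborel (\<lambda>z. B * indicat_real {a..b} z)" by (rule Bi)
  show "AE z in lborel. norm (k x z) <= norm (B * indicat_real {a..b} z)"
   using kb B by (intro AE_I2) (simp add: abs_mult)
 qed
 have kn: "(LINT z|lborel. cmod (k x z)) <= B * (b - a)" for x
 proof -
  have "(LINT z|lborel. cmod (k x z)) <= (LINT z|lborel. B * indicator {a..b} z)"
   by (intro integral_mono integrable_norm[OF ki] Bi kb)
  then show ?thesis using ab by simp
 qed
 have w: "complex_of_real ((wt x)^2) \<noteq> 0" for x using wt_pos[of x] by simp
 have cancel: "u * w * (y / w) = u * y" if "w \<noteq> 0" for u w y :: complex using that by simp
 have eq: "g x * of_real ((wt x)^2) * k x z = g x * (indicat_real {a..b} z *\<^sub>R h x z)" for x z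
  unfolding k_def by (rule cancel[OF w])
 have eq2: "g x * of_real ((wt x)^2) * (LINT z|lborel. k x z) = g x * (LINT z|lborel. indicat_real {a..b} z *\<^sub>R h x z)" for x
  unfolding k_def integral_divide_zero by (rule cancel[OF w])
 show ?thesis using fubini_general(2)[OF gi km ki kn] unfolding eq eq2 .
qed

definition c :: "real => real => complex" where
 "c e z = (LINT x|lborel. g x * of_real (nd ((x - z) / e)))"

lemma gauss_integrable: assumes "0 < e" shows "integrable lborel (\<lambda>x. g x * of_real (nd ((x - z) / e)))"
proof -
 have e: "e \<noteq> 0" using assms by simp
 obtain B where B: "\<And>x. cmod (gp 1 e z x) <= B * (wt x)^2" "B \<ge> 0" using gp_wt[OF e] by blast
 show ?thesis
 proof (rule Bochner_Integration.integrable_bound)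
  show "integrable lborel (\<lambda>x. of_real B * (g x * of_real ((wt x)^2)))" using gi by (rule integrable_mult_right)
  show "AE x in lborel. norm (g x * of_real (nd ((x - z) / e))) <= norm (of_real B * (g x * of_real ((wt x)^2)))"
  proof (rule AE_I2)
   fix x
   have "cmod (g x) * cmod (gp 1 e z x) <= cmod (g x) * (B * (wt x)^2)" by (intro mult_left_mono B) auto
   then show "norm (g x * of_real (nd ((x - z) / e))) <= norm (of_real B * (g x * of_real ((wt x)^2)))"
    using B(2) by (simp add: gp_def norm_mult mult_ac norm_power)
  qed
 qed measurable
qed

text \<open>The derivative of a Gaussian in its centre is minus the derivative in x. The centre is
  integrated from a to b and Fubini applied, in place of differentiating under the integral.\<close>

lemma c_le: assumes e: "0 < e" and ab: "a <= b" shows "c e a = c e b"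
proof -
 define k where "k = (\<lambda>u. complex_of_real (u / e^2 * nd (u / e)))"
 have kd: "((\<lambda>z. complex_of_real (nd ((x - z) / e))) hvd k (x - z)) (at z)" for x z
 proof -
  have "((\<lambda>z. nd ((x - z) / e)) has_real_derivative (- ((x - z) / e) * nd ((x - z) / e)) * (- 1 / e)) (at z)"
   by (rule DERIV_chain2[OF std_deriv]) (use e in \<open>auto intro!: derivative_eq_intros\<close>)
  from hvd_of_real[OF this] show ?thesis
   by (rule hvd_eq_rhs) (simp add: k_def power2_eq_square)
 qed
 have kc: "continuous_on UNIV k"
  unfolding k_def std_normal_density_def by (intro continuous_intros) (use e in auto)
 obtain B where B: "B \<ge> 0" "\<And>z x. \<bar>poly [:0, 1 / e^2:] (x - z)\<bar> * nd ((x - z) / e) <= B * (1 + z^2)^2 * (wt x)^2"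
  using std_poly_wt[of e "[:0, 1 / e^2:]"] e by blast
 define C where "C = B * (1 + (\<bar>a\<bar> + \<bar>b\<bar>)^2)^2"
 have kb: "cmod (k (x - z)) <= C * (wt x)^2" if "a <= z" "z <= b" for x z
 proof -
  have "cmod (k (x - z)) <= B * (1 + z^2)^2 * (wt x)^2"
   using B(2)[of x z] unfolding k_def norm_of_real by (simp add: abs_mult normal_density_nonneg)
  also have "\<dots> <= B * (1 + (\<bar>a\<bar> + \<bar>b\<bar>)^2)^2 * (wt x)^2"
  proof -
   have "z^2 <= (\<bar>a\<bar> + \<bar>b\<bar>)^2" using that by (intro power2_le_iff_abs_le[THEN iffD2]) auto
   then show ?thesis using B(1) by (intro mult_right_mono mult_left_mono power_mono) auto
  qed
  finally show ?thesis by (simp add: C_def)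
 qed
 have [measurable]: "k \<in> borel_measurable borel" by (rule borel_measurable_continuous_onI[OF kc])
 have in1: "(LINT x|lborel. g x * k (x - z)) = 0" for z
 proof -
  have "Dx (gp 1 e z) x = - k (x - z)" for x
   using e by (simp add: Dx_gp gp_def k_def field_simps)
  then show ?thesis using g0[OF e, of z] by simp
 qed
 have in2: "(LINT z|lborel. indicat_real {a..b} z *\<^sub>R k (x - z)) = of_real (nd ((x - b) / e)) - of_real (nd ((x - a) / e))" for x
 proof -
  have "set_integrable lborel {a..b} (\<lambda>z. k (x - z))"
   by (intro borel_integrable_atLeastAtMost' continuous_on_compose2[OF kc]) (auto intro!: continuous_intros)
  from set_borel_integral_eq_integral(2)[OF this] show ?thesis
   using integral_unique[OF fundamental_theorem_of_calculus[OF ab, of "\<lambda>z. of_real (nd ((x - z) / e))" "\<lambda>z. k (x - z)"]]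
    kd[THEN hvd_at_within] by (simp add: set_lebesgue_integral_def)
 qed
 have A1: "(LINT z|lborel. LINT x|lborel. g x * (indicat_real {a..b} z *\<^sub>R k (x - z))) = (LINT x|lborel. g x * (LINT z|lborel. indicat_real {a..b} z *\<^sub>R k (x - z)))"
  by (rule avg_fubini[OF e _ kb]) (use ab B in \<open>auto simp: C_def\<close>)
 have A2: "(LINT x|lborel. g x * (indicat_real {a..b} z *\<^sub>R k (x - z))) = 0" for z
  using in1[of z] by (simp add: mult_scaleR_right)
 have "0 = (LINT x|lborel. g x * (of_real (nd ((x - b) / e)) - of_real (nd ((x - a) / e))))"
  using A1 unfolding A2 in2 by simp
 also have "\<dots> = c e b - c e a"
  unfolding c_def right_diff_distrib using gauss_integrable[OF e] by (rule Bochner_Integration.integral_diff) (rule gauss_integrable[OF e])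
 finally show ?thesis by (simp only: eq_iff_diff_eq_0[of "c e b", symmetric] eq_commute[of 0])
qed

lemma c_const: "0 < e ==> c e a = c e b"
 using c_le[of e a b] c_le[of e b a] linear[of a b] by metis

definition J :: "real => real => real => real => real" where
 "J a b e x = (LINT y|lborel. indicat_real {a..b} (x - e * y) * nd y)"

text \<open>The constant Gaussian average is integrated over centres in [a, b]. The factor c e 0 / e
  is common to all intervals, so the smoothed integrals of g are proportional to length.\<close>

lemma int_J: assumes e: "0 < e" and ab: "a <= b"
 shows "(LINT x|lborel. g x * of_real (J a b e x)) = of_real ((b - a) / e) * c e 0"
proof -
 have e0: "e \<noteq> 0" using e by simp
 obtain B where B: "B \<ge> 0" "\<And>z x. \<bar>poly 1 (x - z)\<bar> * nd ((x - z) / e) <= B * (1 + z^2)^2 * (wt x)^2"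
  using std_poly_wt[OF e0, of 1] by blast
 define C where "C = B * (1 + (\<bar>a\<bar> + \<bar>b\<bar>)^2)^2"
 have kb: "cmod (of_real (nd ((x - z) / e))) <= C * (wt x)^2" if "a <= z" "z <= b" for x z
 proof -
  have "nd ((x - z) / e) <= B * (1 + z^2)^2 * (wt x)^2"
   using B(2)[of x z] by simp
  also have "\<dots> <= B * (1 + (\<bar>a\<bar> + \<bar>b\<bar>)^2)^2 * (wt x)^2"
  proof -
   have "z^2 <= (\<bar>a\<bar> + \<bar>b\<bar>)^2" using that by (intro power2_le_iff_abs_le[THEN iffD2]) auto
   then show ?thesis using B(1) by (intro mult_right_mono mult_left_mono power_mono) auto
  qed
  finally show ?thesis by (simp add: C_def normal_density_nonneg)
 qed
 have A1: "(LINT z|lborel. LINT x|lborel. g x * (indicat_real {a..b} z *\<^sub>R of_real (nd ((x - z) / e))))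
   = (LINT x|lborel. g x * (LINT z|lborel. indicat_real {a..b} z *\<^sub>R of_real (nd ((x - z) / e))))"
  by (rule avg_fubini[OF e _ kb]) (use ab B in \<open>auto simp: C_def\<close>)
 have A2: "(LINT x|lborel. g x * (indicat_real {a..b} z *\<^sub>R of_real (nd ((x - z) / e)))) = indicat_real {a..b} z *\<^sub>R c e 0" for z
  unfolding c_const[OF e, of 0 z] by (simp add: mult_scaleR_right c_def)
 have A3: "(LINT z|lborel. indicat_real {a..b} z *\<^sub>R complex_of_real (nd ((x - z) / e))) = of_real (e * J a b e x)" for x
 proof -
  have "(LINT z|lborel. indicat_real {a..b} z * nd ((x - z) / e)) = e * J a b e x"
   using lborel_integral_real_affine[of "- e" "\<lambda>z. indicat_real {a..b} z * nd ((x - z) / e)" x] e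
   by (simp add: J_def)
  then show ?thesis
   unfolding scaleR_conv_of_real of_real_mult[symmetric] integral_complex_of_real by simp
 qed
 have "(LINT z|lborel. indicat_real {a..b} z *\<^sub>R c e 0) = (LINT x|lborel. g x * of_real (e * J a b e x))"
  using A1 unfolding A2 A3 .
 also have "\<dots> = (LINT x|lborel. of_real e * (g x * of_real (J a b e x)))" by (simp only: of_real_mult mult_ac)
 finally have "(LINT z|lborel. indicat_real {a..b} z *\<^sub>R c e 0) = of_real e * (LINT x|lborel. g x * of_real (J a b e x))"
  by simp
 then have "of_real (b - a) * c e 0 = of_real e * (LINT x|lborel. g x * of_real (J a b e x))"
  using ab by (simp add: scaleR_conv_of_real)
 then show ?thesis using e by (simp add: field_simps)
qed

text \<open>Domination uniform in the width: by \<open>wt_shift\<close> the weight lost in moving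
  from x to a point of [a, b] is paid by moments of the Gaussian up to order four.\<close>

lemma J_bound_uniform: "\<exists>C. \<forall>e x. 0 <= e --> e <= 1 --> \<bar>J a b e x\<bar> <= C * (wt x)^2"
proof -
 define A where "A = 2 * (1 + (\<bar>a\<bar> + \<bar>b\<bar>)^2)"
 have A0: "0 <= A" by (simp add: A_def)
 define m where "m = (\<lambda>y. (1 + y^2)^2 * nd y)"
 have mi: "integrable lborel m"
 proof -
  have "m = (\<lambda>y. nd y * y ^ 0 + 2 * (nd y * y ^ 2) + nd y * y ^ 4)"
   by (simp add: m_def fun_eq_iff power2_eq_square power4_eq_xxxx algebra_simps)
  then show ?thesis by (simp only:) (intro Bochner_Integration.integrable_add integrable_mult_right integrable_std_normal_moment)
 qed
 have "\<bar>J a b e x\<bar> <= (A^2 * (LINT y|lborel. m y)) * (wt x)^2" if e: "0 <= e" "e <= 1" for e x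
 proof -
  have pw: "indicat_real {a..b} (x - e * y) * nd y <= (A^2 * (wt x)^2) * m y" for y
  proof (cases "x - e * y \<in> {a..b}")
   case True
   define t where "t = x - e * y"
   have t2: "t^2 <= (\<bar>a\<bar> + \<bar>b\<bar>)^2" using True by (intro power2_le_iff_abs_le[THEN iffD2]) (auto simp: t_def)
   have "wt (e * y) = wt (- (e * y))" by simp
   also have "\<dots> = wt (t - x)" by (simp add: t_def)
   also have "\<dots> = wt (x - t)" using wt_minus[of "x - t"] by simp
   also have "\<dots> <= 2 * (1 + t^2) * wt x" by (rule wt_shift)
   also have "\<dots> <= A * wt x" using t2 wt_pos[of x] by (auto simp: A_def intro!: mult_right_mono)
   finally have 1: "wt (e * y) <= A * wt x" .
   have "e^2 * y^2 <= 1 * y^2" using e by (intro mult_right_mono) (auto simp: power_le_one)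
   then have "1 <= (1 + y^2) * wt (e * y)"
    using wt_denom_pos[of "e * y"] by (simp add: wt_def field_simps power_mult_distrib)
   also have "\<dots> <= (1 + y^2) * (A * wt x)" by (intro mult_left_mono 1) auto
   finally have "1^2 <= ((1 + y^2) * (A * wt x))^2" by (intro power_mono) auto
   then have "1 * nd y <= ((1 + y^2) * (A * wt x))^2 * nd y"
    by (intro mult_right_mono) (auto simp: normal_density_nonneg)
   also have "\<dots> = (A^2 * (wt x)^2) * m y" by (simp add: m_def power_mult_distrib)
   finally show ?thesis using True by simp
  qed (auto simp: m_def normal_density_nonneg)
  have i: "integrable lborel (\<lambda>y. indicat_real {a..b} (x - e * y) * nd y)"
   by (rule Bochner_Integration.integrable_bound[OF std_int(1)]) (auto simp: indicator_def normal_density_nonneg)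
  have "0 <= J a b e x" unfolding J_def by (intro integral_nonneg_AE AE_I2) (auto simp: normal_density_nonneg)
  moreover have "J a b e x <= (LINT y|lborel. (A^2 * (wt x)^2) * m y)"
   unfolding J_def by (intro integral_mono i pw integrable_mult_right mi)
  ultimately show ?thesis by (simp add: mult_ac)
 qed
 then show ?thesis by blast
qed

definition "es n = 1 / real (Suc n)"

lemma es: "0 < es n" "es n <= 1" "es \<longlonglongrightarrow> 0"
 unfolding es_def using LIMSEQ_Suc[OF lim_1_over_n] by auto

lemma J_lim: assumes x: "x \<noteq> a" "x \<noteq> b" shows "(\<lambda>n. J a b (es n) x) \<longlonglongrightarrow> indicat_real {a..b} x"
proof -
 have "(\<lambda>n. J a b (es n) x) \<longlonglongrightarrow> (LINT y|lborel. indicat_real {a..b} x * nd y)"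
  unfolding J_def
 proof (rule integral_dominated_convergence[where w = nd])
  show "AE y in lborel. (\<lambda>n. indicat_real {a..b} (x - es n * y) * nd y) \<longlonglongrightarrow> indicat_real {a..b} x * nd y"
  proof (rule AE_I2)
   fix y
   have l: "(\<lambda>n. x - es n * y) \<longlonglongrightarrow> x - 0 * y" by (intro tendsto_intros es(3))
   then have l: "(\<lambda>n. x - es n * y) \<longlonglongrightarrow> x" by simp
   have "\<forall>\<^sub>F n in sequentially. indicat_real {a..b} (x - es n * y) = indicat_real {a..b} x"
   proof (cases "a < x \<and> x < b")
    case True
    have "\<forall>\<^sub>F n in sequentially. a < x - es n * y" "\<forall>\<^sub>F n in sequentially. x - es n * y < b"
     using order_tendstoD[OF l] True by auto
    then show ?thesis by eventually_elim (use True in \<open>auto simp: indicator_def\<close>)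
   next
    case False
    then consider "x < a" | "b < x" using x by linarith
    then show ?thesis
    proof cases
     case 1
     from order_tendstoD(2)[OF l 1] show ?thesis by eventually_elim (use 1 in \<open>auto simp: indicator_def\<close>)
    next
     case 2
     from order_tendstoD(1)[OF l 2] show ?thesis by eventually_elim (use 2 in \<open>auto simp: indicator_def\<close>)
    qed
   qed
   then have "(\<lambda>n. indicat_real {a..b} (x - es n * y)) \<longlonglongrightarrow> indicat_real {a..b} x" by (rule tendsto_eventually)
   then show "(\<lambda>n. indicat_real {a..b} (x - es n * y) * nd y) \<longlonglongrightarrow> indicat_real {a..b} x * nd y"
    by (intro tendsto_intros)
  qed
 qed (auto simp: indicator_def normal_density_nonneg)
 then show ?thesis using std_int by simp
qed

lemma int_J_lim: assumes "a <= b"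
 shows "(\<lambda>n. LINT x|lborel. g x * of_real (J a b (es n) x)) \<longlonglongrightarrow> (LINT x|lborel. g x * of_real (indicat_real {a..b} x))"
proof -
 obtain C where C: "\<And>n x. \<bar>J a b (es n) x\<bar> <= C * (wt x)^2" using J_bound_uniform[of a b] es by (meson less_imp_le)
 show ?thesis
 proof (rule integral_dominated_convergence[where w = "\<lambda>x. C * cmod (g x * of_real ((wt x)^2))"])
  show "integrable lborel (\<lambda>x. C * cmod (g x * of_real ((wt x)^2)))" using gi by (intro integrable_mult_right integrable_norm)
  show "AE x in lborel. (\<lambda>n. g x * of_real (J a b (es n) x)) \<longlonglongrightarrow> g x * of_real (indicat_real {a..b} x)"
   using AE_lborel_singleton[of a] AE_lborel_singleton[of b]
   by eventually_elim (intro tendsto_intros tendsto_of_real J_lim)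
  show "AE x in lborel. norm (g x * of_real (J a b (es n) x)) <= C * cmod (g x * of_real ((wt x)^2))" for n
  proof (rule AE_I2)
   fix x
   have "cmod (g x) * \<bar>J a b (es n) x\<bar> <= cmod (g x) * (C * (wt x)^2)" by (intro mult_left_mono C) auto
   then show "norm (g x * of_real (J a b (es n) x)) <= C * cmod (g x * of_real ((wt x)^2))"
    by (simp add: norm_mult norm_power mult_ac)
  qed
  show "(\<lambda>x. g x * of_real (J a b (es n) x)) \<in> borel_measurable lborel" for n unfolding J_def by measurable
 qed measurable
qed

lemma interval_const: assumes ab: "a <= b"
 shows "(LINT x|lborel. g x * of_real (indicat_real {a..b} x)) = of_real (b - a) * (LINT x|lborel. g x * of_real (indicat_real {0..1} x))"
proof -
 have "(\<lambda>n. of_real (b - a) * (LINT x|lborel. g x * of_real (J 0 1 (es n) x))) \<longlonglongrightarrow> of_real (b - a) * (LINT x|lborel. g x * of_real (indicat_real {0..1} x))"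
  by (intro tendsto_intros int_J_lim) simp
 moreover have "of_real (b - a) * (LINT x|lborel. g x * of_real (J 0 1 (es n) x)) = (LINT x|lborel. g x * of_real (J a b (es n) x))" for n
  using int_J[OF es(1) ab, of n] int_J[OF es(1), of 0 1 n] by simp
 ultimately show ?thesis using int_J_lim[OF ab] LIMSEQ_unique by simp
qed

lemma local_integrable: "set_integrable lborel {-N..N} g"
 unfolding set_integrable_def
proof (rule Bochner_Integration.integrable_bound)
 show "integrable lborel (\<lambda>x. of_real ((1 + N^2)^2) * (g x * of_real ((wt x)^2)))" using gi by (rule integrable_mult_right)
 show "AE x in lborel. norm (indicat_real {-N..N} x *\<^sub>R g x) <= norm (of_real ((1 + N^2)^2) * (g x * of_real ((wt x)^2)))"
 proof (rule AE_I2)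
  fix x
  have "cmod (g x) <= (1 + N^2)^2 * (cmod (g x) * (wt x)^2)" if "x \<in> {-N..N}"
  proof -
   have "x^2 <= N^2" using that by (intro power2_le_iff_abs_le[THEN iffD2]) auto
   then have "1 <= (1 + N^2) * wt x" using wt_denom_pos[of x] by (simp add: wt_def field_simps)
   then have "1^2 <= ((1 + N^2) * wt x)^2" by (intro power_mono) auto
   from mult_left_mono[OF this, of "cmod (g x)"] show ?thesis by (simp add: power_mult_distrib mult_ac)
  qed
  then show "norm (indicat_real {-N..N} x *\<^sub>R g x) <= norm (of_real ((1 + N^2)^2) * (g x * of_real ((wt x)^2)))"
   by (auto simp: indicator_def norm_mult norm_power simp del: of_real_add of_real_power)
 qed
qed measurable

text \<open>On a bounded window g and the constant have equal integrals over all intervals. These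
  form a generating pi-system, so the difference integrates to 0 over every Borel set.\<close>

lemma ae_const: "\<exists>C. AE x in lborel. g x = C"
proof -
 define C where "C = (LINT x|lborel. g x * of_real (indicat_real {0..1} x))"
 have "AE x in lborel. x \<in> {- real N..real N} --> g x = C" for N :: nat
 proof -
  define P where "P = (\<lambda>x. indicat_real {- real N..real N} x *\<^sub>R (g x - C))"
  have Pi: "integrable lborel P"
  proof -
   have "set_integrable lborel {- real N..real N} (\<lambda>x. C)" by (rule borel_integrable_atLeastAtMost') (intro continuous_intros)
   from set_integral_diff(1)[OF local_integrable this] show ?thesis by (simp add: set_integrable_def P_def)
  qed
  have PI: "set_integrable lborel A P" if "A \<in> sets borel" for A
   using integrable_mult_indicator[OF _ Pi, of A] that by (simp add: set_integrable_def)
  have basic: "set_lebesgue_integral lborel {a..b} P = 0" for a b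
  proof -
   define l u where "l = max a (- real N)" and "u = min b (real N)"
   have "indicat_real {a..b} x *\<^sub>R P x = indicat_real {l..u} x *\<^sub>R (g x - C)" for x
    by (auto simp: P_def indicator_def l_def u_def)
   then have eq: "set_lebesgue_integral lborel {a..b} P = set_lebesgue_integral lborel {l..u} (\<lambda>x. g x - C)"
    by (simp add: set_lebesgue_integral_def)
   show ?thesis
   proof (cases "l <= u")
    case True
    have 1: "set_integrable lborel {l..u} g"
     by (rule set_integrable_subset[OF local_integrable[of "real N"]]) (auto simp: l_def u_def)
    have 2: "set_integrable lborel {l..u} (\<lambda>x. C)" by (rule borel_integrable_atLeastAtMost') (intro continuous_intros)
    have "set_lebesgue_integral lborel {l..u} g = of_real (u - l) * C"
     using interval_const[OF True] by (simp add: set_lebesgue_integral_def scaleR_conv_of_real C_def mult_ac)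
    moreover have "set_lebesgue_integral lborel {l..u} (\<lambda>x. C) = of_real (u - l) * C"
     using True by (simp add: set_lebesgue_integral_def scaleR_conv_of_real)
    ultimately show ?thesis unfolding eq using set_integral_diff(2)[OF 1 2] by simp
   next
    case False
    then have "{l..u} = {}" by simp
    then show ?thesis unfolding eq by (simp add: set_lebesgue_integral_def)
   qed
  qed
  define G where "G = range (\<lambda>(a, b). {a..b :: real})"
  have Gb: "sigma_sets UNIV G = sets borel" by (simp add: borel_eq_atLeastAtMost G_def)
  have total: "(LINT x|lborel. P x) = 0"
  proof -
   have "indicat_real {- real N..real N} x *\<^sub>R P x = P x" for x by (simp add: P_def indicator_def)
   then show ?thesis using basic[of "- real N" "real N"] by (simp add: set_lebesgue_integral_def)
  qed
  have "set_lebesgue_integral lborel A P = 0" if "A \<in> sigma_sets UNIV G" for A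
  proof -
   have "Int_stable G" by (auto simp: Int_stable_def G_def)
   moreover have "G \<subseteq> Pow UNIV" by simp
   ultimately show ?thesis using that
   proof (induction rule: sigma_sets_induct_disjoint)
    case (basic A) then show ?case using \<open>\<And>a b. set_lebesgue_integral lborel {a..b} P = 0\<close> by (auto simp: G_def)
   next
    case (compl A)
    have A: "A \<in> sets borel" using compl Gb by simp
    have "(LINT x|lborel. indicat_real (UNIV - A) x *\<^sub>R P x) = (LINT x|lborel. P x - indicat_real A x *\<^sub>R P x)"
     by (intro Bochner_Integration.integral_cong refl) (simp add: indicator_def)
    also have "\<dots> = 0"
     using compl total Pi PI[OF A] by (simp add: set_integrable_def set_lebesgue_integral_def)
    finally show ?case by (simp add: set_lebesgue_integral_def)
   next
    case (union A)
    have A: "A i \<in> sets lborel" for i using union Gb by auto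
    have "(LINT x:(\<Union>i. A i)|lborel. P x) = (\<Sum>i. (LINT x:(A i)|lborel. P x))"
     by (rule lebesgue_integral_countable_add[OF A _ PI]) (use union A in \<open>auto simp: disjoint_family_on_def\<close>)
    then show ?case using union by simp
   qed (auto simp: set_lebesgue_integral_def)
  qed
  then have "AE x in lborel. P x = 0" by (intro sigma_finite_measure.density_zero[OF sigma_finite_lborel Pi]) (simp add: Gb)
  then show ?thesis by eventually_elim (auto simp: P_def indicator_def split: if_splits)
 qed
 then have "AE x in lborel. \<forall>N::nat. x \<in> {- real N..real N} --> g x = C"
  by (subst AE_all_countable) blast
 then have "AE x in lborel. g x = C"
 proof eventually_elim
  case (elim x)
  obtain N :: nat where "\<bar>x\<bar> <= real N" using real_arch_simple by blast
  then show ?case using elim by (auto simp: abs_le_iff)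
 qed
 then show ?thesis by blast
qed

end

text \<open>u - prim v has vanishing weak derivative. This converts the distributional domain of the
  Lax operator into pointwise information.\<close>

lemma H1_representative:
 assumes "H1_deriv u v" shows "\<exists>C. AE x in lborel. u x = C + prim v x"
proof -
 have u: "u \<in> L2" and v: "v \<in> L2"
  and weak: "\<And>\<phi>. schwartz \<phi> ==> (LINT x|lborel. u x * Dx \<phi> x) = - (LINT x|lborel. v x * \<phi> x)"
  using assms by (auto simp: H1_deriv_def)
 have [measurable]: "u \<in> borel_measurable borel" "prim v \<in> borel_measurable borel"
  using L2_meas[OF u] prim_meas[OF v] by auto
 have [measurable]: "wt \<in> borel_measurable borel" by (rule borel_measurable_continuous_onI[OF continuous_on_wt])
 have wt2: "(\<lambda>x. complex_of_real ((wt x)^2)) \<in> L2"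
 proof (rule L2_wt[where C = 1])
  show "continuous_on UNIV (\<lambda>x. complex_of_real ((wt x)^2))" by (intro continuous_intros continuous_on_wt)
  show "cmod (of_real ((wt x)^2)) <= 1 * wt x" for x
   using wt_pos[of x] wt_le_1[of x] unfolding norm_of_real by (simp add: power2_eq_square mult_left_le)
 qed
 have pw: "integrable lborel (\<lambda>x. prim v x * of_real ((wt x)^2))"
 proof (rule Bochner_Integration.integrable_bound)
  show "integrable lborel (\<lambda>x. (1 + (LINT y|lborel. (cmod (v y))^2)) * wt x)" by (intro integrable_mult_right wt_integrable)
  show "AE x in lborel. norm (prim v x * of_real ((wt x)^2)) <= norm ((1 + (LINT y|lborel. (cmod (v y))^2)) * wt x)"
  proof (rule AE_I2)
   fix x
   have "norm (prim v x * of_real ((wt x)^2)) <= (1 + (LINT y|lborel. (cmod (v y))^2)) * wt x"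
    using prim_wt_bound[OF v, of x] by (simp add: norm_mult norm_power)
   also have "\<dots> <= norm ((1 + (LINT y|lborel. (cmod (v y))^2)) * wt x)" unfolding real_norm_def by (rule abs_ge_self)
   finally show "norm (prim v x * of_real ((wt x)^2)) <= norm ((1 + (LINT y|lborel. (cmod (v y))^2)) * wt x)" .
  qed
 qed measurable
 interpret weak_const "\<lambda>x. u x - prim v x"
 proof
  show "integrable lborel (\<lambda>x. (u x - prim v x) * of_real ((wt x)^2))"
   unfolding left_diff_distrib by (intro Bochner_Integration.integrable_diff L2_mult_integrable u wt2 pw)
  fix e z :: real assume "0 < e"
  then have e: "e \<noteq> 0" by simp
  have "Dx (gp 1 e z) \<in> L2"
  proof -
   obtain B where "\<And>x. cmod (Dx (gp 1 e z) x) <= B * wt x" unfolding Dx_gp[OF e] using gp_wt1[OF e] by blast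
   then show ?thesis by (rule L2_wt[rotated]) (simp add: Dx_gp[OF e] gp_cont[OF e])
  qed
  then have "(LINT x|lborel. u x * Dx (gp 1 e z) x - prim v x * Dx (gp 1 e z) x)
   = (LINT x|lborel. u x * Dx (gp 1 e z) x) - (LINT x|lborel. prim v x * Dx (gp 1 e z) x)"
   by (intro Bochner_Integration.integral_diff L2_mult_integrable u prim_weak v e)
  then show "(LINT x|lborel. (u x - prim v x) * Dx (gp 1 e z) x) = 0"
   using weak[OF schwartz_gp[OF e]] prim_weak(2)[OF v e] by (simp add: left_diff_distrib)
 qed measurable
 obtain C where "AE x in lborel. u x - prim v x = C" using ae_const by blast
 then have "AE x in lborel. u x = C + prim v x" by eventually_elim (simp add: algebra_simps)
 then show ?thesis by blast
qed

lemma prim_deriv: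
 assumes "continuous_on UNIV v" shows "(prim v hvd v x) (at x)"
proof -
 obtain F where F: "\<And>x. (F hvd v x) (at x)" using antideriv_exists[OF assms] by blast
 have c: "continuous_on S v" for S using assms continuous_on_subset by blast
 have "prim v x = F x - F 0" for x
 proof (cases "0 <= x")
  case True
  have si: "set_integrable lborel {0..x} v" by (rule borel_integrable_atLeastAtMost'[OF c])
  have "prim v x = (LINT y|lborel. indicat_real {0..x} y *\<^sub>R v y)"
   unfolding prim_def
   by (rule integral_cong_AE)
    (use True AE_lborel_singleton[of 0] borel_measurable_continuous_onI[OF assms] in \<open>auto simp: seg_def indicator_def elim!: eventually_mono\<close>)
  also have "\<dots> = F x - F 0"
   using set_borel_integral_eq_integral(2)[OF si] integral_unique[OF fundamental_theorem_of_calculus[OF True hvd_at_within[OF F]]]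
   by (simp add: set_lebesgue_integral_def)
  finally show ?thesis .
 next
  case False
  then have x: "x <= 0" by simp
  have si: "set_integrable lborel {x..0} v" by (rule borel_integrable_atLeastAtMost'[OF c])
  have "prim v x = (LINT y|lborel. - (indicat_real {x..0} y *\<^sub>R v y))"
   unfolding prim_def
   by (rule integral_cong_AE)
    (use False AE_lborel_singleton[of x] borel_measurable_continuous_onI[OF assms] in \<open>auto simp: seg_def indicator_def elim!: eventually_mono\<close>)
  also have "\<dots> = F x - F 0"
   using set_borel_integral_eq_integral(2)[OF si] integral_unique[OF fundamental_theorem_of_calculus[OF x hvd_at_within[OF F]]]
   by (simp add: set_lebesgue_integral_def)
  finally show ?thesis .
 qed
 then have "prim v = (\<lambda>x. F x - F 0)" by auto
 then show ?thesis using F[of x] by (auto intro!: derivative_eq_intros)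
qed

section \<open>Solving the Lax equation by Jost solutions\<close>

lemma L2_add: fixes f g :: "real => complex" assumes "f \<in> L2" "g \<in> L2" shows "(\<lambda>x. f x + g x) \<in> L2"
proof -
 have [measurable]: "f \<in> borel_measurable borel" "g \<in> borel_measurable borel"
  using assms by (auto intro: L2_meas)
 have "integrable lborel (\<lambda>x. (cmod (f x + g x))^2)"
 proof (rule Bochner_Integration.integrable_bound)
  show "integrable lborel (\<lambda>x. 2 * (cmod (f x))^2 + 2 * (cmod (g x))^2)"
   using L2_int[OF assms(1)] L2_int[OF assms(2)] by simp
  show "AE x in lborel. norm ((cmod (f x + g x))^2) <= norm (2 * (cmod (f x))^2 + 2 * (cmod (g x))^2)"
  proof (rule AE_I2)
   fix x
   have "(cmod (f x + g x))^2 <= (cmod (f x) + cmod (g x))^2" by (intro power_mono norm_triangle_ineq) auto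
   also have "\<dots> <= 2 * (cmod (f x))^2 + 2 * (cmod (g x))^2"
    using am_gm[of "cmod (f x)" "cmod (g x)"] by (simp add: power2_sum)
   finally show "norm ((cmod (f x + g x))^2) <= norm (2 * (cmod (f x))^2 + 2 * (cmod (g x))^2)" by simp
  qed
 qed measurable
 then show ?thesis by (simp add: L2_def)
qed

lemma L2_mult_bounded:
 fixes f g :: "real => complex"
 assumes f: "f \<in> L2" and g: "continuous_on UNIV g" "\<And>x. cmod (g x) <= c" shows "(\<lambda>x. g x * f x) \<in> L2"
proof -
 have [measurable]: "f \<in> borel_measurable borel" "g \<in> borel_measurable borel"
  using L2_meas[OF f] borel_measurable_continuous_onI[OF g(1)] by auto
 have "integrable lborel (\<lambda>x. (cmod (g x * f x))^2)"
 proof (rule Bochner_Integration.integrable_bound)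
  show "integrable lborel (\<lambda>x. c^2 * (cmod (f x))^2)" using L2_int[OF f] by simp
  show "AE x in lborel. norm ((cmod (g x * f x))^2) <= norm (c^2 * (cmod (f x))^2)"
   using g(2) by (intro AE_I2) (auto simp: norm_mult power_mult_distrib intro!: mult_right_mono power_mono)
 qed measurable
 then show ?thesis by (simp add: L2_def)
qed

lemma L2_minus: fixes f :: "real => complex" assumes "f \<in> L2" shows "(\<lambda>x. - f x) \<in> L2"
 using assms by (simp add: L2_def)

lemma L2_diff: fixes f g :: "real => complex" assumes "f \<in> L2" "g \<in> L2" shows "(\<lambda>x. f x - g x) \<in> L2"
 using L2_add[OF assms(1) L2_minus[OF assms(2)]] by simp

lemma L2_reflect: fixes f :: "real => complex" assumes "f \<in> L2" shows "(\<lambda>x. f (- x)) \<in> L2"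
proof -
 have [measurable]: "f \<in> borel_measurable borel" by (rule L2_meas[OF assms])
 have "integrable lborel (\<lambda>x. (cmod (f (0 + (- 1) * x)))^2)"
  by (rule lborel_integrable_real_affine[OF L2_int[OF assms]]) simp
 then show ?thesis by (simp add: L2_def)
qed

lemma integral_reflect: "(LINT x|lborel. f (- x)) = (LINT x|lborel. f x)" for f :: "real => 'b::{banach, second_countable_topology}"
 using lborel_integral_real_affine[of "- 1" f 0] by simp

text \<open>Schwartz functions would not do: the weak equation is tested with products with a and b,
  and for a merely continuous potential these are only of class C^1.\<close>

definition tst :: "(real => complex) => (real => complex) => bool" where
 "tst \<eta> \<eta>' \<longleftrightarrow> (\<forall>x. (\<eta> hvd \<eta>' x) (at x)) \<and> continuous_on UNIV \<eta>' \<and>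
   (\<exists>E. \<forall>x. cmod (\<eta> x) <= E * wt x \<and> cmod (\<eta>' x) <= E * wt x)"

lemma tst_L2: assumes "tst \<eta> \<eta>'" shows "\<eta> \<in> L2" "\<eta>' \<in> L2"
proof -
 obtain E where E: "\<And>x. cmod (\<eta> x) <= E * wt x" "\<And>x. cmod (\<eta>' x) <= E * wt x" using assms by (auto simp: tst_def)
 show "\<eta> \<in> L2" using assms E(1) by (intro L2_wt[where C = E] deriv_cont[of \<eta> \<eta>']) (auto simp: tst_def)
 show "\<eta>' \<in> L2" using assms E(2) by (intro L2_wt[where C = E]) (auto simp: tst_def)
qed

lemma tst_mult:
 assumes t: "tst \<eta> \<eta>'" and g: "\<And>x. (g hvd g' x) (at x)" "continuous_on UNIV g'"
  and gb: "\<And>x. cmod (g x) <= c" "\<And>x. cmod (g' x) <= c"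
 shows "tst (\<lambda>x. g x * \<eta> x) (\<lambda>x. g x * \<eta>' x + g' x * \<eta> x)"
proof -
 obtain E where E: "\<And>x. cmod (\<eta> x) <= E * wt x" "\<And>x. cmod (\<eta>' x) <= E * wt x" using t by (auto simp: tst_def)
 have \<eta>d: "(\<eta> hvd \<eta>' x) (at x)" for x using t by (simp add: tst_def)
 have gc: "continuous_on UNIV g" by (rule deriv_cont[OF g(1)])
 have \<eta>c: "continuous_on UNIV \<eta>" by (rule deriv_cont[OF \<eta>d])
 show ?thesis unfolding tst_def
 proof (intro conjI allI exI)
  fix x
  show "((\<lambda>x. g x * \<eta> x) hvd g x * \<eta>' x + g' x * \<eta> x) (at x)"
   by (rule hvd_mult[OF g(1) \<eta>d])
  have c0: "0 <= c" using gb(1)[of x] norm_ge_zero order_trans by blast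
  have E0: "0 <= E * wt x" using E(1)[of x] norm_ge_zero order_trans by blast
  have "cmod (g x * \<eta> x) <= c * (E * wt x)" by (intro cmod_mult_le gb E)
  then show "cmod (g x * \<eta> x) <= (2 * c * E) * wt x" using mult_nonneg_nonneg[OF c0 E0] by simp
  have "cmod (g x * \<eta>' x + g' x * \<eta> x) <= c * (E * wt x) + c * (E * wt x)" by (intro cmod_add_le cmod_mult_le gb E)
  then show "cmod (g x * \<eta>' x + g' x * \<eta> x) <= (2 * c * E) * wt x" by (simp add: mult_ac)
 qed (use t in \<open>auto intro!: continuous_intros gc g(2) \<eta>c simp: tst_def\<close>)
qed

lemma tst_reflect: assumes "tst \<eta> \<eta>'" shows "tst (\<lambda>x. \<eta> (- x)) (\<lambda>x. - \<eta>' (- x))"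
proof -
 obtain E where E: "\<And>x. cmod (\<eta> x) <= E * wt x" "\<And>x. cmod (\<eta>' x) <= E * wt x" using assms by (auto simp: tst_def)
 have "((\<lambda>x. \<eta> (- x)) hvd - \<eta>' (- x)) (at x)" for x
  by (rule hvd_reflect) (use assms in \<open>simp add: tst_def\<close>)
 moreover have "continuous_on UNIV (\<lambda>x. - \<eta>' (- x))"
 proof -
  have c: "continuous_on UNIV \<eta>'" using assms by (simp add: tst_def)
  show ?thesis
   by (rule continuous_on_minus[OF continuous_on_compose2[OF c continuous_on_minus[OF continuous_on_id]]]) simp
 qed
 moreover have "cmod (\<eta> (- x)) <= E * wt x" "cmod (- \<eta>' (- x)) <= E * wt x" for x
  using E[of "- x"] by auto
 ultimately show ?thesis unfolding tst_def by blast
qed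

section \<open>Integral operators with triangular product kernels\<close>

text \<open>One half of a resolvent kernel, on x <= y. The other half is an instance of the same
  locale after reflection.\<close>

locale halfgreen =
 fixes A B \<alpha> :: "real => complex" and C c :: real
 assumes A: "\<And>x. (A hvd \<alpha> x * A x) (at x)"
  and \<alpha>: "continuous_on UNIV \<alpha>" "\<And>x. cmod (\<alpha> x) <= c"
  and B: "continuous_on UNIV B" and AB: "\<And>x y. x <= y ==> cmod (A x * B y) <= C * wt (y - x)" and C: "0 <= C"
begin

definition k :: "real => real => complex" where "k x y = (if x <= y then A x * B y else 0)"
definition gop :: "(real => complex) => real => complex" where "gop h x = (LINT y|lborel. k x y * h y)"

lemma A_cont: "continuous_on S A" by (rule deriv_cont[OF A])

lemma AB_meas [measurable]: "A \<in> borel_measurable borel" "B \<in> borel_measurable borel" "\<alpha> \<in> borel_measurable borel"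
 "wt \<in> borel_measurable borel"
 by (intro borel_measurable_continuous_onI A_cont B \<alpha> continuous_on_wt)+

lemma k_bound: "cmod (k x y) <= C * wt (y - x)"
 using AB[of x y] C wt_pos[of "y - x"] by (auto simp: k_def)

lemma k_meas [measurable]: "(\<lambda>(x, y). k x y) \<in> borel_measurable (borel \<Otimes>\<^sub>M borel)"
 unfolding k_def by measurable

lemma wt_shift_int: "integrable lborel (\<lambda>y. wt (y - x))" "(LINT y|lborel. wt (y - x)) <= 4"
 using integrable_shift[OF wt_integrable, of "- x"] integral_shift[of wt "- x"] wt_integral by auto

lemma wt_shift_int': "integrable lborel (\<lambda>x. wt (y - x))" "(LINT x|lborel. wt (y - x)) <= 4"
proof -
 have "wt (y - x) = wt (x - y)" for x using wt_minus[of "x - y"] by simp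
 then show "integrable lborel (\<lambda>x. wt (y - x))" "(LINT x|lborel. wt (y - x)) <= 4"
  using wt_shift_int[of y] by simp_all
qed

context
 fixes h :: "real => complex"
 assumes h: "h \<in> L2"
begin

lemma hm [measurable]: "h \<in> borel_measurable borel" by (rule L2_meas[OF h])

lemma kh_meas: "(\<lambda>(x, y). k x y * h y) \<in> borel_measurable (lborel \<Otimes>\<^sub>M lborel)"
proof -
 have sets_eq: "sets (lborel \<Otimes>\<^sub>M lborel) = sets (borel \<Otimes>\<^sub>M (borel :: real measure) :: (real \<times> real) measure)"
  by (rule sets_pair_measure_cong) auto
 show ?thesis unfolding measurable_cong_sets[OF sets_eq refl] by measurable
qed

lemma kx_meas: "k x \<in> borel_measurable borel"
 unfolding k_def[abs_def] by measurable

lemma wth_int: "integrable lborel (\<lambda>y. wt (y - x) * cmod (h y))"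
 "(LINT y|lborel. wt (y - x) * cmod (h y)) <= 2 + (LINT y|lborel. (cmod (h y))^2) / 2"
proof -
 have i: "integrable lborel (\<lambda>y. wt (y - x) / 2 + (cmod (h y))^2 / 2)" using wt_shift_int(1) L2_int[OF h] by simp
 have le: "wt (y - x) * cmod (h y) <= wt (y - x) / 2 + (cmod (h y))^2 / 2" for y
 proof -
  have "wt (y - x) * cmod (h y) <= ((wt (y - x))^2 + (cmod (h y))^2) / 2" by (rule am_gm)
  moreover have "(wt (y - x))^2 <= wt (y - x)"
   using wt_pos[of "y - x"] wt_le_1[of "y - x"] by (simp add: power2_eq_square mult_left_le)
  ultimately show ?thesis by (simp add: add_divide_distrib)
 qed
 show ii: "integrable lborel (\<lambda>y. wt (y - x) * cmod (h y))"
  by (rule Bochner_Integration.integrable_bound[OF i])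
   (use le wt_pos in \<open>auto simp: abs_mult less_imp_le intro!: AE_I2 intro: order_trans[OF _ abs_ge_self]\<close>)
 have "(LINT y|lborel. wt (y - x) * cmod (h y)) <= (LINT y|lborel. wt (y - x) / 2 + (cmod (h y))^2 / 2)"
  by (intro integral_mono ii i le)
 also have "\<dots> = (LINT y|lborel. wt (y - x)) / 2 + (LINT y|lborel. (cmod (h y))^2) / 2"
  using wt_shift_int(1) L2_int[OF h] by simp
 finally show "(LINT y|lborel. wt (y - x) * cmod (h y)) <= 2 + (LINT y|lborel. (cmod (h y))^2) / 2"
  using wt_shift_int(2)[of x] by simp
qed

lemma kh_le: "cmod (k x y * h y) <= C * (wt (y - x) * cmod (h y))"
 using mult_right_mono[OF k_bound, of "cmod (h y)" x y] by (simp add: norm_mult mult.assoc)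

lemma kh_int: "integrable lborel (\<lambda>y. k x y * h y)"
proof (rule Bochner_Integration.integrable_bound)
 show "integrable lborel (\<lambda>y. C * (wt (y - x) * cmod (h y)))" by (intro integrable_mult_right wth_int)
 show "(\<lambda>y. k x y * h y) \<in> borel_measurable lborel" using kx_meas by simp
 show "AE y in lborel. norm (k x y * h y) <= norm (C * (wt (y - x) * cmod (h y)))"
  using kh_le by (intro AE_I2) (auto intro: order_trans[OF _ abs_ge_self])
qed

lemma kh_norm_int: "(LINT y|lborel. cmod (k x y * h y)) <= C * (LINT y|lborel. wt (y - x) * cmod (h y))"
proof -
 have "(LINT y|lborel. cmod (k x y * h y)) <= (LINT y|lborel. C * (wt (y - x) * cmod (h y)))"
  by (intro integral_mono integrable_norm kh_int integrable_mult_right wth_int kh_le)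
 then show ?thesis by simp
qed

lemma kh_norm_bound: "(LINT y|lborel. cmod (k x y * h y)) <= C * (2 + (LINT y|lborel. (cmod (h y))^2) / 2)"
 by (rule order_trans[OF kh_norm_int]) (intro mult_left_mono wth_int C)

lemma gop_meas [measurable]: "gop h \<in> borel_measurable borel"
 unfolding gop_def[abs_def] by measurable

lemma weighted_L2: "integrable lborel (\<lambda>x. LINT y|lborel. (cmod (h y))^2 * wt (y - x))"
  "(LINT x|lborel. LINT y|lborel. (cmod (h y))^2 * wt (y - x)) <= 4 * (LINT y|lborel. (cmod (h y))^2)"
proof -
 have sets_eq: "sets (lborel \<Otimes>\<^sub>M lborel) = sets (borel \<Otimes>\<^sub>M (borel :: real measure) :: (real \<times> real) measure)"
  by (rule sets_pair_measure_cong) auto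
 have m: "(\<lambda>(y, x). wt (y - x)) \<in> borel_measurable (lborel \<Otimes>\<^sub>M lborel)"
  unfolding measurable_cong_sets[OF sets_eq refl] by measurable
 have b: "(LINT x|lborel. norm (wt (y - x))) <= 4" for y
  using wt_shift_int'(2)[of y] wt_pos by (simp add: less_imp_le)
 note F = fubini_general[OF L2_int[OF h] m wt_shift_int'(1) b]
 show "integrable lborel (\<lambda>x. LINT y|lborel. (cmod (h y))^2 * wt (y - x))"
  using lborel_pair.integrable_snd[OF F(1)] by simp
 have "(LINT x|lborel. LINT y|lborel. (cmod (h y))^2 * wt (y - x)) = (LINT y|lborel. (cmod (h y))^2 * (LINT x|lborel. wt (y - x)))"
  by (rule F(2))
 also have "\<dots> <= (LINT y|lborel. (cmod (h y))^2 * 4)"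
 proof (rule integral_mono)
  show "integrable lborel (\<lambda>y. (cmod (h y))^2 * (LINT x|lborel. wt (y - x)))"
   using lborel_pair.integrable_fst[OF F(1)] by simp
  show "integrable lborel (\<lambda>y. (cmod (h y))^2 * 4)" using L2_int[OF h] by simp
 qed (intro mult_left_mono wt_shift_int', auto)
 finally show "(LINT x|lborel. LINT y|lborel. (cmod (h y))^2 * wt (y - x)) <= 4 * (LINT y|lborel. (cmod (h y))^2)" by simp
qed

text \<open>Cauchy-Schwarz in the measure with density wt (y - x), obtained by expanding a
  nonnegative square; T / 4 stands for the mean, 4 bounding the mass of \<open>wt\<close>.\<close>

lemma gop_sq: "(cmod (gop h x))^2 <= 4 * C^2 * (LINT y|lborel. (cmod (h y))^2 * wt (y - x))"
proof -
 define T where "T = (LINT y|lborel. wt (y - x) * cmod (h y))"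
 define Z where "Z = (LINT y|lborel. (cmod (h y))^2 * wt (y - x))"
 define K where "K = (LINT y|lborel. wt (y - x))"
 have Zi: "integrable lborel (\<lambda>y. (cmod (h y))^2 * wt (y - x))"
  by (rule Bochner_Integration.integrable_bound[OF L2_int[OF h]])
   (use wt_le_1 wt_pos in \<open>auto simp: abs_mult less_imp_le intro!: mult_left_le\<close>)
 have T0: "0 <= T" unfolding T_def using wt_pos by (intro integral_nonneg_AE) (auto simp: less_imp_le)
 have "0 <= (LINT y|lborel. wt (y - x) * (cmod (h y) - T / 4)^2)"
  using wt_pos by (intro integral_nonneg_AE) (auto simp: less_imp_le)
 also have "\<dots> = (LINT y|lborel. (cmod (h y))^2 * wt (y - x) - T / 2 * (wt (y - x) * cmod (h y)) + (T / 4)^2 * wt (y - x))"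
  by (intro Bochner_Integration.integral_cong refl) (simp add: power2_eq_square algebra_simps)
 also have "\<dots> = Z - T / 2 * T + (T / 4)^2 * K"
  using Zi wth_int(1)[of x] wt_shift_int(1)[of x] by (simp add: T_def Z_def K_def)
 also have "\<dots> <= Z - T / 2 * T + (T / 4)^2 * 4"
  using wt_shift_int(2)[of x] by (intro add_left_mono mult_left_mono) (auto simp: K_def)
 finally have "T^2 <= 4 * Z" by (simp add: power2_eq_square)
 moreover have "cmod (gop h x) <= C * T"
  unfolding gop_def T_def by (rule order_trans[OF integral_norm_bound kh_norm_int])
 then have "(cmod (gop h x))^2 <= C^2 * T^2" unfolding power_mult_distrib[symmetric] by (intro power_mono) auto
 ultimately have "(cmod (gop h x))^2 <= C^2 * (4 * Z)" by (meson mult_left_mono order_trans zero_le_power2)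
 then show ?thesis by (simp add: Z_def)
qed

lemma gop_L2: "gop h \<in> L2" and gop_L2_bound: "(LINT x|lborel. (cmod (gop h x))^2) <= 16 * C^2 * (LINT y|lborel. (cmod (h y))^2)"
proof -
 have wi: "integrable lborel (\<lambda>x. 4 * C^2 * (LINT y|lborel. (cmod (h y))^2 * wt (y - x)))"
  by (intro integrable_mult_right weighted_L2)
 have i: "integrable lborel (\<lambda>x. (cmod (gop h x))^2)"
  by (rule Bochner_Integration.integrable_bound[OF wi]) (use gop_sq in \<open>auto intro!: AE_I2 intro: order_trans[OF _ abs_ge_self]\<close>)
 then show "gop h \<in> L2" by (simp add: L2_def)
 have "(LINT x|lborel. (cmod (gop h x))^2) <= (LINT x|lborel. 4 * C^2 * (LINT y|lborel. (cmod (h y))^2 * wt (y - x)))"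
  by (intro integral_mono i wi gop_sq)
 also have "\<dots> = 4 * C^2 * (LINT x|lborel. LINT y|lborel. (cmod (h y))^2 * wt (y - x))" by simp
 also have "\<dots> <= 4 * C^2 * (4 * (LINT y|lborel. (cmod (h y))^2))" by (intro mult_left_mono weighted_L2) auto
 finally show "(LINT x|lborel. (cmod (gop h x))^2) <= 16 * C^2 * (LINT y|lborel. (cmod (h y))^2)" by simp
qed

text \<open>The weak form of u' = \<alpha> u - A B h for u = gop h: in x the kernel solves the
  homogeneous equation, and its cut-off at the diagonal contributes the source.\<close>

lemma gop_weak:
 assumes t: "tst \<eta> \<eta>'"
 shows "(LINT x|lborel. gop h x * \<eta>' x) = (LINT x|lborel. h x * (A x * B x * \<eta> x)) - (LINT x|lborel. gop h x * (\<alpha> x * \<eta> x))"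
proof -
 obtain E where E: "\<And>x. cmod (\<eta> x) <= E * wt x" "\<And>x. cmod (\<eta>' x) <= E * wt x" using t by (auto simp: tst_def)
 have \<eta>d: "(\<eta> hvd \<eta>' x) (at x)" for x using t by (simp add: tst_def)
 have \<eta>'c: "continuous_on UNIV \<eta>'" using t by (simp add: tst_def)
 have \<eta>c: "continuous_on UNIV \<eta>" by (rule deriv_cont[OF \<eta>d])
 have c0: "0 <= c" using \<alpha>(2)[of 0] norm_ge_zero order_trans by blast
 have E0: "0 <= E"
 proof -
  have "0 <= E * wt 0" using E(1)[of 0] norm_ge_zero order_trans by blast
  then show ?thesis using wt_pos[of 0] by (simp add: zero_le_mult_iff)
 qed
 have i1: "integrable lborel \<eta>'" by (rule integrable_wt_bound[OF \<eta>'c E(2)])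
 have \<alpha>b: "cmod (\<alpha> x * \<eta> x) <= (c * E) * wt x" for x
  using cmod_mult_le[OF \<alpha>(2) E(1), of x x] by (simp add: mult.assoc)
 have i2: "integrable lborel (\<lambda>x. \<alpha> x * \<eta> x)"
  by (rule integrable_wt_bound[OF _ \<alpha>b]) (intro continuous_intros \<alpha> \<eta>c)
 have inner: "(LINT x|lborel. \<eta>' x * k x y) = A y * B y * \<eta> y - (LINT x|lborel. (\<alpha> x * \<eta> x) * k x y)" for y
 proof -
  define F where "F = (\<lambda>x. A x * B y * \<eta> x)"
  define F' where "F' = (\<lambda>x. A x * B y * (\<eta>' x + \<alpha> x * \<eta> x))"
  have Fd: "(F hvd F' x) (at x)" for x
   unfolding F_def
   by (rule hvd_eq_rhs[OF hvd_mult[OF hvd_mult_left[OF A] \<eta>d]])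
    (simp add: F'_def algebra_simps)
  have F'c: "continuous_on UNIV F'" unfolding F'_def by (intro continuous_intros A_cont \<alpha> \<eta>c \<eta>'c)
  have ABb: "cmod (A x * B y) <= C" if "x <= y" for x
   using AB[OF that] wt_le_1[of "y - x"] C by (meson mult_left_le order_trans)
  have F'b: "cmod (F' x) <= (C * (E + c * E)) * wt x" if "x <= y" for x
  proof -
   have "cmod (F' x) <= C * (E * wt x + (c * E) * wt x)"
    unfolding F'_def by (intro cmod_mult_le cmod_add_le ABb that E \<alpha>b)
   then show ?thesis by (simp add: algebra_simps)
  qed
  have si: "set_integrable lborel {..y} F'"
   unfolding set_integrable_def
  proof (rule Bochner_Integration.integrable_bound)
   show "integrable lborel (\<lambda>x. (C * (E + c * E)) * wt x)" by (intro integrable_mult_right wt_integrable)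
   show "(\<lambda>x. indicat_real {..y} x *\<^sub>R F' x) \<in> borel_measurable lborel"
    using borel_measurable_continuous_onI[OF F'c] by simp
   show "AE x in lborel. norm (indicat_real {..y} x *\<^sub>R F' x) <= norm ((C * (E + c * E)) * wt x)"
    using F'b by (intro AE_I2) (auto simp: indicator_def intro: order_trans[OF _ abs_ge_self])
  qed
  have lim: "(F \<longlongrightarrow> 0) at_bot"
  proof (rule tendsto_norm_zero_cancel, rule tendsto_sandwich[OF _ _ tendsto_const])
   show "\<forall>\<^sub>F x in at_bot. norm (F x) <= C * (E * wt x)"
    using eventually_le_at_bot[of y] unfolding F_def
    by eventually_elim (intro cmod_mult_le ABb E)
   have "(wt \<longlongrightarrow> 0) at_bot" unfolding wt_def by real_asymp
   then have "((\<lambda>x. C * (E * wt x)) \<longlongrightarrow> C * (E * 0)) at_bot" by (intro tendsto_intros)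
   then show "((\<lambda>x. C * (E * wt x)) \<longlongrightarrow> 0) at_bot" by simp
  qed simp
  have kb: "cmod (k x y) <= C" for x using ABb[of x] C by (simp add: k_def)
  have km: "(\<lambda>x. k x y) \<in> borel_measurable borel" unfolding k_def[abs_def] by measurable
  have j1: "integrable lborel (\<lambda>x. \<eta>' x * k x y)"
  proof (rule Bochner_Integration.integrable_bound)
   show "integrable lborel (\<lambda>x. C * cmod (\<eta>' x))" by (intro integrable_mult_right integrable_norm i1)
   show "(\<lambda>x. \<eta>' x * k x y) \<in> borel_measurable lborel" using km borel_measurable_continuous_onI[OF \<eta>'c] by simp
   show "AE x in lborel. norm (\<eta>' x * k x y) <= norm (C * cmod (\<eta>' x))"
    using mult_right_mono[OF kb norm_ge_zero] C by (intro AE_I2) (simp add: norm_mult abs_mult mult.commute[of "cmod (\<eta>' _)"])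
  qed
  have j2: "integrable lborel (\<lambda>x. (\<alpha> x * \<eta> x) * k x y)"
  proof (rule Bochner_Integration.integrable_bound)
   show "integrable lborel (\<lambda>x. C * cmod (\<alpha> x * \<eta> x))" by (intro integrable_mult_right integrable_norm i2)
   show "(\<lambda>x. (\<alpha> x * \<eta> x) * k x y) \<in> borel_measurable lborel" using km borel_measurable_continuous_onI[OF \<eta>c] by simp
   show "AE x in lborel. norm ((\<alpha> x * \<eta> x) * k x y) <= norm (C * cmod (\<alpha> x * \<eta> x))"
    using kb C by (intro AE_I2) (simp add: norm_mult abs_mult mult.commute[of C] mult_left_mono)
  qed
  have "(LINT x|lborel. \<eta>' x * k x y) + (LINT x|lborel. (\<alpha> x * \<eta> x) * k x y)
    = (LINT x|lborel. \<eta>' x * k x y + (\<alpha> x * \<eta> x) * k x y)"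
   using j1 j2 by simp
  also have "\<dots> = (LINT x|lborel. indicat_real {..y} x *\<^sub>R F' x)"
   by (intro Bochner_Integration.integral_cong refl) (simp add: k_def F'_def indicator_def algebra_simps)
  also have "\<dots> = F y" by (rule FTC_left_set[OF Fd F'c si lim])
  finally show ?thesis by (simp add: F_def algebra_simps)
 qed
 note F1 = fubini_general[OF i1 kh_meas kh_int kh_norm_bound]
 note F2 = fubini_general[OF i2 kh_meas kh_int kh_norm_bound]
 have i3: "integrable lborel (\<lambda>x. h x * (A x * B x * \<eta> x))"
 proof (rule L2_mult_integrable[OF h L2_wt[where C = "C * E"]])
  show "continuous_on UNIV (\<lambda>x. A x * B x * \<eta> x)" by (intro continuous_intros A_cont B \<eta>c)
  show "cmod (A x * B x * \<eta> x) <= C * E * wt x" for x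
   using cmod_mult_le[OF AB[of x x] E(1)[of x]] by (simp add: wt_def mult.assoc)
 qed
 have i4: "integrable lborel (\<lambda>y. LINT x|lborel. (\<alpha> x * \<eta> x) * (k x y * h y))"
  using lborel_pair.integrable_snd[OF F2(1)] by simp
 have mh: "(LINT x|lborel. f x * (k x y * h y)) = h y * (LINT x|lborel. f x * k x y)" for f y
  unfolding integral_mult_right_zero[symmetric] by (intro Bochner_Integration.integral_cong refl) (simp only: mult_ac)
 have "(LINT x|lborel. gop h x * \<eta>' x) = (LINT x|lborel. \<eta>' x * gop h x)" by (simp only: mult.commute)
 also have "\<dots> = (LINT y|lborel. LINT x|lborel. \<eta>' x * (k x y * h y))" unfolding gop_def by (rule F1(2)[symmetric])
 also have "\<dots> = (LINT y|lborel. h y * (A y * B y * \<eta> y) - (LINT x|lborel. (\<alpha> x * \<eta> x) * (k x y * h y)))"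
  unfolding mh inner by (simp add: right_diff_distrib)
 also have "\<dots> = (LINT y|lborel. h y * (A y * B y * \<eta> y)) - (LINT y|lborel. LINT x|lborel. (\<alpha> x * \<eta> x) * (k x y * h y))"
  by (rule Bochner_Integration.integral_diff[OF i3 i4])
 also have "(LINT y|lborel. LINT x|lborel. (\<alpha> x * \<eta> x) * (k x y * h y)) = (LINT x|lborel. (\<alpha> x * \<eta> x) * gop h x)"
  unfolding gop_def by (rule F2(2))
 finally show ?thesis by (simp only: mult.commute[of "gop h _"])
qed

end

end

lemma prim_cont: assumes v: "v \<in> L2" shows "continuous_on UNIV (prim v)"
proof -
 have [measurable]: "v \<in> borel_measurable borel" by (rule L2_meas[OF v])
 have "(\<lambda>n. prim v (s n)) \<longlonglongrightarrow> prim v x" if s: "s \<longlonglongrightarrow> x" for s x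
 proof -
  obtain N where N: "\<And>n. \<bar>s n\<bar> <= N" using convergent_imp_Bseq[OF convergentI[OF s]] by (auto simp: Bseq_def)
  have sN: "\<bar>seg (s n) y\<bar> <= \<bar>seg N y\<bar> + \<bar>seg (- N) y\<bar>" for n y
   using N[of n] by (auto simp: seg_def)
  have i: "integrable lborel (\<lambda>y. cmod (seg N y *\<^sub>R v y) + cmod (seg (- N) y *\<^sub>R v y))"
   using seg_L2_bound(1)[OF v] by (intro Bochner_Integration.integrable_add integrable_norm)
  show ?thesis unfolding prim_def
  proof (rule integral_dominated_convergence[OF _ _ i])
   show "AE y in lborel. norm (seg (s n) y *\<^sub>R v y) <= cmod (seg N y *\<^sub>R v y) + cmod (seg (- N) y *\<^sub>R v y)" for n
    using mult_right_mono[OF sN, of "cmod (v _)" n] by (intro AE_I2) (simp add: distrib_right)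
   show "AE y in lborel. (\<lambda>n. seg (s n) y *\<^sub>R v y) \<longlonglongrightarrow> seg x y *\<^sub>R v y"
    using AE_lborel_singleton[of x]
   proof eventually_elim
    case (elim y)
    then consider "x < y" | "y < x" by linarith
    then have "\<forall>\<^sub>F n in sequentially. seg (s n) y = seg x y"
    proof cases
     case 1
     from order_tendstoD(2)[OF s 1] show ?thesis by eventually_elim (use 1 in \<open>auto simp: seg_def\<close>)
    next
     case 2
     from order_tendstoD(1)[OF s 2] show ?thesis by eventually_elim (use 2 in \<open>auto simp: seg_def\<close>)
    qed
    then show ?case by (intro tendsto_intros tendsto_eventually)
   qed
  qed measurable
 qed
 then show ?thesis by (simp add: continuous_on_sequentially o_def)
qed

lemma L2_lower_zero:
 fixes g :: "real => complex"
 assumes g: "g \<in> L2" and m: "0 <= m" and low: "\<And>n::nat. \<exists>a. \<forall>x\<in>{a..a + real n}. m <= cmod (g x)"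
 shows "m = 0"
proof (rule ccontr)
 assume "m \<noteq> 0"
 then have m0: "0 < m" using m by simp
 define I where "I = (LINT x|lborel. (cmod (g x))^2)"
 obtain n :: nat where n: "I / m^2 < real n" using reals_Archimedean2 by blast
 obtain a where a: "\<And>x. x \<in> {a..a + real n} ==> m <= cmod (g x)" using low by blast
 have "(LINT x|lborel. m^2 * indicat_real {a..a + real n} x) <= I"
  unfolding I_def
 proof (rule integral_mono[OF _ L2_int[OF g]])
  show "integrable lborel (\<lambda>x. m^2 * indicat_real {a..a + real n} x)"
   by (intro integrable_mult_right integrable_real_indicator) (auto simp: emeasure_lborel_Icc_eq)
  show "m^2 * indicat_real {a..a + real n} x <= (cmod (g x))^2" for x
   using a[of x] m0 by (auto simp: indicator_def power_mono)
 qed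
 then have "m^2 * real n <= I" by simp
 then show False using n m0 by (simp add: divide_less_eq mult.commute)
qed

lemma exp_le_wt: assumes "0 <= t" shows "exp (- t) <= 2 * wt t"
proof -
 have "1 + t^2 <= 2 * exp t" using exp_lower_Taylor_quadratic[OF assms] assms by simp
 then show ?thesis using wt_denom_pos[of t] by (simp add: wt_def exp_minus field_simps)
qed

section \<open>Jost solutions and the resolvent\<close>

locale jost =
 fixes \<kappa> M :: real and q r a b :: "real => complex"
 assumes \<kappa>: "1 <= \<kappa>" and q: "pot M q" and r: "pot M r"
  and a: "ric \<kappa> q r (1/4) a" and b: "ricb \<kappa> q r (1/4) b"
begin

lemma ab_cont: "continuous_on S a" "continuous_on S b"
 by (rule ric_cont[OF a], rule deriv_cont, rule ricbD[OF b])

lemma ab_bound: "1/2 <= cmod (1 - a x * b x)"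
proof -
 have "cmod (a x * b x) <= 1/4 * (1/4)" by (intro cmod_mult_le ric_le[OF a] ricb_le[OF b])
 then show ?thesis using norm_triangle_ineq2[of 1 "a x * b x"] by simp
qed

lemma ab_nonzero: "1 - a x * b x \<noteq> 0" using ab_bound[of x] by auto

definition "P = (SOME F. (\<forall>x. (F hvd q x * a x) (at x)) \<and> (\<forall>x. cmod (F x) <= 2 * (M * (1/4))))"
definition "Q = (SOME F. (\<forall>x. (F hvd r x * b x) (at x)) \<and> (\<forall>x. cmod (F x) <= 2 * (M * (1/4))))"

lemma P: "(P hvd q x * a x) (at x)" "cmod (P x) <= 2 * (M * (1/4))"
proof -
 have "pot (M * (1/4)) (\<lambda>x. q x * a x)" by (intro pot_mult_bounded q ab_cont ric_le[OF a])
 then have "\<exists>F. (\<forall>x. (F hvd q x * a x) (at x)) \<and> (\<forall>x. cmod (F x) <= 2 * (M * (1/4)))"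
  by (rule pot_antideriv) blast
 from someI_ex[OF this] show "(P hvd q x * a x) (at x)" "cmod (P x) <= 2 * (M * (1/4))"
  unfolding P_def by blast+
qed

lemma Q: "(Q hvd r x * b x) (at x)" "cmod (Q x) <= 2 * (M * (1/4))"
proof -
 have "pot (M * (1/4)) (\<lambda>x. r x * b x)" by (intro pot_mult_bounded r ab_cont ricb_le[OF b])
 then have "\<exists>F. (\<forall>x. (F hvd r x * b x) (at x)) \<and> (\<forall>x. cmod (F x) <= 2 * (M * (1/4)))"
  by (rule pot_antideriv) blast
 from someI_ex[OF this] show "(Q hvd r x * b x) (at x)" "cmod (Q x) <= 2 * (M * (1/4))"
  unfolding Q_def by blast+
qed

text \<open>The Jost solutions are \<phi> (1, a), decaying at -infinity, and \<psi> (b, 1), decaying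
  at +infinity; the Riccati solutions are the ratios of their components.\<close>

definition "\<phi> x = exp (of_real (\<kappa> * x) + P x)"
definition "\<psi> x = exp (of_real (- \<kappa> * x) + Q x)"
definition "W = \<phi> 0 * \<psi> 0 * (1 - a 0 * b 0)"

lemma exp_chain: "(f hvd f') (at x) ==> ((\<lambda>x. exp (f x)) hvd f' * exp (f x)) (at x)"
 for f :: "real => complex"
 using field_vector_diff_chain_at[OF _ DERIV_exp, of f f' x] by (simp add: o_def)

lemma \<phi>: "(\<phi> hvd (of_real \<kappa> + q x * a x) * \<phi> x) (at x)"
proof -
 have "((\<lambda>x. complex_of_real (\<kappa> * x)) hvd of_real \<kappa>) (at x)"
  by (rule hvd_of_real) (auto intro!: derivative_eq_intros)
 from exp_chain[OF hvd_add[OF this P(1)]] show ?thesis unfolding \<phi>_def .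
qed

lemma \<psi>: "(\<psi> hvd (- of_real \<kappa> + r x * b x) * \<psi> x) (at x)"
proof -
 have "((\<lambda>x. complex_of_real (- \<kappa> * x)) hvd of_real (- \<kappa>)) (at x)"
  by (rule hvd_of_real) (auto intro!: derivative_eq_intros)
 from exp_chain[OF hvd_add[OF this Q(1)]] show ?thesis unfolding \<psi>_def by simp
qed

lemma \<phi>\<psi>_cont: "continuous_on S \<phi>" "continuous_on S \<psi>"
 by (rule deriv_cont, rule \<phi>, rule deriv_cont, rule \<psi>)

lemma \<phi>\<psi>_nonzero: "\<phi> x \<noteq> 0" "\<psi> x \<noteq> 0" by (auto simp: \<phi>_def \<psi>_def)

text \<open>The Wronskian of the two Jost solutions.\<close>

lemma W: "\<phi> x * \<psi> x * (1 - a x * b x) = W"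
proof -
 have "((\<lambda>x. \<phi> x * \<psi> x * (1 - a x * b x)) hvd 0) (at x)" for x
  by (rule hvd_eq_rhs[OF hvd_mult[OF hvd_mult[OF \<phi> \<psi>]
     hvd_diff[OF hvd_const hvd_mult[OF ricD[OF a] ricbD[OF b]]]]])
   (simp add: algebra_simps power2_eq_square)
 then obtain c where "\<And>x. \<phi> x * \<psi> x * (1 - a x * b x) = c"
  using hvd_zero_constant[of UNIV "\<lambda>x. \<phi> x * \<psi> x * (1 - a x * b x)"] by (auto simp: hvd_at_within)
 then show ?thesis by (simp add: W_def)
qed

lemma W_nonzero: "W \<noteq> 0" using \<phi>\<psi>_nonzero[of 0] ab_nonzero[of 0] by (simp add: W_def)

lemma \<omega>: "\<phi> x * \<psi> x / W = 1 / (1 - a x * b x)"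
 using W[of x] W_nonzero ab_nonzero[of x] by (simp add: field_simps)

definition "C = 2 * exp M / cmod W"

lemma C: "0 <= C" by (simp add: C_def)

text \<open>The exponentials combine to exp (- \<kappa> (y - x)) up to a bounded factor; this is
  weakened to algebraic decay so that \<open>wt\<close> can be used throughout.\<close>

lemma kernel_bound: assumes "x <= y" shows "cmod (\<phi> x * (\<psi> y / W)) <= C * wt (y - x)"
proof -
 have "\<phi> x * \<psi> y = exp (of_real (- \<kappa> * (y - x)) + (P x + Q y))"
  unfolding \<phi>_def \<psi>_def exp_add[symmetric] by (simp add: algebra_simps)
 then have "cmod (\<phi> x * \<psi> y) = exp (- \<kappa> * (y - x) + Re (P x + Q y))"
  by (simp add: norm_exp_eq_Re)
 also have "\<dots> = exp (- \<kappa> * (y - x)) * exp (Re (P x + Q y))" by (rule exp_add)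
 also have "\<dots> <= exp (- (y - x)) * exp M"
 proof (rule mult_mono)
  have "1 * (y - x) <= \<kappa> * (y - x)" using \<kappa> assms by (intro mult_right_mono) auto
  then show "exp (- \<kappa> * (y - x)) <= exp (- (y - x))" by simp
  have "Re (P x + Q y) <= cmod (P x + Q y)" by (rule complex_Re_le_cmod)
  also have "\<dots> <= 2 * (M * (1/4)) + 2 * (M * (1/4))" by (intro cmod_add_le P Q)
  finally show "exp (Re (P x + Q y)) <= exp M" by simp
 qed auto
 also have "\<dots> <= (2 * wt (y - x)) * exp M" using exp_le_wt[of "y - x"] assms by (intro mult_right_mono) auto
 finally have "cmod (\<phi> x * \<psi> y) / cmod W <= (2 * wt (y - x)) * exp M / cmod W" by (intro divide_right_mono) auto
 then show ?thesis by (simp add: C_def norm_mult norm_divide mult_ac)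
qed

definition "cc = \<kappa> + M"

lemma \<alpha>_bounds: "cmod (of_real \<kappa> + q x * a x) <= cc" "cmod (of_real \<kappa> - r x * b x) <= cc"
proof -
 have "cmod (of_real \<kappa> + q x * a x) <= \<kappa> + M * (1/4)" "cmod (of_real \<kappa> - r x * b x) <= \<kappa> + M * (1/4)"
  using \<kappa> by (intro cmod_add_le cmod_diff_le cmod_mult_le pot_bound1[OF q] pot_bound1[OF r] ric_le[OF a] ricb_le[OF b]; simp)+
 then show "cmod (of_real \<kappa> + q x * a x) <= cc" "cmod (of_real \<kappa> - r x * b x) <= cc"
  using pot_nonneg[OF q] by (auto simp: cc_def)
qed

sublocale L: halfgreen \<phi> "\<lambda>y. \<psi> y / W" "\<lambda>x. of_real \<kappa> + q x * a x" C cc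
proof
 show "continuous_on UNIV (\<lambda>x. of_real \<kappa> + q x * a x)" by (intro continuous_intros pot_cont[OF q] ab_cont)
 show "continuous_on UNIV (\<lambda>y. \<psi> y / W)" by (intro continuous_intros \<phi>\<psi>_cont) (simp add: W_nonzero)
qed (use \<phi> \<alpha>_bounds kernel_bound C in auto)

sublocale R: halfgreen "\<lambda>x. \<psi> (- x)" "\<lambda>y. \<phi> (- y) / W" "\<lambda>x. of_real \<kappa> - r (- x) * b (- x)" C cc
proof
 show "((\<lambda>x. \<psi> (- x)) hvd (of_real \<kappa> - r (- x) * b (- x)) * \<psi> (- x)) (at x)" for x
  by (rule hvd_eq_rhs[OF hvd_reflect[OF \<psi>]]) (simp add: algebra_simps)
 show "continuous_on UNIV (\<lambda>x. of_real \<kappa> - r (- x) * b (- x))"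
  by (intro continuous_intros continuous_on_compose2[OF pot_cont[OF r, of UNIV]] continuous_on_compose2[OF ab_cont(2)[of UNIV]]) auto
 show "continuous_on UNIV (\<lambda>y. \<phi> (- y) / W)"
  by (intro continuous_intros continuous_on_compose2[OF \<phi>\<psi>_cont(1)[of UNIV]]) (auto simp: W_nonzero)
 show "cmod (\<psi> (- x) * (\<phi> (- y) / W)) <= C * wt (y - x)" if "x <= y" for x y
  using kernel_bound[of "- y" "- x"] that by (simp add: mult_ac)
qed (use \<alpha>_bounds C in auto)

text \<open>Variation of constants in the basis of Jost solutions: the solution is X (1, a) + Y (b,
  1), where X integrates over y >= x and Y over y <= x.\<close>

definition "X f1 f2 = L.gop (\<lambda>y. f1 y + b y * f2 y)"
definition "Y f1 f2 x = R.gop (\<lambda>y. a (- y) * f1 (- y) + f2 (- y)) (- x)"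
definition "u1 f1 f2 x = X f1 f2 x + b x * Y f1 f2 x"
definition "u2 f1 f2 x = a x * X f1 f2 x + Y f1 f2 x"

definition "da x = r x - 2 * of_real \<kappa> * a x - q x * (a x)^2"
definition "db x = q x + 2 * of_real \<kappa> * b x - r x * (b x)^2"

lemma dab: "continuous_on UNIV da" "continuous_on UNIV db" "cmod (da x) <= 2 * M + \<kappa>" "cmod (db x) <= 2 * M + \<kappa>"
proof -
 show "continuous_on UNIV da" "continuous_on UNIV db" unfolding da_def db_def
  by (intro continuous_intros pot_cont[OF q] pot_cont[OF r] ab_cont)+
 have "cmod (da x) <= M + 2 * \<kappa> * (1/4) + M * (1/4)^2" "cmod (db x) <= M + 2 * \<kappa> * (1/4) + M * (1/4)^2"
  unfolding da_def db_def using \<kappa>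
  by (intro cmod_add_le cmod_diff_le cmod_mult_le cmod_sq_le pot_bound1[OF q] pot_bound1[OF r] ric_le[OF a] ricb_le[OF b]; simp)+
 moreover have "M + 2 * \<kappa> * (1/4) + M * (1/4)^2 <= 2 * M + \<kappa>" using pot_nonneg[OF q] \<kappa> by (simp add: power2_eq_square)
 ultimately show "cmod (da x) <= 2 * M + \<kappa>" "cmod (db x) <= 2 * M + \<kappa>" by linarith+
qed

lemma tst_a: "tst \<eta> \<eta>' ==> tst (\<lambda>x. a x * \<eta> x) (\<lambda>x. a x * \<eta>' x + da x * \<eta> x)"
 and tst_b: "tst \<eta> \<eta>' ==> tst (\<lambda>x. b x * \<eta> x) (\<lambda>x. b x * \<eta>' x + db x * \<eta> x)"
proof -
 have le: "1/4 <= 2 * M + \<kappa>" using pot_nonneg[OF q] \<kappa> by simp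
 show "tst \<eta> \<eta>' ==> tst (\<lambda>x. a x * \<eta> x) (\<lambda>x. a x * \<eta>' x + da x * \<eta> x)"
  by (erule tst_mult[where c = "2 * M + \<kappa>"]) (use ricD[OF a] dab order_trans[OF ric_le[OF a] le] in \<open>auto simp: da_def\<close>)
 show "tst \<eta> \<eta>' ==> tst (\<lambda>x. b x * \<eta> x) (\<lambda>x. b x * \<eta>' x + db x * \<eta> x)"
  by (erule tst_mult[where c = "2 * M + \<kappa>"]) (use ricbD[OF b] dab order_trans[OF ricb_le[OF b] le] in \<open>auto simp: db_def\<close>)
qed

context
 fixes f1 f2 :: "real => complex"
 assumes f: "f1 \<in> L2" "f2 \<in> L2"
begin

lemma h1: "(\<lambda>y. f1 y + b y * f2 y) \<in> L2"
 by (intro L2_add L2_mult_bounded[where c = "1/4"] f ab_cont ricb_le[OF b])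

lemma h2: "(\<lambda>y. a y * f1 y + f2 y) \<in> L2"
 by (intro L2_add L2_mult_bounded[where c = "1/4"] f ab_cont ric_le[OF a])

lemma X_L2: "X f1 f2 \<in> L2" unfolding X_def by (rule L.gop_L2[OF h1])

lemma Y_L2: "Y f1 f2 \<in> L2"
proof -
 have "R.gop (\<lambda>y. a (- y) * f1 (- y) + f2 (- y)) \<in> L2" by (rule R.gop_L2[OF L2_reflect[OF h2]])
 from L2_reflect[OF this] show ?thesis by (simp add: Y_def[abs_def])
qed

lemma u_L2: "u1 f1 f2 \<in> L2" "u2 f1 f2 \<in> L2"
 unfolding u1_def u2_def
 by (intro L2_add L2_mult_bounded[where c = "1/4"] X_L2 Y_L2 ab_cont ric_le[OF a] ricb_le[OF b])+

lemma X_weak: assumes "tst \<eta> \<eta>'"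
 shows "(LINT x|lborel. X f1 f2 x * \<eta>' x) = (LINT x|lborel. (f1 x + b x * f2 x) * (1 / (1 - a x * b x) * \<eta> x)) - (LINT x|lborel. X f1 f2 x * ((of_real \<kappa> + q x * a x) * \<eta> x))"
 using L.gop_weak[OF h1 assms] \<omega> by (simp add: X_def)

lemma Y_weak: assumes t: "tst \<eta> \<eta>'"
 shows "(LINT x|lborel. Y f1 f2 x * \<eta>' x) = (LINT x|lborel. Y f1 f2 x * ((of_real \<kappa> - r x * b x) * \<eta> x)) - (LINT x|lborel. (a x * f1 x + f2 x) * (1 / (1 - a x * b x) * \<eta> x))"
proof -
 define Z where "Z = R.gop (\<lambda>y. a (- y) * f1 (- y) + f2 (- y))"
 have YZ: "Y f1 f2 (- x) = Z x" for x by (simp add: Y_def Z_def)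
 have w: "\<psi> x * \<phi> x / W = 1 / (1 - a x * b x)" for x using \<omega>[of x] by (simp add: mult.commute)
 have "(LINT x|lborel. Y f1 f2 x * \<eta>' x) = - (LINT x|lborel. Z x * - \<eta>' (- x))"
  using integral_reflect[of "\<lambda>x. Y f1 f2 x * \<eta>' x"] by (simp add: YZ)
 also have "(LINT x|lborel. Z x * - \<eta>' (- x)) = (LINT x|lborel. (a (- x) * f1 (- x) + f2 (- x)) * (\<psi> (- x) * (\<phi> (- x) / W) * \<eta> (- x)))
   - (LINT x|lborel. Z x * ((of_real \<kappa> - r (- x) * b (- x)) * \<eta> (- x)))"
  unfolding Z_def by (rule R.gop_weak[OF L2_reflect[OF h2] tst_reflect[OF t]])
 also have "(LINT x|lborel. (a (- x) * f1 (- x) + f2 (- x)) * (\<psi> (- x) * (\<phi> (- x) / W) * \<eta> (- x)))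
   = (LINT x|lborel. (a x * f1 x + f2 x) * (1 / (1 - a x * b x) * \<eta> x))"
  using integral_reflect[of "\<lambda>x. (a x * f1 x + f2 x) * (1 / (1 - a x * b x) * \<eta> x)"] by (simp add: w)
 also have "(LINT x|lborel. Z x * ((of_real \<kappa> - r (- x) * b (- x)) * \<eta> (- x))) = (LINT x|lborel. Y f1 f2 x * ((of_real \<kappa> - r x * b x) * \<eta> x))"
  using integral_reflect[of "\<lambda>x. Y f1 f2 x * ((of_real \<kappa> - r x * b x) * \<eta> x)"] by (simp add: YZ)
 finally show ?thesis by simp
qed

definition "v1 x = of_real \<kappa> * u1 f1 f2 x + q x * u2 f1 f2 x - f1 x"
definition "v2 x = f2 x + r x * u1 f1 f2 x - of_real \<kappa> * u2 f1 f2 x"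

lemma v_L2: "v1 \<in> L2" "v2 \<in> L2"
 unfolding v1_def v2_def
 by (intro L2_add L2_diff L2_mult_bounded[where c = "\<kappa> + M"] u_L2 f continuous_intros pot_cont[OF q] pot_cont[OF r];
   use \<kappa> pot_nonneg[OF q] order_trans[OF pot_bound1[OF q]] order_trans[OF pot_bound1[OF r]] in auto)+

lemma om_cont: "continuous_on UNIV (\<lambda>x. 1 / (1 - a x * b x))"
 by (intro continuous_intros ab_cont) (use ab_nonzero in auto)

lemma om_bound: "cmod (1 / (1 - a x * b x)) <= 2"
 using ab_bound[of x] ab_nonzero[of x] by (simp add: norm_divide divide_le_eq)

text \<open>The product rule in weak form for u1 = X + b Y and u2 = a X + Y. The factor 1 / (1 - a
  b) from the diagonal cancels the determinant of the basis (1, a), (b, 1).\<close>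

lemma weak:
 assumes t: "tst \<eta> \<eta>'"
 shows "(LINT x|lborel. u1 f1 f2 x * \<eta>' x) = - (LINT x|lborel. v1 x * \<eta> x)"
  and "(LINT x|lborel. u2 f1 f2 x * \<eta>' x) = - (LINT x|lborel. v2 x * \<eta> x)"
proof -
 note X2 = X_L2 and Y2 = Y_L2
 define w where "w = (\<lambda>x. 1 / (1 - a x * b x))"
 have w1: "w x * (1 - a x * b x) = 1" for x using ab_nonzero[of x] by (simp add: w_def)
 have m: "(\<lambda>x. g x * \<theta> x) \<in> L2" if "\<theta> \<in> L2" "continuous_on UNIV g" "\<And>x. cmod (g x) <= c" for g \<theta> c
  by (rule L2_mult_bounded[OF that])
 have w2: "(\<lambda>x. w x * \<theta> x) \<in> L2" if "\<theta> \<in> L2" for \<theta>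
  unfolding w_def by (rule L2_mult_bounded[OF that om_cont om_bound])
 have al: "(\<lambda>x. (of_real \<kappa> + q x * a x) * \<theta> x) \<in> L2" "(\<lambda>x. (of_real \<kappa> - r x * b x) * \<theta> x) \<in> L2" if "\<theta> \<in> L2" for \<theta>
  by (rule L2_mult_bounded[OF that _ \<alpha>_bounds(1)], intro continuous_intros pot_cont[OF q] ab_cont,
    rule L2_mult_bounded[OF that _ \<alpha>_bounds(2)], intro continuous_intros pot_cont[OF r] ab_cont)
 have \<eta>2: "\<eta> \<in> L2" "\<eta>' \<in> L2" using tst_L2[OF t] by auto
 have a\<eta>: "(\<lambda>x. a x * \<eta> x) \<in> L2" "(\<lambda>x. b x * \<eta> x) \<in> L2" "(\<lambda>x. da x * \<eta> x) \<in> L2" "(\<lambda>x. db x * \<eta> x) \<in> L2"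
  using L2_mult_bounded[OF \<eta>2(1) ab_cont(1) ric_le[OF a]] L2_mult_bounded[OF \<eta>2(1) ab_cont(2) ricb_le[OF b]]
   L2_mult_bounded[OF \<eta>2(1) dab(1,3)] L2_mult_bounded[OF \<eta>2(1) dab(2,4)] by auto
 have a\<eta>': "(\<lambda>x. a x * \<eta>' x) \<in> L2" "(\<lambda>x. b x * \<eta>' x) \<in> L2"
  using L2_mult_bounded[OF \<eta>2(2) ab_cont(1) ric_le[OF a]] L2_mult_bounded[OF \<eta>2(2) ab_cont(2) ricb_le[OF b]] by auto
 note I = L2_mult_integrable
 note di = Bochner_Integration.integral_diff and ad = Bochner_Integration.integral_add
 have "(LINT x|lborel. u1 f1 f2 x * \<eta>' x) = (LINT x|lborel. X f1 f2 x * \<eta>' x + (Y f1 f2 x * (b x * \<eta>' x + db x * \<eta> x) - Y f1 f2 x * (db x * \<eta> x)))"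
  by (intro Bochner_Integration.integral_cong refl) (simp add: u1_def algebra_simps)
 also have "\<dots> = (LINT x|lborel. X f1 f2 x * \<eta>' x) + ((LINT x|lborel. Y f1 f2 x * (b x * \<eta>' x + db x * \<eta> x)) - (LINT x|lborel. Y f1 f2 x * (db x * \<eta> x)))"
  using I[OF X2 \<eta>2(2)] I[OF Y2 L2_add[OF a\<eta>'(2) a\<eta>(4)]] I[OF Y2 a\<eta>(4)] by simp
 also have "\<dots> = ((LINT x|lborel. (f1 x + b x * f2 x) * (w x * \<eta> x)) - (LINT x|lborel. X f1 f2 x * ((of_real \<kappa> + q x * a x) * \<eta> x)))
   + (((LINT x|lborel. Y f1 f2 x * ((of_real \<kappa> - r x * b x) * (b x * \<eta> x))) - (LINT x|lborel. (a x * f1 x + f2 x) * (w x * (b x * \<eta> x)))) - (LINT x|lborel. Y f1 f2 x * (db x * \<eta> x)))"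
  unfolding X_weak[OF t] Y_weak[OF tst_b[OF t]] w_def ..
 also have "\<dots> = (LINT x|lborel. ((f1 x + b x * f2 x) * (w x * \<eta> x) - X f1 f2 x * ((of_real \<kappa> + q x * a x) * \<eta> x))
   + ((Y f1 f2 x * ((of_real \<kappa> - r x * b x) * (b x * \<eta> x)) - (a x * f1 x + f2 x) * (w x * (b x * \<eta> x))) - Y f1 f2 x * (db x * \<eta> x)))"
  using I[OF h1 w2[OF \<eta>2(1)]] I[OF X2 al(1)[OF \<eta>2(1)]] I[OF Y2 al(2)[OF a\<eta>(2)]] I[OF h2 w2[OF a\<eta>(2)]] I[OF Y2 a\<eta>(4)] by simp
 also have "\<dots> = (LINT x|lborel. - (v1 x * \<eta> x))"
 proof (intro Bochner_Integration.integral_cong refl)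
  fix x
  have "((f1 x + b x * f2 x) * (w x * \<eta> x) - X f1 f2 x * ((of_real \<kappa> + q x * a x) * \<eta> x))
   + ((Y f1 f2 x * ((of_real \<kappa> - r x * b x) * (b x * \<eta> x)) - (a x * f1 x + f2 x) * (w x * (b x * \<eta> x))) - Y f1 f2 x * (db x * \<eta> x))
   = (w x * (1 - a x * b x)) * f1 x * \<eta> x - (of_real \<kappa> * u1 f1 f2 x + q x * u2 f1 f2 x) * \<eta> x"
   unfolding u1_def u2_def db_def by (simp add: algebra_simps power2_eq_square)
  then show "((f1 x + b x * f2 x) * (w x * \<eta> x) - X f1 f2 x * ((of_real \<kappa> + q x * a x) * \<eta> x))
   + ((Y f1 f2 x * ((of_real \<kappa> - r x * b x) * (b x * \<eta> x)) - (a x * f1 x + f2 x) * (w x * (b x * \<eta> x))) - Y f1 f2 x * (db x * \<eta> x)) = - (v1 x * \<eta> x)"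
   unfolding w1 by (simp add: v1_def algebra_simps)
 qed
 finally show "(LINT x|lborel. u1 f1 f2 x * \<eta>' x) = - (LINT x|lborel. v1 x * \<eta> x)" by simp
 have "(LINT x|lborel. u2 f1 f2 x * \<eta>' x) = (LINT x|lborel. Y f1 f2 x * \<eta>' x + (X f1 f2 x * (a x * \<eta>' x + da x * \<eta> x) - X f1 f2 x * (da x * \<eta> x)))"
  by (intro Bochner_Integration.integral_cong refl) (simp add: u2_def algebra_simps)
 also have "\<dots> = (LINT x|lborel. Y f1 f2 x * \<eta>' x) + ((LINT x|lborel. X f1 f2 x * (a x * \<eta>' x + da x * \<eta> x)) - (LINT x|lborel. X f1 f2 x * (da x * \<eta> x)))"
  using I[OF Y2 \<eta>2(2)] I[OF X2 L2_add[OF a\<eta>'(1) a\<eta>(3)]] I[OF X2 a\<eta>(3)] by simp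
 also have "\<dots> = ((LINT x|lborel. Y f1 f2 x * ((of_real \<kappa> - r x * b x) * \<eta> x)) - (LINT x|lborel. (a x * f1 x + f2 x) * (w x * \<eta> x)))
   + (((LINT x|lborel. (f1 x + b x * f2 x) * (w x * (a x * \<eta> x))) - (LINT x|lborel. X f1 f2 x * ((of_real \<kappa> + q x * a x) * (a x * \<eta> x)))) - (LINT x|lborel. X f1 f2 x * (da x * \<eta> x)))"
  unfolding Y_weak[OF t] X_weak[OF tst_a[OF t]] w_def ..
 also have "\<dots> = (LINT x|lborel. (Y f1 f2 x * ((of_real \<kappa> - r x * b x) * \<eta> x) - (a x * f1 x + f2 x) * (w x * \<eta> x))
   + (((f1 x + b x * f2 x) * (w x * (a x * \<eta> x)) - X f1 f2 x * ((of_real \<kappa> + q x * a x) * (a x * \<eta> x))) - X f1 f2 x * (da x * \<eta> x)))"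
  using I[OF h2 w2[OF \<eta>2(1)]] I[OF Y2 al(2)[OF \<eta>2(1)]] I[OF X2 al(1)[OF a\<eta>(1)]] I[OF h1 w2[OF a\<eta>(1)]] I[OF X2 a\<eta>(3)] by simp
 also have "\<dots> = (LINT x|lborel. - (v2 x * \<eta> x))"
 proof (intro Bochner_Integration.integral_cong refl)
  fix x
  have "(Y f1 f2 x * ((of_real \<kappa> - r x * b x) * \<eta> x) - (a x * f1 x + f2 x) * (w x * \<eta> x))
   + (((f1 x + b x * f2 x) * (w x * (a x * \<eta> x)) - X f1 f2 x * ((of_real \<kappa> + q x * a x) * (a x * \<eta> x))) - X f1 f2 x * (da x * \<eta> x))
   = (of_real \<kappa> * u2 f1 f2 x - r x * u1 f1 f2 x) * \<eta> x - (w x * (1 - a x * b x)) * f2 x * \<eta> x"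
   unfolding u1_def u2_def da_def by (simp add: algebra_simps power2_eq_square)
  then show "(Y f1 f2 x * ((of_real \<kappa> - r x * b x) * \<eta> x) - (a x * f1 x + f2 x) * (w x * \<eta> x))
   + (((f1 x + b x * f2 x) * (w x * (a x * \<eta> x)) - X f1 f2 x * ((of_real \<kappa> + q x * a x) * (a x * \<eta> x))) - X f1 f2 x * (da x * \<eta> x)) = - (v2 x * \<eta> x)"
   unfolding w1 by (simp add: v2_def algebra_simps)
 qed
 finally show "(LINT x|lborel. u2 f1 f2 x * \<eta>' x) = - (LINT x|lborel. v2 x * \<eta> x)" by simp
qed

end

text \<open>The Wronskians of a solution with the two Jost solutions are constant. As each Jost
  solution decays at one end, a nonzero constant would keep a combination of the solution bounded
  below on a half line, against L^2. So both combinations vanish, and 1 - a b \<noteq> 0 inverts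
  them.\<close>

lemma homogeneous_zero:
 assumes H: "H1_deriv w1 z1" "H1_deriv w2 z2"
  and eq: "AE x in lborel. z1 x = of_real \<kappa> * w1 x + q x * w2 x" "AE x in lborel. z2 x = r x * w1 x - of_real \<kappa> * w2 x"
 shows "AE x in lborel. w1 x = 0" "AE x in lborel. w2 x = 0"
proof -
 have L: "w1 \<in> L2" "w2 \<in> L2" "z1 \<in> L2" "z2 \<in> L2" using H by (auto simp: H1_deriv_def)
 have [measurable]: "w1 \<in> borel_measurable borel" "w2 \<in> borel_measurable borel" "z1 \<in> borel_measurable borel" "z2 \<in> borel_measurable borel"
  using L by (auto intro: L2_meas)
 obtain C1 where C1: "AE x in lborel. w1 x = C1 + prim z1 x" using H1_representative[OF H(1)] by blast
 obtain C2 where C2: "AE x in lborel. w2 x = C2 + prim z2 x" using H1_representative[OF H(2)] by blast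
 define p1 p2 where "p1 = (\<lambda>x. C1 + prim z1 x)" and "p2 = (\<lambda>x. C2 + prim z2 x)"
 have pc: "continuous_on UNIV p1" "continuous_on UNIV p2"
  unfolding p1_def p2_def by (intro continuous_intros prim_cont L)+
 have [measurable]: "p1 \<in> borel_measurable borel" "p2 \<in> borel_measurable borel"
  using pc by (auto intro: borel_measurable_continuous_onI)
 have [measurable]: "q \<in> borel_measurable borel" "r \<in> borel_measurable borel"
  using pot_cont[OF q, of UNIV] pot_cont[OF r, of UNIV] by (auto intro: borel_measurable_continuous_onI)
 \<comment> \<open>Replacing the weak derivatives by these continuous expressions shows that the
   representatives p1 and p2 are continuously differentiable.\<close>
 define y1 y2 where "y1 = (\<lambda>x. of_real \<kappa> * p1 x + q x * p2 x)" and "y2 = (\<lambda>x. r x * p1 x - of_real \<kappa> * p2 x)"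
 have yc: "continuous_on UNIV y1" "continuous_on UNIV y2"
  unfolding y1_def y2_def by (intro continuous_intros pc pot_cont[OF q] pot_cont[OF r])+
 have z1: "AE x in lborel. z1 x = y1 x" using C1 C2 eq(1) by eventually_elim (simp add: y1_def p1_def p2_def)
 have z2: "AE x in lborel. z2 x = y2 x" using C1 C2 eq(2) by eventually_elim (simp add: y2_def p1_def p2_def)
 have [measurable]: "y1 \<in> borel_measurable borel" "y2 \<in> borel_measurable borel"
  using yc by (auto intro: borel_measurable_continuous_onI)
 have pcong: "prim f = prim g" if "AE x in lborel. f x = g x" "f \<in> borel_measurable borel" "g \<in> borel_measurable borel"
  for f g :: "real => complex"
 proof
  fix x
  show "prim f x = prim g x" unfolding prim_def
   by (rule integral_cong_AE) (use that in \<open>auto elim: eventually_mono\<close>)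
 qed
 have "prim z1 = prim y1" "prim z2 = prim y2" using z1 z2 by (auto intro: pcong)
 then have p': "(p1 hvd y1 x) (at x)" "(p2 hvd y2 x) (at x)" for x
  unfolding p1_def p2_def using prim_deriv[OF yc(1), of x] prim_deriv[OF yc(2), of x]
  by (auto intro!: derivative_eq_intros)
 have pL: "p1 \<in> L2" "p2 \<in> L2"
 proof -
  have C1': "AE x in lborel. w1 x = p1 x" and C2': "AE x in lborel. w2 x = p2 x"
   using C1 C2 by (simp_all add: p1_def p2_def)
  have ae1: "AE x in lborel. (cmod (w1 x))^2 = (cmod (p1 x))^2" using C1' by eventually_elim simp
  have m1: "(\<lambda>x. (cmod (p1 x))^2) \<in> borel_measurable lborel" by measurable
  have "integrable lborel (\<lambda>x. (cmod (p1 x))^2)"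
   by (rule integrable_cong_AE_imp[OF L2_int[OF L(1)] m1 ae1])
  then show "p1 \<in> L2" unfolding L2_def by auto
  have ae2: "AE x in lborel. (cmod (w2 x))^2 = (cmod (p2 x))^2" using C2' by eventually_elim simp
  have m2: "(\<lambda>x. (cmod (p2 x))^2) \<in> borel_measurable lborel" by measurable
  have "integrable lborel (\<lambda>x. (cmod (p2 x))^2)"
   by (rule integrable_cong_AE_imp[OF L2_int[OF L(2)] m2 ae2])
  then show "p2 \<in> L2" unfolding L2_def by auto
 qed
 define e where "e = exp (- (M / 2))"
 have bound: "e * exp (\<kappa> * \<bar>x\<bar>) * cmod (\<phi> x) <= 1" if "x <= 0" for x
 proof -
  have "Re (P x) <= M / 2" using order_trans[OF complex_Re_le_cmod P(2), of x] by simp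
  then have "exp (- (M / 2)) * exp (\<kappa> * \<bar>x\<bar>) * exp (\<kappa> * x + Re (P x)) <= 1"
   using that by (simp flip: exp_add)
  then show ?thesis by (simp add: e_def \<phi>_def norm_exp_eq_Re)
 qed
 have bound': "e * exp (\<kappa> * \<bar>x\<bar>) * cmod (\<psi> x) <= 1" if "0 <= x" for x
 proof -
  have "Re (Q x) <= M / 2" using order_trans[OF complex_Re_le_cmod Q(2), of x] by simp
  then have "exp (- (M / 2)) * exp (\<kappa> * \<bar>x\<bar>) * exp (- \<kappa> * x + Re (Q x)) <= 1"
   using that by (simp flip: exp_add)
  then show ?thesis by (simp add: e_def \<psi>_def norm_exp_eq_Re)
 qed
 have lowb: "c * e <= cmod g" if "cmod (f * g) = c" "e * exp (\<kappa> * \<bar>x\<bar>) * cmod f <= 1" for f g :: complex and c x :: real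
 proof -
  have "1 <= exp (\<kappa> * \<bar>x\<bar>)" using \<kappa> by simp
  then have "e * 1 * cmod f <= e * exp (\<kappa> * \<bar>x\<bar>) * cmod f" by (intro mult_right_mono mult_left_mono) (auto simp: e_def)
  then have "e * cmod f <= 1" using that(2) by simp
  then have "(e * cmod f) * cmod g <= 1 * cmod g" by (intro mult_right_mono) auto
  then show ?thesis using that(1) by (simp add: norm_mult mult_ac)
 qed
 have e0: "0 < e" by (simp add: e_def)
 have s1: "p1 x * a x - p2 x = 0" for x
 proof -
  have d: "((\<lambda>x. \<phi> x * (p1 x * a x - p2 x)) hvd 0) (at x)" for x
   by (rule hvd_eq_rhs[OF hvd_mult[OF \<phi> hvd_diff[OF hvd_mult[OF p'(1) ricD[OF a]] p'(2)]]])
    (simp add: y1_def y2_def algebra_simps power2_eq_square)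
  obtain c where c: "\<And>x. \<phi> x * (p1 x * a x - p2 x) = c"
   using hvd_zero_constant[of UNIV "\<lambda>x. \<phi> x * (p1 x * a x - p2 x)"] d by (auto simp: hvd_at_within)
  have gL: "(\<lambda>x. p1 x * a x - p2 x) \<in> L2"
   using L2_diff[OF L2_mult_bounded[OF pL(1) ab_cont(1) ric_le[OF a]] pL(2)] by (simp add: mult.commute)
  have "cmod c * e = 0"
  proof (rule L2_lower_zero[OF gL])
   show "\<exists>a'. \<forall>x\<in>{a'..a' + real n}. cmod c * e <= cmod (p1 x * a x - p2 x)" for n
    by (intro exI[of _ "- real n"] ballI lowb[OF _ bound]) (use c in auto)
  qed (use e0 in auto)
  then show ?thesis using c[of x] \<phi>\<psi>_nonzero[of x] e0 by simp
 qed
 have s2: "p1 x - b x * p2 x = 0" for x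
 proof -
  have d: "((\<lambda>x. \<psi> x * (p1 x - b x * p2 x)) hvd 0) (at x)" for x
   by (rule hvd_eq_rhs[OF hvd_mult[OF \<psi> hvd_diff[OF p'(1) hvd_mult[OF ricbD[OF b] p'(2)]]]])
    (simp add: y1_def y2_def algebra_simps power2_eq_square)
  obtain c where c: "\<And>x. \<psi> x * (p1 x - b x * p2 x) = c"
   using hvd_zero_constant[of UNIV "\<lambda>x. \<psi> x * (p1 x - b x * p2 x)"] d by (auto simp: hvd_at_within)
  have gL: "(\<lambda>x. p1 x - b x * p2 x) \<in> L2"
   using L2_diff[OF pL(1) L2_mult_bounded[OF pL(2) ab_cont(2) ricb_le[OF b]]] .
  have "cmod c * e = 0"
  proof (rule L2_lower_zero[OF gL])
   show "\<exists>a'. \<forall>x\<in>{a'..a' + real n}. cmod c * e <= cmod (p1 x - b x * p2 x)" for n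
    by (intro exI[of _ 0] ballI lowb[OF _ bound']) (use c in auto)
  qed (use e0 in auto)
  then show ?thesis using c[of x] \<phi>\<psi>_nonzero[of x] e0 by simp
 qed
 have "p1 x = 0 \<and> p2 x = 0" for x
 proof -
  have "p1 x * (1 - a x * b x) = (p1 x - b x * p2 x) - b x * (p1 x * a x - p2 x)" by (simp add: algebra_simps)
  then have "p1 x = 0" using s1[of x] s2[of x] ab_nonzero[of x] by simp
  then show ?thesis using s1[of x] by simp
 qed
 then show "AE x in lborel. w1 x = 0" "AE x in lborel. w2 x = 0"
  using C1 C2 by (auto simp: p1_def p2_def elim: eventually_mono)
qed

end

section \<open>The Green's function\<close>

definition mat2 :: "complex => complex => complex => complex => complex ^ 2 ^ 2" where
 "mat2 a b c d = (\<chi> i j. if i = 1 then (if j = 1 then a else b) else (if j = 1 then c else d))"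

definition vec2 :: "complex => complex => complex ^ 2" where
 "vec2 a b = (\<chi> i. if i = 1 then a else b)"

lemma mat2_nth [simp]: "mat2 a b c d $ 1 $ 1 = a" "mat2 a b c d $ 1 $ 2 = b"
 "mat2 a b c d $ 2 $ 1 = c" "mat2 a b c d $ 2 $ 2 = d"
 by (simp_all add: mat2_def)

lemma vec2_nth [simp]: "vec2 a b $ 1 = a" "vec2 a b $ 2 = b"
 by (simp_all add: vec2_def)

lemma mat2_eqI: "A $ 1 $ 1 = B $ 1 $ 1 ==> A $ 1 $ 2 = B $ 1 $ 2 ==> A $ 2 $ 1 = B $ 2 $ 1 ==> A $ 2 $ 2 = B $ 2 $ 2 ==> A = B"
 for A B :: "complex ^ 2 ^ 2"
 by (simp add: vec_eq_iff forall_2)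

lemma vec2_eqI: "v $ 1 = w $ 1 ==> v $ 2 = w $ 2 ==> v = w" for v w :: "complex ^ 2"
 by (simp add: vec_eq_iff forall_2)

lemma mv_nth: "(A *v v) $ i = A $ i $ 1 * v $ 1 + A $ i $ 2 * v $ 2" for A :: "complex ^ 2 ^ 2"
 by (simp add: matrix_vector_mult_def sum_2)

lemma G0_pos_mat2: "G0_pos \<kappa> x y = mat2 (if x < y then of_real (exp (- \<kappa> * \<bar>x - y\<bar>)) else 0) 0 0 (if y < x then of_real (exp (- \<kappa> * \<bar>x - y\<bar>)) else 0)"
 by (rule mat2_eqI) (simp_all add: G0_pos_def)

lemma norm_vec2: "(norm v)^2 = (cmod (v $ 1))^2 + (cmod (v $ 2))^2" for v :: "complex ^ 2"
 by (simp add: norm_vec_def L2_set_def sum_2)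

lemma bl_nth: "bounded_linear (\<lambda>v :: complex ^ 2. v $ i)" by (rule bounded_linear_vec_nth)

lemma bl_vec2: "bounded_linear (\<lambda>z. vec2 z 0)" "bounded_linear (\<lambda>z. vec2 0 z)"
proof -
 have n: "norm (vec2 z 0) = cmod z" "norm (vec2 0 z) = cmod z" for z
  by (simp_all add: norm_vec_def L2_set_def sum_2)
 show "bounded_linear (\<lambda>z. vec2 z 0)" "bounded_linear (\<lambda>z. vec2 0 z)"
  by (rule bounded_linear_intro[where K = 1]; auto intro: vec2_eqI simp: n)+
qed

lemma vec2_split: "v = vec2 (v $ 1) 0 + vec2 0 (v $ 2)"
 by (rule vec2_eqI) simp_all

lemma vec2_meas:
 fixes v :: "real => complex ^ 2"
 assumes "(\<lambda>y. v y $ 1) \<in> borel_measurable borel" "(\<lambda>y. v y $ 2) \<in> borel_measurable borel"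
 shows "v \<in> borel_measurable borel"
proof -
 have "(\<lambda>y. vec2 (v y $ 1) 0) \<in> borel_measurable borel" "(\<lambda>y. vec2 0 (v y $ 2)) \<in> borel_measurable borel"
  using assms measurable_compose[OF assms(1) borel_measurable_continuous_onI[OF linear_continuous_on[OF bl_vec2(1)]]]
   measurable_compose[OF assms(2) borel_measurable_continuous_onI[OF linear_continuous_on[OF bl_vec2(2)]]] by auto
 then have "(\<lambda>y. vec2 (v y $ 1) 0 + vec2 0 (v y $ 2)) \<in> borel_measurable borel" by (rule borel_measurable_add)
 then show ?thesis using vec2_split[symmetric] by simp
qed

lemma vec2_meas_nth: "v \<in> borel_measurable borel ==> (\<lambda>y. v y $ i) \<in> borel_measurable borel" for v :: "real => complex ^ 2"
 by (rule measurable_compose[OF _ borel_measurable_continuous_onI[OF linear_continuous_on[OF bl_nth]]])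

lemma vec2_integrable:
 fixes v :: "real => complex ^ 2"
 assumes "integrable lborel (\<lambda>y. v y $ 1)" "integrable lborel (\<lambda>y. v y $ 2)"
 shows "integrable lborel v" "(LINT y|lborel. v y) = vec2 (LINT y|lborel. v y $ 1) (LINT y|lborel. v y $ 2)"
proof -
 have "integrable lborel (\<lambda>y. vec2 (v y $ 1) 0 + vec2 0 (v y $ 2))"
  by (intro Bochner_Integration.integrable_add integrable_bounded_linear[OF bl_vec2(1) assms(1)] integrable_bounded_linear[OF bl_vec2(2) assms(2)])
 then show i: "integrable lborel v" using vec2_split[symmetric] by simp
 show "(LINT y|lborel. v y) = vec2 (LINT y|lborel. v y $ 1) (LINT y|lborel. v y $ 2)"
  by (rule vec2_eqI) (simp_all add: integral_bounded_linear[OF bl_nth i])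
qed

lemma L2_nth: fixes f :: "real => complex ^ 2" assumes "f \<in> L2" shows "(\<lambda>x. f x $ i) \<in> L2"
proof -
 have m: "(\<lambda>x. f x $ i) \<in> borel_measurable borel" by (rule vec2_meas_nth[OF L2_meas[OF assms]])
 have "integrable lborel (\<lambda>x. (cmod (f x $ i))^2)"
  by (rule Bochner_Integration.integrable_bound[OF L2_int[OF assms]])
   (use m Finite_Cartesian_Product.norm_nth_le in \<open>auto intro!: power_mono\<close>)
 then show ?thesis using m by (simp add: L2_def)
qed

lemma L2_vec2:
 fixes f :: "real => complex ^ 2"
 assumes "(\<lambda>x. f x $ 1) \<in> L2" "(\<lambda>x. f x $ 2) \<in> L2" shows "f \<in> L2"
 using vec2_meas[OF L2_meas[OF assms(1)] L2_meas[OF assms(2)]] L2_int[OF assms(1)] L2_int[OF assms(2)]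
 by (simp add: L2_def norm_vec2)

lemma schwartz_deriv: "schwartz f ==> ((Dx ^^ n) f hvd (Dx ^^ Suc n) f x) (at x)"
proof -
 assume "schwartz f"
 then have "((Dx ^^ n) f) differentiable (at x)" unfolding schwartz_def by blast
 then show ?thesis by (simp add: vector_derivative_works Dx_def)
qed

lemma schwartz_wt: assumes "schwartz f" shows "\<exists>E. \<forall>x. cmod ((Dx ^^ n) f x) <= E * wt x"
proof -
 obtain B0 where B0: "\<And>x. cmod (x ^ 0 *\<^sub>R (Dx ^^ n) f x) <= B0" using assms unfolding schwartz_def bounded_iff by blast
 obtain B2 where B2: "\<And>x. cmod (x ^ 2 *\<^sub>R (Dx ^^ n) f x) <= B2" using assms unfolding schwartz_def bounded_iff by blast
 have "cmod ((Dx ^^ n) f x) <= (B0 + B2) * wt x" for x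
 proof -
  have "(1 + x^2) * cmod ((Dx ^^ n) f x) <= B0 + B2" using B0[of x] B2[of x] by (simp add: algebra_simps)
  then show ?thesis using wt_denom_pos[of x] by (simp add: wt_def field_simps)
 qed
 then show ?thesis by blast
qed

lemma schwartz_tst: assumes "schwartz \<eta>" shows "tst \<eta> (Dx \<eta>)"
proof -
 obtain E0 where E0: "\<And>x. cmod (\<eta> x) <= E0 * wt x" using schwartz_wt[OF assms, of 0] by auto
 obtain E1 where E1: "\<And>x. cmod (Dx \<eta> x) <= E1 * wt x" using schwartz_wt[OF assms, of 1] by auto
 have "cmod (\<eta> x) <= max E0 E1 * wt x" "cmod (Dx \<eta> x) <= max E0 E1 * wt x" for x
  using order_trans[OF E0 mult_right_mono[of E0 "max E0 E1" "wt x"]] order_trans[OF E1 mult_right_mono[of E1 "max E0 E1" "wt x"]] wt_pos[of x]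
  by auto
 moreover have "continuous_on UNIV (Dx \<eta>)" using schwartz_deriv[OF assms, of 1] by (intro deriv_cont) simp
 ultimately show ?thesis using schwartz_deriv[OF assms, of 0] unfolding tst_def by auto
qed

lemma H1_deriv_diff:
 assumes "H1_deriv u v" "H1_deriv u' v'" shows "H1_deriv (\<lambda>x. u x - u' x) (\<lambda>x. v x - v' x)"
proof -
 have L: "u \<in> L2" "v \<in> L2" "u' \<in> L2" "v' \<in> L2" using assms by (auto simp: H1_deriv_def)
 have "(LINT x|lborel. (u x - u' x) * Dx \<eta> x) = - (LINT x|lborel. (v x - v' x) * \<eta> x)" if s: "schwartz \<eta>" for \<eta>
 proof -
  note t = tst_L2[OF schwartz_tst[OF s]]
  have "(LINT x|lborel. (u x - u' x) * Dx \<eta> x) = (LINT x|lborel. u x * Dx \<eta> x) - (LINT x|lborel. u' x * Dx \<eta> x)"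
   unfolding left_diff_distrib using L t by (intro Bochner_Integration.integral_diff L2_mult_integrable)
  also have "\<dots> = - ((LINT x|lborel. v x * \<eta> x) - (LINT x|lborel. v' x * \<eta> x))"
   using assms s by (simp add: H1_deriv_def)
  also have "(LINT x|lborel. v x * \<eta> x) - (LINT x|lborel. v' x * \<eta> x) = (LINT x|lborel. (v x - v' x) * \<eta> x)"
   unfolding left_diff_distrib using L t by (intro Bochner_Integration.integral_diff[symmetric] L2_mult_integrable)
  finally show ?thesis .
 qed
 then show ?thesis using L L2_diff by (simp add: H1_deriv_def)
qed

lemma Lax_meas: "Lax q r k u f ==> u \<in> borel_measurable borel"
 unfolding Lax_def H1_deriv_def by (elim exE conjE, rule vec2_meas; rule L2_meas, assumption)

section \<open>The kernel of the resolvent\<close>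

context jost
begin

definition "Phi x y = \<phi> x * (\<psi> y / W)"
definition "Psi x y = \<psi> x * (\<phi> y / W)"

text \<open>The product kernel minus the free one. The jump of the product kernel across the
  diagonal is (1 - a b) / (1 - a b) = 1, the same as for the free kernel, which is why the
  difference is continuous.\<close>

definition corr :: "real => real => complex ^ 2 ^ 2" where
 "corr x y = (if x <= y
   then mat2 (Phi x y - of_real (exp (\<kappa> * (x - y)))) (Phi x y * b y) (a x * Phi x y) (a x * Phi x y * b y)
   else mat2 (b x * Psi x y * a y) (b x * Psi x y) (Psi x y * a y) (Psi x y - of_real (exp (- (\<kappa> * (x - y))))))"

lemma full_kernel:
 assumes "x \<noteq> y"
 shows "G0 \<kappa> x y + corr x y = (if x <= y then mat2 (Phi x y) (Phi x y * b y) (a x * Phi x y) (a x * Phi x y * b y)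
   else mat2 (b x * Psi x y * a y) (b x * Psi x y) (Psi x y * a y) (Psi x y))"
 using assms \<kappa> by (intro mat2_eqI) (auto simp: G0_def G0_pos_mat2 corr_def algebra_simps)

lemma corr_diag: "corr x x = mat2 (a x * b x / (1 - a x * b x)) (b x / (1 - a x * b x)) (a x / (1 - a x * b x)) (a x * b x / (1 - a x * b x))"
proof -
 have "Phi x x = 1 / (1 - a x * b x)" using \<omega>[of x] by (simp add: Phi_def)
 moreover have "1 / (1 - z) - 1 = z / (1 - z)" if "1 - z \<noteq> 0" for z :: complex using that by (simp add: divide_simps)
 note this[OF ab_nonzero[of x]]
 ultimately show ?thesis by (intro mat2_eqI) (simp_all add: corr_def)
qed

lemma corr_cont: "continuous_on UNIV (\<lambda>(x, y). corr x y)"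
proof -
 let ?f = "\<lambda>p :: real \<times> real. mat2 (Phi (fst p) (snd p) - of_real (exp (\<kappa> * (fst p - snd p)))) (Phi (fst p) (snd p) * b (snd p)) (a (fst p) * Phi (fst p) (snd p)) (a (fst p) * Phi (fst p) (snd p) * b (snd p))"
 let ?g = "\<lambda>p :: real \<times> real. mat2 (b (fst p) * Psi (fst p) (snd p) * a (snd p)) (b (fst p) * Psi (fst p) (snd p)) (Psi (fst p) (snd p) * a (snd p)) (Psi (fst p) (snd p) - of_real (exp (- (\<kappa> * (fst p - snd p)))))"
 have c: "continuous_on S (\<lambda>p. g (fst p))" "continuous_on S (\<lambda>p. g (snd p))" if "continuous_on UNIV g" for g :: "real => complex" and S :: "(real \<times> real) set"
  by (rule continuous_on_compose2[OF that]; auto intro!: continuous_intros)+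
 note cc = c[OF ab_cont(1)] c[OF ab_cont(2)] c[OF \<phi>\<psi>_cont(1)] c[OF \<phi>\<psi>_cont(2)]
 have Pc: "continuous_on S (\<lambda>p. Phi (fst p) (snd p))" "continuous_on S (\<lambda>p. Psi (fst p) (snd p))" for S
  unfolding Phi_def Psi_def by (intro continuous_intros cc; simp add: W_nonzero)+
 have m: "continuous_on S (\<lambda>p. mat2 (f1 p) (f2 p) (f3 p) (f4 p))"
  if "continuous_on S f1" "continuous_on S f2" "continuous_on S f3" "continuous_on S f4" for f1 f2 f3 f4 and S :: "(real \<times> real) set"
  unfolding mat2_def
 proof (intro continuous_on_vec_lambda)
  fix i j :: 2
  show "continuous_on S (\<lambda>p. if i = 1 then if j = 1 then f1 p else f2 p else if j = 1 then f3 p else f4 p)"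
   using that by (cases "i = 1"; cases "j = 1") simp_all
 qed
 have "continuous_on UNIV (\<lambda>p. if fst p - snd p <= 0 then ?f p else ?g p)"
 proof (rule continuous_on_cases_le)
  fix p :: "real \<times> real" assume "fst p - snd p = 0"
  then have e: "snd p = fst p" by simp
  have P: "Phi x x = 1 / (1 - a x * b x)" "Psi x x = 1 / (1 - a x * b x)" for x
   using \<omega>[of x] by (simp_all add: Phi_def Psi_def mult.commute)
  show "?f p = ?g p" unfolding e P using ab_nonzero[of "fst p"] by (intro mat2_eqI) (simp_all add: field_simps)
 qed (intro m continuous_intros Pc cc)+
 moreover have "(\<lambda>(x, y). corr x y) = (\<lambda>p. if fst p - snd p <= 0 then ?f p else ?g p)"
  by (auto simp: corr_def fun_eq_iff)
 ultimately show ?thesis by simp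
qed

definition sol :: "(real => complex ^ 2) => real => complex ^ 2" where
 "sol f x = vec2 (u1 (\<lambda>y. f y $ 1) (\<lambda>y. f y $ 2) x) (u2 (\<lambda>y. f y $ 1) (\<lambda>y. f y $ 2) x)"

lemma sol_Lax: assumes "f \<in> L2" shows "Lax q r \<kappa> (sol f) f"
proof -
 note f = L2_nth[OF assms, of 1] L2_nth[OF assms, of 2]
 have "H1_deriv (u1 (\<lambda>y. f y $ 1) (\<lambda>y. f y $ 2)) (v1 (\<lambda>y. f y $ 1) (\<lambda>y. f y $ 2))"
  "H1_deriv (u2 (\<lambda>y. f y $ 1) (\<lambda>y. f y $ 2)) (v2 (\<lambda>y. f y $ 1) (\<lambda>y. f y $ 2))"
  unfolding H1_deriv_def using u_L2[OF f] v_L2[OF f] weak[OF f schwartz_tst] by blast+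
 then show ?thesis unfolding Lax_def
  using assms by (intro conjI exI) (auto simp: sol_def v1_def[OF f] v2_def[OF f] algebra_simps)
qed

lemma sol_integral:
 assumes "f \<in> L2"
 shows "integrable lborel (\<lambda>y. (G0 \<kappa> x y + corr x y) *v f y)" "sol f x = (LINT y|lborel. (G0 \<kappa> x y + corr x y) *v f y)"
proof -
 note f = L2_nth[OF assms, of 1] L2_nth[OF assms, of 2]
 define h1 where "h1 = (\<lambda>y. f y $ 1 + b y * f y $ 2)"
 define h2 where "h2 = (\<lambda>y. a y * f y $ 1 + f y $ 2)"
 define kl where "kl = (\<lambda>y. L.k x y * h1 y)"
 define kr where "kr = (\<lambda>y. R.k (- x) (- y) * h2 y)"
 have kl: "integrable lborel kl" unfolding kl_def h1_def by (rule L.kh_int[OF h1[OF f]])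
 have kr0: "integrable lborel (\<lambda>y. R.k (- x) y * h2 (- y))"
  unfolding h2_def by (rule R.kh_int[OF L2_reflect[OF h2[OF f]]])
 have kr: "integrable lborel kr"
  using lborel_integrable_real_affine[OF kr0, of "- 1" 0] by (simp add: kr_def)
 have X: "X (\<lambda>y. f y $ 1) (\<lambda>y. f y $ 2) x = (LINT y|lborel. kl y)"
  by (simp add: X_def L.gop_def kl_def h1_def)
 have Y: "Y (\<lambda>y. f y $ 1) (\<lambda>y. f y $ 2) x = (LINT y|lborel. kr y)"
  using integral_reflect[of "\<lambda>y. R.k (- x) y * h2 (- y)"] by (simp add: Y_def R.gop_def kr_def h2_def)
 define V where "V = (\<lambda>y. vec2 (kl y + b x * kr y) (a x * kl y + kr y))"
 have ae: "AE y in lborel. (G0 \<kappa> x y + corr x y) *v f y = V y"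
  using AE_lborel_singleton[of x]
 proof eventually_elim
  case (elim y)
  show ?case
  proof (cases "x <= y")
   case True
   then have "kr y = 0" "kl y = Phi x y * h1 y" using elim by (auto simp: kr_def kl_def R.k_def L.k_def Phi_def)
   then show ?thesis using True elim by (intro vec2_eqI) (simp_all add: full_kernel mv_nth V_def h1_def algebra_simps)
  next
   case False
   then have "kl y = 0" "kr y = Psi x y * h2 y" by (auto simp: kr_def kl_def R.k_def L.k_def Psi_def)
   then show ?thesis using False elim by (intro vec2_eqI) (simp_all add: full_kernel mv_nth V_def h2_def algebra_simps)
  qed
 qed
 have Vi: "integrable lborel V" "(LINT y|lborel. V y) = vec2 (LINT y|lborel. V y $ 1) (LINT y|lborel. V y $ 2)"
  by (rule vec2_integrable; use kl kr in \<open>simp add: V_def\<close>)+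
 have m0: "(\<lambda>y. (G0 \<kappa> x y + corr x y) *v f y) \<in> borel_measurable borel"
 proof -
  have cx: "continuous_on UNIV (\<lambda>y. corr x y)"
  proof -
   have "continuous_on UNIV (\<lambda>y. (\<lambda>(x, y). corr x y) (x, y))"
    by (rule continuous_on_compose2[OF corr_cont continuous_on_Pair[OF continuous_on_const continuous_on_id]]) simp
   then show ?thesis by simp
  qed
  have cm: "(\<lambda>y. corr x y $ i $ j) \<in> borel_measurable borel" for i j
   by (intro borel_measurable_continuous_onI continuous_intros cx)
  have [measurable]: "(\<lambda>y. f y $ i) \<in> borel_measurable borel" for i by (rule vec2_meas_nth[OF L2_meas[OF assms]])
  have gm: "(\<lambda>y. G0 \<kappa> x y $ i $ j) \<in> borel_measurable borel" for i j
   using \<kappa> exhaust_2[of i] exhaust_2[of j] by (auto simp: G0_def G0_pos_mat2)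
  show ?thesis using cm gm by (intro vec2_meas) (simp_all add: mv_nth)
 qed
 have mV: "V \<in> borel_measurable lborel" using Vi(1) by auto
 show "integrable lborel (\<lambda>y. (G0 \<kappa> x y + corr x y) *v f y)"
  by (rule integrable_cong_AE_imp[OF Vi(1)]) (use m0 ae in \<open>auto elim: eventually_mono\<close>)
 have "(LINT y|lborel. (G0 \<kappa> x y + corr x y) *v f y) = (LINT y|lborel. V y)"
  by (rule integral_cong_AE) (use m0 mV ae in auto)
 also have "\<dots> = sol f x"
  unfolding Vi(2) using kl kr by (intro vec2_eqI) (simp_all add: V_def sol_def u1_def u2_def X Y)
 finally show "sol f x = (LINT y|lborel. (G0 \<kappa> x y + corr x y) *v f y)" by simp
qed

lemma Lax_unique: assumes L: "Lax q r \<kappa> u f" shows "AE x in lborel. u x = sol f x"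
proof -
 have f: "f \<in> L2" using L by (simp add: Lax_def)
 obtain z1 z2 where z: "H1_deriv (\<lambda>x. u x $ 1) z1" "H1_deriv (\<lambda>x. u x $ 2) z2"
  "AE x in lborel. f x $ 1 = of_real \<kappa> * u x $ 1 - z1 x + q x * u x $ 2 \<and> f x $ 2 = - r x * u x $ 1 + (of_real \<kappa> * u x $ 2 + z2 x)"
  using L by (auto simp: Lax_def)
 obtain y1 y2 where y: "H1_deriv (\<lambda>x. sol f x $ 1) y1" "H1_deriv (\<lambda>x. sol f x $ 2) y2"
  "AE x in lborel. f x $ 1 = of_real \<kappa> * sol f x $ 1 - y1 x + q x * sol f x $ 2 \<and> f x $ 2 = - r x * sol f x $ 1 + (of_real \<kappa> * sol f x $ 2 + y2 x)"
  using sol_Lax[OF f] by (auto simp: Lax_def)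
 have e1: "AE x in lborel. z1 x - y1 x = of_real \<kappa> * (u x $ 1 - sol f x $ 1) + q x * (u x $ 2 - sol f x $ 2)"
  using z(3) y(3) by eventually_elim (auto simp: algebra_simps)
 have e2: "AE x in lborel. z2 x - y2 x = r x * (u x $ 1 - sol f x $ 1) - of_real \<kappa> * (u x $ 2 - sol f x $ 2)"
  using z(3) y(3) by eventually_elim (auto simp: algebra_simps)
 note homogeneous_zero[OF H1_deriv_diff[OF z(1) y(1)] H1_deriv_diff[OF z(2) y(2)] e1 e2]
 then show ?thesis by eventually_elim (auto intro: vec2_eqI)
qed

lemma sq_combine: "p <= 2 * x + 2 * y ==> y <= z ==> p <= 2 * (x + z)" "p <= 2 * y + 2 * x ==> y <= z ==> p <= 2 * (z + x)"
 "p <= 2 * u + 2 * y ==> y <= w ==> p' <= 2 * y' + 2 * w ==> y' <= u ==> p + p' <= 4 * u + 4 * w"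
 for p p' x y z u w y' :: real
 by auto

lemma sq_sum_le: "(cmod (x + y))^2 <= 2 * (cmod x)^2 + 2 * (cmod y)^2"
proof -
 have "(cmod (x + y))^2 <= (cmod x + cmod y)^2" by (intro power_mono norm_triangle_ineq) auto
 then show ?thesis using am_gm[of "cmod x" "cmod y"] by (simp add: power2_sum)
qed

lemma sq_small_le: "cmod w <= 1/4 ==> (cmod (w * y))^2 <= (cmod y)^2"
 by (intro power_mono) (auto simp: norm_mult intro: order_trans mult_left_le_one_le)

lemma sol_bound:
 assumes "f \<in> L2" shows "L2_norm (sol f) <= 16 * C * L2_norm f"
proof -
 note f = L2_nth[OF assms, of 1] L2_nth[OF assms, of 2]
 define F1 F2 where "F1 = (\<lambda>y. f y $ 1)" and "F2 = (\<lambda>y. f y $ 2)"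
 note F = f[folded F1_def F2_def]
 define I where "I = (LINT x|lborel. (norm (f x))^2)"
 have fi: "integrable lborel (\<lambda>x. (norm (f x))^2)" by (rule L2_int[OF assms])
 have h1b: "(LINT y|lborel. (cmod (F1 y + b y * F2 y))^2) <= 2 * I"
 proof -
  have "(LINT y|lborel. (cmod (F1 y + b y * F2 y))^2) <= (LINT y|lborel. 2 * (norm (f y))^2)"
  proof (rule integral_mono[OF L2_int[OF h1[OF F]]])
   show "(cmod (F1 y + b y * F2 y))^2 <= 2 * (norm (f y))^2" for y
    unfolding norm_vec2 F1_def F2_def by (rule sq_combine(1)[OF sq_sum_le sq_small_le[OF ricb_le[OF b]]])
  qed (use fi in simp)
  then show ?thesis by (simp add: I_def)
 qed
 have h2b: "(LINT y|lborel. (cmod (a y * F1 y + F2 y))^2) <= 2 * I"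
 proof -
  have "(LINT y|lborel. (cmod (a y * F1 y + F2 y))^2) <= (LINT y|lborel. 2 * (norm (f y))^2)"
  proof (rule integral_mono[OF L2_int[OF h2[OF F]]])
   show "(cmod (a y * F1 y + F2 y))^2 <= 2 * (norm (f y))^2" for y
    unfolding norm_vec2 F1_def F2_def by (rule sq_combine(2)[OF sq_sum_le sq_small_le[OF ric_le[OF a]]])
  qed (use fi in simp)
  then show ?thesis by (simp add: I_def)
 qed
 have Xb: "(LINT x|lborel. (cmod (X F1 F2 x))^2) <= 16 * C^2 * (2 * I)"
  unfolding X_def by (rule order_trans[OF L.gop_L2_bound[OF h1[OF F]]]) (intro mult_left_mono h1b, simp)
 have Yb: "(LINT x|lborel. (cmod (Y F1 F2 x))^2) <= 16 * C^2 * (2 * I)"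
 proof -
  have "(LINT x|lborel. (cmod (Y F1 F2 x))^2) = (LINT x|lborel. (cmod (R.gop (\<lambda>y. a (- y) * F1 (- y) + F2 (- y)) x))^2)"
   using integral_reflect[of "\<lambda>x. (cmod (R.gop (\<lambda>y. a (- y) * F1 (- y) + F2 (- y)) x))^2"] by (simp add: Y_def)
  also have "\<dots> <= 16 * C^2 * (LINT y|lborel. (cmod (a (- y) * F1 (- y) + F2 (- y)))^2)"
   by (rule R.gop_L2_bound[OF L2_reflect[OF h2[OF F]]])
  also have "(LINT y|lborel. (cmod (a (- y) * F1 (- y) + F2 (- y)))^2) = (LINT y|lborel. (cmod (a y * F1 y + F2 y))^2)"
   by (rule integral_reflect)
  also have "16 * C^2 * (LINT y|lborel. (cmod (a y * F1 y + F2 y))^2) <= 16 * C^2 * (2 * I)" by (intro mult_left_mono h2b) simp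
  finally show ?thesis .
 qed
 have XYi: "integrable lborel (\<lambda>x. (cmod (X F1 F2 x))^2)" "integrable lborel (\<lambda>x. (cmod (Y F1 F2 x))^2)"
  by (intro L2_int X_L2 Y_L2 F)+
 have si: "integrable lborel (\<lambda>x. (norm (sol f x))^2)"
  using L2_int[OF u_L2(1)[OF F]] L2_int[OF u_L2(2)[OF F]] by (simp add: norm_vec2 sol_def F1_def F2_def)
 have "(LINT x|lborel. (norm (sol f x))^2) <= (LINT x|lborel. 4 * (cmod (X F1 F2 x))^2 + 4 * (cmod (Y F1 F2 x))^2)"
 proof (rule integral_mono[OF si])
  show "(norm (sol f x))^2 <= 4 * (cmod (X F1 F2 x))^2 + 4 * (cmod (Y F1 F2 x))^2" for x
   unfolding norm_vec2 sol_def u1_def u2_def F1_def[symmetric] F2_def[symmetric] vec2_nth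
   by (rule sq_combine(3)[OF sq_sum_le sq_small_le[OF ricb_le[OF b]] sq_sum_le sq_small_le[OF ric_le[OF a]]])
 qed (use XYi in simp)
 also have "\<dots> = 4 * (LINT x|lborel. (cmod (X F1 F2 x))^2) + 4 * (LINT x|lborel. (cmod (Y F1 F2 x))^2)" using XYi by simp
 also have "\<dots> <= (16 * C)^2 * I" using Xb Yb by (simp add: power_mult_distrib)
 finally have "sqrt (LINT x|lborel. (norm (sol f x))^2) <= sqrt ((16 * C)^2 * I)" by (rule real_sqrt_le_mono)
 then show ?thesis using C by (simp add: L2_norm_def I_def real_sqrt_mult)
qed

lemma green: "green_correction q r \<kappa> corr"
 unfolding green_correction_def
proof (intro conjI allI impI)
 show "continuous_on UNIV (\<lambda>(x, y). corr x y)" by (rule corr_cont)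
 show "Lax_invertible q r \<kappa>" unfolding Lax_invertible_def
 proof (intro conjI ballI exI allI impI)
  show "Lax q r \<kappa> (sol f) f" if "f \<in> L2" for f using that by (rule sol_Lax)
  fix u f assume L: "Lax q r \<kappa> u f"
  then have f: "f \<in> L2" by (simp add: Lax_def)
  have um: "u \<in> borel_measurable borel" by (rule Lax_meas[OF L])
  have sm: "sol f \<in> borel_measurable borel" by (rule Lax_meas[OF sol_Lax[OF f]])
  have ae: "AE x in lborel. (norm (u x))^2 = (norm (sol f x))^2" using Lax_unique[OF L] by eventually_elim simp
  have "(\<lambda>x. (norm (u x))^2) \<in> borel_measurable lborel" "(\<lambda>x. (norm (sol f x))^2) \<in> borel_measurable lborel"
   using um sm by measurable
  note integral_cong_AE[OF this ae]
  then have "L2_norm u = L2_norm (sol f)" unfolding L2_norm_def by (rule arg_cong)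
  then show "L2_norm u <= 16 * C * L2_norm f" using sol_bound[OF f] by simp
 qed
 fix u f assume L: "Lax q r \<kappa> u f"
 then have f: "f \<in> L2" by (simp add: Lax_def)
 show "AE x in lborel. integrable lborel (\<lambda>y. (G0 \<kappa> x y + corr x y) *v f y) \<and> u x = (LINT y|lborel. (G0 \<kappa> x y + corr x y) *v f y)"
  using Lax_unique[OF L]
 proof eventually_elim
  case (elim x)
  show ?case using sol_integral[OF f, of x] elim by simp
 qed
qed

end

section \<open>Uniqueness of the kernel\<close>

lemma ae_zero_continuous:
 fixes H :: "real => complex ^ 2"
 assumes c: "continuous_on UNIV H" and ae: "AE x in lborel. H x = 0"
 shows "H x = 0"
proof -
 have "closed {x. H x = 0}" using closed_Collect_eq[OF c continuous_on_const] .
 then have o: "open {x. H x \<noteq> 0}" by (simp add: open_closed Collect_neg_eq[symmetric] Compl_eq)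
 have "{x. H x \<noteq> 0} \<in> null_sets lborel"
  using ae AE_iff_null_sets[of "{x. H x \<noteq> 0}" lborel] o by auto
 then have "negligible {x. H x \<noteq> 0}" using negligible_iff_null_sets null_sets_completionI by blast
 then have "{x. H x \<noteq> 0} = {}" using open_not_negligible[OF o] by blast
 then show ?thesis by blast
qed

text \<open>This makes the definite description meaningful. Data supported on [s, t] show that the
  integral of the difference over y in [s, t] vanishes for almost every x, by continuity for every
  x, and differentiating in t gives pointwise equality.\<close>

lemma green_correction_unique:
 assumes D: "green_correction q r \<kappa> D" and D': "green_correction q r \<kappa> D'"
 shows "D = D'"
proof (intro ext)
 fix x0 y0
 have c: "continuous_on UNIV (\<lambda>(x, y). D x y)" "continuous_on UNIV (\<lambda>(x, y). D' x y)"
  using D D' by (auto simp: green_correction_def)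
 have "(D x0 y0 - D' x0 y0) *v v = 0" for v
 proof -
  define E where "E = (\<lambda>x y. (D x y - D' x y) *v v)"
  have Ec: "continuous_on UNIV (\<lambda>(x, y). E x y)"
  proof -
   have "continuous_on UNIV (\<lambda>p. (\<lambda>(x, y). D x y) p - (\<lambda>(x, y). D' x y) p)" by (intro continuous_intros c)
   then have "continuous_on UNIV (\<lambda>p. (((\<lambda>(x, y). D x y) p - (\<lambda>(x, y). D' x y) p) *v v))"
    unfolding matrix_vector_mult_def by (intro continuous_intros c)
   then show ?thesis by (simp add: E_def split_def)
  qed
  have Ecx: "continuous_on S (E x)" for S x
  proof -
   have "continuous_on S (\<lambda>y. (\<lambda>(x, y). E x y) (x, y))"
    by (rule continuous_on_compose2[OF Ec continuous_on_Pair[OF continuous_on_const continuous_on_id]]) simp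
   then show ?thesis by simp
  qed
  have zero: "integral {s..t} (E x) = 0" for s t x
  proof -
   define f where "f = (\<lambda>y. indicat_real {s..t} y *\<^sub>R v)"
   have f: "f \<in> L2"
   proof -
    have "integrable lborel (\<lambda>y. (norm v)^2 * indicat_real {s..t} y)"
     by (intro integrable_mult_right integrable_real_indicator) (auto simp: emeasure_lborel_Icc_eq)
    moreover have "(norm (f y))^2 = (norm v)^2 * indicat_real {s..t} y" for y by (simp add: f_def indicator_def)
    ultimately show ?thesis by (simp add: L2_def f_def)
   qed
   obtain u where u: "Lax q r \<kappa> u f" using D f by (auto simp: green_correction_def Lax_invertible_def)
   have ae: "AE x in lborel. integral {s..t} (E x) = 0"
   proof -
    have "AE x in lborel. integrable lborel (\<lambda>y. (G0 \<kappa> x y + D x y) *v f y) \<and> u x = (LINT y|lborel. (G0 \<kappa> x y + D x y) *v f y)"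
     "AE x in lborel. integrable lborel (\<lambda>y. (G0 \<kappa> x y + D' x y) *v f y) \<and> u x = (LINT y|lborel. (G0 \<kappa> x y + D' x y) *v f y)"
     using D D' u by (auto simp: green_correction_def)
    then show ?thesis
    proof eventually_elim
     case (elim x)
     have "(LINT y|lborel. (G0 \<kappa> x y + D x y) *v f y - (G0 \<kappa> x y + D' x y) *v f y) = 0"
      using elim by simp
     moreover have "(G0 \<kappa> x y + D x y) *v f y - (G0 \<kappa> x y + D' x y) *v f y = indicat_real {s..t} y *\<^sub>R E x y" for y
      by (intro vec2_eqI) (simp_all add: mv_nth E_def f_def algebra_simps scaleR_conv_of_real[where 'a = complex])
     ultimately have "set_lebesgue_integral lborel {s..t} (E x) = 0" by (simp add: set_lebesgue_integral_def)
     then show ?case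
      using set_borel_integral_eq_integral(2)[OF borel_integrable_atLeastAtMost'[OF Ecx]] by simp
    qed
   qed
   have "continuous_on UNIV (\<lambda>x. integral (cbox s t) (E x))"
    by (rule integral_continuous_on_param) (rule continuous_on_subset[OF Ec], simp)
   then show ?thesis using ae_zero_continuous[of "\<lambda>x. integral {s..t} (E x)"] ae by simp
  qed
  have "((\<lambda>t. integral {y0..t} (E x0)) hvd E x0 y0) (at y0 within {y0..y0 + 1})"
   by (rule integral_has_vector_derivative[OF Ecx]) simp
  then have "((\<lambda>t. 0) hvd E x0 y0) (at y0 within {y0..y0 + 1})" unfolding zero .
  then have "((\<lambda>t. 0) hvd E x0 y0) (at y0 within cbox y0 (y0 + 1))" by simp
  from vector_derivative_unique_within_closed_interval[OF _ _ this hvd_const]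
  have "E x0 y0 = 0" by simp
  then show ?thesis by (simp add: E_def)
 qed
 then have "D x0 y0 *v v = D' x0 y0 *v v" for v by (simp add: matrix_vector_mult_diff_rdistrib)
 then show "D x0 y0 = D' x0 y0" by (simp add: matrix_eq)
qed

lemma G_minus_G0_eq: "green_correction q r \<kappa> D ==> G_minus_G0 q r \<kappa> = D"
 unfolding G_minus_G0_def using green_correction_unique by blast

section \<open>The symmetry between \<kappa> and - \<kappa>\<close>

definition sv :: "complex ^ 2 => complex ^ 2" where "sv v = vec2 (v $ 2) (v $ 1)"
definition sm :: "complex ^ 2 ^ 2 => complex ^ 2 ^ 2" where "sm A = mat2 (A $ 2 $ 2) (A $ 2 $ 1) (A $ 1 $ 2) (A $ 1 $ 1)"

lemma sv_nth [simp]: "sv v $ 1 = v $ 2" "sv v $ 2 = v $ 1" by (simp_all add: sv_def)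
lemma sv_sv [simp]: "sv (sv v) = v" by (rule vec2_eqI) simp_all
lemma sv_minus [simp]: "sv (- v) = - sv v" by (rule vec2_eqI) simp_all
lemma norm_sv [simp]: "norm (sv v) = norm v"
 by (simp add: norm_vec_def L2_set_def sum_2 add.commute)

lemma bl_sv: "bounded_linear sv"
 by (rule bounded_linear_intro[where K = 1]) (auto intro: vec2_eqI)

text \<open>Exchanging the two components turns L(- \<kappa>) for (q, r) into minus L(\<kappa>) for
  (r, q).\<close>

lemma Lax_swap: "Lax q r (- \<kappa>) u f \<longleftrightarrow> Lax r q \<kappa> (\<lambda>x. sv (u x)) (\<lambda>x. - sv (f x))"
proof -
 have L: "(\<lambda>x. - sv (f x)) \<in> L2 \<longleftrightarrow> f \<in> L2"
 proof
  show "f \<in> L2" if "(\<lambda>x. - sv (f x)) \<in> L2"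
   using L2_minus[OF L2_nth[OF that, of 1]] L2_minus[OF L2_nth[OF that, of 2]] by (intro L2_vec2) simp_all
  show "(\<lambda>x. - sv (f x)) \<in> L2" if "f \<in> L2"
   using L2_minus[OF L2_nth[OF that, of 1]] L2_minus[OF L2_nth[OF that, of 2]] by (intro L2_vec2) simp_all
 qed
 have e: "(f x $ 1 = of_real (- \<kappa>) * u x $ 1 - v1 x + q x * u x $ 2 \<and> f x $ 2 = - r x * u x $ 1 + (of_real (- \<kappa>) * u x $ 2 + v2 x))
  \<longleftrightarrow> ((- sv (f x)) $ 1 = of_real \<kappa> * sv (u x) $ 1 - v2 x + r x * sv (u x) $ 2 \<and> (- sv (f x)) $ 2 = - q x * sv (u x) $ 1 + (of_real \<kappa> * sv (u x) $ 2 + v1 x))" for x v1 v2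
  by (auto simp: algebra_simps minus_equation_iff add_eq_0_iff eq_neg_iff_add_eq_0)
 show ?thesis unfolding Lax_def L e by (auto simp del: sv_def)
qed

lemma green_swap:
 assumes k: "0 < \<kappa>" and D: "green_correction r q \<kappa> D"
 shows "green_correction q r (- \<kappa>) (\<lambda>x y. - sm (D x y))"
 unfolding green_correction_def
proof (intro conjI allI impI)
 have inv: "Lax_invertible r q \<kappa>" and c: "continuous_on UNIV (\<lambda>(x, y). D x y)" using D by (auto simp: green_correction_def)
 show "Lax_invertible q r (- \<kappa>)" unfolding Lax_invertible_def
 proof (intro conjI ballI)
  fix f :: "real => complex ^ 2" assume f: "f \<in> L2"
  have "(\<lambda>x. - sv (f x)) \<in> L2"
   using L2_minus[OF L2_nth[OF f, of 1]] L2_minus[OF L2_nth[OF f, of 2]] by (intro L2_vec2) simp_all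
  then obtain u where "Lax r q \<kappa> u (\<lambda>x. - sv (f x))" using inv by (auto simp: Lax_invertible_def)
  then have "Lax q r (- \<kappa>) (\<lambda>x. sv (u x)) f" by (simp add: Lax_swap)
  then show "\<exists>u. Lax q r (- \<kappa>) u f" by blast
 next
  obtain K where K: "\<And>u f. Lax r q \<kappa> u f ==> L2_norm u <= K * L2_norm f" using inv by (auto simp: Lax_invertible_def)
  have "L2_norm u <= K * L2_norm f" if "Lax q r (- \<kappa>) u f" for u f
   using K[OF that[unfolded Lax_swap]] by (simp add: L2_norm_def)
  then show "\<exists>C. \<forall>u f. Lax q r (- \<kappa>) u f --> L2_norm u <= C * L2_norm f" by blast
 qed
 have cij: "continuous_on UNIV (\<lambda>p. D (fst p) (snd p) $ i $ j)" for i j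
  using c by (auto intro!: continuous_intros simp: split_def)
 have "continuous_on UNIV (\<lambda>p. - sm (D (fst p) (snd p)))"
  unfolding sm_def mat2_def
 proof (intro continuous_on_minus continuous_on_vec_lambda)
  fix i j :: 2
  show "continuous_on UNIV (\<lambda>p. if i = 1 then if j = 1 then D (fst p) (snd p) $ 2 $ 2 else D (fst p) (snd p) $ 2 $ 1
    else if j = 1 then D (fst p) (snd p) $ 1 $ 2 else D (fst p) (snd p) $ 1 $ 1)"
   using cij by (cases "i = 1"; cases "j = 1") simp_all
 qed
 then show "continuous_on UNIV (\<lambda>(x, y). - sm (D x y))" by (simp add: split_def)
 fix u f assume L: "Lax q r (- \<kappa>) u f"
 have ker: "(G0 (- \<kappa>) x y + - sm (D x y)) *v f y = sv ((G0 \<kappa> x y + D x y) *v (- sv (f y)))" for x y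
  using k by (intro vec2_eqI) (simp_all add: mv_nth G0_def G0_pos_mat2 sm_def algebra_simps abs_minus_commute)
 have "AE x in lborel. integrable lborel (\<lambda>y. (G0 \<kappa> x y + D x y) *v (- sv (f y))) \<and> sv (u x) = (LINT y|lborel. (G0 \<kappa> x y + D x y) *v (- sv (f y)))"
  using D L[unfolded Lax_swap] by (auto simp: green_correction_def)
 then show "AE x in lborel. integrable lborel (\<lambda>y. (G0 (- \<kappa>) x y + - sm (D x y)) *v f y) \<and>
   u x = (LINT y|lborel. (G0 (- \<kappa>) x y + - sm (D x y)) *v f y)"
 proof eventually_elim
  case (elim x)
  then have i: "integrable lborel (\<lambda>y. (G0 \<kappa> x y + D x y) *v (- sv (f y)))"
   and e: "sv (u x) = (LINT y|lborel. (G0 \<kappa> x y + D x y) *v (- sv (f y)))" by auto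
  have "u x = sv (LINT y|lborel. (G0 \<kappa> x y + D x y) *v (- sv (f y)))" unfolding e[symmetric] by simp
  then show ?case
   unfolding ker using integrable_bounded_linear[OF bl_sv i] integral_bounded_linear[OF bl_sv i] by simp
 qed
qed

lemma green_pos:
 assumes "jost \<kappa> M q r a b"
 shows "has_green q r \<kappa>" "g12 q r \<kappa> x = b x / (1 - a x * b x)" "g21 q r \<kappa> x = a x / (1 - a x * b x)"
  "gam q r \<kappa> x = 2 * (a x * b x) / (1 - a x * b x)"
proof -
 interpret jost \<kappa> M q r a b by fact
 show "has_green q r \<kappa>" unfolding has_green_def using green by blast
 have G: "G_minus_G0 q r \<kappa> x x = corr x x" using G_minus_G0_eq[OF green] by simp
 have G0: "G0 \<kappa> x x = 0" using \<kappa> by (intro mat2_eqI) (simp_all add: G0_def G0_pos_mat2)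
 have s: "sgn \<kappa> = 1" using \<kappa> by simp
 show "g12 q r \<kappa> x = b x / (1 - a x * b x)" "g21 q r \<kappa> x = a x / (1 - a x * b x)"
  "gam q r \<kappa> x = 2 * (a x * b x) / (1 - a x * b x)"
  by (simp_all add: g12_def g21_def gam_def G_def G G0 corr_diag s)
qed

text \<open>The Jost data belong to the exchanged pair (r, q). The sign of the swapped kernel is
  compensated by \<open>sgn\<close>.\<close>

lemma green_neg:
 assumes "jost \<kappa> M r q a b"
 shows "has_green q r (- \<kappa>)" "g12 q r (- \<kappa>) x = a x / (1 - a x * b x)" "g21 q r (- \<kappa>) x = b x / (1 - a x * b x)"
  "gam q r (- \<kappa>) x = 2 * (a x * b x) / (1 - a x * b x)"
proof -
 interpret jost \<kappa> M r q a b by fact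
 have k: "0 < \<kappa>" using \<kappa> by simp
 note gs = green_swap[OF k green]
 show "has_green q r (- \<kappa>)" unfolding has_green_def using gs by blast
 have G: "G_minus_G0 q r (- \<kappa>) x x = - sm (corr x x)" using G_minus_G0_eq[OF gs] by simp
 have G0: "G0 (- \<kappa>) x x = 0" using \<kappa> by (intro mat2_eqI) (simp_all add: G0_def G0_pos_mat2)
 have s: "sgn (- \<kappa>) = - 1" using \<kappa> by simp
 show "g12 q r (- \<kappa>) x = a x / (1 - a x * b x)" "g21 q r (- \<kappa>) x = b x / (1 - a x * b x)"
  "gam q r (- \<kappa>) x = 2 * (a x * b x) / (1 - a x * b x)"
  unfolding g12_def g21_def gam_def G_def G G0 s by (simp_all add: corr_diag sm_def)
qed

section \<open>Smallness of the Riccati solutions\<close>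

text \<open>A power of 2 is never 3 times a power of 2, so at most one of the two chains can hit
  \<open>kx\<close>, the parameter without an energy bound.\<close>

lemma chain_ratio:
 assumes "0 < k"
 obtains c :: real where "c = 2 \<or> c = 3" "\<And>n. c * 2 ^ n * k \<noteq> kx"
proof -
 have "\<not> (2 * 2 ^ n * k = kx \<and> 3 * 2 ^ m * k = kx)" for n m
 proof
  assume "2 * 2 ^ n * k = kx \<and> 3 * 2 ^ m * k = kx"
  then have "(2 * 2 ^ n :: real) = 3 * 2 ^ m" using assms by (metis mult_cancel_right less_irrefl)
  then have "real (2 * 2 ^ n) = real (3 * 2 ^ m)" by simp
  then have "2 ^ Suc n = (3 * 2 ^ m :: nat)" unfolding of_nat_eq_iff by simp
  then have "3 dvd (2 ^ Suc n :: nat)" by (metis dvd_triv_left)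
  then have "3 dvd (2 :: nat)" using prime_dvd_power[of "3 :: nat" 2 "Suc n"] by simp
  then show False by simp
 qed
 then show ?thesis using that[of 2] that[of 3] by blast
qed

text \<open>Telescoping along k, c k, 2 c k, 4 c k and so on. Each increment is bounded by the
  energy at its larger parameter, so k itself may equal \<open>kx\<close>; the far end of the chain
  vanishes by \<open>riccati.decay\<close>.\<close>

lemma chain_bound:
 assumes q: "pot M q" and ric: "\<And>\<nu>. 1 <= \<nu> ==> riccati \<sigma> \<nu> M q (a \<nu>)"
  and en: "\<And>\<nu>. 1 <= \<nu> ==> \<nu> \<noteq> kx ==> en \<nu> (a \<nu>) (K * \<nu> powr (- \<epsilon>))"
  and \<epsilon>: "0 < \<epsilon>" and K: "0 <= K" and k: "1 <= k"
 shows "cmod (a k x) <= sqrt (6 * K) / (1 - 2 powr (- \<epsilon> / 2))"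
proof -
 obtain c :: real where c: "c = 2 \<or> c = 3" and ck: "\<And>n. c * 2 ^ n * k \<noteq> kx"
  using chain_ratio[of k kx] k by auto
 define \<nu> where "\<nu> = (\<lambda>n. c * 2 ^ n * k)"
 define \<theta> :: real where "\<theta> = 2 powr (- \<epsilon> / 2)"
 have \<theta>: "0 < \<theta>" "\<theta> < 1" using \<epsilon> by (auto simp: \<theta>_def powr_less_one)
 have \<nu>2: "2 ^ n <= \<nu> n" for n
 proof -
  have "2 ^ n * 1 <= 2 ^ n * (c * k)" using c k by (intro mult_left_mono) auto
  then show ?thesis by (simp add: \<nu>_def mult_ac)
 qed
 have \<nu>1: "1 <= \<nu> n" for n using \<nu>2[of n] one_le_power[of "2 :: real" n] by linarith
 have \<nu>S: "\<nu> (Suc n) = 2 * \<nu> n" and \<nu>k: "\<nu> n \<noteq> kx" for n using ck[of n] by (simp_all add: \<nu>_def)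
 have step: "cmod (a \<nu>' x - a \<kappa> x) <= sqrt (6 * K) * \<theta> ^ n"
  if "1 <= \<kappa>" "2 * \<kappa> <= \<nu>'" "\<nu>' <= 3 * \<kappa>" "2 ^ n <= \<nu>'" "\<nu>' \<noteq> kx" for \<kappa> \<nu>' n
 proof -
  have "(cmod (a \<nu>' x - a \<kappa> x))^2 <= 6 * (K * \<nu>' powr (- \<epsilon>))"
   by (rule chordal_bound[OF ric ric that(2,3) en]) (use that in auto)
  also have "\<dots> <= 6 * (K * (2 ^ n) powr (- \<epsilon>))"
   using \<epsilon> K that(4) by (intro mult_left_mono powr_mono2') auto
  also have "((2::real) ^ n) powr (- \<epsilon>) = (\<theta> ^ n)^2"
  proof -
   have "\<theta> ^ n = (2 ^ n) powr (- \<epsilon> / 2)"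
    by (simp add: \<theta>_def powr_realpow[symmetric] powr_powr mult.commute)
   then show ?thesis by (simp add: power2_eq_square powr_add[symmetric])
  qed
  finally have "(cmod (a \<nu>' x - a \<kappa> x))^2 <= (sqrt (6 * K) * \<theta> ^ n)^2"
   using K by (simp add: power_mult_distrib)
  then show ?thesis by (rule power2_le_imp_le) (use K \<theta> in auto)
 qed
 have tele: "cmod (a k x) <= cmod (a (\<nu> n) x) + sqrt (6 * K) * (\<Sum>i<Suc n. \<theta> ^ i)" for n
 proof (induction n)
  case 0
  have "cmod (a (\<nu> 0) x - a k x) <= sqrt (6 * K) * \<theta> ^ 0"
   using c k ck[of 0] \<nu>1[of 0] by (intro step) (auto simp: \<nu>_def)
  then show ?case using norm_triangle_ineq2[of "a k x" "a (\<nu> 0) x"] by (simp add: norm_minus_commute)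
 next
  case (Suc n)
  have "cmod (a (\<nu> (Suc n)) x - a (\<nu> n) x) <= sqrt (6 * K) * \<theta> ^ Suc n"
   using \<nu>1[of n] \<nu>S[of n] \<nu>2[of "Suc n"] \<nu>k[of "Suc n"] by (intro step) auto
  then have "cmod (a (\<nu> n) x) <= cmod (a (\<nu> (Suc n)) x) + sqrt (6 * K) * \<theta> ^ Suc n"
   using norm_triangle_ineq2[of "a (\<nu> n) x" "a (\<nu> (Suc n)) x"] by (simp add: norm_minus_commute)
  then show ?case using Suc by (simp add: algebra_simps)
 qed
 have M0: "0 <= M" by (rule pot_nonneg[OF q])
 have "cmod (a k x) <= 2 * M * (1 / 2) ^ n + sqrt (6 * K) / (1 - \<theta>)" for n
 proof -
  have "cmod (a (\<nu> n) x) <= 2 * M / \<nu> n * wt x" by (rule riccati.decay[OF ric[OF \<nu>1]])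
  also have "\<dots> <= 2 * M / 2 ^ n * 1"
   using M0 \<nu>2[of n] wt_le_1[of x] wt_pos[of x] \<nu>1[of n] by (intro mult_mono divide_left_mono) auto
  also have "\<dots> = 2 * M * (1 / 2) ^ n" by (simp add: power_divide)
  finally have 1: "cmod (a (\<nu> n) x) <= 2 * M * (1 / 2) ^ n" .
  have "(\<Sum>i<Suc n. \<theta> ^ i) <= 1 / (1 - \<theta>)"
  proof -
   have "(\<Sum>i<Suc n. \<theta> ^ i) = (1 - \<theta> ^ Suc n) / (1 - \<theta>)" using \<theta> by (subst sum_gp_strict) auto
   also have "\<dots> <= 1 / (1 - \<theta>)" using \<theta> by (intro divide_right_mono) auto
   finally show ?thesis .
  qed
  then have "sqrt (6 * K) * (\<Sum>i<Suc n. \<theta> ^ i) <= sqrt (6 * K) * (1 / (1 - \<theta>))" using K by (intro mult_left_mono) auto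
  then show ?thesis using tele[of n] 1 by simp
 qed
 moreover have "(\<lambda>n. 2 * M * (1 / 2) ^ n + sqrt (6 * K) / (1 - \<theta>)) \<longlonglongrightarrow> 2 * M * 0 + sqrt (6 * K) / (1 - \<theta>)"
  by (intro tendsto_intros LIMSEQ_power_zero) simp
 ultimately have "cmod (a k x) <= 2 * M * 0 + sqrt (6 * K) / (1 - \<theta>)" by (intro LIMSEQ_le_const) auto
 then show ?thesis by (simp add: \<theta>_def)
qed

section \<open>The bootstrap between 1/4 and 1/8\<close>

abbreviation (input) cj :: "real => (real => complex) => real => complex" where
 "cj \<sigma> q \<equiv> (\<lambda>x. of_real \<sigma> * cnj (q x))"

text \<open>All parameters at once, since the bound at k draws on a chain of parameters tending to
  infinity.\<close>

definition good :: "real => real => (real => complex) => bool" where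
 "good c \<sigma> q \<longleftrightarrow> (\<forall>k\<ge>1. (\<exists>a. ric k q (cj \<sigma> q) c a) \<and> (\<exists>b. ricb k q (cj \<sigma> q) c b))"

lemma good_mono: "good c \<sigma> q ==> c <= c' ==> good c' \<sigma> q"
 unfolding good_def ricb_iff_ric using ric_mono by blast

lemma en_mono: "en k a B ==> B <= B' ==> en k a B'"
 unfolding en_def by (meson order_trans)

text \<open>The self-improving half of the continuity argument, driven by the energies. The 12 is 6
  * 2: the 6 from \<open>chordal_bound\<close>, the 2 from the passage to b.\<close>

lemma good_improve:
 assumes \<sigma>: "\<sigma> = 1 \<or> \<sigma> = - 1" and q: "pot M q" and g: "good (1/4) \<sigma> q" and \<epsilon>: "0 < \<epsilon>"
  and en: "\<And>k a. 1 <= k ==> k \<noteq> kx ==> ric k q (cj \<sigma> q) (1/4) a ==> en k a (K * k powr (- \<epsilon>))"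
  and small: "sqrt (12 * K) / (1 - 2 powr (- \<epsilon> / 2)) <= 1/8"
 shows "good (1/8) \<sigma> q"
proof -
 have "\<forall>k. \<exists>a. 1 <= k --> ric k q (cj \<sigma> q) (1/4) a" using g by (auto simp: good_def)
 then obtain a where a: "\<And>k. 1 <= k ==> ric k q (cj \<sigma> q) (1/4) (a k)" by metis
 have "\<forall>k. \<exists>b. 1 <= k --> ricb k q (cj \<sigma> q) (1/4) b" using g by (auto simp: good_def)
 then obtain b where b: "\<And>k. 1 <= k ==> ricb k q (cj \<sigma> q) (1/4) (b k)" by metis
 have A: "riccati \<sigma> k M q (a k)" if "1 <= k" for k
  using \<sigma> q a[OF that] that by unfold_locales auto
 have B: "riccati \<sigma> k M (cj \<sigma> (\<lambda>x. q (- x))) (\<lambda>x. - b k (- x))" if "1 <= k" for k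
  by (rule riccati_reflect[OF \<sigma> that q b[OF that]])
 have enA: "en k (a k) (K * k powr (- \<epsilon>))" if "1 <= k" "k \<noteq> kx" for k
  by (rule en[OF that a[OF that(1)]])
 have enB: "en k (\<lambda>x. - b k (- x)) (2 * K * k powr (- \<epsilon>))" if "1 <= k" "k \<noteq> kx" for k
  using energy_right[OF A[OF that(1)] b[OF that(1)] enA[OF that]] by (simp add: mult_ac)
 have K: "0 <= K"
 proof -
  have "max 1 (kx + 1) \<noteq> kx" by linarith
  then have "0 <= K * (max 1 (kx + 1)) powr (- \<epsilon>)" by (intro en_nonneg[OF enA]) auto
  moreover have "0 < (max 1 (kx + 1)) powr (- \<epsilon>)" by simp
  ultimately show ?thesis by (simp add: zero_le_mult_iff)
 qed
 have 1: "cmod (a k x) <= 1/8" if "1 <= k" for k x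
 proof -
  have s6: "12 * K = 6 * (2 * K)" by simp
  have "cmod (a k x) <= sqrt (6 * (2 * K)) / (1 - 2 powr (- \<epsilon> / 2))"
   by (rule chain_bound[where a = a and kx = kx, OF q A _ \<epsilon> _ that])
    (use K in \<open>auto intro!: en_mono[OF enA] mult_right_mono\<close>)
  from order_trans[OF this small[unfolded s6]] show ?thesis by simp
 qed
 have 2: "cmod (b k x) <= 1/8" if "1 <= k" for k x
 proof -
  have s6: "12 * K = 6 * (2 * K)" by simp
  have "cmod (- b k (- (- x))) <= sqrt (6 * (2 * K)) / (1 - 2 powr (- \<epsilon> / 2))"
   by (rule chain_bound[where a = "\<lambda>k x. - b k (- x)" and kx = kx, OF riccati.q[OF B[OF order_refl]] B enB \<epsilon> _ that])
    (use K in auto)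
  from order_trans[OF this small[unfolded s6]] show ?thesis by simp
 qed
 have "ric k q (cj \<sigma> q) (1/8) (a k)" "ricb k q (cj \<sigma> q) (1/8) (b k)" if "1 <= k" for k
  using a[OF that] b[OF that] 1[OF that] 2[OF that] by (auto simp: ric_def ricb_def)
 then show ?thesis unfolding good_def by blast
qed

text \<open>The openness half of the continuity argument: the gap between 1/8 and 1/4 pays for a
  perturbation of size e, uniformly over potentials with the same \<open>M\<close>.\<close>

lemma good_stable:
 assumes M: "0 <= M" and \<sigma>: "\<sigma> = 1 \<or> \<sigma> = - 1"
 obtains e where "0 < e"
  "\<And>q q'. [|pot M q; continuous_on UNIV q'; \<And>x. cmod (q' x - q x) <= e; good (1/8) \<sigma> q|] ==> good (1/4) \<sigma> q'"
proof -
 obtain e where e: "0 < e" and st: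
  "\<And>\<kappa> q r q' r' a. [|1 <= \<kappa>; pot M q; continuous_on UNIV r; continuous_on UNIV q'; continuous_on UNIV r';
    \<And>x. cmod (q' x - q x) <= e; \<And>x. cmod (r' x - r x) <= e; ric \<kappa> q r (1/8) a|]
   ==> \<exists>a'. ric \<kappa> q' r' (1/4) a'" using ric_stable[OF M] by blast
 have s1: "\<bar>\<sigma>\<bar> = 1" using \<sigma> by auto
 show ?thesis
 proof (rule that[OF e])
  fix q q' assume q: "pot M q" and q': "continuous_on UNIV q'" and d: "\<And>x. cmod (q' x - q x) <= e" and g: "good (1/8) \<sigma> q"
  have qc: "continuous_on UNIV q" by (rule pot_cont[OF q])
  have rc: "continuous_on UNIV (cj \<sigma> q)" "continuous_on UNIV (cj \<sigma> q')" by (intro continuous_intros qc q')+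
  have neg: "continuous_on UNIV (\<lambda>x. f (- x))" if "continuous_on UNIV f" for f :: "real => complex"
   by (rule continuous_on_compose2[OF that]) (auto intro: continuous_intros)
  have dr: "cmod (cj \<sigma> q' x - cj \<sigma> q x) <= e" for x
  proof -
   have "cj \<sigma> q' x - cj \<sigma> q x = of_real \<sigma> * cnj (q' x - q x)" by (simp add: algebra_simps)
   then show ?thesis using d[of x] s1 by (simp add: norm_mult del: complex_cnj_diff)
  qed
  have "(\<exists>a. ric k q' (cj \<sigma> q') (1/4) a) \<and> (\<exists>b. ricb k q' (cj \<sigma> q') (1/4) b)" if k: "1 <= k" for k
  proof
   obtain a b where a: "ric k q (cj \<sigma> q) (1/8) a" and b: "ricb k q (cj \<sigma> q) (1/8) b" using g k by (auto simp: good_def)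
   show "\<exists>a. ric k q' (cj \<sigma> q') (1/4) a" by (rule st[OF k q rc(1) q' rc(2) d dr a])
   have ex_a: "\<exists>a'. ric k (\<lambda>x. cj \<sigma> q' (- x)) (\<lambda>x. q' (- x)) (1/4) a'"
    by (rule st[OF k pot_reflect[OF pot_cnj[OF q s1]] neg[OF qc] neg[OF rc(2)] neg[OF q'] dr d b[unfolded ricb_iff_ric]])
   obtain a' where "ric k (\<lambda>x. cj \<sigma> q' (- x)) (\<lambda>x. q' (- x)) (1/4) a'"
    using ex_a by blast
   then have "ricb k q' (cj \<sigma> q') (1/4) (\<lambda>x. - a' (- x))" by (rule ric_reflect_ricb)
   then show "\<exists>b. ricb k q' (cj \<sigma> q') (1/4) b" by (rule exI[of _ "\<lambda>x. - a' (- x)"])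
  qed
  then show "good (1/4) \<sigma> q'" by (simp add: good_def)
 qed
qed

lemma Hs_nonneg: "0 <= Hs_norm s q"
 unfolding Hs_norm_def by (intro real_sqrt_ge_zero integral_nonneg_AE) auto

lemma Hs_scale: "Hs_norm s (\<lambda>x. of_real c * q x) = \<bar>c\<bar> * Hs_norm s q"
proof -
 have f: "fourier (\<lambda>x. of_real c * q x) \<xi> = of_real c * fourier q \<xi>" for \<xi>
 proof -
  have "(LINT x|lborel. exp (- (\<i> * of_real (\<xi> * x))) * (of_real c * q x)) = (LINT x|lborel. of_real c * (exp (- (\<i> * of_real (\<xi> * x))) * q x))"
   by (simp add: mult_ac)
  then show ?thesis unfolding fourier_def integral_mult_right_zero by simp
 qed
 have e: "(4 + \<xi>^2) powr s * (cmod (of_real c * fourier q \<xi>))^2 = c^2 * ((4 + \<xi>^2) powr s * (cmod (fourier q \<xi>))^2)" for \<xi>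
  by (simp add: norm_mult power_mult_distrib)
 show ?thesis unfolding Hs_norm_def f e integral_mult_right_zero real_sqrt_mult by simp
qed

lemma static_en:
 assumes \<sigma>: "\<sigma> = 1 \<or> \<sigma> = - 1" and s: "- 1 / 2 < s" "s < 0" and q: "pot M q" and k: "1 <= k"
  and a: "ric k q (cj \<sigma> q) (1/4) a" and H: "Hs_norm s q <= \<delta>"
 shows "en k a (enK (2 + 2 * s) * (2 * \<delta>^2) * k powr (- (1 + 2 * s)))"
proof -
 have "(Hs_norm s q)^2 <= \<delta>^2" using H Hs_nonneg by (intro power_mono)
 then have "(LINT x|lborel. (cmod (Vint k q l x))^2) <= 2 * \<delta>^2 * l powr (2 + 2 * s)" if "0 < l" "l <= 1" for l
  by (intro order_trans[OF Vint_Hs[OF q k that s]] mult_right_mono) auto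
 then have "sewing \<sigma> k M q a (2 + 2 * s) (2 * \<delta>^2)"
  using \<sigma> q k a s by unfold_locales auto
 from sewing.energy_en[OF this] show ?thesis by simp
qed

text \<open>The smallness that \<open>good_improve\<close> asks for. The 2 before \<open>enK\<close>
  is the loss of \<open>energy_transfer\<close> between two times, and \<open>2 * \<delta>^2\<close>
  comes from \<open>Vint_Hs\<close>.\<close>

definition small_enough :: "real => real => bool" where
 "small_enough s \<delta> \<longleftrightarrow> sqrt (12 * (2 * (enK (2 + 2 * s) * (2 * \<delta>^2)))) / (1 - 2 powr (- (1 + 2 * s) / 2)) <= 1/8"

lemma small_enough_exists:
 assumes s: "- 1 / 2 < s"
 obtains \<delta> where "0 < \<delta>" "small_enough s \<delta>"
proof -
 define c where "c = (1 - 2 powr (- (1 + 2 * s) / 2)) / 8"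
 have "2 powr (- (1 + 2 * s) / 2) < (1::real)" using s by (auto intro!: powr_less_one)
 then have c: "0 < c" by (simp add: c_def)
 define D where "D = 48 * (\<bar>enK (2 + 2 * s)\<bar> + 1)"
 have D: "0 < D" by (simp add: D_def add_nonneg_pos)
 define \<delta> where "\<delta> = c / sqrt D"
 have \<delta>: "0 < \<delta>" using c D by (simp add: \<delta>_def)
 have "\<delta>^2 * D = c^2" using D by (simp add: \<delta>_def power_divide)
 moreover have "12 * (2 * (enK (2 + 2 * s) * (2 * \<delta>^2))) <= \<delta>^2 * D"
 proof -
  have "enK (2 + 2 * s) * \<delta>^2 <= (\<bar>enK (2 + 2 * s)\<bar> + 1) * \<delta>^2" by (intro mult_right_mono) auto
  then show ?thesis by (simp add: D_def algebra_simps)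
 qed
 ultimately have "sqrt (12 * (2 * (enK (2 + 2 * s) * (2 * \<delta>^2)))) <= sqrt (c^2)" by (intro real_sqrt_le_mono) simp
 then have "sqrt (12 * (2 * (enK (2 + 2 * s) * (2 * \<delta>^2)))) <= c" using c by simp
 moreover have "1 - 2 powr (- (1 + 2 * s) / 2) = 8 * c" by (simp add: c_def)
 ultimately have "small_enough s \<delta>" unfolding small_enough_def using c by (simp add: divide_le_eq)
 then show ?thesis using that \<delta> by blast
qed

lemma good_static:
 assumes \<sigma>: "\<sigma> = 1 \<or> \<sigma> = - 1" and s: "- 1 / 2 < s" "s < 0" and q: "pot M q"
  and H: "Hs_norm s q <= \<delta>" and sm: "small_enough s \<delta>" and g: "good (1/4) \<sigma> q"
 shows "good (1/8) \<sigma> q"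
\<comment> \<open>kx = 0 is below every admissible k, so at a fixed time no parameter is
  exceptional.\<close>
proof (rule good_improve[OF \<sigma> q g, where \<epsilon> = "1 + 2 * s" and kx = 0])
 show "sqrt (12 * (2 * (enK (2 + 2 * s) * (2 * \<delta>^2)))) / (1 - 2 powr (- (1 + 2 * s) / 2)) <= 1 / 8"
  using sm by (simp add: small_enough_def)
 fix k :: real and a assume k: "1 <= k" and a: "ric k q (cj \<sigma> q) (1/4) a"
 note e = static_en[OF \<sigma> s q k a H]
 show "en k a (2 * (enK (2 + 2 * s) * (2 * \<delta>^2)) * k powr (- (1 + 2 * s)))"
  by (rule en_mono[OF e]) (use en_nonneg[OF e] in linarith)
qed (use s in auto)

text \<open>A continuity method in the amplitude: q is reached from 0 through (j / N) q. The H^s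
  norm stays below \<delta> on the way, and N is chosen from the radius of stability, which depends
  on \<open>M\<close> only.\<close>

lemma good_initial:
 assumes \<sigma>: "\<sigma> = 1 \<or> \<sigma> = - 1" and s: "- 1 / 2 < s" "s < 0" and q: "pot M q"
  and H: "Hs_norm s q <= \<delta>" and sm: "small_enough s \<delta>"
 shows "good (1/8) \<sigma> q"
proof -
 have M: "0 <= M" by (rule pot_nonneg[OF q])
 obtain e where e: "0 < e" and st:
  "\<And>q q'. [|pot M q; continuous_on UNIV q'; \<And>x. cmod (q' x - q x) <= e; good (1/8) \<sigma> q|] ==> good (1/4) \<sigma> q'"
  using good_stable[OF M \<sigma>] by blast
 obtain N :: nat where N: "M / e < real N" using reals_Archimedean2 by blast
 have N0: "0 < real N" using N M e by (smt (verit) divide_nonneg_pos)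
 have MN: "M / real N <= e" using N e N0 by (simp add: field_simps)
 define Q where "Q = (\<lambda>j :: nat. \<lambda>x. of_real (real j / real N) * q x)"
 have Qpot: "pot M (Q j)" if "j <= N" for j
 proof -
  have j: "real j / real N <= 1" "0 <= real j / real N" using that N0 by auto
  have "continuous_on UNIV (Q j)" unfolding Q_def by (intro continuous_intros pot_cont[OF q])
  moreover have "cmod (Q j x) <= M * wt x" for x
  proof -
   have "cmod (Q j x) = real j / real N * cmod (q x)" using j unfolding Q_def norm_mult norm_of_real by simp
   also have "\<dots> <= 1 * cmod (q x)" using j by (intro mult_right_mono) auto
   finally show ?thesis using pot_bound[OF q, of x] by simp
  qed
  ultimately show ?thesis by (simp add: pot_def)
 qed
 have QH: "Hs_norm s (Q j) <= \<delta>" if "j <= N" for j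
 proof -
  have "Hs_norm s (Q j) = real j / real N * Hs_norm s q" unfolding Q_def Hs_scale by simp
  also have "\<dots> <= 1 * Hs_norm s q" using that N0 Hs_nonneg by (intro mult_right_mono) auto
  finally show ?thesis using H by simp
 qed
 have "good (1/8) \<sigma> (Q j)" if "j <= N" for j using that
 proof (induction j)
  case 0
  show ?case by (auto simp: good_def ric_def ricb_def Q_def intro!: exI[of _ "\<lambda>_. 0"])
 next
  case (Suc j)
  have "good (1/4) \<sigma> (Q (Suc j))"
  proof (rule st[OF Qpot[of j]])
   show "continuous_on UNIV (Q (Suc j))" by (rule pot_cont[OF Qpot[OF Suc.prems]])
   show "cmod (Q (Suc j) x - Q j x) <= e" for x
   proof -
    have "Q (Suc j) x - Q j x = of_real (1 / real N) * q x" using N0 by (simp add: Q_def field_simps)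
    then have "cmod (Q (Suc j) x - Q j x) = 1 / real N * cmod (q x)" using N0 by (simp only: norm_mult norm_of_real) simp
    also have "\<dots> <= 1 / real N * M" using pot_bound1[OF q, of x] N0 by (intro mult_left_mono) auto
    finally show ?thesis using MN by simp
   qed
  qed (use Suc in auto)
  then show ?case by (rule good_static[OF \<sigma> s Qpot[OF Suc.prems] QH[OF Suc.prems] sm])
 qed
 from this[of N] show ?thesis using N0 by (simp add: Q_def)
qed

section \<open>Curves of Schwartz functions as curves in the sup norm\<close>

definition ucurve :: "(real => real => complex) => bool" where
 "ucurve f \<longleftrightarrow> (\<forall>t. continuous_on UNIV (f t)) \<and> (\<forall>t. \<exists>B. \<forall>x. cmod (f t x) <= B) \<and>
   (\<forall>t. \<forall>e>0. \<exists>d>0. \<forall>\<tau>. \<bar>\<tau> - t\<bar> < d --> (\<forall>x. cmod (f \<tau> x - f t x) <= e))"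

text \<open>Such a family is a continuous curve in the Banach space of bounded continuous functions,
  to which compactness of [-T, T] applies.\<close>

lemma ucurve_compact:
 assumes f: "ucurve f"
 shows "\<exists>B. \<forall>t. \<bar>t\<bar> <= T --> (\<forall>x. cmod (f t x) <= B)"
  and "0 < e ==> \<exists>d>0. \<forall>t \<tau>. \<bar>t\<bar> <= T --> \<bar>\<tau>\<bar> <= T --> \<bar>\<tau> - t\<bar> < d --> (\<forall>x. cmod (f \<tau> x - f t x) <= e)"
proof -
 have fb: "f t \<in> bcontfun" for t
  using f by (auto simp: ucurve_def bcontfun_def bounded_iff)
 define h where "h = (\<lambda>t. Bcontfun (f t))"
 have ap: "apply_bcontfun (h t) = f t" for t by (simp add: h_def Bcontfun_inverse fb)
 have hc: "continuous_on S h" for S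
 proof (unfold continuous_on_iff, intro ballI allI impI)
  fix t e :: real assume "0 < e"
  then obtain d where d: "0 < d" "\<And>\<tau> x. \<bar>\<tau> - t\<bar> < d ==> cmod (f \<tau> x - f t x) <= e / 2"
   using f unfolding ucurve_def by (meson half_gt_zero)
  have "dist (h \<tau>) (h t) < e" if "dist \<tau> t < d" for \<tau>
  proof -
   have "dist (h \<tau>) (h t) <= e / 2"
    using d(2)[of \<tau>] that by (intro dist_bound) (auto simp: ap dist_norm)
   then show ?thesis using \<open>0 < e\<close> by simp
  qed
  then show "\<exists>d>0. \<forall>x'\<in>S. dist x' t < d --> dist (h x') (h t) < e" using d(1) by blast
 qed
 have "bounded (h ` {-T..T})" by (intro compact_imp_bounded compact_continuous_image hc) simp
 then obtain B where B: "\<forall>t\<in>{-T..T}. norm (h t) <= B" unfolding bounded_iff by blast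
 have "cmod (f t x) <= B" if "\<bar>t\<bar> <= T" for t x
  using order_trans[OF norm_bounded[of "h t" x] B[rule_format, of t]] that by (simp add: ap abs_le_iff)
 then show "\<exists>B. \<forall>t. \<bar>t\<bar> <= T --> (\<forall>x. cmod (f t x) <= B)" by blast
 assume "0 < e"
 moreover have "uniformly_continuous_on {-T..T} h" by (intro compact_uniformly_continuous hc) simp
 ultimately obtain d where d: "0 < d" "\<And>t \<tau>. t \<in> {-T..T} ==> \<tau> \<in> {-T..T} ==> dist \<tau> t < d ==> dist (h \<tau>) (h t) < e"
  unfolding uniformly_continuous_on_def by blast
 have "cmod (f \<tau> x - f t x) <= e" if "\<bar>t\<bar> <= T" "\<bar>\<tau>\<bar> <= T" "\<bar>\<tau> - t\<bar> < d" for t \<tau> x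
  using order_trans[OF dist_bounded[of "h \<tau>" x "h t"] less_imp_le[OF d(2)[of t \<tau>]]] that by (simp add: ap dist_norm abs_le_iff)
 then show "\<exists>d>0. \<forall>t \<tau>. \<bar>t\<bar> <= T --> \<bar>\<tau>\<bar> <= T --> \<bar>\<tau> - t\<bar> < d --> (\<forall>x. cmod (f \<tau> x - f t x) <= e)" using d(1) by blast
qed

lemma schwartz_curve_ucurve:
 assumes q: "schwartz_curve q"
 shows "ucurve (\<lambda>t x. x ^ m *\<^sub>R (Dx ^^ n) (q t) x)"
 unfolding ucurve_def
proof (intro conjI allI impI)
 have sc: "schwartz (q t)" for t using q by (auto simp: schwartz_curve_def)
 show "continuous_on UNIV (\<lambda>x. x ^ m *\<^sub>R (Dx ^^ n) (q t) x)" for t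
  using deriv_cont[OF schwartz_deriv[OF sc]] by (intro continuous_intros)
 show "\<exists>B. \<forall>x. cmod (x ^ m *\<^sub>R (Dx ^^ n) (q t) x) <= B" for t
  using sc[of t] unfolding schwartz_def bounded_iff by blast
 fix t e :: real assume "0 < e"
 moreover have "uniform_limit UNIV (\<lambda>\<tau> x. x ^ m *\<^sub>R (Dx ^^ n) (q \<tau>) x) (\<lambda>x. x ^ m *\<^sub>R (Dx ^^ n) (q t) x) (at t)"
  using q by (auto simp: schwartz_curve_def)
 ultimately have "\<forall>\<^sub>F \<tau> in at t. \<forall>x\<in>UNIV. dist (x ^ m *\<^sub>R (Dx ^^ n) (q \<tau>) x) (x ^ m *\<^sub>R (Dx ^^ n) (q t) x) < e"
  by (rule uniform_limitD[rotated])
 then obtain d where d: "0 < d" "\<And>\<tau> x. \<tau> \<noteq> t ==> dist \<tau> t < d ==> dist (x ^ m *\<^sub>R (Dx ^^ n) (q \<tau>) x) (x ^ m *\<^sub>R (Dx ^^ n) (q t) x) < e"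
  unfolding eventually_at by auto
 have "cmod (x ^ m *\<^sub>R (Dx ^^ n) (q \<tau>) x - x ^ m *\<^sub>R (Dx ^^ n) (q t) x) <= e" if "\<bar>\<tau> - t\<bar> < d" for \<tau> x
 proof (cases "\<tau> = t")
  case False
  then show ?thesis using d(2)[OF False, of x] that by (simp add: dist_norm dist_real_def)
 qed (use \<open>0 < e\<close> in simp)
 then show "\<exists>d>0. \<forall>\<tau>. \<bar>\<tau> - t\<bar> < d --> (\<forall>x. cmod (x ^ m *\<^sub>R (Dx ^^ n) (q \<tau>) x - x ^ m *\<^sub>R (Dx ^^ n) (q t) x) <= e)"
  using d(1) by blast
qed

lemma schwartz_curve_pot:
 assumes q: "schwartz_curve q"
 obtains M where "\<And>t. \<bar>t\<bar> <= T ==> pot M ((Dx ^^ n) (q t))"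
proof -
 obtain B0 where B0: "\<And>t x. \<bar>t\<bar> <= T ==> cmod (x ^ 0 *\<^sub>R (Dx ^^ n) (q t) x) <= B0"
  using ucurve_compact(1)[OF schwartz_curve_ucurve[OF q, of 0 n]] by blast
 obtain B2 where B2: "\<And>t x. \<bar>t\<bar> <= T ==> cmod (x ^ 2 *\<^sub>R (Dx ^^ n) (q t) x) <= B2"
  using ucurve_compact(1)[OF schwartz_curve_ucurve[OF q, of 2 n]] by blast
 have sc: "schwartz (q t)" for t using q by (auto simp: schwartz_curve_def)
 have "pot (B0 + B2) ((Dx ^^ n) (q t))" if t: "\<bar>t\<bar> <= T" for t
 proof -
  have "cmod ((Dx ^^ n) (q t) x) <= (B0 + B2) * wt x" for x
  proof -
   have "(1 + x^2) * cmod ((Dx ^^ n) (q t) x) <= B0 + B2" using B0[OF t, of x] B2[OF t, of x] by (simp add: algebra_simps)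
   then show ?thesis using wt_denom_pos[of x] by (simp add: wt_def field_simps)
  qed
  then show ?thesis using deriv_cont[OF schwartz_deriv[OF sc]] by (simp add: pot_def)
 qed
 then show ?thesis using that by blast
qed

section \<open>Zero curvature and conservation\<close>

text \<open>v, V12, V21, -v are the entries of the second Lax matrix at spectral parameter \<mu>.
  The last clause gives v the same limit v0 at both ends of the line, so that the fluxes there
  cancel.\<close>

definition zc :: "real => (real => complex) => (real => complex) => (real => complex) => (real => complex) =>
  (real => complex) => (real => complex) => (real => complex) => real => bool" where
 "zc \<mu> q r qt rt V12 V21 v C \<longleftrightarrow>
   (\<forall>x. (V12 hvd (qt x + 2 * of_real \<mu> * V12 x - 2 * q x * v x)) (at x)) \<and>
   (\<forall>x. (V21 hvd (rt x - 2 * of_real \<mu> * V21 x + 2 * r x * v x)) (at x)) \<and>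
   (\<forall>x. (v hvd (q x * V21 x - r x * V12 x)) (at x)) \<and>
   (\<forall>x. cmod (V12 x) <= C * wt x) \<and> (\<forall>x. cmod (V21 x) <= C * wt x) \<and>
   (\<forall>x. cmod (qt x) <= C) \<and> (\<forall>x. cmod (rt x) <= C) \<and>
   (\<exists>v0. cmod v0 <= C \<and> (\<forall>x. cmod (v x - v0) <= C * wt x))"

lemma zc_nonneg: "zc \<mu> q r qt rt V12 V21 v C ==> 0 <= C"
 unfolding zc_def by (meson norm_ge_zero order_trans)

lemma zc_add:
 assumes A: "zc \<mu> q r qt rt V12 V21 v C" and B: "zc \<mu> q r qt' rt' V12' V21' v' C'"
 shows "zc \<mu> q r (\<lambda>x. qt x + qt' x) (\<lambda>x. rt x + rt' x) (\<lambda>x. V12 x + V12' x) (\<lambda>x. V21 x + V21' x) (\<lambda>x. v x + v' x) (C + C')"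
proof -
 obtain v0 v0' where v: "cmod v0 <= C" "\<forall>x. cmod (v x - v0) <= C * wt x" "cmod v0' <= C'" "\<forall>x. cmod (v' x - v0') <= C' * wt x"
  using A B by (auto simp: zc_def)
 have e: "v x + v' x - (v0 + v0') = (v x - v0) + (v' x - v0')" for x by simp
 show ?thesis unfolding zc_def distrib_right
 proof (intro conjI allI exI[of _ "v0 + v0'"])
  fix x
  show "((\<lambda>x. V12 x + V12' x) hvd qt x + qt' x + 2 * of_real \<mu> * (V12 x + V12' x) - 2 * q x * (v x + v' x)) (at x)"
   by (rule hvd_eq_rhs[OF hvd_add]) (use A B in \<open>auto simp: zc_def algebra_simps\<close>)
  show "((\<lambda>x. V21 x + V21' x) hvd rt x + rt' x - 2 * of_real \<mu> * (V21 x + V21' x) + 2 * r x * (v x + v' x)) (at x)"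
   by (rule hvd_eq_rhs[OF hvd_add]) (use A B in \<open>auto simp: zc_def algebra_simps\<close>)
  show "((\<lambda>x. v x + v' x) hvd q x * (V21 x + V21' x) - r x * (V12 x + V12' x)) (at x)"
   by (rule hvd_eq_rhs[OF hvd_add]) (use A B in \<open>auto simp: zc_def algebra_simps\<close>)
  show "cmod (v x + v' x - (v0 + v0')) <= C * wt x + C' * wt x" unfolding e using v by (intro cmod_add_le) auto
 qed (use A B v in \<open>auto simp: zc_def intro!: cmod_add_le\<close>)
qed

lemma zc_scale:
 assumes A: "zc \<mu> q r qt rt V12 V21 v C"
 shows "zc \<mu> q r (\<lambda>x. c * qt x) (\<lambda>x. c * rt x) (\<lambda>x. c * V12 x) (\<lambda>x. c * V21 x) (\<lambda>x. c * v x) (cmod c * C)"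
proof -
 obtain v0 where v: "cmod v0 <= C" "\<forall>x. cmod (v x - v0) <= C * wt x"
  using A by (auto simp: zc_def)
 have e: "c * v x - c * v0 = c * (v x - v0)" for x by (simp add: algebra_simps)
 show ?thesis unfolding zc_def mult.assoc
 proof (intro conjI allI exI[of _ "c * v0"])
  fix x
  show "((\<lambda>x. c * V12 x) hvd c * qt x + 2 * (of_real \<mu> * (c * V12 x)) - 2 * (q x * (c * v x))) (at x)"
   by (rule hvd_eq_rhs[OF hvd_mult_right]) (use A in \<open>auto simp: zc_def algebra_simps\<close>)
  show "((\<lambda>x. c * V21 x) hvd c * rt x - 2 * (of_real \<mu> * (c * V21 x)) + 2 * (r x * (c * v x))) (at x)"
   by (rule hvd_eq_rhs[OF hvd_mult_right]) (use A in \<open>auto simp: zc_def algebra_simps\<close>)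
  show "((\<lambda>x. c * v x) hvd q x * (c * V21 x) - r x * (c * V12 x)) (at x)"
   by (rule hvd_eq_rhs[OF hvd_mult_right]) (use A in \<open>auto simp: zc_def algebra_simps\<close>)
  show "cmod (c * v x - c * v0) <= cmod c * (C * wt x)" unfolding e using v by (intro cmod_mult_le) auto
 qed (use A v in \<open>auto simp: zc_def intro!: cmod_mult_le\<close>)
qed

text \<open>P and P' are the projective action of the second Lax matrix on the component ratios a
  and b. Zero curvature says that they solve the linearised Riccati equations, which identifies them
  as time derivatives. The final estimate is the cancellation of fluxes at the two ends.\<close>

lemma zc_ric:
 assumes z: "zc \<mu> q r qt rt V12 V21 v C" and a: "ric \<mu> q r (1/4) a" and b: "ricb \<mu> q r (1/4) b"
 defines "P \<equiv> \<lambda>x. V21 x - 2 * v x * a x - V12 x * (a x)^2" and "P' \<equiv> \<lambda>x. V12 x + 2 * v x * b x - V21 x * (b x)^2"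
 shows "(P hvd (- (2 * of_real \<mu> + 2 * q x * a x) * P x + (rt x - qt x * (a x)^2))) (at x)" "cmod (P x) <= 4 * C"
  "(P' hvd ((2 * of_real \<mu> - 2 * r x * b x) * P' x + (qt x - rt x * (b x)^2))) (at x)" "cmod (P' x) <= 4 * C"
  "((\<lambda>x. v x + V12 x * a x) hvd (qt x * a x + q x * P x)) (at x)"
  "((\<lambda>x. - v x + V21 x * b x) hvd (rt x * b x + r x * P' x)) (at x)"
  "cmod ((v x + V12 x * a x) - (v (- x) + V12 (- x) * a (- x))) <= 3 * C * wt x"
proof -
 have V: "(V12 hvd (qt x + 2 * of_real \<mu> * V12 x - 2 * q x * v x)) (at x)"
  "(V21 hvd (rt x - 2 * of_real \<mu> * V21 x + 2 * r x * v x)) (at x)"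
  "(v hvd (q x * V21 x - r x * V12 x)) (at x)"
  using z by (auto simp: zc_def)
 note da = ricD[OF a, of x] note db = ricbD[OF b, of x]
 have sq: "((\<lambda>x. (f x)^2) hvd 2 * f x * D) (at x)" if "(f hvd D) (at x)" for f :: "real => complex" and D
  unfolding power2_eq_square by (rule hvd_eq_rhs[OF hvd_mult[OF that that]]) simp
 show "(P hvd (- (2 * of_real \<mu> + 2 * q x * a x) * P x + (rt x - qt x * (a x)^2))) (at x)"
  unfolding P_def
  by (rule hvd_eq_rhs[OF hvd_diff[OF hvd_diff[OF V(2)
    hvd_mult[OF hvd_mult_right[OF V(3)] da]] hvd_mult[OF V(1) sq[OF da]]]])
   (simp add: algebra_simps power2_eq_square)
 show "(P' hvd ((2 * of_real \<mu> - 2 * r x * b x) * P' x + (qt x - rt x * (b x)^2))) (at x)"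
  unfolding P'_def
  by (rule hvd_eq_rhs[OF hvd_diff[OF hvd_add[OF V(1)
    hvd_mult[OF hvd_mult_right[OF V(3)] db]] hvd_mult[OF V(2) sq[OF db]]]])
   (simp add: algebra_simps power2_eq_square)
 show "((\<lambda>x. v x + V12 x * a x) hvd (qt x * a x + q x * P x)) (at x)" unfolding P_def
  by (rule hvd_eq_rhs[OF hvd_add[OF V(3) hvd_mult[OF V(1) da]]])
   (simp add: algebra_simps power2_eq_square)
 show "((\<lambda>x. - v x + V21 x * b x) hvd (rt x * b x + r x * P' x)) (at x)" unfolding P'_def
  by (rule hvd_eq_rhs[OF hvd_add[OF hvd_minus[OF V(3)] hvd_mult[OF V(2) db]]])
   (simp add: algebra_simps power2_eq_square)
 have C: "0 <= C" by (rule zc_nonneg[OF z])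
 obtain v0 where v0: "cmod v0 <= C" "\<And>x. cmod (v x - v0) <= C * wt x" using z by (auto simp: zc_def)
 have V12: "cmod (V12 x) <= C * wt x" and V21: "cmod (V21 x) <= C * wt x" for x using z by (auto simp: zc_def)
 have w: "C * wt x <= C" for x using mult_left_mono[OF wt_le_1[of x] C] by simp
 have vb: "cmod (2 * v x) <= 4 * C"
  using norm_triangle_sub[of "v x" v0] v0(1) v0(2)[of x] w[of x] by (simp add: norm_mult)
 have *: "cmod (y - 2 * v x * c - y' * c^2) <= 4 * C" if "cmod c <= 1/4" "cmod y <= C" "cmod y' <= C" for c y y'
  using order_trans[OF cmod_diff_le[OF cmod_diff_le[OF that(2) cmod_mult_le[OF vb that(1)]] cmod_mult_le[OF that(3) cmod_sq_le[OF that(1)]]], of "4 * C"] C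
  by (simp add: power2_eq_square)
 show "cmod (P x) <= 4 * C"
  unfolding P_def using *[OF ric_le[OF a, of x] order_trans[OF V21[of x] w] order_trans[OF V12[of x] w]] .
 show "cmod (P' x) <= 4 * C"
  unfolding P'_def using *[of "- b x" "V12 x" "V21 x"] ricb_le[OF b, of x] order_trans[OF V12[of x] w] order_trans[OF V21[of x] w] by simp
 have "(v x + V12 x * a x) - (v (- x) + V12 (- x) * a (- x)) = ((v x - v0) - (v (- x) - v0)) + (V12 x * a x - V12 (- x) * a (- x))" by simp
 also have "cmod \<dots> <= (C * wt x + C * wt (- x)) + (C * wt x * (1/4) + C * wt (- x) * (1/4))"
  by (intro cmod_add_le cmod_diff_le cmod_mult_le v0(2) V12 ric_le[OF a])
 also have "\<dots> <= 3 * C * wt x" using C wt_pos[of x] by (simp add: less_imp_le)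
 finally show "cmod ((v x + V12 x * a x) - (v (- x) + V12 (- x) * a (- x))) <= 3 * C * wt x" .
qed

section \<open>Calculus of uniform time derivatives\<close>

lemma udiff_mult:
 assumes f: "udiff f f' t" and g: "udiff g g' t" and K: "\<And>x. cmod (f t x) <= K" "\<And>x. cmod (g t x) <= K" "\<And>x. cmod (f' x) <= K" "\<And>x. cmod (g' x) <= K"
 shows "udiff (\<lambda>\<tau> x. f \<tau> x * g \<tau> x) (\<lambda>x. f' x * g t x + f t x * g' x) t"
 unfolding udiff_def
proof (intro allI impI)
 fix e :: real assume e: "0 < e"
 have K0: "0 <= K" using order_trans[OF norm_ge_zero K(1)] .
 define e1 where "e1 = e / (2 * (3 * K + 1))"
 have e1: "0 < e1" using e K0 by (simp add: e1_def)
 obtain d1 where d1: "0 < d1" "\<And>\<tau> x. \<bar>\<tau> - t\<bar> < d1 ==> cmod (f \<tau> x - f t x - of_real (\<tau> - t) * f' x) <= e1 * \<bar>\<tau> - t\<bar>"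
  using f e1 unfolding udiff_def by blast
 obtain d2 where d2: "0 < d2" "\<And>\<tau> x. \<bar>\<tau> - t\<bar> < d2 ==> cmod (g \<tau> x - g t x - of_real (\<tau> - t) * g' x) <= e1 * \<bar>\<tau> - t\<bar>"
  using g e1 unfolding udiff_def by blast
 obtain d3 where d3: "0 < d3" "\<And>\<tau> x. \<bar>\<tau> - t\<bar> < d3 ==> cmod (g \<tau> x - g t x) <= (K + 1) * \<bar>\<tau> - t\<bar>"
  using udiff_lipschitz[OF g K(4)] by blast
 define d where "d = Min {d1, d2, d3, 1, e / (2 * (K * (K + 1) + 1))}"
 have d: "0 < d" "d <= d1" "d <= d2" "d <= d3" "d <= 1" "d <= e / (2 * (K * (K + 1) + 1))"
  using d1 d2 d3 e K0 by (auto simp: d_def intro!: divide_pos_pos add_nonneg_pos)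
 have "cmod (f \<tau> x * g \<tau> x - f t x * g t x - of_real (\<tau> - t) * (f' x * g t x + f t x * g' x)) <= e * \<bar>\<tau> - t\<bar>" if \<tau>: "\<bar>\<tau> - t\<bar> < d" for \<tau> x
 proof -
  define h where "h = \<bar>\<tau> - t\<bar>"
  have h: "0 <= h" "h <= 1" "h <= e / (2 * (K * (K + 1) + 1))" using \<tau> d by (auto simp: h_def)
  have gd: "cmod (g \<tau> x - g t x) <= (K + 1) * h" using d3(2)[of \<tau> x] \<tau> d by (simp add: h_def)
  have gb: "cmod (g \<tau> x) <= 2 * K + 1"
  proof -
   have "cmod (g \<tau> x) <= K + (K + 1) * h" using norm_triangle_sub[of "g \<tau> x" "g t x"] gd K(2)[of x] by linarith
   also have "\<dots> <= K + (K + 1) * 1" using K0 h by (intro add_left_mono mult_left_mono) auto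
   finally show ?thesis by simp
  qed
  have "f \<tau> x * g \<tau> x - f t x * g t x - of_real (\<tau> - t) * (f' x * g t x + f t x * g' x)
   = (f \<tau> x - f t x - of_real (\<tau> - t) * f' x) * g \<tau> x + f t x * (g \<tau> x - g t x - of_real (\<tau> - t) * g' x)
    + of_real (\<tau> - t) * f' x * (g \<tau> x - g t x)" by (simp add: algebra_simps)
  also have "cmod \<dots> <= e1 * h * (2 * K + 1) + K * (e1 * h) + h * K * ((K + 1) * h)"
   using d1(2)[of \<tau> x] d2(2)[of \<tau> x] \<tau> d gd gb K
   by (intro cmod_add_le cmod_mult_le) (auto simp: h_def)
  also have "\<dots> = h * (e1 * (3 * K + 1) + K * (K + 1) * h)" by (simp add: algebra_simps)
  also have "\<dots> <= h * (e / 2 + e / 2)"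
  proof (intro mult_left_mono add_mono)
   show "e1 * (3 * K + 1) <= e / 2" using K0 by (simp add: e1_def field_simps)
   have "K * (K + 1) * h <= (K * (K + 1) + 1) * (e / (2 * (K * (K + 1) + 1)))"
    using h K0 by (intro mult_mono) (auto intro!: add_nonneg_nonneg)
   also have "\<dots> = e / 2"
   proof -
    have "0 < K * (K + 1) + 1" using K0 by (intro add_nonneg_pos) auto
    moreover have "Y * (e / (2 * Y)) = e / 2" if "0 < Y" for Y using that by simp
    ultimately show ?thesis by blast
   qed
   finally show "K * (K + 1) * h <= e / 2" .
  qed (use h in auto)
  finally show ?thesis by (simp add: h_def mult.commute)
 qed
 then show "\<exists>d>0. \<forall>\<tau>. \<bar>\<tau> - t\<bar> < d --> (\<forall>x. cmod (f \<tau> x * g \<tau> x - f t x * g t x - of_real (\<tau> - t) * (f' x * g t x + f t x * g' x)) <= e * \<bar>\<tau> - t\<bar>)"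
  using d(1) by blast
qed

lemma udiff_integral:
 assumes f: "udiff f f' t" and d0: "0 < d0" and fi: "\<And>\<tau>. \<bar>\<tau> - t\<bar> < d0 ==> f \<tau> integrable_on {u..w}"
  and I: "(f' has_integral I) {u..w}" and uw: "u <= w"
 shows "((\<lambda>\<tau>. integral {u..w} (f \<tau>)) hvd I) (at t)"
proof -
 have "udiff (\<lambda>\<tau> _. integral {u..w} (f \<tau>)) (\<lambda>_. I) t"
  unfolding udiff_def
 proof (intro allI impI)
  fix e :: real assume e: "0 < e"
  define e1 where "e1 = e / (w - u + 1)"
  have e1: "0 < e1" using e uw by (simp add: e1_def)
  obtain d where d: "0 < d" "\<And>\<tau> x. \<bar>\<tau> - t\<bar> < d ==> cmod (f \<tau> x - f t x - of_real (\<tau> - t) * f' x) <= e1 * \<bar>\<tau> - t\<bar>"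
   using f e1 unfolding udiff_def by blast
  have "cmod (integral {u..w} (f \<tau>) - integral {u..w} (f t) - of_real (\<tau> - t) * I) <= e * \<bar>\<tau> - t\<bar>" if \<tau>: "\<bar>\<tau> - t\<bar> < min d d0" for \<tau>
  proof -
   have "((\<lambda>x. f \<tau> x - f t x - of_real (\<tau> - t) * f' x) has_integral (integral {u..w} (f \<tau>) - integral {u..w} (f t) - of_real (\<tau> - t) * I)) {u..w}"
    using \<tau> d0 by (intro has_integral_diff has_integral_mult_right integrable_integral fi I) auto
   from has_integral_bound_real[OF _ finite.emptyI this, where B = "e1 * \<bar>\<tau> - t\<bar>"]
   have "cmod (integral {u..w} (f \<tau>) - integral {u..w} (f t) - of_real (\<tau> - t) * I) <= e1 * \<bar>\<tau> - t\<bar> * measure lborel {u..w}"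
    using d(2) \<tau> e1 by auto
   also have "\<dots> = (e1 * (w - u)) * \<bar>\<tau> - t\<bar>" using uw by simp
   also have "\<dots> <= e * \<bar>\<tau> - t\<bar>"
   proof (rule mult_right_mono)
    show "e1 * (w - u) <= e" using e uw by (simp add: e1_def field_simps)
   qed simp
   finally show ?thesis .
  qed
  then show "\<exists>d>0. \<forall>\<tau>. \<bar>\<tau> - t\<bar> < d --> (\<forall>x::real. cmod (integral {u..w} (f \<tau>) - integral {u..w} (f t) - of_real (\<tau> - t) * I) <= e * \<bar>\<tau> - t\<bar>)"
   using d(1) d0 by (intro exI[of _ "min d d0"]) auto
 qed
 from udiff_pointwise[OF this] show ?thesis .
qed

lemma udiff_cj: assumes "udiff f f' t" "\<sigma> = 1 \<or> \<sigma> = - 1" shows "udiff (\<lambda>\<tau>. cj \<sigma> (f \<tau>)) (cj \<sigma> f') t"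
proof -
 have "cmod (cj \<sigma> (f \<tau>) x - cj \<sigma> (f t) x - of_real (\<tau> - t) * cj \<sigma> f' x) = cmod (f \<tau> x - f t x - of_real (\<tau> - t) * f' x)" for \<tau> x
 proof -
  have "cj \<sigma> (f \<tau>) x - cj \<sigma> (f t) x - of_real (\<tau> - t) * cj \<sigma> f' x = of_real \<sigma> * cnj (f \<tau> x - f t x - of_real (\<tau> - t) * f' x)"
   by (simp add: algebra_simps)
  then show ?thesis using assms(2) by (auto simp: norm_mult simp del: complex_cnj_diff)
 qed
 then show ?thesis using assms(1) unfolding udiff_def by simp
qed

lemma vector_deriv_bound:
 fixes F :: "real => complex"
 assumes "\<And>\<tau>. \<bar>\<tau> - z\<bar> < S ==> (F hvd F' \<tau>) (at \<tau>)" "\<And>\<tau>. \<bar>\<tau> - z\<bar> < S ==> cmod (F' \<tau>) <= B"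
  and "\<bar>t - z\<bar> < S" "0 < S"
 shows "cmod (F t - F z) <= B * \<bar>t - z\<bar>"
proof -
 have "norm (F t - F z) <= B * norm (t - z)"
 proof (rule differentiable_bound[where S = "{z - S<..<z + S}" and f' = "\<lambda>\<tau> h. h *\<^sub>R F' \<tau>"])
  show "(F has_derivative (\<lambda>h. h *\<^sub>R F' \<tau>)) (at \<tau> within {z - S<..<z + S})" if "\<tau> \<in> {z - S<..<z + S}" for \<tau>
   using assms(1)[of \<tau>] that by (auto simp: hvd_def abs_less_iff intro: has_derivative_at_withinI)
  show "onorm (\<lambda>h. h *\<^sub>R F' \<tau>) <= B" if "\<tau> \<in> {z - S<..<z + S}" for \<tau>
  proof (rule onorm_le)
   show "norm (h *\<^sub>R F' \<tau>) <= B * norm h" for h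
    using mult_right_mono[OF assms(2)[of \<tau>], of "\<bar>h\<bar>"] that by (simp add: mult.commute abs_less_iff)
  qed
 qed (use assms in \<open>auto simp: abs_less_iff\<close>)
 then show ?thesis by simp
qed

text \<open>The mean value inequality: pointwise derivatives that are continuous at t uniformly in x
  give a uniform derivative.\<close>

lemma udiff_MVT:
 assumes d: "0 < d" and D: "\<And>\<tau> x. \<bar>\<tau> - t\<bar> < d ==> ((\<lambda>\<tau>. f \<tau> x) hvd f' \<tau> x) (at \<tau>)"
  and c: "\<And>e. 0 < e ==> \<exists>d>0. \<forall>\<tau>. \<bar>\<tau> - t\<bar> < d --> (\<forall>x. cmod (f' \<tau> x - f' t x) <= e)"
 shows "udiff f (f' t) t"
 unfolding udiff_def
proof (intro allI impI)
 fix e :: real assume "0 < e"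
 then obtain d' where d': "0 < d'" "\<And>\<tau> x. \<bar>\<tau> - t\<bar> < d' ==> cmod (f' \<tau> x - f' t x) <= e" using c by blast
 have "cmod (f \<tau> x - f t x - of_real (\<tau> - t) * f' t x) <= e * \<bar>\<tau> - t\<bar>" if \<tau>: "\<bar>\<tau> - t\<bar> < min d d'" for \<tau> x
 proof -
  have "((\<lambda>\<tau>. f \<tau> x - (\<tau> - t) *\<^sub>R f' t x) hvd (f' \<tau>' x - f' t x)) (at \<tau>')" if "\<bar>\<tau>' - t\<bar> < min d d'" for \<tau>'
  proof (intro hvd_diff D)
   show "((\<lambda>\<tau>. (\<tau> - t) *\<^sub>R f' t x) hvd f' t x) (at \<tau>')"
    unfolding hvd_def by (auto intro!: derivative_eq_intros)
  qed (use that in simp)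
  from vector_deriv_bound[OF this, where B = e and t = \<tau> and z = t and S = "min d d'"] d' \<tau> d
  have "cmod (f \<tau> x - (\<tau> - t) *\<^sub>R f' t x - (f t x - (t - t) *\<^sub>R f' t x)) <= e * \<bar>\<tau> - t\<bar>" by auto
  then show ?thesis by (simp add: scaleR_conv_of_real algebra_simps)
 qed
 then show "\<exists>d>0. \<forall>\<tau>. \<bar>\<tau> - t\<bar> < d --> (\<forall>x. cmod (f \<tau> x - f t x - of_real (\<tau> - t) * f' t x) <= e * \<bar>\<tau> - t\<bar>)"
  using d d'(1) by (intro exI[of _ "min d d'"]) auto
qed

section \<open>The continuity argument in time\<close>

text \<open>\<open>ud\<close> and \<open>zcx\<close> are conditional on \<open>good\<close> because
  the vector field of a difference flow contains the Green's function. \<open>kx\<close> is the pole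
  of the second Lax matrix, and C in \<open>zcx\<close> is uniform on compact time
  intervals.\<close>

locale flow =
 fixes \<sigma> s \<delta> kx :: real and q qt :: "real => real => complex"
 assumes \<sigma>: "\<sigma> = 1 \<or> \<sigma> = - 1" and s: "- 1 / 2 < s" "s < 0"
  and q: "schwartz_curve q" and H: "Hs_norm s (q 0) <= \<delta>" and small: "small_enough s \<delta>"
  and ud: "\<And>t d. 0 < d ==> (\<And>\<tau>. \<bar>\<tau> - t\<bar> < d ==> good (1/4) \<sigma> (q \<tau>)) ==> udiff q (qt t) t"
  and zcx: "\<And>T \<mu>. 1 <= \<mu> ==> \<mu> \<noteq> kx ==> \<exists>C. \<forall>t. \<bar>t\<bar> <= T --> good (1/4) \<sigma> (q t) -->
    (\<exists>V12 V21 v. zc \<mu> (q t) (cj \<sigma> (q t)) (qt t) (cj \<sigma> (qt t)) V12 V21 v C)"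
begin

lemma q_pot: obtains M where "\<And>t. \<bar>t\<bar> <= T ==> pot M (q t)"
 using schwartz_curve_pot[OF q, of T 0] by auto

lemma s1: "\<bar>\<sigma>\<bar> = 1" using \<sigma> by auto

lemma udiff_a:
 assumes k: "1 <= k" and d: "0 < d"
  and a: "\<And>\<tau>. \<bar>\<tau> - t\<bar> < d ==> good (1/4) \<sigma> (q \<tau>)" "\<And>\<tau>. \<bar>\<tau> - t\<bar> < d ==> ric k (q \<tau>) (cj \<sigma> (q \<tau>)) (1/4) (a \<tau>)"
  and b: "\<And>\<tau>. \<bar>\<tau> - t\<bar> < d ==> ricb k (q \<tau>) (cj \<sigma> (q \<tau>)) (1/4) (b \<tau>)"
  and z: "zc k (q t) (cj \<sigma> (q t)) (qt t) (cj \<sigma> (qt t)) V12 V21 v C"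
 shows "udiff a (\<lambda>x. V21 x - 2 * v x * a t x - V12 x * (a t x)^2) t"
  "udiff b (\<lambda>x. V12 x + 2 * v x * b t x - V21 x * (b t x)^2) t"
  "udiff q (qt t) t" "udiff (\<lambda>\<tau>. cj \<sigma> (q \<tau>)) (cj \<sigma> (qt t)) t"
proof -
 obtain M where M: "pot M (q t)" using q_pot[of "\<bar>t\<bar>"] by auto
 have C: "0 <= C" by (rule zc_nonneg[OF z])
 have qt: "cmod (qt t x) <= 4 * C" "cmod (cj \<sigma> (qt t) x) <= 4 * C" for x
 proof -
  have "cmod (qt t x) <= C" "cmod (cj \<sigma> (qt t) x) <= C" using z by (auto simp: zc_def)
  then show "cmod (qt t x) <= 4 * C" "cmod (cj \<sigma> (qt t) x) <= 4 * C" using C by linarith+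
 qed
 have at: "ric k (q t) (cj \<sigma> (q t)) (1/4) (a t)" and bt: "ricb k (q t) (cj \<sigma> (q t)) (1/4) (b t)" using a b d by auto
 note Z = zc_ric[OF z at bt]
 show u: "udiff q (qt t) t" by (rule ud[OF d a(1)])
 show u': "udiff (\<lambda>\<tau>. cj \<sigma> (q \<tau>)) (cj \<sigma> (qt t)) t" by (rule udiff_cj[OF u \<sigma>])
 show "udiff a (\<lambda>x. V21 x - 2 * v x * a t x - V12 x * (a t x)^2) t"
  by (rule udiff_ric[OF k M u u' qt d a(2) Z(1,2)])
 show "udiff b (\<lambda>x. V12 x + 2 * v x * b t x - V21 x * (b t x)^2) t"
  by (rule udiff_ricb[OF k pot_cnj[OF M s1] u u' qt d b Z(3,4)])
qed

text \<open>On [-X, X] the time derivative of the integral of q a is a difference of fluxes, at most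
  3 C \<open>wt X\<close>. As X grows it disappears, and the energy bound is carried over directly
  from time 0.\<close>

lemma en_conserved:
 assumes g: "\<And>\<tau>. \<bar>\<tau>\<bar> < S ==> good (1/4) \<sigma> (q \<tau>)" and k: "1 <= k" "k \<noteq> kx" and t: "\<bar>t\<bar> < S"
  and at: "ric k (q t) (cj \<sigma> (q t)) (1/4) a'"
 shows "en k a' (2 * (enK (2 + 2 * s) * (2 * \<delta>^2)) * k powr (- (1 + 2 * s)))"
proof -
 obtain M where M: "\<And>t. \<bar>t\<bar> <= S ==> pot M (q t)" using q_pot[of S] by blast
 have S: "0 < S" using t by linarith
 obtain C where C: "\<And>t. \<bar>t\<bar> <= S ==> good (1/4) \<sigma> (q t) ==>
    (\<exists>V12 V21 v. zc k (q t) (cj \<sigma> (q t)) (qt t) (cj \<sigma> (qt t)) V12 V21 v C)" using zcx[OF k, of S] by blast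
 have "\<forall>\<tau>. \<exists>a. \<bar>\<tau>\<bar> < S --> ric k (q \<tau>) (cj \<sigma> (q \<tau>)) (1/4) a" using g k(1) by (auto simp: good_def)
 then obtain a where a: "\<And>\<tau>. \<bar>\<tau>\<bar> < S ==> ric k (q \<tau>) (cj \<sigma> (q \<tau>)) (1/4) (a \<tau>)" by metis
 have "\<forall>\<tau>. \<exists>b. \<bar>\<tau>\<bar> < S --> ricb k (q \<tau>) (cj \<sigma> (q \<tau>)) (1/4) b" using g k(1) by (auto simp: good_def)
 then obtain b where b: "\<And>\<tau>. \<bar>\<tau>\<bar> < S ==> ricb k (q \<tau>) (cj \<sigma> (q \<tau>)) (1/4) (b \<tau>)" by metis
 have a': "a' = a t" by (rule ric_unique[OF k(1) M at a[OF t]]) (use t in simp)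
 have R: "riccati \<sigma> k M (q \<tau>) (a \<tau>)" if "\<bar>\<tau>\<bar> < S" for \<tau>
  using \<sigma> k(1) M[of \<tau>] a[OF that] that by unfold_locales auto
 have int: "(\<lambda>x. q \<tau> x * a \<tau> x) integrable_on {u..w}" if "\<bar>\<tau>\<bar> < S" for \<tau> u w
  by (rule riccati.qa_integrable[OF R[OF that]])
 have der: "\<exists>D. ((\<lambda>\<tau>. integral {-X..X} (\<lambda>x. q \<tau> x * a \<tau> x)) hvd D) (at \<tau>) \<and> cmod D <= 3 * C * wt X"
  if \<tau>: "\<bar>\<tau>\<bar> < S" and X: "0 <= X" for \<tau> X
 proof -
  define d where "d = S - \<bar>\<tau>\<bar>"
  have d: "0 < d" "\<And>\<tau>'. \<bar>\<tau>' - \<tau>\<bar> < d ==> \<bar>\<tau>'\<bar> < S" using \<tau> by (auto simp: d_def)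
  obtain V12 V21 v where z: "zc k (q \<tau>) (cj \<sigma> (q \<tau>)) (qt \<tau>) (cj \<sigma> (qt \<tau>)) V12 V21 v C"
   using C[of \<tau>] g[OF \<tau>] \<tau> by auto
  note U = udiff_a[OF k(1) d(1) g a b z, OF d(2) d(2) d(2)]
  note Z = zc_ric[OF z a[OF \<tau>] b[OF \<tau>]]
  have C0: "0 <= C" by (rule zc_nonneg[OF z])
  have Mt: "pot M (q \<tau>)" using M \<tau> by simp
  have K: "cmod (q \<tau> x) <= M + 1 + 4 * C" "cmod (a \<tau> x) <= M + 1 + 4 * C" "cmod (qt \<tau> x) <= M + 1 + 4 * C"
   "cmod (V21 x - 2 * v x * a \<tau> x - V12 x * (a \<tau> x)^2) <= M + 1 + 4 * C" for x
  proof -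
   have "cmod (qt \<tau> x) <= C" using z by (auto simp: zc_def)
   then show "cmod (q \<tau> x) <= M + 1 + 4 * C" "cmod (a \<tau> x) <= M + 1 + 4 * C" "cmod (qt \<tau> x) <= M + 1 + 4 * C"
    "cmod (V21 x - 2 * v x * a \<tau> x - V12 x * (a \<tau> x)^2) <= M + 1 + 4 * C"
    using C0 pot_nonneg[OF Mt] pot_bound1[OF Mt, of x] ric_le[OF a[OF \<tau>], of x] Z(2)[of x] by linarith+
  qed
  note P = udiff_mult[OF U(3) U(1) K]
  let ?J = "\<lambda>x. v x + V12 x * a \<tau> x"
  have "((\<lambda>x. qt \<tau> x * a \<tau> x + q \<tau> x * (V21 x - 2 * v x * a \<tau> x - V12 x * (a \<tau> x)^2)) has_integral (?J X - ?J (- X))) {-X..X}"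
   using X by (intro fundamental_theorem_of_calculus hvd_at_within[OF Z(5)]) auto
  from udiff_integral[OF P d(1) int[OF d(2)] this] X
  show ?thesis using Z(7)[of X] by (intro exI[of _ "?J X - ?J (- X)"]) auto
 qed
 have diff: "cmod (integral {-X..X} (\<lambda>x. q t x * a t x) - integral {-X..X} (\<lambda>x. q 0 x * a 0 x)) <= 3 * C * wt X * \<bar>t\<bar>" if X: "0 <= X" for X
 proof -
  obtain D where D: "\<And>\<tau>. \<bar>\<tau>\<bar> < S ==> ((\<lambda>\<tau>. integral {-X..X} (\<lambda>x. q \<tau> x * a \<tau> x)) hvd D \<tau>) (at \<tau>)"
   "\<And>\<tau>. \<bar>\<tau>\<bar> < S ==> cmod (D \<tau>) <= 3 * C * wt X" using der[OF _ X] by metis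
  show ?thesis using vector_deriv_bound[of 0 S "\<lambda>\<tau>. integral {-X..X} (\<lambda>x. q \<tau> x * a \<tau> x)" D "3 * C * wt X" t] D S t by simp
 qed
 have lim: "((\<lambda>X. Re (integral {-X..X} (\<lambda>x. q t x * a t x)) - Re (integral {-X..X} (\<lambda>x. q 0 x * a 0 x))) \<longlongrightarrow> 0) at_top"
 proof (rule Lim_null_comparison)
  show "\<forall>\<^sub>F X in at_top. norm (Re (integral {-X..X} (\<lambda>x. q t x * a t x)) - Re (integral {-X..X} (\<lambda>x. q 0 x * a 0 x))) <= 3 * C * wt X * \<bar>t\<bar>"
   using eventually_ge_at_top[of 0]
  proof eventually_elim
   case (elim X)
   show ?case using order_trans[OF abs_Re_le_cmod diff[OF elim]] by simp
  qed
  have "(wt \<longlongrightarrow> 0) at_top" unfolding wt_def by real_asymp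
  then have "((\<lambda>X. 3 * C * wt X * \<bar>t\<bar>) \<longlongrightarrow> 3 * C * 0 * \<bar>t\<bar>) at_top" by (intro tendsto_intros)
  then show "((\<lambda>X. 3 * C * wt X * \<bar>t\<bar>) \<longlongrightarrow> 0) at_top" by simp
 qed
 have M0: "pot M (q 0)" using M[of 0] S by simp
 have a0: "ric k (q 0) (cj \<sigma> (q 0)) (1/4) (a 0)" using a[of 0] S by simp
 have R0: "riccati \<sigma> k M (q 0) (a 0)" using R[of 0] S by simp
 show ?thesis unfolding a'
  using energy_transfer[OF R0 R[OF t] lim static_en[OF \<sigma> s M0 k(1) a0 H]] by (simp add: mult_ac)
qed

lemma all_good: "good (1/8) \<sigma> (q t)"
proof -
 define T where "T = \<bar>t\<bar>"
 obtain M where M: "\<And>t. \<bar>t\<bar> <= T + 1 ==> pot M (q t)" using q_pot[of "T + 1"] by blast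
 have T: "0 <= T" by (simp add: T_def)
 have M0: "pot M (q 0)" using M[of 0] T by simp
 obtain e where e: "0 < e" and st:
  "\<And>q q'. [|pot M q; continuous_on UNIV q'; \<And>x. cmod (q' x - q x) <= e; good (1/8) \<sigma> q|] ==> good (1/4) \<sigma> q'"
  using good_stable[OF pot_nonneg[OF M0] \<sigma>] by blast
 have uc: "ucurve q" using schwartz_curve_ucurve[OF q, of 0 0] by simp
 obtain d0 where d0: "0 < d0" "\<And>t \<tau> x. \<bar>t\<bar> <= T + 1 ==> \<bar>\<tau>\<bar> <= T + 1 ==> \<bar>\<tau> - t\<bar> < d0 ==> cmod (q \<tau> x - q t x) <= e"
  using ucurve_compact(2)[OF uc e, of "T + 1"] by blast
 define d where "d = min d0 1"
 have d: "0 < d" "d <= 1" "d <= d0" using d0(1) by (auto simp: d_def)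
 have main: "good (1/8) \<sigma> (q t)" if "\<bar>t\<bar> <= T" "\<bar>t\<bar> <= real n * (d / 2)" for t n using that
 proof (induction n arbitrary: t)
  case 0
  then show ?case using good_initial[OF \<sigma> s M0 H small] by simp
 next
  case (Suc n)
  \<comment> \<open>Steps of length d / 2, half the reach of stability: \<open>good\<close> then
    holds on the open interval of radius m + d, which contains the new t in its interior, as
    differentiation at t demands.\<close>
  define m where "m = min T (real n * (d / 2))"
  have m: "0 <= m" "m <= T" "m <= real n * (d / 2)" using T d by (auto simp: m_def)
  have g: "good (1/4) \<sigma> (q \<tau>)" if \<tau>: "\<bar>\<tau>\<bar> < m + d" for \<tau>
  proof -
   define t0 where "t0 = max (- m) (min m \<tau>)"
   have t0: "\<bar>t0\<bar> <= m" "\<bar>\<tau> - t0\<bar> < d" using m \<tau> d by (auto simp: t0_def)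
   have "good (1/8) \<sigma> (q t0)" by (rule Suc.IH) (use t0 m in auto)
   moreover have "cmod (q \<tau> x - q t0 x) <= e" for x
    by (rule d0(2)) (use t0 m \<tau> d in auto)
   moreover have "pot M (q t0)" "pot M (q \<tau>)" using t0 m \<tau> d by (auto intro!: M)
   ultimately show ?thesis by (intro st[of "q t0"]) (auto intro: pot_cont)
  qed
  have tS: "\<bar>t\<bar> < m + d"
  proof (cases "T <= real n * (d / 2)")
   case True then show ?thesis using Suc.prems d by (simp add: m_def)
  next
   case False then show ?thesis using Suc.prems d by (simp add: m_def algebra_simps)
  qed
  show ?case
  proof (rule good_improve[OF \<sigma> M g[OF tS], where \<epsilon> = "1 + 2 * s" and kx = kx])
   show "sqrt (12 * (2 * (enK (2 + 2 * s) * (2 * \<delta>^2)))) / (1 - 2 powr (- (1 + 2 * s) / 2)) <= 1 / 8"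
    using small by (simp add: small_enough_def)
   show "en k a (2 * (enK (2 + 2 * s) * (2 * \<delta>^2)) * k powr (- (1 + 2 * s)))"
    if "1 <= k" "k \<noteq> kx" "ric k (q t) (cj \<sigma> (q t)) (1/4) a" for k a
    by (rule en_conserved[OF g that(1,2) tS that(3)])
  qed (use s Suc.prems in auto)
 qed
 obtain n :: nat where "T / (d / 2) < real n" using reals_Archimedean2 by blast
 then have "T <= real n * (d / 2)" using d by (simp add: field_simps)
 then show ?thesis by (intro main[of t n]) (auto simp: T_def)
qed

end

section \<open>From Riccati solutions to densities\<close>

lemma good_jost:
 assumes \<sigma>: "\<sigma> = 1 \<or> \<sigma> = - 1" and q: "pot M q" and g: "good (1/4) \<sigma> q" and k: "1 <= k"
 obtains a b where "jost k M q (cj \<sigma> q) a b" "jost k M (cj \<sigma> q) q (cj \<sigma> a) (cj \<sigma> b)"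
  "ric k q (cj \<sigma> q) (1/4) a" "ricb k q (cj \<sigma> q) (1/4) b"
proof -
 have s1: "\<bar>\<sigma>\<bar> = 1" using \<sigma> by auto
 obtain a b where ab: "ric k q (cj \<sigma> q) (1/4) a" "ricb k q (cj \<sigma> q) (1/4) b" using g k by (auto simp: good_def)
 note r = pot_cnj[OF q s1]
 have "jost k M q (cj \<sigma> q) a b" using k q r ab by unfold_locales
 moreover have "jost k M (cj \<sigma> q) q (cj \<sigma> a) (cj \<sigma> b)"
  using k q r ric_cnj[OF ab(1) s1] ricb_cnj[OF ab(2) s1] by unfold_locales
 ultimately show ?thesis using that ab by blast
qed

lemma good_has_green:
 assumes \<sigma>: "\<sigma> = 1 \<or> \<sigma> = - 1" and q: "pot M q" and g: "good (1/4) \<sigma> q" and k: "1 <= \<bar>k\<bar>"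
 shows "has_green q (cj \<sigma> q) k"
proof (cases "0 <= k")
 case True
 then show ?thesis using good_jost[OF \<sigma> q g, of k] green_pos(1) k by (metis abs_of_nonneg)
next
 case False
 then have "1 <= - k" using k by simp
 then obtain a b where "jost (- k) M (cj \<sigma> q) q (cj \<sigma> a) (cj \<sigma> b)" using good_jost[OF \<sigma> q g] by metis
 from green_neg(1)[OF this] show ?thesis by simp
qed

text \<open>2 + \<gamma> = 2 / (1 - a b), so the denominators cancel and quotients by 2 + \<gamma>
  become linear in a and b.\<close>

lemma cancel_pair:
 assumes "1 - a * b \<noteq> (0 :: complex)"
 shows "(y * (a / (1 - a * b)) + z * (b / (1 - a * b))) / (2 + 2 * (a * b) / (1 - a * b)) = (y * a + z * b) / 2"
proof -
 have "2 + 2 * (a * b) / (1 - a * b) = 2 / (1 - a * b)" using assms by (simp add: field_simps)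
 moreover have "y * (a / w) + z * (b / w) = (y * a + z * b) / w" for w by (simp add: add_divide_distrib)
 ultimately show ?thesis using assms by simp
qed

lemma jost_rho:
 assumes J: "jost k M q r a b"
 shows "(y * g21 q r k x + z * g12 q r k x) / (2 + gam q r k x) = (y * a x + z * b x) / 2"
  "rho q r k x = (q x * a x - r x * b x) / 2" "2 + gam q r k x \<noteq> 0"
proof -
 interpret jost k M q r a b by fact
 note g = green_pos(2-4)[OF J, of x]
 have nz: "1 - a x * b x \<noteq> 0" by (rule ab_nonzero)
 have e: "(y * g21 q r k x + z * g12 q r k x) / (2 + gam q r k x) = (y * a x + z * b x) / 2" for y z
  unfolding g by (rule cancel_pair[OF nz])
 then show "(y * g21 q r k x + z * g12 q r k x) / (2 + gam q r k x) = (y * a x + z * b x) / 2" .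
 show "rho q r k x = (q x * a x - r x * b x) / 2" using e[of "q x" "- r x"] by (simp add: rho_def)
 have "2 + gam q r k x = 2 / (1 - a x * b x)" unfolding g using nz by (simp add: field_simps)
 then show "2 + gam q r k x \<noteq> 0" using nz by simp
qed

context flow
begin

text \<open>The density is half of q a - r b, so the current is minus half the difference of the two
  fluxes v + V12 a and -v + V21 b. The constant c is free, since only the derivative of the current
  matters.\<close>

lemma conservation:
 assumes \<mu>: "1 <= \<mu>"
  and j: "\<And>t a b M. jost \<mu> M (q t) (cj \<sigma> (q t)) a b ==>
   \<exists>V12 V21 v C c. zc \<mu> (q t) (cj \<sigma> (q t)) (qt t) (cj \<sigma> (qt t)) V12 V21 v C \<and>
    (\<forall>x. j t x = c - v x - (V12 x * a x - V21 x * b x) / 2)"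
 shows "quantities_defined \<mu> q (\<lambda>t. cj \<sigma> (q t)) \<and> conservation_law (\<lambda>t. rho (q t) (cj \<sigma> (q t)) \<mu>) j"
proof -
 have g: "good (1/4) \<sigma> (q t)" for t by (rule good_mono[OF all_good]) simp
 have "\<forall>t. \<exists>M a b. jost \<mu> M (q t) (cj \<sigma> (q t)) a b"
 proof
  fix t
  obtain M where "pot M (q t)" using q_pot[of "\<bar>t\<bar>"] by auto
  then show "\<exists>M a b. jost \<mu> M (q t) (cj \<sigma> (q t)) a b" using good_jost[OF \<sigma> _ g \<mu>] by metis
 qed
 then obtain M a b where J: "\<And>t. jost \<mu> (M t) (q t) (cj \<sigma> (q t)) (a t) (b t)" by metis
 have ab: "ric \<mu> (q t) (cj \<sigma> (q t)) (1/4) (a t)" "ricb \<mu> (q t) (cj \<sigma> (q t)) (1/4) (b t)" for t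
  using J[of t] by (simp_all add: jost_def)
 have rho: "rho (q t) (cj \<sigma> (q t)) \<mu> x = (q t x * a t x - cj \<sigma> (q t) x * b t x) / 2" for t x by (rule jost_rho(2)[OF J])
 have "has_green (q t) (cj \<sigma> (q t)) k" if "1 <= \<bar>k\<bar>" for t k
 proof -
  have "pot (M t) (q t)" using J[of t] by (simp add: jost_def)
  then show ?thesis by (rule good_has_green[OF \<sigma> _ g that])
 qed
 then have 1: "quantities_defined \<mu> q (\<lambda>t. cj \<sigma> (q t))"
  using jost_rho(3)[OF J] by (simp add: quantities_defined_def)
 have 2: "(\<lambda>\<tau>. rho (q \<tau>) (cj \<sigma> (q \<tau>)) \<mu> x) differentiable at t \<and> (\<lambda>y. j t y) differentiable at x \<and>
   vector_derivative (\<lambda>\<tau>. rho (q \<tau>) (cj \<sigma> (q \<tau>)) \<mu> x) (at t) + vector_derivative (\<lambda>y. j t y) (at x) = 0" for t x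
 proof -
  obtain V12 V21 v C c where z: "zc \<mu> (q t) (cj \<sigma> (q t)) (qt t) (cj \<sigma> (qt t)) V12 V21 v C"
   and jt: "\<And>x. j t x = c - v x - (V12 x * a t x - V21 x * b t x) / 2" using j[OF J] by blast
  note U = udiff_a[OF \<mu> zero_less_one g ab z]
  note Z = zc_ric[OF z ab]
  let ?P = "V21 x - 2 * v x * a t x - V12 x * (a t x)^2" and ?P' = "V12 x + 2 * v x * b t x - V21 x * (b t x)^2"
  let ?D = "((q t x * ?P + qt t x * a t x) - (cj \<sigma> (q t) x * ?P' + cj \<sigma> (qt t) x * b t x)) / 2"
  have "((\<lambda>\<tau>. (q \<tau> x * a \<tau> x - cj \<sigma> (q \<tau>) x * b \<tau> x) / 2) hvd ?D) (at t)"
   by (intro hvd_divide hvd_diff hvd_mult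
    udiff_pointwise[OF U(1)] udiff_pointwise[OF U(2)] udiff_pointwise[OF U(3)] udiff_pointwise[OF U(4)])
  then have r: "((\<lambda>\<tau>. rho (q \<tau>) (cj \<sigma> (q \<tau>)) \<mu> x) hvd ?D) (at t)" unfolding rho .
  have "((\<lambda>x. c - ((v x + V12 x * a t x) - (- v x + V21 x * b t x)) / 2) hvd
    (0 - ((qt t x * a t x + q t x * ?P) - (cj \<sigma> (qt t) x * b t x + cj \<sigma> (q t) x * ?P')) / 2)) (at x)"
   by (intro hvd_divide hvd_diff hvd_const Z(5,6))
  moreover have "(\<lambda>x. c - ((v x + V12 x * a t x) - (- v x + V21 x * b t x)) / 2) = j t"
   by (rule ext) (simp add: jt field_simps)
  moreover have "0 - ((qt t x * a t x + q t x * ?P) - (cj \<sigma> (qt t) x * b t x + cj \<sigma> (q t) x * ?P')) / 2 = - ?D"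
   by (simp add: add.commute)
  ultimately have j': "(j t hvd - ?D) (at x)" by metis
  show ?thesis
   using differentiableI_vector[OF r] differentiableI_vector[OF j'] vector_derivative_at[OF r] vector_derivative_at[OF j'] by simp
 qed
 show ?thesis using 1 2 by (simp add: conservation_law_def)
qed

end

section \<open>The individual flows\<close>

definition wb :: "real => (real => complex) => bool" where
 "wb c f \<longleftrightarrow> (\<forall>x. cmod (f x) <= c * wt x)"

lemma wb_le: assumes "wb c f" shows "cmod (f x) <= c"
proof -
 have "0 <= c * wt x" using assms by (meson wb_def norm_ge_zero order_trans)
 then have "0 <= c" using wt_pos[of x] by (simp add: zero_le_mult_iff)
 then show ?thesis using assms wt_le_1[of x] mult_left_mono[of "wt x" 1 c] unfolding wb_def by (metis mult.right_neutral order_trans)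
qed

lemma wb_add: "wb c f ==> wb c' g ==> wb (c + c') (\<lambda>x. f x + g x)"
 unfolding wb_def distrib_right by (auto intro: cmod_add_le)

lemma wb_diff: "wb c f ==> wb c' g ==> wb (c + c') (\<lambda>x. f x - g x)"
 unfolding wb_def distrib_right by (auto intro: cmod_diff_le)

lemma wb_minus: "wb c f ==> wb c (\<lambda>x. - f x)"
 unfolding wb_def by simp

lemma wb_scale: "wb c f ==> wb (cmod k * c) (\<lambda>x. k * f x)"
 unfolding wb_def mult.assoc by (auto intro: cmod_mult_le)

lemma wb_mult: "wb c f ==> wb c' g ==> wb (c' * c) (\<lambda>x. g x * f x)"
 using wb_le[of c' g] unfolding wb_def mult.assoc by (auto intro: cmod_mult_le)

lemma wb_sq: "wb c f ==> wb (c * c) (\<lambda>x. (f x)^2)"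
 unfolding power2_eq_square by (rule wb_mult)

lemma wb_pot: "pot M f ==> wb M f" by (simp add: pot_def wb_def)

text \<open>The summands of the bound are kept symbolic, so that the rules for \<open>wb\<close> can
  compute them while the pairs below are checked.\<close>

lemma zcI:
 assumes "\<And>x. (V12 hvd (qt x + 2 * of_real \<mu> * V12 x - 2 * q x * v x)) (at x)"
  "\<And>x. (V21 hvd (rt x - 2 * of_real \<mu> * V21 x + 2 * r x * v x)) (at x)"
  "\<And>x. (v hvd (q x * V21 x - r x * V12 x)) (at x)"
  and v: "v = (\<lambda>x. v0 + w x)" and b: "wb c1 V12" "wb c2 V21" "wb c3 qt" "wb c4 rt" "wb c5 w"
 shows "zc \<mu> q r qt rt V12 V21 v (c1 + c2 + c3 + c4 + c5 + cmod v0)"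
proof -
 define C where "C = c1 + c2 + c3 + c4 + c5 + cmod v0"
 have c0: "0 <= c1" "0 <= c2" "0 <= c3" "0 <= c4" "0 <= c5"
  using order_trans[OF norm_ge_zero wb_le] b by blast+
 have *: "cmod (f x) <= C * wt x" if "wb c f" "c <= C" for f c x
  using that(1) mult_right_mono[OF that(2), of "wt x"] wt_pos[of x] unfolding wb_def by (meson less_imp_le order_trans)
 have **: "cmod (f x) <= C" if "wb c f" "c <= C" for f c x using wb_le[OF that(1), of x] that(2) by simp
 have "zc \<mu> q r qt rt V12 V21 v C"
  unfolding zc_def
 proof (intro conjI allI exI[of _ v0])
  show "cmod (v x - v0) <= C * wt x" for x using *[OF b(5), of x] c0 by (simp add: v C_def)
 qed (use assms(1-3) *[OF b(1)] *[OF b(2)] **[OF b(3)] **[OF b(4)] c0 in \<open>auto simp: C_def\<close>)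
 then show ?thesis by (simp add: C_def)
qed

section \<open>The basic zero curvature pairs\<close>

text \<open>Order 3 is the number of derivatives in mKdV. A sequence of functions in place of
  iterated \<open>Dx\<close> treats q and its conjugate alike.\<close>

definition jet :: "real => (nat => real => complex) => bool" where
 "jet M f \<longleftrightarrow> (\<forall>n x. n < 3 --> (f n hvd f (Suc n) x) (at x)) \<and> (\<forall>n. n <= 3 --> wb M (f n))"

lemma jetD:
 assumes "jet M f"
 shows "(f 0 hvd f 1 x) (at x)" "(f 1 hvd f 2 x) (at x)" "(f 2 hvd f 3 x) (at x)"
  "wb M (f 0)" "wb M (f 1)" "wb M (f 2)" "wb M (f 3)"
 using assms by (auto simp: jet_def numeral_eq_Suc)

lemma hvd_sq: "(f hvd D) (at x) ==> ((\<lambda>x. (f x)^2) hvd 2 * f x * D) (at x)" for f :: "real => complex"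
 unfolding power2_eq_square by (rule hvd_eq_rhs[OF hvd_mult]) auto

lemmas hvd_intros = hvd_add hvd_diff hvd_minus
 hvd_mult hvd_const hvd_sq

text \<open>Written exactly as the rules for \<open>wb\<close> assemble it, so that the bounds
  follow by unification.\<close>

definition C_NLS :: "real => real => real" where
 "C_NLS \<mu> M = cmod \<i> * (M + cmod (2 * of_real \<mu>) * M) + cmod \<i> * (cmod (2 * of_real \<mu>) * M + M)
   + (cmod \<i> * M + cmod (2 * \<i>) * (M * M * M)) + (cmod (2 * \<i>) * (M * M * M) + cmod \<i> * M) + cmod \<i> * (M * M)
   + cmod (2 * \<i> * (of_real \<mu>)^2)"

text \<open>The classical AKNS matrix: off-diagonal entries of degree 1 in \<mu>, diagonal of degree
  2. For mKdV the degrees are 2 and 3.\<close>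

lemma zc_NLS:
 assumes q: "jet M q" and r: "jet M r"
 shows "zc \<mu> (q 0) (r 0) (\<lambda>x. \<i> * q 2 x - 2 * \<i> * ((q 0 x)^2 * r 0 x)) (\<lambda>x. 2 * \<i> * ((r 0 x)^2 * q 0 x) - \<i> * r 2 x)
   (\<lambda>x. \<i> * (q 1 x + 2 * of_real \<mu> * q 0 x)) (\<lambda>x. \<i> * (2 * of_real \<mu> * r 0 x - r 1 x))
   (\<lambda>x. 2 * \<i> * (of_real \<mu>)^2 + (- (\<i> * (q 0 x * r 0 x)))) (C_NLS \<mu> M)"
 unfolding C_NLS_def
 by (rule zcI)
  ((rule hvd_eq_rhs, (rule hvd_intros jetD(1-3)[OF q] jetD(1-3)[OF r])+, simp add: algebra_simps power2_eq_square)
   | rule refl | intro wb_add wb_diff wb_minus wb_scale wb_mult wb_sq jetD(4-7)[OF q] jetD(4-7)[OF r])+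

definition C_mKdV :: "real => real => real" where
 "C_mKdV \<mu> M = (cmod 2 * (M * M * M) + M + cmod (2 * of_real \<mu>) * M + cmod (4 * (of_real \<mu>)^2) * M)
   + (cmod 2 * (M * M * M) + M + cmod (2 * of_real \<mu>) * M + cmod (4 * (of_real \<mu>)^2) * M)
   + (cmod 6 * (M * (M * M)) + M) + (cmod 6 * (M * (M * M)) + M) + (M * M + M * M + cmod (2 * of_real \<mu>) * (M * M)) + cmod (- (4 * (of_real \<mu>) ^ 3))"

lemma zc_mKdV:
 assumes q: "jet M q" and r: "jet M r"
 shows "zc \<mu> (q 0) (r 0) (\<lambda>x. 6 * (q 0 x * (r 0 x * q 1 x)) - q 3 x) (\<lambda>x. 6 * (q 0 x * (r 0 x * r 1 x)) - r 3 x)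
   (\<lambda>x. 2 * ((q 0 x)^2 * r 0 x) - q 2 x - 2 * of_real \<mu> * q 1 x - 4 * (of_real \<mu>)^2 * q 0 x)
   (\<lambda>x. 2 * ((r 0 x)^2 * q 0 x) - r 2 x + 2 * of_real \<mu> * r 1 x - 4 * (of_real \<mu>)^2 * r 0 x)
   (\<lambda>x. - (4 * (of_real \<mu>) ^ 3) + (q 1 x * r 0 x - q 0 x * r 1 x + 2 * of_real \<mu> * (q 0 x * r 0 x))) (C_mKdV \<mu> M)"
 unfolding C_mKdV_def
 by (rule zcI)
  ((rule hvd_eq_rhs, (rule hvd_intros jetD(1-3)[OF q] jetD(1-3)[OF r])+, simp add: algebra_simps power2_eq_square power3_eq_cube)
   | rule refl | intro wb_add wb_diff wb_minus wb_scale wb_mult wb_sq jetD(4-7)[OF q] jetD(4-7)[OF r])+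

text \<open>Generated by a constant diagonal matrix. It supplies the term in q of the NLS difference
  flow and carries no current.\<close>

lemma zc_phase:
 assumes q: "wb M q" and r: "wb M r"
 shows "zc \<mu> q r q (\<lambda>x. - r x) (\<lambda>x. 0) (\<lambda>x. 0) (\<lambda>x. 1 / 2 + 0) (0 + 0 + M + M + 0 + cmod (1 / 2))"
proof (rule zcI[where w = "\<lambda>x. 0"])
 show "wb M (\<lambda>x. - r x)" by (rule wb_minus[OF r])
qed (use q in \<open>auto simp: wb_def\<close>)

text \<open>For translations the second Lax matrix is the spatial one.\<close>

lemma zc_translation:
 assumes q: "jet M q" and r: "jet M r"
 shows "zc \<mu> (q 0) (r 0) (q 1) (r 1) (q 0) (r 0) (\<lambda>x. of_real \<mu> + 0) (M + M + M + M + 0 + cmod (of_real \<mu>))"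
proof (rule zcI[where w = "\<lambda>x. 0"])
 show "(q 0 hvd q 1 x + 2 * of_real \<mu> * q 0 x - 2 * q 0 x * (of_real \<mu> + 0)) (at x)" for x
  by (rule hvd_eq_rhs[OF jetD(1)[OF q]]) simp
 show "(r 0 hvd r 1 x - 2 * of_real \<mu> * r 0 x + 2 * r 0 x * (of_real \<mu> + 0)) (at x)" for x
  by (rule hvd_eq_rhs[OF jetD(1)[OF r]]) simp
 show "((\<lambda>x. of_real \<mu> + 0) hvd q 0 x * r 0 x - r 0 x * q 0 x) (at x)" for x by (simp add: mult.commute)
qed (use jetD[OF q] jetD[OF r] in \<open>auto simp: wb_def[of 0]\<close>)

text \<open>All three follow from w' = (q a + r b) w and a b w = w - 1; they are the familiar
  equations of the diagonal Green's function.\<close>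

lemma jost_gs:
 assumes J: "jost k M q r a b"
 defines "w \<equiv> \<lambda>x. inverse (1 - a x * b x)"
 shows "((\<lambda>x. b x * w x) hvd (2 * of_real k * (b x * w x) + q x * (1 + 2 * (a x * b x * w x)))) (at x)"
  "((\<lambda>x. a x * w x) hvd (- 2 * of_real k * (a x * w x) + r x * (1 + 2 * (a x * b x * w x)))) (at x)"
  "((\<lambda>x. 2 * (a x * b x * w x)) hvd 2 * (q x * (a x * w x) + r x * (b x * w x))) (at x)"
  "wb (4 * M) (\<lambda>x. b x * w x)" "wb (4 * M) (\<lambda>x. a x * w x)" "wb (4 * M) (\<lambda>x. 2 * (a x * b x * w x))"
proof -
 interpret jost k M q r a b by fact
 have w1: "a x * b x * w x = w x - 1" for x using ab_nonzero[of x] by (simp add: w_def field_simps)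
 have da: "(a hvd (r x - 2 * of_real k * a x - q x * (a x)^2)) (at x)" by (rule ricD[OF a])
 have db: "(b hvd (q x + 2 * of_real k * b x - r x * (b x)^2)) (at x)" by (rule ricbD[OF b])
 let ?D = "(a x * (q x + 2 * of_real k * b x - r x * (b x)^2) + (r x - 2 * of_real k * a x - q x * (a x)^2) * b x)"
 have inv: "- (inverse z * (h *\<^sub>R (- y * z)) * inverse z) = h *\<^sub>R (y * inverse z)" if "z \<noteq> 0" for z y :: complex and h :: real
  using that by (simp add: field_simps scaleR_conv_of_real)
 have "((\<lambda>x. 1 - a x * b x) hvd (0 - ?D)) (at x)"
  by (intro hvd_diff hvd_const hvd_mult da db)
 moreover have "0 - ?D = - (r x * b x + q x * a x) * (1 - a x * b x)" by (simp add: algebra_simps power2_eq_square)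
 ultimately have "((\<lambda>x. 1 - a x * b x) has_derivative (\<lambda>h. h *\<^sub>R (- (r x * b x + q x * a x) * (1 - a x * b x)))) (at x)"
  by (simp add: hvd_def)
 from Deriv.has_derivative_inverse[OF ab_nonzero this]
 have dw: "(w hvd (r x * b x + q x * a x) * w x) (at x)"
  unfolding hvd_def w_def
  by (rule has_derivative_eq_rhs) (rule ext, rule inv[OF ab_nonzero])
 have B: "q x * (1 + 2 * (a x * b x * w x)) = q x * (w x + a x * b x * w x)" "r x * (1 + 2 * (a x * b x * w x)) = r x * (w x + a x * b x * w x)"
  by (simp_all add: w1)
 show "((\<lambda>x. b x * w x) hvd (2 * of_real k * (b x * w x) + q x * (1 + 2 * (a x * b x * w x)))) (at x)"
  unfolding B by (rule hvd_eq_rhs[OF hvd_mult[OF db dw]]) (simp add: algebra_simps power2_eq_square)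
 show "((\<lambda>x. a x * w x) hvd (- 2 * of_real k * (a x * w x) + r x * (1 + 2 * (a x * b x * w x)))) (at x)"
  unfolding B by (rule hvd_eq_rhs[OF hvd_mult[OF da dw]]) (simp add: algebra_simps power2_eq_square)
 show "((\<lambda>x. 2 * (a x * b x * w x)) hvd 2 * (q x * (a x * w x) + r x * (b x * w x))) (at x)"
  unfolding w1
  by (rule hvd_eq_rhs[OF hvd_mult_right[OF hvd_diff[OF dw hvd_const]]]) (simp add: algebra_simps)
 have M: "0 <= M" by (rule pot_nonneg[OF q])
 have wbd: "cmod (w x) <= 2" for x
 proof -
  have "cmod (a x * b x) <= 1/4 * (1/4)" by (intro cmod_mult_le ric_le[OF a] ricb_le[OF b])
  then have "1/2 <= cmod (1 - a x * b x)" using norm_triangle_ineq2[of 1 "a x * b x"] by simp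
  then have "inverse (cmod (1 - a x * b x)) <= inverse (1/2)" by (intro le_imp_inverse_le) auto
  then show ?thesis by (simp add: w_def norm_inverse)
 qed
 have Mk: "2 * M / k * wt x <= 2 * M * wt x" for x
 proof -
  have "2 * M / k <= 2 * M / 1" using M \<kappa> by (intro divide_left_mono) auto
  then show ?thesis using wt_pos[of x] by (intro mult_right_mono) auto
 qed
 have ab': "cmod (a x) <= 2 * M * wt x" "cmod (b x) <= 2 * M * wt x" for x
  using order_trans[OF ric_decay[OF \<kappa> q r a] Mk] order_trans[OF ricb_decay[OF \<kappa> q r b] Mk] .
 show bw: "wb (4 * M) (\<lambda>x. b x * w x)" unfolding wb_def using cmod_mult_le[OF ab'(2) wbd] by (simp add: mult_ac)
 show "wb (4 * M) (\<lambda>x. a x * w x)" unfolding wb_def using cmod_mult_le[OF ab'(1) wbd] by (simp add: mult_ac)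
 show "wb (4 * M) (\<lambda>x. 2 * (a x * b x * w x))" unfolding wb_def
 proof
  fix x
  have "cmod (2 * (a x * (b x * w x))) <= 2 * (1/4 * (4 * M * wt x))"
   by (intro cmod_mult_le ric_le[OF a] bw[unfolded wb_def, rule_format]) simp
  moreover have "0 <= M * wt x" using M wt_pos[of x] by simp
  ultimately show "cmod (2 * (a x * b x * w x)) <= 4 * M * wt x" by (simp add: mult.assoc)
 qed
qed

text \<open>The system has the same form for both signs of k, so one zero curvature pair serves
  \<kappa> and - \<kappa>.\<close>

definition gs_eqs :: "real => real => (real => complex) => (real => complex) => bool" where
 "gs_eqs k M q r \<longleftrightarrow>
  (\<forall>x. (g12 q r k hvd (2 * of_real k * g12 q r k x + q x * (1 + gam q r k x))) (at x)) \<and>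
  (\<forall>x. (g21 q r k hvd (- 2 * of_real k * g21 q r k x + r x * (1 + gam q r k x))) (at x)) \<and>
  (\<forall>x. (gam q r k hvd 2 * (q x * g21 q r k x + r x * g12 q r k x)) (at x)) \<and>
  wb (4 * M) (g12 q r k) \<and> wb (4 * M) (g21 q r k) \<and> wb (4 * M) (gam q r k)"

lemma gs_eqs_pos: assumes J: "jost k M q r a b" shows "gs_eqs k M q r"
proof -
 note g = green_pos(2-4)[OF J]
 have e: "g12 q r k = (\<lambda>x. b x * inverse (1 - a x * b x))" "g21 q r k = (\<lambda>x. a x * inverse (1 - a x * b x))"
  "gam q r k = (\<lambda>x. 2 * (a x * b x * inverse (1 - a x * b x)))"
  by (rule ext, simp add: g divide_inverse)+
 show ?thesis unfolding gs_eqs_def e using jost_gs[OF J] by blast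
qed

lemma gs_eqs_neg: assumes J: "jost k M r q a b" shows "gs_eqs (- k) M q r"
proof -
 note g = green_neg(2-4)[OF J]
 have e: "g12 q r (- k) = (\<lambda>x. a x * inverse (1 - a x * b x))" "g21 q r (- k) = (\<lambda>x. b x * inverse (1 - a x * b x))"
  "gam q r (- k) = (\<lambda>x. 2 * (a x * b x * inverse (1 - a x * b x)))"
  by (rule ext, simp add: g divide_inverse)+
 have c: "q x * y + r x * z = r x * z + q x * y" for x y z by simp
 show ?thesis unfolding gs_eqs_def e c of_real_minus using jost_gs[OF J] by simp
qed

text \<open>The second Lax matrix is, up to signs and a constant on the diagonal, the diagonal
  Green's function at k divided by 2 (k - \<mu>). Its pole is the origin of the exceptional
  parameter.\<close>

lemma zc_pair:
 assumes g: "gs_eqs k M q r" and k: "k \<noteq> \<mu>"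
 defines "l \<equiv> complex_of_real (1 / (2 * (k - \<mu>)))"
 shows "zc \<mu> q r (g12 q r k) (g21 q r k) (\<lambda>x. l * g12 q r k x) (\<lambda>x. - l * g21 q r k x) (\<lambda>x. - l / 2 + (- l / 2) * gam q r k x)
  (cmod l * (4 * M) + cmod (- l) * (4 * M) + 4 * M + 4 * M + cmod (- l / 2) * (4 * M) + cmod (- l / 2))"
proof (rule zcI)
 have w: "wb (4 * M) (g12 q r k)" "wb (4 * M) (g21 q r k)" "wb (4 * M) (gam q r k)" using g by (auto simp: gs_eqs_def)
 show "wb (4 * M) (g12 q r k)" "wb (4 * M) (g21 q r k)" by fact+
 show "wb (cmod l * (4 * M)) (\<lambda>x. l * g12 q r k x)" "wb (cmod (- l) * (4 * M)) (\<lambda>x. - l * g21 q r k x)"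
  "wb (cmod (- l / 2) * (4 * M)) (\<lambda>x. (- l / 2) * gam q r k x)" by (rule wb_scale, fact)+
 show "(\<lambda>x. - l / 2 + (- l / 2) * gam q r k x) = (\<lambda>x. - l / 2 + (- l / 2) * gam q r k x)" by (rule refl)
 \<comment> \<open>The partial fraction identity that leaves exactly one copy of g12, respectively
   g21, as the vector field.\<close>
 have l: "l * (2 * of_real k) = 1 + 2 * of_real \<mu> * l"
 proof -
  have "(1 / (2 * (k - \<mu>))) * (2 * k) = 1 + 2 * \<mu> * (1 / (2 * (k - \<mu>)))" using k by (simp add: field_simps)
  then have "complex_of_real ((1 / (2 * (k - \<mu>))) * (2 * k)) = complex_of_real (1 + 2 * \<mu> * (1 / (2 * (k - \<mu>))))" by (rule arg_cong)
  then show ?thesis unfolding l_def by simp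
 qed
 fix x
 have d: "(g12 q r k hvd (2 * of_real k * g12 q r k x + q x * (1 + gam q r k x))) (at x)"
  "(g21 q r k hvd (- 2 * of_real k * g21 q r k x + r x * (1 + gam q r k x))) (at x)"
  "(gam q r k hvd 2 * (q x * g21 q r k x + r x * g12 q r k x)) (at x)"
  using g by (auto simp: gs_eqs_def)
 have l': "l * (2 * of_real k * y) = y + 2 * of_real \<mu> * (l * y)" for y
  using arg_cong[OF l, of "\<lambda>z. z * y"] by (simp add: algebra_simps)
 show "((\<lambda>x. l * g12 q r k x) hvd g12 q r k x + 2 * of_real \<mu> * (l * g12 q r k x) - 2 * q x * (- l / 2 + (- l / 2) * gam q r k x)) (at x)"
  by (rule hvd_eq_rhs[OF hvd_mult_right[OF d(1)]]) (simp only: distrib_left l', simp add: algebra_simps)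
 show "((\<lambda>x. - l * g21 q r k x) hvd g21 q r k x - 2 * of_real \<mu> * (- l * g21 q r k x) + 2 * r x * (- l / 2 + (- l / 2) * gam q r k x)) (at x)"
  by (rule hvd_eq_rhs[OF hvd_mult_right[OF d(2)]])
   (use l'[of "g21 q r k x"] in \<open>simp add: algebra_simps\<close>)
 show "((\<lambda>x. - l / 2 + (- l / 2) * gam q r k x) hvd q x * (- l * g21 q r k x) - r x * (l * g12 q r k x)) (at x)"
  by (rule hvd_eq_rhs[OF hvd_add[OF hvd_const hvd_mult_right[OF d(3)]]])
   (simp add: algebra_simps)
qed

section \<open>Continuity of the vector fields in time\<close>

text \<open>A condition at one time only: along the flow g12 is controlled just near times at which
  \<open>good\<close> has already been established.\<close>

definition uct :: "(real => real => complex) => real => bool" where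
 "uct f t \<longleftrightarrow> (\<exists>B. \<forall>x. cmod (f t x) <= B) \<and>
   (\<forall>e>0. \<exists>d>0. \<forall>\<tau>. \<bar>\<tau> - t\<bar> < d --> (\<forall>x. cmod (f \<tau> x - f t x) <= e))"

lemma ucurve_uct: "ucurve f ==> uct f t" by (simp add: ucurve_def uct_def)

lemma uct_const: "uct (\<lambda>_ _. c) t" by (auto simp: uct_def intro: exI[of _ 1])

lemma uct_add: assumes f: "uct f t" and g: "uct g t" shows "uct (\<lambda>\<tau> x. f \<tau> x + g \<tau> x) t"
 unfolding uct_def
proof (intro conjI allI impI)
 obtain B B' where "\<And>x. cmod (f t x) <= B" "\<And>x. cmod (g t x) <= B'" using f g unfolding uct_def by blast
 then have "cmod (f t x + g t x) <= B + B'" for x by (intro cmod_add_le)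
 then show "\<exists>B. \<forall>x. cmod (f t x + g t x) <= B" by blast
 fix e :: real assume "0 < e"
 then have e: "0 < e / 2" by simp
 obtain d1 where d1: "0 < d1" "\<And>\<tau> x. \<bar>\<tau> - t\<bar> < d1 ==> cmod (f \<tau> x - f t x) <= e / 2" using f e unfolding uct_def by blast
 obtain d2 where d2: "0 < d2" "\<And>\<tau> x. \<bar>\<tau> - t\<bar> < d2 ==> cmod (g \<tau> x - g t x) <= e / 2" using g e unfolding uct_def by blast
 have "cmod (f \<tau> x + g \<tau> x - (f t x + g t x)) <= e" if "\<bar>\<tau> - t\<bar> < min d1 d2" for \<tau> x
  using cmod_add_le[OF d1(2)[of \<tau> x] d2(2)[of \<tau> x]] that by (simp add: algebra_simps)
 then show "\<exists>d>0. \<forall>\<tau>. \<bar>\<tau> - t\<bar> < d --> (\<forall>x. cmod (f \<tau> x + g \<tau> x - (f t x + g t x)) <= e)"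
  using d1(1) d2(1) by (intro exI[of _ "min d1 d2"]) auto
qed

lemma uct_mult: assumes f: "uct f t" and g: "uct g t" shows "uct (\<lambda>\<tau> x. f \<tau> x * g \<tau> x) t"
 unfolding uct_def
proof (intro conjI allI impI)
 obtain B1 B2 where B12: "\<And>x. cmod (f t x) <= B1" "\<And>x. cmod (g t x) <= B2" using f g unfolding uct_def by blast
 define B where "B = max B1 B2"
 have B: "cmod (f t x) <= B" "cmod (g t x) <= B" for x using B12[of x] by (auto simp: B_def)
 have B0: "0 <= B" using order_trans[OF norm_ge_zero B(1)] .
 show "\<exists>B. \<forall>x. cmod (f t x * g t x) <= B" using cmod_mult_le[OF B] by blast
 fix e :: real assume e: "0 < e"
 define e1 where "e1 = min 1 (e / (2 * B + 1))"
 have e1: "0 < e1" "e1 <= 1" using e B0 by (auto simp: e1_def)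
 have e1': "e1 * (2 * B + 1) <= e"
 proof -
  have "e1 <= e / (2 * B + 1)" by (simp add: e1_def)
  then show ?thesis using B0 by (simp add: le_divide_eq)
 qed
 obtain d1 where d1: "0 < d1" "\<And>\<tau> x. \<bar>\<tau> - t\<bar> < d1 ==> cmod (f \<tau> x - f t x) <= e1" using f e1 unfolding uct_def by blast
 obtain d2 where d2: "0 < d2" "\<And>\<tau> x. \<bar>\<tau> - t\<bar> < d2 ==> cmod (g \<tau> x - g t x) <= e1" using g e1 unfolding uct_def by blast
 have "cmod (f \<tau> x * g \<tau> x - f t x * g t x) <= e" if \<tau>: "\<bar>\<tau> - t\<bar> < min d1 d2" for \<tau> x
 proof -
  have D: "cmod (f \<tau> x - f t x) <= e1" "cmod (g \<tau> x - g t x) <= e1" using d1(2)[of \<tau> x] d2(2)[of \<tau> x] \<tau> by auto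
  have D': "cmod (g \<tau> x - g t x) <= 1" using D(2) e1 by linarith
  have "f \<tau> x * g \<tau> x - f t x * g t x = (f \<tau> x - f t x) * (g \<tau> x - g t x) + f t x * (g \<tau> x - g t x) + (f \<tau> x - f t x) * g t x"
   by (simp add: algebra_simps)
  also have "cmod \<dots> <= e1 * 1 + B * e1 + e1 * B" by (intro cmod_add_le cmod_mult_le D D' B)
  also have "\<dots> = e1 * (2 * B + 1)" by (simp add: algebra_simps)
  finally show ?thesis using e1' by simp
 qed
 then show "\<exists>d>0. \<forall>\<tau>. \<bar>\<tau> - t\<bar> < d --> (\<forall>x. cmod (f \<tau> x * g \<tau> x - f t x * g t x) <= e)"
  using d1(1) d2(1) by (intro exI[of _ "min d1 d2"]) auto
qed

lemma uct_minus: "uct f t ==> uct (\<lambda>\<tau> x. - f \<tau> x) t"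
 using uct_mult[OF uct_const[of "- 1"]] by simp

lemma uct_diff: "uct f t ==> uct g t ==> uct (\<lambda>\<tau> x. f \<tau> x - g \<tau> x) t"
 using uct_add[OF _ uct_minus] by simp

lemma uct_cj: assumes "uct f t" "\<sigma> = 1 \<or> \<sigma> = - 1" shows "uct (\<lambda>\<tau>. cj \<sigma> (f \<tau>)) t"
proof -
 have "cmod (cj \<sigma> (f \<tau>) x - cj \<sigma> (f t) x) = cmod (f \<tau> x - f t x)" "cmod (cj \<sigma> (f t) x) = cmod (f t x)" for \<tau> x
 proof -
  have "cj \<sigma> (f \<tau>) x - cj \<sigma> (f t) x = of_real \<sigma> * cnj (f \<tau> x - f t x)" by (simp add: algebra_simps)
  then show "cmod (cj \<sigma> (f \<tau>) x - cj \<sigma> (f t) x) = cmod (f \<tau> x - f t x)"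
   using assms(2) by (auto simp: norm_mult simp del: complex_cnj_diff)
 qed (use assms(2) in \<open>auto simp: norm_mult\<close>)
 then show ?thesis using assms(1) unfolding uct_def by simp
qed

lemma uct_inverse:
 assumes f: "uct f t" and d: "0 < d" and b: "\<And>\<tau> x. \<bar>\<tau> - t\<bar> < d ==> 1/2 <= cmod (f \<tau> x)"
 shows "uct (\<lambda>\<tau> x. inverse (f \<tau> x)) t"
 unfolding uct_def
proof (intro conjI allI impI)
 have i: "cmod (inverse (f \<tau> x)) <= 2" "f \<tau> x \<noteq> 0" if "\<bar>\<tau> - t\<bar> < d" for \<tau> x
 proof -
  have "inverse (cmod (f \<tau> x)) <= inverse (1/2)" using b[OF that, of x] by (intro le_imp_inverse_le) auto
  then show "cmod (inverse (f \<tau> x)) <= 2" by (simp add: norm_inverse)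
  show "f \<tau> x \<noteq> 0" using b[OF that, of x] by auto
 qed
 show "\<exists>B. \<forall>x. cmod (inverse (f t x)) <= B" using i(1)[of t] d by auto
 fix e :: real assume "0 < e"
 then have e: "0 < e / 4" by simp
 obtain d1 where d1: "0 < d1" "\<And>\<tau> x. \<bar>\<tau> - t\<bar> < d1 ==> cmod (f \<tau> x - f t x) <= e / 4" using f e unfolding uct_def by blast
 have "cmod (inverse (f \<tau> x) - inverse (f t x)) <= e" if \<tau>: "\<bar>\<tau> - t\<bar> < min d d1" for \<tau> x
 proof -
  have td: "\<bar>\<tau> - t\<bar> < d" "\<bar>t - t\<bar> < d" "\<bar>\<tau> - t\<bar> < d1" using \<tau> d by auto
  have "inverse (f \<tau> x) - inverse (f t x) = - (inverse (f \<tau> x) * (f \<tau> x - f t x) * inverse (f t x))"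
   by (rule inverse_diff_inverse[OF i(2)[OF td(1)] i(2)[OF td(2)]])
  also have "cmod \<dots> <= 2 * (e / 4) * 2"
   unfolding norm_minus_cancel by (intro cmod_mult_le i(1) td d1(2))
  finally show ?thesis by simp
 qed
 then show "\<exists>d>0. \<forall>\<tau>. \<bar>\<tau> - t\<bar> < d --> (\<forall>x. cmod (inverse (f \<tau> x) - inverse (f t x)) <= e)"
  using d d1(1) by (intro exI[of _ "min d d1"]) auto
qed

lemma uct_cong:
 assumes "uct f t" "0 < d" "\<And>\<tau> x. \<bar>\<tau> - t\<bar> < d ==> g \<tau> x = f \<tau> x"
 shows "uct g t"
proof -
 have gt: "g t x = f t x" for x using assms(2,3) by simp
 have "\<exists>d'>0. \<forall>\<tau>. \<bar>\<tau> - t\<bar> < d' --> (\<forall>x. cmod (g \<tau> x - g t x) <= e)" if e: "0 < e" for e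
 proof -
  obtain d1 where d1: "0 < d1" "\<And>\<tau> x. \<bar>\<tau> - t\<bar> < d1 ==> cmod (f \<tau> x - f t x) <= e" using assms(1) e unfolding uct_def by blast
  then show ?thesis using assms(2,3) gt by (intro exI[of _ "min d d1"]) auto
 qed
 then show ?thesis using assms(1) gt by (simp add: uct_def)
qed

lemma uct_ric:
 assumes \<sigma>: "\<sigma> = 1 \<or> \<sigma> = - 1" and q: "uct q t" and k: "1 <= k" and M: "pot M (q t)" and d: "0 < d"
  and a: "\<And>\<tau>. \<bar>\<tau> - t\<bar> < d ==> ric k (q \<tau>) (cj \<sigma> (q \<tau>)) (1/4) (a \<tau>)"
  and b: "\<And>\<tau>. \<bar>\<tau> - t\<bar> < d ==> ricb k (q \<tau>) (cj \<sigma> (q \<tau>)) (1/4) (b \<tau>)"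
 shows "uct a t" "uct b t"
proof -
 have s1: "\<bar>\<sigma>\<bar> = 1" using \<sigma> by auto
 have at: "ric k (q t) (cj \<sigma> (q t)) (1/4) (a t)" and bt: "ricb k (q t) (cj \<sigma> (q t)) (1/4) (b t)" using a b d by auto
 define L where "L = exp (2 * M) * 2"
 have L: "0 < L" by (simp add: L_def)
 have *: "\<exists>d>0. \<forall>\<tau>. \<bar>\<tau> - t\<bar> < d --> (\<forall>x. cmod (a \<tau> x - a t x) <= e \<and> cmod (b \<tau> x - b t x) <= e)" if e: "0 < e" for e
 proof -
  have e1: "0 < e / L" using e L by simp
  obtain d1 where d1: "0 < d1" "\<And>\<tau> x. \<bar>\<tau> - t\<bar> < d1 ==> cmod (q \<tau> x - q t x) <= e / L" using q e1 unfolding uct_def by blast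
  obtain d2 where d2: "0 < d2" "\<And>\<tau> x. \<bar>\<tau> - t\<bar> < d2 ==> cmod (cj \<sigma> (q \<tau>) x - cj \<sigma> (q t) x) <= e / L"
   using uct_cj[OF q \<sigma>] e1 unfolding uct_def by blast
  have eL: "exp (2 * M) * (2 * (e / L)) = e" by (simp add: L_def)
  have "cmod (a \<tau> x - a t x) <= e \<and> cmod (b \<tau> x - b t x) <= e" if \<tau>: "\<bar>\<tau> - t\<bar> < min d (min d1 d2)" for \<tau> x
  proof
   have td: "\<bar>\<tau> - t\<bar> < d" "\<bar>\<tau> - t\<bar> < d1" "\<bar>\<tau> - t\<bar> < d2" using \<tau> by auto
   show "cmod (a \<tau> x - a t x) <= e"
    using ric_lipschitz[OF k M at a[OF td(1)] d1(2)[OF td(2)] d2(2)[OF td(3)], of x] unfolding eL .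
   show "cmod (b \<tau> x - b t x) <= e"
    using ricb_lipschitz[OF k pot_cnj[OF M s1] bt b[OF td(1)] d1(2)[OF td(2)] d2(2)[OF td(3)], of x] unfolding eL .
  qed
  then show ?thesis using d d1(1) d2(1) by (intro exI[of _ "min d (min d1 d2)"]) auto
 qed
 show "uct a t" unfolding uct_def using ric_le[OF at] * by blast
 show "uct b t" unfolding uct_def using ricb_le[OF bt] * by blast
qed

lemma uct_g12:
 assumes \<sigma>: "\<sigma> = 1 \<or> \<sigma> = - 1" and q: "schwartz_curve q" and k: "1 <= k" and d: "0 < d"
  and g: "\<And>\<tau>. \<bar>\<tau> - t\<bar> < d ==> good (1/4) \<sigma> (q \<tau>)"
 shows "uct (\<lambda>\<tau>. g12 (q \<tau>) (cj \<sigma> (q \<tau>)) k) t" "uct (\<lambda>\<tau>. g12 (q \<tau>) (cj \<sigma> (q \<tau>)) (- k)) t"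
proof -
 obtain M where M: "\<And>\<tau>. \<bar>\<tau>\<bar> <= \<bar>t\<bar> + d ==> pot M (q \<tau>)" using schwartz_curve_pot[OF q, of "\<bar>t\<bar> + d" 0] by auto
 have M': "pot M (q \<tau>)" if "\<bar>\<tau> - t\<bar> < d" for \<tau> using that by (intro M) linarith
 have "\<forall>\<tau>. \<exists>a b. \<bar>\<tau> - t\<bar> < d --> jost k M (q \<tau>) (cj \<sigma> (q \<tau>)) a b \<and> jost k M (cj \<sigma> (q \<tau>)) (q \<tau>) (cj \<sigma> a) (cj \<sigma> b)
   \<and> ric k (q \<tau>) (cj \<sigma> (q \<tau>)) (1/4) a \<and> ricb k (q \<tau>) (cj \<sigma> (q \<tau>)) (1/4) b"
  using good_jost[OF \<sigma> M' g k] by metis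
 then obtain a b where ab: "\<And>\<tau>. \<bar>\<tau> - t\<bar> < d ==> jost k M (q \<tau>) (cj \<sigma> (q \<tau>)) (a \<tau>) (b \<tau>)"
   "\<And>\<tau>. \<bar>\<tau> - t\<bar> < d ==> jost k M (cj \<sigma> (q \<tau>)) (q \<tau>) (cj \<sigma> (a \<tau>)) (cj \<sigma> (b \<tau>))"
   "\<And>\<tau>. \<bar>\<tau> - t\<bar> < d ==> ric k (q \<tau>) (cj \<sigma> (q \<tau>)) (1/4) (a \<tau>)" "\<And>\<tau>. \<bar>\<tau> - t\<bar> < d ==> ricb k (q \<tau>) (cj \<sigma> (q \<tau>)) (1/4) (b \<tau>)"
  by metis
 have uq: "uct q t" using schwartz_curve_ucurve[OF q, of 0 0] by (intro ucurve_uct) simp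
 have td: "\<bar>t - t\<bar> < d" using d by simp
 have u: "uct a t" "uct b t" using uct_ric[OF \<sigma> uq k M'[OF td] d ab(3,4)] by auto
 note u' = uct_cj[OF u(1) \<sigma>] uct_cj[OF u(2) \<sigma>]
 have low: "1/2 <= cmod (1 - y * z)" if "cmod y <= 1/4" "cmod z <= 1/4" for y z
  using cmod_mult_le[OF that] norm_triangle_ineq2[of 1 "y * z"] by simp
 have cl: "cmod (of_real \<sigma> * cnj y) <= c" if "cmod y <= c" for y c using that \<sigma> by (auto simp: norm_mult)
 have l1: "1/2 <= cmod (1 - a \<tau> x * b \<tau> x)" if "\<bar>\<tau> - t\<bar> < d" for \<tau> x
  by (rule low[OF ric_le[OF ab(3)[OF that]] ricb_le[OF ab(4)[OF that]]])
 have l2: "1/2 <= cmod (1 - cj \<sigma> (a \<tau>) x * cj \<sigma> (b \<tau>) x)" if "\<bar>\<tau> - t\<bar> < d" for \<tau> x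
  by (rule low[OF cl[OF ric_le[OF ab(3)[OF that]]] cl[OF ricb_le[OF ab(4)[OF that]]]])
 have i1: "uct (\<lambda>\<tau> x. inverse (1 - a \<tau> x * b \<tau> x)) t"
  by (rule uct_inverse[OF uct_diff[OF uct_const uct_mult[OF u]] d l1])
 have i2: "uct (\<lambda>\<tau> x. inverse (1 - cj \<sigma> (a \<tau>) x * cj \<sigma> (b \<tau>) x)) t"
  by (rule uct_inverse[OF uct_diff[OF uct_const uct_mult[OF u']] d l2])
 from uct_mult[OF u(2) i1] show "uct (\<lambda>\<tau>. g12 (q \<tau>) (cj \<sigma> (q \<tau>)) k) t"
  by (rule uct_cong[OF _ d]) (simp add: green_pos(2)[OF ab(1)] divide_inverse)
 from uct_mult[OF u'(1) i2] show "uct (\<lambda>\<tau>. g12 (q \<tau>) (cj \<sigma> (q \<tau>)) (- k)) t"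
  by (rule uct_cong[OF _ d]) (simp add: green_neg(2)[OF ab(2)] divide_inverse)
qed

section \<open>Linear combinations of flows\<close>

text \<open>Matrix and current are bundled, so that adding and scaling flows adds and scales their
  currents.\<close>

definition flow_at :: "real => real => (real => complex) => (real => complex) => (real => complex) => (real => complex) => real => bool" where
 "flow_at \<sigma> \<mu> f qt rt j C \<longleftrightarrow>
   (\<exists>V12 V21 v c. zc \<mu> f (cj \<sigma> f) qt rt V12 V21 v C \<and>
    (\<forall>N a b x. jost \<mu> N f (cj \<sigma> f) a b --> j x = c - v x - (V12 x * a x - V21 x * b x) / 2))"

lemma flow_atI:
 assumes "zc \<mu> f (cj \<sigma> f) qt rt V12 V21 v C"
  "\<And>N a b x. jost \<mu> N f (cj \<sigma> f) a b ==> j x = c - v x - (V12 x * a x - V21 x * b x) / 2"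
 shows "flow_at \<sigma> \<mu> f qt rt j C"
 using assms unfolding flow_at_def by blast

lemma flow_atE:
 assumes "flow_at \<sigma> \<mu> f qt rt j C"
 obtains V12 V21 v c where "zc \<mu> f (cj \<sigma> f) qt rt V12 V21 v C"
  "\<And>N a b x. jost \<mu> N f (cj \<sigma> f) a b ==> j x = c - v x - (V12 x * a x - V21 x * b x) / 2"
 using assms unfolding flow_at_def by metis

type_synonym func = "(real => complex) => real => complex"

text \<open>The evolution \<open>R\<close> of r is recorded separately: building blocks such as g12
  at one parameter, or the phase flow, do not preserve r = \<sigma> cnj q; the total does. C depends
  on f through M only, hence is uniform on compact time intervals.\<close>

definition flow_data :: "real => real => func => func => func => bool" where
 "flow_data \<sigma> \<mu> Q R j \<longleftrightarrow> (\<forall>M. \<exists>C. \<forall>f. jet M (\<lambda>n. (Dx ^^ n) f) --> schwartz f --> good (1/4) \<sigma> f -->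
   flow_at \<sigma> \<mu> f (Q f) (R f) (j f) C)"

lemma flow_dataI:
 assumes "\<And>M f. jet M (\<lambda>n. (Dx ^^ n) f) ==> schwartz f ==> good (1/4) \<sigma> f ==> flow_at \<sigma> \<mu> f (Q f) (R f) (j f) (C M)"
 shows "flow_data \<sigma> \<mu> Q R j"
 using assms unfolding flow_data_def by blast

lemma flow_dataE:
 assumes "flow_data \<sigma> \<mu> Q R j"
 obtains C where "\<And>M f. jet M (\<lambda>n. (Dx ^^ n) f) ==> schwartz f ==> good (1/4) \<sigma> f ==> flow_at \<sigma> \<mu> f (Q f) (R f) (j f) (C M)"
 using assms unfolding flow_data_def by metis

lemma flow_data_add:
 assumes "flow_data \<sigma> \<mu> Q R j" "flow_data \<sigma> \<mu> Q' R' j'"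
 shows "flow_data \<sigma> \<mu> (\<lambda>f x. Q f x + Q' f x) (\<lambda>f x. R f x + R' f x) (\<lambda>f x. j f x + j' f x)"
proof -
 obtain C where C: "\<And>M f. jet M (\<lambda>n. (Dx ^^ n) f) ==> schwartz f ==> good (1/4) \<sigma> f ==> flow_at \<sigma> \<mu> f (Q f) (R f) (j f) (C M)"
  using flow_dataE[OF assms(1)] by blast
 obtain C' where C': "\<And>M f. jet M (\<lambda>n. (Dx ^^ n) f) ==> schwartz f ==> good (1/4) \<sigma> f ==> flow_at \<sigma> \<mu> f (Q' f) (R' f) (j' f) (C' M)"
  using flow_dataE[OF assms(2)] by blast
 show ?thesis
 proof (rule flow_dataI[where C = "\<lambda>M. C M + C' M"])
  fix M f assume f: "jet M (\<lambda>n. (Dx ^^ n) f)" "schwartz f" "good (1/4) \<sigma> f"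
  obtain V12 V21 v c where 1: "zc \<mu> f (cj \<sigma> f) (Q f) (R f) V12 V21 v (C M)"
   "\<And>N a b x. jost \<mu> N f (cj \<sigma> f) a b ==> j f x = c - v x - (V12 x * a x - V21 x * b x) / 2" using flow_atE[OF C[OF f]] by blast
  obtain V12' V21' v' c' where 2: "zc \<mu> f (cj \<sigma> f) (Q' f) (R' f) V12' V21' v' (C' M)"
   "\<And>N a b x. jost \<mu> N f (cj \<sigma> f) a b ==> j' f x = c' - v' x - (V12' x * a x - V21' x * b x) / 2" using flow_atE[OF C'[OF f]] by blast
  show "flow_at \<sigma> \<mu> f (\<lambda>x. Q f x + Q' f x) (\<lambda>x. R f x + R' f x) (\<lambda>x. j f x + j' f x) (C M + C' M)"
   by (rule flow_atI[OF zc_add[OF 1(1) 2(1)], where c = "c + c'"]) (simp add: 1(2) 2(2) field_simps)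
 qed
qed

lemma flow_data_scale:
 assumes "flow_data \<sigma> \<mu> Q R j"
 shows "flow_data \<sigma> \<mu> (\<lambda>f x. z * Q f x) (\<lambda>f x. z * R f x) (\<lambda>f x. z * j f x)"
proof -
 obtain C where C: "\<And>M f. jet M (\<lambda>n. (Dx ^^ n) f) ==> schwartz f ==> good (1/4) \<sigma> f ==> flow_at \<sigma> \<mu> f (Q f) (R f) (j f) (C M)"
  using flow_dataE[OF assms] by blast
 show ?thesis
 proof (rule flow_dataI[where C = "\<lambda>M. cmod z * C M"])
  fix M f assume f: "jet M (\<lambda>n. (Dx ^^ n) f)" "schwartz f" "good (1/4) \<sigma> f"
  obtain V12 V21 v c where 1: "zc \<mu> f (cj \<sigma> f) (Q f) (R f) V12 V21 v (C M)"
   "\<And>N a b x. jost \<mu> N f (cj \<sigma> f) a b ==> j f x = c - v x - (V12 x * a x - V21 x * b x) / 2" using flow_atE[OF C[OF f]] by blast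
  show "flow_at \<sigma> \<mu> f (\<lambda>x. z * Q f x) (\<lambda>x. z * R f x) (\<lambda>x. z * j f x) (cmod z * C M)"
   by (rule flow_atI[OF zc_scale[OF 1(1)], where c = "z * c"]) (simp add: 1(2) field_simps)
 qed
qed

lemma Dx_cj:
 assumes "schwartz f" shows "(Dx ^^ n) (cj \<sigma> f) = cj \<sigma> ((Dx ^^ n) f)"
proof (induction n)
 case (Suc n)
 have "(cj \<sigma> ((Dx ^^ n) f) hvd cj \<sigma> ((Dx ^^ Suc n) f) x) (at x)" for x
  using hvd_mult_right[OF bounded_linear.has_vector_derivative[OF bounded_linear_cnj schwartz_deriv[OF assms]]] by blast
 then have "Dx (cj \<sigma> ((Dx ^^ n) f)) = cj \<sigma> ((Dx ^^ Suc n) f)" unfolding Dx_def[of "cj \<sigma> ((Dx ^^ n) f)"]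
  by (intro ext vector_derivative_at)
 then show ?case using Suc by simp
qed simp

lemma jet_cj:
 assumes j: "jet M (\<lambda>n. (Dx ^^ n) f)" and \<sigma>: "\<sigma> = 1 \<or> \<sigma> = - 1"
 shows "jet M (\<lambda>n. cj \<sigma> ((Dx ^^ n) f))"
proof -
 have "((\<lambda>x. of_real \<sigma> * cnj (g x)) hvd of_real \<sigma> * cnj D) (at x)" if "(g hvd D) (at x)" for g D x
  by (rule hvd_mult_right[OF bounded_linear.has_vector_derivative[OF bounded_linear_cnj that]])
 moreover have "wb M (cj \<sigma> g)" if "wb M g" for g using that \<sigma> by (auto simp: wb_def norm_mult)
 ultimately show ?thesis using j unfolding jet_def by blast
qed

lemma schwartz_curve_jet:
 assumes q: "schwartz_curve q"
 obtains M where "\<And>t. \<bar>t\<bar> <= T ==> jet M (\<lambda>n. (Dx ^^ n) (q t))"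
proof -
 have "\<forall>n. \<exists>M. \<forall>t. \<bar>t\<bar> <= T --> pot M ((Dx ^^ n) (q t))" using schwartz_curve_pot[OF q] by metis
 then obtain m where m: "\<And>n t. \<bar>t\<bar> <= T ==> pot (m n) ((Dx ^^ n) (q t))" by metis
 have sc: "schwartz (q t)" for t using q by (auto simp: schwartz_curve_def)
 have "jet (Max (m ` {..3})) (\<lambda>n. (Dx ^^ n) (q t))" if "\<bar>t\<bar> <= T" for t
  unfolding jet_def
 proof (intro conjI allI impI)
  show "((Dx ^^ n) (q t) hvd (Dx ^^ Suc n) (q t) x) (at x)" for n x by (rule schwartz_deriv[OF sc])
  show "wb (Max (m ` {..3})) ((Dx ^^ n) (q t))" if "n <= 3" for n
   using that by (intro wb_pot[OF pot_mono[OF m[OF \<open>\<bar>t\<bar> <= T\<close>]]] Max_ge) auto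
 qed
 then show ?thesis using that by blast
qed

lemma jet_pot: assumes "jet M (\<lambda>n. (Dx ^^ n) f)" shows "pot M f"
proof -
 have "(f hvd Dx f x) (at x)" for x using jetD(1)[OF assms, of x] by simp
 then have "continuous_on UNIV f" by (rule deriv_cont)
 then show ?thesis using jetD(4)[OF assms] by (simp add: pot_def wb_def)
qed

text \<open>The data are demanded at every parameter except \<open>kx\<close>, not only at the \<mu>
  of the conclusion, because smallness of a and b at \<mu> rests on energies along a whole
  chain.\<close>

lemma flow_conclude:
 assumes \<sigma>: "\<sigma> = 1 \<or> \<sigma> = - 1" and s: "- 1 / 2 < s" "s < 0"
  and q: "schwartz_curve q" and H: "Hs_norm s (q 0) <= \<delta>" and small: "small_enough s \<delta>"
  and ev: "evolves (\<lambda>t. cj \<sigma> (q t)) c F q" and c: "c \<noteq> 0"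
  and Q: "\<And>f x. c * Q f x = F f (cj \<sigma> f) x"
  and R: "\<And>f M. pot M f ==> schwartz f ==> good (1/4) \<sigma> f ==> R f = cj \<sigma> (Q f)"
  and fd: "\<And>\<mu>. 1 <= \<mu> ==> \<mu> \<noteq> kx ==> flow_data \<sigma> \<mu> Q R (j \<mu>)"
  and cont: "\<And>t d. 0 < d ==> (\<And>\<tau>. \<bar>\<tau> - t\<bar> < d ==> good (1/4) \<sigma> (q \<tau>)) ==> uct (\<lambda>t. Q (q t)) t"
  and \<mu>: "1 <= \<mu>" "\<mu> \<noteq> kx"
 shows "quantities_defined \<mu> q (\<lambda>t. cj \<sigma> (q t)) \<and> conservation_law (\<lambda>t. rho (q t) (cj \<sigma> (q t)) \<mu>) (\<lambda>t. j \<mu> (q t))"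
proof -
 have sc: "schwartz (q t)" for t using q by (auto simp: schwartz_curve_def)
 have D: "((\<lambda>\<tau>. q \<tau> x) hvd Q (q t) x) (at t)" for t x
 proof -
  have "(\<lambda>\<tau>. q \<tau> x) differentiable (at t)" "c * vector_derivative (\<lambda>\<tau>. q \<tau> x) (at t) = c * Q (q t) x"
   using ev by (auto simp: evolves_def Q)
  then show ?thesis using c by (simp add: vector_derivative_works)
 qed
 interpret flow \<sigma> s \<delta> kx q "\<lambda>t. Q (q t)"
 proof
  show "udiff q (Q (q t)) t" if "0 < d" "\<And>\<tau>. \<bar>\<tau> - t\<bar> < d ==> good (1/4) \<sigma> (q \<tau>)" for t d
  proof (rule udiff_MVT[where f' = "\<lambda>t. Q (q t)", OF zero_less_one])
   show "\<exists>d>0. \<forall>\<tau>. \<bar>\<tau> - t\<bar> < d --> (\<forall>x. cmod (Q (q \<tau>) x - Q (q t) x) <= e)" if "0 < e" for e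
    using cont[OF \<open>0 < d\<close>] \<open>\<And>\<tau>. \<bar>\<tau> - t\<bar> < d ==> good (1/4) \<sigma> (q \<tau>)\<close> \<open>0 < e\<close> unfolding uct_def by blast
  qed (rule D)
  fix T \<nu> :: real assume \<nu>: "1 <= \<nu>" "\<nu> \<noteq> kx"
  obtain M where M: "\<And>t. \<bar>t\<bar> <= T ==> jet M (\<lambda>n. (Dx ^^ n) (q t))" using schwartz_curve_jet[OF q] by blast
  obtain C where C: "\<And>M f. jet M (\<lambda>n. (Dx ^^ n) f) ==> schwartz f ==> good (1/4) \<sigma> f ==> flow_at \<sigma> \<nu> f (Q f) (R f) (j \<nu> f) (C M)"
   using flow_dataE[OF fd[OF \<nu>]] by blast
  show "\<exists>C. \<forall>t. \<bar>t\<bar> <= T --> good (1/4) \<sigma> (q t) -->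
    (\<exists>V12 V21 v. zc \<nu> (q t) (cj \<sigma> (q t)) (Q (q t)) (cj \<sigma> (Q (q t))) V12 V21 v C)"
  proof (intro exI[of _ "C M"] allI impI)
   fix t assume t: "\<bar>t\<bar> <= T" "good (1/4) \<sigma> (q t)"
   show "\<exists>V12 V21 v. zc \<nu> (q t) (cj \<sigma> (q t)) (Q (q t)) (cj \<sigma> (Q (q t))) V12 V21 v (C M)"
    using C[OF M[OF t(1)] sc t(2)] R[OF jet_pot[OF M[OF t(1)]] sc t(2)] by (auto simp: flow_at_def)
  qed
 qed (use \<sigma> s q H small in auto)
 show ?thesis
 proof (rule conservation[OF \<mu>(1)])
  fix t a b N assume J: "jost \<mu> N (q t) (cj \<sigma> (q t)) a b"
  have g: "good (1/4) \<sigma> (q t)" by (rule good_mono[OF all_good]) simp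
  obtain M where M: "jet M (\<lambda>n. (Dx ^^ n) (q t))" using schwartz_curve_jet[OF q, of "\<bar>t\<bar>"] by blast
  obtain C where C: "\<And>M f. jet M (\<lambda>n. (Dx ^^ n) f) ==> schwartz f ==> good (1/4) \<sigma> f ==> flow_at \<sigma> \<mu> f (Q f) (R f) (j \<mu> f) (C M)"
   using flow_dataE[OF fd[OF \<mu>]] by blast
  show "\<exists>V12 V21 v C c. zc \<mu> (q t) (cj \<sigma> (q t)) (Q (q t)) (cj \<sigma> (Q (q t))) V12 V21 v C \<and>
    (\<forall>x. j \<mu> (q t) x = c - v x - (V12 x * a x - V21 x * b x) / 2)"
   using C[OF M sc g] R[OF jet_pot[OF M] sc g] J unfolding flow_at_def by metis
 qed
qed

section \<open>The four flows\<close>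

abbreviation Q_NLS :: "real => func" where
 "Q_NLS \<sigma> \<equiv> (\<lambda>f x. \<i> * (Dx ^^ 2) f x - 2 * \<i> * ((f x)^2 * cj \<sigma> f x))"
abbreviation R_NLS :: "real => func" where
 "R_NLS \<sigma> \<equiv> (\<lambda>f x. 2 * \<i> * ((cj \<sigma> f x)^2 * f x) - \<i> * cj \<sigma> ((Dx ^^ 2) f) x)"
abbreviation Q_mKdV :: "real => func" where
 "Q_mKdV \<sigma> \<equiv> (\<lambda>f x. 6 * (f x * (cj \<sigma> f x * (Dx ^^ 1) f x)) - (Dx ^^ 3) f x)"
abbreviation R_mKdV :: "real => func" where
 "R_mKdV \<sigma> \<equiv> (\<lambda>f x. 6 * (f x * (cj \<sigma> f x * cj \<sigma> ((Dx ^^ 1) f) x)) - cj \<sigma> ((Dx ^^ 3) f) x)"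

lemma R_NLS: "\<sigma> = 1 \<or> \<sigma> = - 1 ==> R_NLS \<sigma> f = cj \<sigma> (Q_NLS \<sigma> f)"
 by (auto simp: fun_eq_iff algebra_simps power2_eq_square)

lemma R_mKdV: "\<sigma> = 1 \<or> \<sigma> = - 1 ==> R_mKdV \<sigma> f = cj \<sigma> (Q_mKdV \<sigma> f)"
 by (auto simp: fun_eq_iff algebra_simps)

lemma fd_NLS:
 assumes \<sigma>: "\<sigma> = 1 \<or> \<sigma> = - 1"
 shows "flow_data \<sigma> \<mu> (Q_NLS \<sigma>) (R_NLS \<sigma>) (\<lambda>f. j_NLS f (cj \<sigma> f) \<mu>)"
proof (rule flow_dataI)
 fix M f assume f: "jet M (\<lambda>n. (Dx ^^ n) f)" "schwartz f"
 have Dr: "Dx (cj \<sigma> f) = cj \<sigma> (Dx f)" using Dx_cj[OF f(2), of 1] by simp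
 note z = zc_NLS[OF f(1) jet_cj[OF f(1) \<sigma>], unfolded funpow_0]
 show "flow_at \<sigma> \<mu> f (Q_NLS \<sigma> f) (R_NLS \<sigma> f) (j_NLS f (cj \<sigma> f) \<mu>) (C_NLS \<mu> M)"
  \<comment> \<open>This c removes the constant term of v, which \<open>j_NLS\<close> does not
    contain.\<close>
  by (rule flow_atI[OF z, where c = "2 * \<i> * (of_real \<mu>)^2"]) (simp only: j_NLS_def Dr jost_rho(1,2), simp add: field_simps)
qed

lemma fd_mKdV:
 assumes \<sigma>: "\<sigma> = 1 \<or> \<sigma> = - 1"
 shows "flow_data \<sigma> \<mu> (Q_mKdV \<sigma>) (R_mKdV \<sigma>) (\<lambda>f. j_mKdV f (cj \<sigma> f) \<mu>)"
proof (rule flow_dataI)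
 fix M f assume f: "jet M (\<lambda>n. (Dx ^^ n) f)" "schwartz f"
 have Dr: "Dx (cj \<sigma> f) = cj \<sigma> (Dx f)" using Dx_cj[OF f(2), of 1] by simp
 have Drr: "Dx (cj \<sigma> (Dx f)) = cj \<sigma> ((Dx ^^ 2) f)" using Dx_cj[OF f(2), of 2 \<sigma>] by (simp add: numeral_2_eq_2 Dr)
 have D2: "Dx (Dx f) = (Dx ^^ 2) f" "Dx f = (Dx ^^ 1) f" by (simp_all add: numeral_2_eq_2)
 note z = zc_mKdV[OF f(1) jet_cj[OF f(1) \<sigma>], unfolded funpow_0]
 show "flow_at \<sigma> \<mu> f (Q_mKdV \<sigma> f) (R_mKdV \<sigma> f) (j_mKdV f (cj \<sigma> f) \<mu>) (C_mKdV \<mu> M)"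
 proof (rule flow_atI[OF z, where c = "- (4 * (of_real \<mu>) ^ 3)"])
  fix N a b x assume J: "jost \<mu> N f (cj \<sigma> f) a b"
  have m: "(y * g21 f (cj \<sigma> f) \<mu> x - z * g12 f (cj \<sigma> f) \<mu> x) / (2 + gam f (cj \<sigma> f) \<mu> x) = (y * a x - z * b x) / 2" for y z
   using jost_rho(1)[OF J, of y x "- z"] by simp
  show "j_mKdV f (cj \<sigma> f) \<mu> x = - (4 * (of_real \<mu>) ^ 3)
   - (- (4 * (of_real \<mu>) ^ 3) + ((Dx ^^ 1) f x * cj \<sigma> f x - f x * cj \<sigma> ((Dx ^^ 1) f) x + 2 * of_real \<mu> * (f x * cj \<sigma> f x)))
   - ((2 * ((f x)^2 * cj \<sigma> f x) - (Dx ^^ 2) f x - 2 * of_real \<mu> * (Dx ^^ 1) f x - 4 * (of_real \<mu>)^2 * f x) * a x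
     - (2 * ((cj \<sigma> f x)^2 * f x) - cj \<sigma> ((Dx ^^ 2) f) x + 2 * of_real \<mu> * cj \<sigma> ((Dx ^^ 1) f) x - 4 * (of_real \<mu>)^2 * cj \<sigma> f x) * b x) / 2"
   unfolding j_mKdV_def j_NLS_def Dr Drr D2(1) m jost_rho(1,2)[OF J] by (simp add: field_simps power2_eq_square)
 qed
qed

lemma good_gs:
 assumes \<sigma>: "\<sigma> = 1 \<or> \<sigma> = - 1" and f: "pot M f" and g: "good (1/4) \<sigma> f" and k: "1 <= \<bar>k\<bar>"
 shows "gs_eqs k M f (cj \<sigma> f)"
proof (cases "0 <= k")
 case True
 then have "1 <= k" using k by simp
 then show ?thesis using good_jost[OF \<sigma> f g] gs_eqs_pos by metis
next
 case False
 then have "1 <= - k" using k by simp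
 then obtain a b where "jost (- k) M (cj \<sigma> f) f (cj \<sigma> a) (cj \<sigma> b)" using good_jost[OF \<sigma> f g] by metis
 from gs_eqs_neg[OF this] show ?thesis by simp
qed

text \<open>The evolution q_t = g12(k) on its own; its current is -i times \<open>j_pair\<close>,
  and the difference flows are combinations of it at k = \<kappa> and k = - \<kappa>.\<close>

lemma fd_pair:
 assumes \<sigma>: "\<sigma> = 1 \<or> \<sigma> = - 1" and k: "1 <= \<bar>k\<bar>" "k \<noteq> \<mu>"
 shows "flow_data \<sigma> \<mu> (\<lambda>f. g12 f (cj \<sigma> f) k) (\<lambda>f. g21 f (cj \<sigma> f) k) (\<lambda>f x. - \<i> * j_pair f (cj \<sigma> f) \<mu> k x)"
proof -
 define l where "l = complex_of_real (1 / (2 * (k - \<mu>)))"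
 define C where "C = (\<lambda>M. cmod l * (4 * M) + cmod (- l) * (4 * M) + 4 * M + 4 * M + cmod (- l / 2) * (4 * M) + cmod (- l / 2))"
 have d: "y / (2 * of_real (k - \<mu>) * h) = l * (y / h)" "y / (4 * of_real (k - \<mu>)) = l * y / 2" for y h :: complex
  by (simp_all add: l_def)
 show ?thesis
 proof (rule flow_dataI[where C = C])
  fix M f assume f: "jet M (\<lambda>n. (Dx ^^ n) f)" "good (1/4) \<sigma> f"
  note z = zc_pair[OF good_gs[OF \<sigma> jet_pot[OF f(1)] f(2) k(1)] k(2), folded l_def]
  show "flow_at \<sigma> \<mu> f (g12 f (cj \<sigma> f) k) (g21 f (cj \<sigma> f) k) (\<lambda>x. - \<i> * j_pair f (cj \<sigma> f) \<mu> k x) (C M)"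
   unfolding C_def by (rule flow_atI[OF z, where c = "- l / 2"])
    (simp only: j_pair_def d jost_rho(1), simp add: algebra_simps add_divide_distrib)
 qed
qed

lemma fd_phase:
 assumes \<sigma>: "\<sigma> = 1 \<or> \<sigma> = - 1"
 shows "flow_data \<sigma> \<mu> (\<lambda>f. f) (\<lambda>f x. - cj \<sigma> f x) (\<lambda>f x. 0)"
proof (rule flow_dataI)
 fix M f assume f: "jet M (\<lambda>n. (Dx ^^ n) f)"
 have "wb M f" "wb M (cj \<sigma> f)" using jetD(4)[OF f] jetD(4)[OF jet_cj[OF f \<sigma>]] by simp_all
 note z = zc_phase[OF this]
 show "flow_at \<sigma> \<mu> f f (\<lambda>x. - cj \<sigma> f x) (\<lambda>x. 0) (0 + 0 + M + M + 0 + cmod (1 / 2))"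
  by (rule flow_atI[OF z, where c = "1 / 2"]) simp
qed

lemma fd_translation:
 assumes \<sigma>: "\<sigma> = 1 \<or> \<sigma> = - 1"
 shows "flow_data \<sigma> \<mu> (Dx ^^ 1) (\<lambda>f. cj \<sigma> ((Dx ^^ 1) f)) (\<lambda>f x. - rho f (cj \<sigma> f) \<mu> x)"
proof (rule flow_dataI)
 fix M f assume f: "jet M (\<lambda>n. (Dx ^^ n) f)"
 note z = zc_translation[OF f jet_cj[OF f \<sigma>], unfolded funpow_0]
 show "flow_at \<sigma> \<mu> f ((Dx ^^ 1) f) (cj \<sigma> ((Dx ^^ 1) f)) (\<lambda>x. - rho f (cj \<sigma> f) \<mu> x) (M + M + M + M + 0 + cmod (of_real \<mu>))"
  by (rule flow_atI[OF z, where c = "of_real \<mu>"]) (simp add: jost_rho(2))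
qed

text \<open>Conjugation pairs \<kappa> with - \<kappa>. This is why the difference flows contain g12
  at both: only then is the evolution compatible with r = \<sigma> cnj q.\<close>

lemma gs_conj:
 assumes \<sigma>: "\<sigma> = 1 \<or> \<sigma> = - 1" and f: "pot M f" and g: "good (1/4) \<sigma> f" and k: "1 <= k"
 shows "cj \<sigma> (g12 f (cj \<sigma> f) k) x = g21 f (cj \<sigma> f) (- k) x" "cj \<sigma> (g12 f (cj \<sigma> f) (- k)) x = g21 f (cj \<sigma> f) k x"
proof -
 obtain a b where J: "jost k M f (cj \<sigma> f) a b" "jost k M (cj \<sigma> f) f (cj \<sigma> a) (cj \<sigma> b)" using good_jost[OF \<sigma> f g k] by metis
 show "cj \<sigma> (g12 f (cj \<sigma> f) k) x = g21 f (cj \<sigma> f) (- k) x" "cj \<sigma> (g12 f (cj \<sigma> f) (- k)) x = g21 f (cj \<sigma> f) k x"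
  unfolding green_pos(2,3)[OF J(1)] green_neg(2,3)[OF J(2)] using \<sigma> by auto
qed

lemma uct_Dx: "schwartz_curve q ==> uct (\<lambda>t. (Dx ^^ n) (q t)) t"
 using schwartz_curve_ucurve[of q 0 n] by (intro ucurve_uct) simp

lemma Dx_numeral: "(Dx ^^ 2) f = Dx (Dx f)" "(Dx ^^ 3) f = Dx (Dx (Dx f))"
 by (simp_all add: numeral_eq_Suc)

lemma uct_NLS: assumes q: "schwartz_curve q" and \<sigma>: "\<sigma> = 1 \<or> \<sigma> = - 1"
 shows "uct (\<lambda>t. Q_NLS \<sigma> (q t)) t"
proof -
 have u: "uct q t" using uct_Dx[OF q, of 0 t] by simp
 show ?thesis unfolding power2_eq_square
  by (intro uct_diff uct_mult[OF uct_const] uct_mult[OF uct_mult[OF u u] uct_cj[OF u \<sigma>]] uct_Dx[OF q])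
qed

lemma uct_mKdV: assumes q: "schwartz_curve q" and \<sigma>: "\<sigma> = 1 \<or> \<sigma> = - 1"
 shows "uct (\<lambda>t. Q_mKdV \<sigma> (q t)) t"
proof -
 have u: "uct q t" using uct_Dx[OF q, of 0 t] by simp
 show ?thesis
  by (intro uct_diff uct_mult[OF uct_const] uct_mult[OF u uct_mult[OF uct_cj[OF u \<sigma>] uct_Dx[OF q]]] uct_Dx[OF q])
qed

theorem corollary4p14:
  fixes s \<sigma> :: real
  assumes "- 1 / 2 < s" "s < 0"
    and "\<sigma> = 1 \<or> \<sigma> = - 1"
  shows "\<exists>\<delta>>0. \<forall>\<kappa>\<ge>1. \<forall>\<mu>\<ge>1. \<forall>q r :: real \<Rightarrow> real \<Rightarrow> complex.
     schwartz_curve q \<and> Hs_norm s (q 0) \<le> \<delta> \<and> r = (\<lambda>t x. of_real \<sigma> * cnj (q t x)) \<longrightarrow>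
     (NLS_flow q r \<longrightarrow>
        quantities_defined \<mu> q r \<and>
        conservation_law (\<lambda>t. rho (q t) (r t) \<mu>) (\<lambda>t. j_NLS (q t) (r t) \<mu>)) \<and>
     (mKdV_flow q r \<longrightarrow>
        quantities_defined \<mu> q r \<and>
        conservation_law (\<lambda>t. rho (q t) (r t) \<mu>) (\<lambda>t. j_mKdV (q t) (r t) \<mu>)) \<and>
     (NLS_diff_flow \<kappa> q r \<and> \<kappa> \<noteq> \<mu> \<longrightarrow>
        quantities_defined \<mu> q r \<and>
        conservation_law (\<lambda>t. rho (q t) (r t) \<mu>) (\<lambda>t. j_NLS_diff (q t) (r t) \<mu> \<kappa>)) \<and>
     (mKdV_diff_flow \<kappa> q r \<and> \<kappa> \<noteq> \<mu> \<longrightarrow>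
        quantities_defined \<mu> q r \<and>
        conservation_law (\<lambda>t. rho (q t) (r t) \<mu>) (\<lambda>t. j_mKdV_diff (q t) (r t) \<mu> \<kappa>))"
proof -
 note s = assms(1,2) and \<sigma> = assms(3)
 obtain \<delta> where \<delta>: "0 < \<delta>" "small_enough s \<delta>" using small_enough_exists[OF s(1)] by blast
 show ?thesis
 proof (intro exI[of _ \<delta>] conjI allI impI; (elim conjE)?)
  show "0 < \<delta>" by (rule \<delta>)
  fix \<kappa> \<mu> :: real and q r :: "real => real => complex"
  assume \<kappa>: "1 <= \<kappa>" and \<mu>: "1 <= \<mu>" and q: "schwartz_curve q" and H: "Hs_norm s (q 0) <= \<delta>"
   and r: "r = (\<lambda>t x. of_real \<sigma> * cnj (q t x))"
  note concl = flow_conclude[OF \<sigma> s q H \<delta>(2)]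
  \<comment> \<open>For NLS and mKdV no parameter is exceptional, and kx is set to 0.\<close>
  have \<mu>0: "\<mu> \<noteq> 0" using \<mu> by simp
  have km: "1 <= \<bar>\<kappa>\<bar>" "1 <= \<bar>- \<kappa>\<bar>" using \<kappa> by auto
  have nm: "- \<kappa> \<noteq> \<nu>" if "1 <= \<nu>" for \<nu> using \<kappa> that by simp
  {
   assume fl: "NLS_flow q r"
   show "quantities_defined \<mu> q r" "conservation_law (\<lambda>t. rho (q t) (r t) \<mu>) (\<lambda>t. j_NLS (q t) (r t) \<mu>)"
    using concl[OF fl[unfolded NLS_flow_def r] complex_i_not_zero _ R_NLS[OF \<sigma>] fd_NLS[OF \<sigma>] uct_NLS[OF q \<sigma>] \<mu> \<mu>0]
    by (simp_all add: r Dx_numeral algebra_simps)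
  }
  {
   assume fl: "mKdV_flow q r"
   show "quantities_defined \<mu> q r" "conservation_law (\<lambda>t. rho (q t) (r t) \<mu>) (\<lambda>t. j_mKdV (q t) (r t) \<mu>)"
    using concl[OF fl[unfolded mKdV_flow_def r] one_neq_zero _ R_mKdV[OF \<sigma>] fd_mKdV[OF \<sigma>] uct_mKdV[OF q \<sigma>] \<mu> \<mu>0]
    by (simp_all add: r Dx_numeral algebra_simps)
  }
  {
   assume fl: "NLS_diff_flow \<kappa> q r" and ne: "\<kappa> \<noteq> \<mu>"
   \<comment> \<open>The coefficients of the flow equation after division by i; the term in q is a
     phase flow with zero current.\<close>
   let ?z = "4 * \<i> * of_real \<kappa> ^ 3" and ?y = "4 * \<i> * of_real \<kappa> ^ 2"
   let ?Q = "\<lambda>f x. Q_NLS \<sigma> f x + ?z * g12 f (cj \<sigma> f) \<kappa> x + (- ?z) * g12 f (cj \<sigma> f) (- \<kappa>) x + ?y * f x"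
   let ?R = "\<lambda>f x. R_NLS \<sigma> f x + ?z * g21 f (cj \<sigma> f) \<kappa> x + (- ?z) * g21 f (cj \<sigma> f) (- \<kappa>) x + ?y * (- cj \<sigma> f x)"
   have fd: "flow_data \<sigma> \<nu> ?Q ?R (\<lambda>f x. j_NLS f (cj \<sigma> f) \<nu> x + ?z * (- \<i> * j_pair f (cj \<sigma> f) \<nu> \<kappa> x)
     + (- ?z) * (- \<i> * j_pair f (cj \<sigma> f) \<nu> (- \<kappa>) x) + ?y * 0)" if "1 <= \<nu>" "\<nu> \<noteq> \<kappa>" for \<nu>
    by (intro flow_data_add flow_data_scale fd_NLS[OF \<sigma>] fd_pair[OF \<sigma>] fd_phase[OF \<sigma>] km nm[OF that(1)] that(2)[symmetric])
   have J: "j_NLS f (cj \<sigma> f) \<nu> x + ?z * (- \<i> * j_pair f (cj \<sigma> f) \<nu> \<kappa> x) + (- ?z) * (- \<i> * j_pair f (cj \<sigma> f) \<nu> (- \<kappa>) x)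
       + ?y * 0 = j_NLS_diff f (cj \<sigma> f) \<nu> \<kappa> x" for f \<nu> x
    by (simp add: j_NLS_diff_def algebra_simps)
   have "quantities_defined \<mu> q (\<lambda>t. cj \<sigma> (q t)) \<and>
     conservation_law (\<lambda>t. rho (q t) (cj \<sigma> (q t)) \<mu>) (\<lambda>t. (\<lambda>\<mu> f x. j_NLS_diff f (cj \<sigma> f) \<mu> \<kappa> x) \<mu> (q t))"
   proof (rule concl[OF fl[unfolded NLS_diff_flow_def r] complex_i_not_zero _ _ fd[unfolded J] _ \<mu> ne[symmetric]])
    fix f M assume f: "pot M f" "good (1/4) \<sigma> f"
    show "?R f = cj \<sigma> (?Q f)"
     unfolding gs_conj[OF \<sigma> f \<kappa>, symmetric] fun_cong[OF R_NLS[OF \<sigma>]] by (simp add: fun_eq_iff algebra_simps)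
   next
    fix t d :: real assume d: "0 < d" "\<And>\<tau>. \<bar>\<tau> - t\<bar> < d ==> good (1/4) \<sigma> (q \<tau>)"
    show "uct (\<lambda>t. ?Q (q t)) t"
     by (intro uct_add uct_mult[OF uct_const] uct_NLS[OF q \<sigma>] uct_g12[OF \<sigma> q \<kappa> d] uct_Dx[OF q, of 0, simplified])
   qed (simp_all add: Dx_numeral algebra_simps)
   then show "quantities_defined \<mu> q r" "conservation_law (\<lambda>t. rho (q t) (r t) \<mu>) (\<lambda>t. j_NLS_diff (q t) (r t) \<mu> \<kappa>)"
    by (simp_all add: r)
  }
  {
   assume fl: "mKdV_diff_flow \<kappa> q r" and ne: "\<kappa> \<noteq> \<mu>"
   \<comment> \<open>The term - 4 \<open>\<kappa>\<^sup>2\<close> q' is a translation, whose current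
     is - \<open>rho\<close>; this produces the summand 4 \<open>\<kappa>\<^sup>2\<close>
     \<open>rho\<close> of the current.\<close>
   let ?z = "- (8 * of_real \<kappa> ^ 4) :: complex" and ?y = "- (4 * of_real \<kappa> ^ 2) :: complex"
   let ?Q = "\<lambda>f x. Q_mKdV \<sigma> f x + ?z * g12 f (cj \<sigma> f) \<kappa> x + ?z * g12 f (cj \<sigma> f) (- \<kappa>) x + ?y * (Dx ^^ 1) f x"
   let ?R = "\<lambda>f x. R_mKdV \<sigma> f x + ?z * g21 f (cj \<sigma> f) \<kappa> x + ?z * g21 f (cj \<sigma> f) (- \<kappa>) x + ?y * cj \<sigma> ((Dx ^^ 1) f) x"
   have fd: "flow_data \<sigma> \<nu> ?Q ?R (\<lambda>f x. j_mKdV f (cj \<sigma> f) \<nu> x + ?z * (- \<i> * j_pair f (cj \<sigma> f) \<nu> \<kappa> x)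
     + ?z * (- \<i> * j_pair f (cj \<sigma> f) \<nu> (- \<kappa>) x) + ?y * (- rho f (cj \<sigma> f) \<nu> x))" if "1 <= \<nu>" "\<nu> \<noteq> \<kappa>" for \<nu>
    by (intro flow_data_add flow_data_scale fd_mKdV[OF \<sigma>] fd_pair[OF \<sigma>] fd_translation[OF \<sigma>] km nm[OF that(1)] that(2)[symmetric])
   have J: "j_mKdV f (cj \<sigma> f) \<nu> x + ?z * (- \<i> * j_pair f (cj \<sigma> f) \<nu> \<kappa> x) + ?z * (- \<i> * j_pair f (cj \<sigma> f) \<nu> (- \<kappa>) x)
       + ?y * (- rho f (cj \<sigma> f) \<nu> x) = j_mKdV_diff f (cj \<sigma> f) \<nu> \<kappa> x" for f \<nu> x
    by (simp add: j_mKdV_diff_def algebra_simps)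
   have "quantities_defined \<mu> q (\<lambda>t. cj \<sigma> (q t)) \<and>
     conservation_law (\<lambda>t. rho (q t) (cj \<sigma> (q t)) \<mu>) (\<lambda>t. (\<lambda>\<mu> f x. j_mKdV_diff f (cj \<sigma> f) \<mu> \<kappa> x) \<mu> (q t))"
   proof (rule concl[OF fl[unfolded mKdV_diff_flow_def r] one_neq_zero _ _ fd[unfolded J] _ \<mu> ne[symmetric]])
    fix f M assume f: "pot M f" "good (1/4) \<sigma> f"
    show "?R f = cj \<sigma> (?Q f)"
     unfolding gs_conj[OF \<sigma> f \<kappa>, symmetric] fun_cong[OF R_mKdV[OF \<sigma>]] by (simp add: fun_eq_iff algebra_simps)
   next
    fix t d :: real assume d: "0 < d" "\<And>\<tau>. \<bar>\<tau> - t\<bar> < d ==> good (1/4) \<sigma> (q \<tau>)"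
    show "uct (\<lambda>t. ?Q (q t)) t"
     by (intro uct_add uct_mult[OF uct_const] uct_mKdV[OF q \<sigma>] uct_g12[OF \<sigma> q \<kappa> d] uct_Dx[OF q])
   qed (simp_all add: Dx_numeral algebra_simps)
   then show "quantities_defined \<mu> q r" "conservation_law (\<lambda>t. rho (q t) (r t) \<mu>) (\<lambda>t. j_mKdV_diff (q t) (r t) \<mu> \<kappa>)"
    by (simp_all add: r)
  }
 qed
qed

end
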